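(* Suppose that $$\sup_{\lambda\in\mathbb C_+}\frac{|M_+(\lambda)+M_-(\lambda)|}{|M_+(\lambda)-M_-(\lambda)|}<\infty.$$ Then the operator $A=(\operatorname{sgn} x)\left(-\frac{d^2}{dx^2}+q(x)\right)$ is similar to a selfadjoint operator.
   Context: Setting. $q:\mathbb R\to\mathbb R$ is continuous, and the minimal operators $L^\pm_{\min}$ generated by $-\frac{d^2}{dx^2}+q(x)$ in $L^2(\mathbb R_\pm)$ have deficiency indices $(1,1)$ (limit point case at $\pm\infty$). $L=-\frac{d^2}{dx^2}+q(x)$ denotes the corresponding selfadjoint operator in $L^2(\mathbb R)$, $J$ is multiplication by $\operatorname{sgn}x$, and $A=JL$ with $\operatorname{dom}A=\operatorname{dom}L$. Weyl functions. Let $s(x,\lambda),c(x,\lambda)$ solve $-y''+qy=\lambda y$ with $s(0,\lambda)=c'(0,\lambda)=0$, $s'(0,\lambda)=c(0,\lambda)=1$. For $\lambda\in\mathbb C\setminus\mathbb R$, $m_\pm(\lambda)$ is the number such that $s(\cdot,\lambda)\mp m_\pm(\lambda)c(\cdot,\lambda)\in L^2(\mathbb R_\pm)$. Put $M_\pm(\lambda):=\pm m_\pm(\pm\lambda)$. $\mathbb C_+$ is the open upper half-plane. Closed operators $T_1,T_2$ in a Hilbert space are similar if there is a bounded operator $V$ with bounded inverse such that $V\operatorname{dom}(T_1)=\operatorname{dom}(T_2)$ and $T_2=VT_1V^{-1}$. *)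

theory Defs
  imports "HOL-Analysis.Analysis"
begin

section \<open>The Hilbert space of square integrable functions on the line\<close>

definition sq_integrable :: "(real \<Rightarrow> complex) \<Rightarrow> bool" where
  "sq_integrable f \<longleftrightarrow>
     f \<in> borel_measurable lborel \<and> integrable lborel (\<lambda>x. (cmod (f x))\<^sup>2)"

definition L2_eq :: "(real \<Rightarrow> complex) \<Rightarrow> (real \<Rightarrow> complex) \<Rightarrow> bool" where
  "L2_eq f g \<longleftrightarrow> sq_integrable f \<and> sq_integrable g \<and> (AE x in lborel. f x = g x)"

lemma sq_integrable_mult_cnj:
  assumes "sq_integrable f" "sq_integrable g"
  shows "integrable lborel (\<lambda>x. f x * cnj (g x))"
proof (rule Bochner_Integration.integrable_bound)
  show "integrable lborel (\<lambda>x. (cmod (f x))\<^sup>2 + (cmod (g x))\<^sup>2)"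
    using assms by (auto simp: sq_integrable_def)
  show "(\<lambda>x. f x * cnj (g x)) \<in> borel_measurable lborel"
  proof -
    have "cnj \<in> borel_measurable borel"
      by (intro borel_measurable_continuous_onI continuous_intros)
    then have "(\<lambda>x. cnj (g x)) \<in> borel_measurable lborel"
      using assms by (auto simp: sq_integrable_def intro: measurable_compose)
    then show ?thesis
      using assms by (auto simp: sq_integrable_def intro: borel_measurable_times)
  qed
  have "a * b \<le> a\<^sup>2 + b\<^sup>2" for a b :: real
    using sum_squares_bound[of a b] sum_power2_ge_zero[of a b] by linarith
  then show "AE x in lborel. norm (f x * cnj (g x)) \<le> norm ((cmod (f x))\<^sup>2 + (cmod (g x))\<^sup>2)"
    by (simp add: norm_mult)
qed

lemma sq_integrable_zero: "sq_integrable (\<lambda>_. 0)"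
  by (simp add: sq_integrable_def)

lemma sq_integrable_bounded_mult:
  assumes "sq_integrable f" "a \<in> borel_measurable lborel" "\<And>x. cmod (a x) \<le> C"
  shows "sq_integrable (\<lambda>x. a x * f x)"
  unfolding sq_integrable_def
proof
  show m: "(\<lambda>x. a x * f x) \<in> borel_measurable lborel"
    using assms by (auto simp: sq_integrable_def intro: borel_measurable_times)
  show "integrable lborel (\<lambda>x. (cmod (a x * f x))\<^sup>2)"
  proof (rule Bochner_Integration.integrable_bound)
    show "integrable lborel (\<lambda>x. C\<^sup>2 * (cmod (f x))\<^sup>2)"
      using assms by (auto simp: sq_integrable_def)
    show "(\<lambda>x. (cmod (a x * f x))\<^sup>2) \<in> borel_measurable lborel"
      using m by measurable
    show "AE x in lborel. norm ((cmod (a x * f x))\<^sup>2) \<le> norm (C\<^sup>2 * (cmod (f x))\<^sup>2)"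
      by (auto simp: norm_mult power_mult_distrib intro!: mult_right_mono power_mono assms(3))
  qed
qed

lemma sq_integrable_scale: "sq_integrable f \<Longrightarrow> sq_integrable (\<lambda>x. a * f x)"
  by (rule sq_integrable_bounded_mult[where C = "cmod a"]) auto

lemma sq_integrable_add:
  assumes "sq_integrable f" "sq_integrable g"
  shows "sq_integrable (\<lambda>x. f x + g x)"
  unfolding sq_integrable_def
proof
  show m: "(\<lambda>x. f x + g x) \<in> borel_measurable lborel"
    using assms by (auto simp: sq_integrable_def intro: borel_measurable_add)
  show "integrable lborel (\<lambda>x. (cmod (f x + g x))\<^sup>2)"
  proof (rule Bochner_Integration.integrable_bound)
    show "integrable lborel (\<lambda>x. 2 * (cmod (f x))\<^sup>2 + 2 * (cmod (g x))\<^sup>2)"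
      using assms by (auto simp: sq_integrable_def)
    show "(\<lambda>x. (cmod (f x + g x))\<^sup>2) \<in> borel_measurable lborel"
      using m by measurable
    have "(cmod (a + b))\<^sup>2 \<le> 2 * (cmod a)\<^sup>2 + 2 * (cmod b)\<^sup>2" for a b
    proof -
      have "(cmod (a + b))\<^sup>2 \<le> (cmod a + cmod b)\<^sup>2"
        by (intro power_mono norm_triangle_ineq) auto
      also have "\<dots> \<le> 2 * (cmod a)\<^sup>2 + 2 * (cmod b)\<^sup>2"
        using sum_squares_bound[of "cmod a" "cmod b"] by (simp add: power2_sum)
      finally show ?thesis .
    qed
    then show "AE x in lborel. norm ((cmod (f x + g x))\<^sup>2)
        \<le> norm (2 * (cmod (f x))\<^sup>2 + 2 * (cmod (g x))\<^sup>2)"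
      by simp
  qed
qed

lemma L2_eqI: "sq_integrable f \<Longrightarrow> (\<And>x. f x = g x) \<Longrightarrow> L2_eq f g"
  by (drule ext[of f g]) (simp add: L2_eq_def)

quotient_type L2R = "real \<Rightarrow> complex" / partial: L2_eq
proof (rule part_equivpI)
  show "\<exists>f. L2_eq f f"
    using sq_integrable_zero by (auto simp: L2_eq_def)
  show "symp L2_eq"
    by (auto simp: symp_def L2_eq_def)
  show "transp L2_eq"
    by (auto simp: transp_def L2_eq_def)
qed

lift_definition cinner :: "L2R \<Rightarrow> L2R \<Rightarrow> complex" is
  "\<lambda>f g. LINT x|lborel. f x * cnj (g x)"
  by (intro integral_cong_AE)
    (auto simp: L2_eq_def dest: borel_measurable_integrable[OF sq_integrable_mult_cnj])

lemma cinner_commute: "cinner f g = cnj (cinner g f)"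
proof transfer
  fix f g assume "L2_eq f f" "L2_eq g g"
  show "(LINT x|lborel. f x * cnj (g x)) = cnj (LINT x|lborel. g x * cnj (f x))"
    by (subst Bochner_Integration.integral_cnj[symmetric]) (simp add: mult.commute)
qed

lemma Re_integral_mult_cnj_self:
  "Re (LINT x|lborel. f x * cnj (f x)) = (LINT x|lborel. (cmod (f x))\<^sup>2)"
proof -
  have "(LINT x|lborel. f x * cnj (f x)) = (LINT x|lborel. complex_of_real ((cmod (f x))\<^sup>2))"
    by (simp only: complex_norm_square[symmetric] of_real_power)
  then show ?thesis
    by (simp only: integral_complex_of_real Re_complex_of_real)
qed

lift_definition scaleC :: "complex \<Rightarrow> L2R \<Rightarrow> L2R" is
  "\<lambda>a f x. a * f x"
  by (auto simp: L2_eq_def intro: sq_integrable_scale)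

instantiation L2R :: real_inner
begin

lift_definition zero_L2R :: L2R is "\<lambda>_. 0"
  by (auto simp: L2_eq_def sq_integrable_zero)

lift_definition plus_L2R :: "L2R \<Rightarrow> L2R \<Rightarrow> L2R" is "\<lambda>f g x. f x + g x"
  by (auto simp: L2_eq_def sq_integrable_add)

definition scaleR_L2R :: "real \<Rightarrow> L2R \<Rightarrow> L2R" where
  "scaleR_L2R r f = scaleC (complex_of_real r) f"

definition uminus_L2R :: "L2R \<Rightarrow> L2R" where
  "uminus_L2R f = scaleC (- 1) f"

definition minus_L2R :: "L2R \<Rightarrow> L2R \<Rightarrow> L2R" where
  "minus_L2R f g = f + (- g)" for f g :: L2R

definition inner_L2R :: "L2R \<Rightarrow> L2R \<Rightarrow> real" where
  "inner_L2R f g = Re (cinner f g)"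

definition norm_L2R :: "L2R \<Rightarrow> real" where
  "norm_L2R f = sqrt (inner f f)"

definition dist_L2R :: "L2R \<Rightarrow> L2R \<Rightarrow> real" where
  "dist_L2R f g = norm (f - g)"

definition sgn_L2R :: "L2R \<Rightarrow> L2R" where
  "sgn_L2R f = scaleR (inverse (norm f)) f"

definition uniformity_L2R :: "(L2R \<times> L2R) filter" where
  "uniformity_L2R = (INF e\<in>{0<..}. principal {(x, y). dist x y < e})"

definition open_L2R :: "L2R set \<Rightarrow> bool" where
  "open_L2R U \<longleftrightarrow> (\<forall>x\<in>U. eventually (\<lambda>(x', y). x' = x \<longrightarrow> y \<in> U) uniformity)"

instance
proof
  fix f g h :: L2R and a b :: real
  show "f + g + h = f + (g + h)"
    by transfer (rule L2_eqI, auto simp: L2_eq_def add.assoc intro: sq_integrable_add)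
  show "f + g = g + f"
    by transfer (rule L2_eqI, auto simp: L2_eq_def add.commute intro: sq_integrable_add)
  show "0 + f = f"
    by transfer (auto simp: L2_eq_def)
  show "- f + f = 0"
    unfolding uminus_L2R_def by transfer (auto simp: L2_eq_def sq_integrable_zero)
  show "f - g = f + - g"
    by (simp add: minus_L2R_def)
  show "a *\<^sub>R (f + g) = a *\<^sub>R f + a *\<^sub>R g"
    unfolding scaleR_L2R_def
    by transfer (rule L2_eqI,
        auto simp: L2_eq_def distrib_left intro: sq_integrable_add sq_integrable_scale)
  show "(a + b) *\<^sub>R f = a *\<^sub>R f + b *\<^sub>R f"
    unfolding scaleR_L2R_def
    by transfer (rule L2_eqI,
        auto simp: L2_eq_def distrib_right intro: sq_integrable_add sq_integrable_scale)
  show "a *\<^sub>R b *\<^sub>R f = (a * b) *\<^sub>R f"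
    unfolding scaleR_L2R_def
    by transfer (rule L2_eqI,
        auto simp: L2_eq_def mult.assoc intro: sq_integrable_scale)
  show "1 *\<^sub>R f = f"
    unfolding scaleR_L2R_def by transfer (auto simp: L2_eq_def)
  show "dist f g = norm (f - g)"
    by (rule dist_L2R_def)
  show "sgn f = scaleR (inverse (norm f)) f"
    by (rule sgn_L2R_def)
  show "norm f = sqrt (inner f f)"
    by (rule norm_L2R_def)
  show "uniformity = (INF e\<in>{0<..}. principal {(x, y::L2R). dist x y < e})"
    by (rule uniformity_L2R_def)
  show "open U \<longleftrightarrow> (\<forall>x\<in>U. eventually (\<lambda>(x', y). x' = x \<longrightarrow> y \<in> U) uniformity)" for U :: "L2R set"
    by (rule open_L2R_def)
  show "inner f g = inner g f"
    unfolding inner_L2R_def by (subst cinner_commute) simp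
  show "inner (f + g) h = inner f h + inner g h"
    unfolding inner_L2R_def by transfer
      (simp add: L2_eq_def distrib_right Bochner_Integration.integral_add sq_integrable_mult_cnj)
  show "inner (a *\<^sub>R f) g = a * inner f g"
    unfolding inner_L2R_def scaleR_L2R_def by transfer (simp add: mult.assoc)
  show "0 \<le> inner f f"
    unfolding inner_L2R_def by transfer (simp add: Re_integral_mult_cnj_self)
  show "inner f f = 0 \<longleftrightarrow> f = 0"
    unfolding inner_L2R_def
  proof transfer
    fix f assume f: "L2_eq f f"
    then have "integrable lborel (\<lambda>x. (cmod (f x))\<^sup>2)"
      by (simp add: L2_eq_def sq_integrable_def)
    then have "(LINT x|lborel. (cmod (f x))\<^sup>2) = 0 \<longleftrightarrow> (AE x in lborel. (cmod (f x))\<^sup>2 = 0)"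
      by (rule integral_nonneg_eq_0_iff_AE) simp
    then show "Re (LINT x|lborel. f x * cnj (f x)) = 0 \<longleftrightarrow> L2_eq f (\<lambda>_. 0)"
      using f by (simp add: Re_integral_mult_cnj_self L2_eq_def sq_integrable_zero)
  qed
qed

end

global_interpretation L2R: vector_space scaleC
proof
  fix a b :: complex and f g :: L2R
  show "scaleC a (f + g) = scaleC a f + scaleC a g"
    by transfer (rule L2_eqI,
        auto simp: L2_eq_def distrib_left intro: sq_integrable_add sq_integrable_scale)
  show "scaleC (a + b) f = scaleC a f + scaleC b f"
    by transfer (rule L2_eqI,
        auto simp: L2_eq_def distrib_right intro: sq_integrable_add sq_integrable_scale)
  show "scaleC a (scaleC b f) = scaleC (a * b) f"
    by transfer (rule L2_eqI,
        auto simp: L2_eq_def mult.assoc intro: sq_integrable_scale)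
  show "scaleC 1 f = f"
    by transfer (auto simp: L2_eq_def)
qed

text \<open>\<open>L\<^sup>2(S)\<close> is identified, by extending functions by zero, with a closed subspace of
  \<open>L\<^sup>2(\<real>)\<close>.\<close>

definition L2_on :: "real set \<Rightarrow> L2R set" where
  "L2_on S = {f. AE x in lborel. x \<notin> S \<longrightarrow> rep_L2R f x = 0}"

section \<open>Unbounded operators\<close>

text \<open>Operators are given by their graphs. The adjoint is taken in a closed subspace \<open>H\<close> of
  \<open>L\<^sup>2(\<real>)\<close>, regarded as a Hilbert space in its own right.\<close>

definition adjoint_in :: "L2R set \<Rightarrow> (L2R \<times> L2R) set \<Rightarrow> (L2R \<times> L2R) set" where
  "adjoint_in H T =
     {(g, k). g \<in> H \<and> k \<in> H \<and> (\<forall>(f, h)\<in>T. cinner h g = cinner f k)}"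

definition selfadjoint :: "(L2R \<times> L2R) set \<Rightarrow> bool" where
  "selfadjoint T \<longleftrightarrow> closure (Domain T) = UNIV \<and> adjoint_in UNIV T = T"

definition closed_operator :: "(L2R \<times> L2R) set \<Rightarrow> bool" where
  "closed_operator T \<longleftrightarrow>
     (0, 0) \<in> T \<and>
     (\<forall>f h g k. (f, h) \<in> T \<longrightarrow> (g, k) \<in> T \<longrightarrow> (f + g, h + k) \<in> T) \<and>
     (\<forall>a f h. (f, h) \<in> T \<longrightarrow> (scaleC a f, scaleC a h) \<in> T) \<and>
     single_valued T \<and> closed T"

text \<open>The graph of \<open>V T V\<^sup>-\<^sup>1\<close>, with its natural domain \<open>V (dom T)\<close>, is \<open>map_prod V V ` T\<close>.\<close>

definition similar_operators :: "(L2R \<times> L2R) set \<Rightarrow> (L2R \<times> L2R) set \<Rightarrow> bool" where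
  "similar_operators T\<^sub>1 T\<^sub>2 \<longleftrightarrow>
     closed_operator T\<^sub>1 \<and> closed_operator T\<^sub>2 \<and>
     (\<exists>V. bounded_linear V \<and> (\<forall>a f. V (scaleC a f) = scaleC a (V f)) \<and>
          bij V \<and> bounded_linear (inv V) \<and>
          V ` Domain T\<^sub>1 = Domain T\<^sub>2 \<and> T\<^sub>2 = map_prod V V ` T\<^sub>1)"

text \<open>The two deficiency indices are the complex dimensions of \<open>ker (T\<^sup>* - \<i>)\<close> and
  \<open>ker (T\<^sup>* + \<i>)\<close>. An infinite-dimensional space has \<open>L2R.dim\<close> equal to 0, so only positive
  values of these indices are meaningful.\<close>

definition deficiency_indices :: "L2R set \<Rightarrow> (L2R \<times> L2R) set \<Rightarrow> nat \<times> nat" where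
  "deficiency_indices H T =
     (L2R.dim {g. (g, scaleC \<i> g) \<in> adjoint_in H T},
      L2R.dim {g. (g, scaleC (- \<i>) g) \<in> adjoint_in H T})"

section \<open>Sturm--Liouville operators\<close>

text \<open>\<open>u\<close> is locally absolutely continuous with \<open>u' = v\<close> almost everywhere.\<close>

definition has_AC_derivative :: "(real \<Rightarrow> complex) \<Rightarrow> (real \<Rightarrow> complex) \<Rightarrow> bool" where
  "has_AC_derivative u v \<longleftrightarrow>
     (\<forall>a b. a \<le> b \<longrightarrow>
        set_integrable lborel {a..b} v \<and> u b - u a = (LINT x:{a..b}|lborel. v x))"

text \<open>The operator \<open>L\<close>: all \<open>y \<in> L\<^sup>2(\<real>)\<close> with \<open>y, y'\<close> locally absolutely continuous and
  \<open>-y'' + q y \<in> L\<^sup>2(\<real>)\<close>. It is selfadjoint if \<open>q\<close> is in the limit point case at both ends.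
  (If \<open>y'\<close> is locally absolutely continuous, then \<open>y\<close> is differentiable everywhere.)\<close>

definition SL_operator :: "(real \<Rightarrow> real) \<Rightarrow> (L2R \<times> L2R) set" where
  "SL_operator q =
     {(f, h). \<exists>y y' y''.
        (\<forall>x. (y has_vector_derivative y' x) (at x)) \<and> has_AC_derivative y' y'' \<and>
        (AE x in lborel. rep_L2R f x = y x) \<and>
        (AE x in lborel. rep_L2R h x = - y'' x + complex_of_real (q x) * y x)}"

text \<open>The minimal operator in \<open>L\<^sup>2(S)\<close>, for an interval \<open>S\<close>: the closure of the operator on
  functions with compact support inside the interior of \<open>S\<close>. Extended by zero, such functions
  are in the domain of the operator on the whole line.\<close>

definition SL_minimal :: "(real \<Rightarrow> real) \<Rightarrow> real set \<Rightarrow> (L2R \<times> L2R) set" where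
  "SL_minimal q S =
     closure {(f, h) \<in> SL_operator q. \<exists>K. compact K \<and> K \<subseteq> interior S \<and> f \<in> L2_on K}"

lift_definition mult_sgn :: "L2R \<Rightarrow> L2R" is
  "\<lambda>f x. complex_of_real (sgn x) * f x"
  by (auto simp: L2_eq_def sgn_if intro!: sq_integrable_bounded_mult[where C = 1])

definition indefinite_SL_operator :: "(real \<Rightarrow> real) \<Rightarrow> (L2R \<times> L2R) set" where
  "indefinite_SL_operator q = {(f, mult_sgn h) |f h. (f, h) \<in> SL_operator q}"

section \<open>Weyl functions\<close>

text \<open>The solution of \<open>-y'' + q y = z y\<close> with \<open>y(0) = a\<close> and \<open>y'(0) = b\<close>. For continuous \<open>q\<close>
  it exists and is unique.\<close>

definition SL_solution ::
    "(real \<Rightarrow> real) \<Rightarrow> complex \<Rightarrow> complex \<Rightarrow> complex \<Rightarrow> real \<Rightarrow> complex" where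
  "SL_solution q a b z =
     (THE y. \<exists>y' y''.
        (\<forall>x. (y has_vector_derivative y' x) (at x)) \<and>
        (\<forall>x. (y' has_vector_derivative y'' x) (at x)) \<and>
        (\<forall>x. - y'' x + complex_of_real (q x) * y x = z * y x) \<and>
        y 0 = a \<and> y' 0 = b)"

definition SL_s :: "(real \<Rightarrow> real) \<Rightarrow> real \<Rightarrow> complex \<Rightarrow> complex" where
  "SL_s q x z = SL_solution q 0 1 z x"

definition SL_c :: "(real \<Rightarrow> real) \<Rightarrow> real \<Rightarrow> complex \<Rightarrow> complex" where
  "SL_c q x z = SL_solution q 1 0 z x"

definition sq_integrable_on :: "(real \<Rightarrow> complex) \<Rightarrow> real set \<Rightarrow> bool" where
  "sq_integrable_on f S \<longleftrightarrow>
     set_borel_measurable lborel S f \<and> set_integrable lborel S (\<lambda>x. (cmod (f x))\<^sup>2)"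

text \<open>In the limit point case, \<open>m\<^sub>\<plusminus>(z)\<close> exists and is unique for every nonreal \<open>z\<close>.\<close>

definition weyl_m_plus :: "(real \<Rightarrow> real) \<Rightarrow> complex \<Rightarrow> complex" where
  "weyl_m_plus q z = (THE m. sq_integrable_on (\<lambda>x. SL_s q x z - m * SL_c q x z) {0..})"

definition weyl_m_minus :: "(real \<Rightarrow> real) \<Rightarrow> complex \<Rightarrow> complex" where
  "weyl_m_minus q z = (THE m. sq_integrable_on (\<lambda>x. SL_s q x z + m * SL_c q x z) {..0})"

definition weyl_M_plus :: "(real \<Rightarrow> real) \<Rightarrow> complex \<Rightarrow> complex" where
  "weyl_M_plus q z = weyl_m_plus q z"

definition weyl_M_minus :: "(real \<Rightarrow> real) \<Rightarrow> complex \<Rightarrow> complex" where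
  "weyl_M_minus q z = - weyl_m_minus q (- z)"

end

(* The Cayley transform U = (A + i)(A - i)^(-1) of A is studied through its powers. Both A and a
   selfadjoint coupling of the two half-line operators differ from the Neumann decoupling by
   rank-one resolvent terms, and for data supported on one half-line the quotient of the two terms
   has modulus |M_+ + M_-| / |M_+ - M_-|. The hypothesis thus bounds the resolvent of U in the unit
   disc pointwise by resolvents of contractions, and averaging over circles (Parseval) gives
   (1 - r^2) sum r^(2n) |U^n f|^2 <= K |f|^2. As U preserves the indefinite form given by J, these
   averages are also bounded below by |f|^2 / K, and a cluster point as r -> 1 is an equivalent inner
   product in which U is unitary, that is, A is selfadjoint. *)
theory Submission
  imports Defs "HOL-Complex_Analysis.Complex_Analysis"
begin

section \<open>Hilbert space tools for \<open>L2R\<close>\<close>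

subsection \<open>The complex Hilbert space structure\<close>

text \<open>A resolvent bound of order 1/|Im z| alone would not give similarity. What does is that
  the comparison holds vector by vector, so that it survives squaring and averaging over circles. It
  is made on one half-line at a time because the numerators of the two rank-one terms are
  \<open>a1 - a2\<close> and \<open>- a1 - a2\<close>, where \<open>a1\<close>, \<open>a2\<close>
  are boundary values of the two Neumann solutions; the moduli agree when one of these vanishes.
  Only the upper half-plane is used for estimates, so powers of the inverse of U are never bounded.
  The indefinite form takes their place: |f|^2 = (J U^n f, U^n J f), hence a small |U^n f| would
  force a large |U^n J f|, which the upper bound excludes on average. The limit point hypothesis
  enters through the vanishing at infinity of the boundary bracket on the whole maximal domain. Then
  each half-line contributes only two boundary values at 0 and a Weyl function, and the comparison
  of resolvents becomes algebra with these.\<close>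

lemma sq_integrable_rep: "sq_integrable (rep_L2R F)"
  using Quotient3_rep_reflp[OF Quotient3_L2R, of F] by (simp add: L2_eq_def)

lemma abs_rep_L2R: "abs_L2R (rep_L2R F) = F"
  by (rule Quotient3_abs_rep[OF Quotient3_L2R])

lemma abs_L2R_eq_iff:
  assumes "sq_integrable f" "sq_integrable g"
  shows "abs_L2R f = abs_L2R g \<longleftrightarrow> (AE x in lborel. f x = g x)"
proof -
  have "L2_eq f f" "L2_eq g g" using assms by (auto simp: L2_eq_def)
  then show ?thesis
    using Quotient3_rel[OF Quotient3_L2R, of f g] assms by (auto simp: L2_eq_def)
qed

lemma rep_abs_L2R:
  assumes "sq_integrable f"
  shows "AE x in lborel. rep_L2R (abs_L2R f) x = f x"
  using abs_L2R_eq_iff[OF sq_integrable_rep assms] abs_rep_L2R by blast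

lemma abs_L2R_add:
  "sq_integrable f \<Longrightarrow> sq_integrable g \<Longrightarrow> abs_L2R f + abs_L2R g = abs_L2R (\<lambda>x. f x + g x)"
  by (simp add: plus_L2R.abs_eq L2_eq_def)

lemma abs_L2R_scaleC:
  "sq_integrable f \<Longrightarrow> scaleC a (abs_L2R f) = abs_L2R (\<lambda>x. a * f x)"
  by (simp add: scaleC.abs_eq L2_eq_def)

lemma cinner_abs:
  "sq_integrable f \<Longrightarrow> sq_integrable g \<Longrightarrow>
    cinner (abs_L2R f) (abs_L2R g) = (LINT x|lborel. f x * cnj (g x))"
  by (simp add: cinner.abs_eq L2_eq_def)


lemma uminus_L2R_scaleC: "- f = scaleC (- 1) f"
  by (rule uminus_L2R_def)

lemma sq_integrable_diff:
  "sq_integrable f \<Longrightarrow> sq_integrable g \<Longrightarrow> sq_integrable (\<lambda>x. f x - g x)"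
  using sq_integrable_add[of f "\<lambda>x. (-1) * g x"] sq_integrable_scale[of g "-1"] by simp

lemma abs_L2R_diff:
  assumes "sq_integrable f" "sq_integrable g"
  shows "abs_L2R f - abs_L2R g = abs_L2R (\<lambda>x. f x - g x)"
  unfolding minus_L2R_def uminus_L2R_def abs_L2R_scaleC[OF assms(2)]
  by (subst abs_L2R_add[OF assms(1) sq_integrable_scale[OF assms(2)]]) simp

lemma cinner_add_left: "cinner (f + g) h = cinner f h + cinner g h"
  by transfer (simp add: L2_eq_def distrib_right Bochner_Integration.integral_add sq_integrable_mult_cnj)

lemma cinner_scale_left: "cinner (scaleC a f) g = a * cinner f g"
  by transfer (simp add: mult.assoc)

lemma cinner_add_right: "cinner h (f + g) = cinner h f + cinner h g"
  by (metis cinner_add_left cinner_commute complex_cnj_add)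

lemma cinner_scale_right: "cinner f (scaleC a g) = cnj a * cinner f g"
  by (metis cinner_scale_left cinner_commute complex_cnj_mult)

lemma cinner_minus_left: "cinner (- f) g = - cinner f g"
  unfolding uminus_L2R_scaleC cinner_scale_left by simp

lemma cinner_minus_right: "cinner f (- g) = - cinner f g"
  unfolding uminus_L2R_scaleC cinner_scale_right by simp

lemma cinner_diff_left: "cinner (f - g) h = cinner f h - cinner g h"
  using cinner_add_left[of f "- g" h] by (simp add: cinner_minus_left)

lemma cinner_diff_right: "cinner h (f - g) = cinner h f - cinner h g"
  using cinner_add_right[of h f "- g"] by (simp add: cinner_minus_right)

lemma cinner_zero_left [simp]: "cinner 0 f = 0"
  using cinner_scale_left[of 0 0 f] by simp

lemma cinner_zero_right [simp]: "cinner f 0 = 0"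
  using cinner_scale_right[of f 0 0] by simp

lemmas cinner_simps = cinner_add_left cinner_add_right cinner_diff_left cinner_diff_right
  cinner_scale_left cinner_scale_right cinner_minus_left cinner_minus_right

lemma cinner_self: "cinner f f = complex_of_real ((norm f)\<^sup>2)"
proof -
  have "Re (cinner f f) = (norm f)\<^sup>2"
    by (metis inner_L2R_def power2_norm_eq_inner)
  moreover have "Im (cinner f f) = 0"
    using cinner_commute[of f f] by (metis Reals_cnj_iff complex_is_Real_iff)
  ultimately show ?thesis by (simp add: complex_eq_iff)
qed

lemma norm_abs_L2R: "sq_integrable f \<Longrightarrow> (norm (abs_L2R f))\<^sup>2 = (LINT x|lborel. (cmod (f x))\<^sup>2)"
  by (metis Re_complex_of_real cinner_self cinner_abs Re_integral_mult_cnj_self)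

lemma norm_scaleC: "norm (scaleC a f) = cmod a * norm f"
proof -
  have "complex_of_real ((norm (scaleC a f))\<^sup>2) = complex_of_real ((cmod a * norm f)\<^sup>2)"
    unfolding cinner_self[symmetric] cinner_scale_left cinner_scale_right
    using complex_norm_square[of a] by (simp add: cinner_self power_mult_distrib mult.commute)
  then have "(norm (scaleC a f))\<^sup>2 = (cmod a * norm f)\<^sup>2"
    using of_real_eq_iff by blast
  then show ?thesis
    by (simp add: power2_eq_iff_nonneg)
qed

lemma scaleC_of_real: "scaleC (complex_of_real r) f = r *\<^sub>R f"
  by (simp add: scaleR_L2R_def)

lemma cinner_norm_bound: "cmod (cinner f g) \<le> norm f * norm g"
proof (cases "cinner f g = 0")
  case False
  define a where "a = cnj (cinner f g) / complex_of_real (cmod (cinner f g))"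
  have a: "cmod a = 1" using False by (simp add: a_def norm_divide)
  have "cinner (scaleC a f) g = complex_of_real (cmod (cinner f g))"
    using False complex_norm_square[of "cinner f g"]
    by (simp add: a_def cinner_scale_left field_simps power2_eq_square)
  then have "cmod (cinner f g) = inner (scaleC a f) g"
    by (simp add: inner_L2R_def)
  also have "\<dots> \<le> norm (scaleC a f) * norm g"
    by (rule norm_cauchy_schwarz)
  finally show ?thesis by (simp add: norm_scaleC a)
qed auto

lemma norm_add_sq: "(norm (f + g))\<^sup>2 = (norm f)\<^sup>2 + (norm g)\<^sup>2 + 2 * Re (cinner f g)" for f g :: L2R
  by (simp add: power2_norm_eq_inner inner_add_left inner_add_right inner_commute[of g f])
     (simp add: inner_L2R_def)

lemma norm_add_sq_le: "(norm (f + g))\<^sup>2 \<le> 2 * (norm f)\<^sup>2 + 2 * (norm g)\<^sup>2"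
  for f g :: "'a::real_normed_vector"
proof -
  have "(norm (f + g))\<^sup>2 \<le> (norm f + norm g)\<^sup>2"
    by (intro power_mono norm_triangle_ineq) auto
  also have "\<dots> \<le> 2 * (norm f)\<^sup>2 + 2 * (norm g)\<^sup>2"
    using sum_squares_bound[of "norm f" "norm g"] by (simp add: power2_sum)
  finally show ?thesis .
qed

lemma bounded_bilinear_cinner: "bounded_bilinear cinner"
proof
  show "\<exists>K. \<forall>a b. norm (cinner a b) \<le> norm a * norm b * K"
    by (intro exI[of _ 1]) (auto simp: cinner_norm_bound)
qed (auto simp: cinner_simps scaleC_of_real[symmetric] scaleR_conv_of_real)

lemma bounded_linear_scaleC: "bounded_linear (scaleC a)"
proof
  show "\<exists>K. \<forall>x. norm (scaleC a x) \<le> norm x * K"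
    by (intro exI[of _ "cmod a"]) (simp add: norm_scaleC)
qed (auto simp: L2R.scale_right_distrib scaleC_of_real[symmetric] mult.commute)

lemmas tendsto_cinner = bounded_bilinear.tendsto[OF bounded_bilinear_cinner]
lemmas continuous_on_cinner = bounded_bilinear.continuous_on[OF bounded_bilinear_cinner]

subsection \<open>Completeness\<close>

lemma norm_abs_L2R_nn:
  assumes "sq_integrable f"
  shows "ennreal ((norm (abs_L2R f))\<^sup>2) = (\<integral>\<^sup>+x. ennreal ((cmod (f x))\<^sup>2) \<partial>lborel)"
  using assms by (subst nn_integral_eq_integral) (auto simp: sq_integrable_def norm_abs_L2R)

lemma sq_integrable_nn:
  assumes "f \<in> borel_measurable lborel" "(\<integral>\<^sup>+x. ennreal ((cmod (f x))\<^sup>2) \<partial>lborel) < \<infinity>"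
  shows "sq_integrable f"
  unfolding sq_integrable_def
  using assms by (intro conjI integrableI_bounded) auto

text \<open>The Riesz-Fischer argument: fast decay of the increments in norm forces pointwise
  convergence almost everywhere, and Fatou's lemma identifies the pointwise limit as the limit in
  norm.\<close>

lemma L2R_fast_Cauchy_convergent:
  fixes X :: "nat \<Rightarrow> L2R"
  assumes X: "\<And>n. (norm (X (Suc n) - X n))\<^sup>2 \<le> (1/4) ^ n"
    and C: "Cauchy X"
  shows "convergent X"
proof -
  define f where "f n = rep_L2R (X n)" for n
  have sqf: "sq_integrable (f n)" for n by (simp add: f_def sq_integrable_rep)
  have Xf: "X n = abs_L2R (f n)" for n by (simp add: f_def abs_rep_L2R)
  have [measurable]: "f n \<in> borel_measurable borel" for n using sqf[of n] by (simp add: sq_integrable_def)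
  have diff: "ennreal ((norm (X m - X n))\<^sup>2) = (\<integral>\<^sup>+x. ennreal ((cmod (f m x - f n x))\<^sup>2) \<partial>lborel)" for m n
    unfolding Xf abs_L2R_diff[OF sqf sqf] by (rule norm_abs_L2R_nn[OF sq_integrable_diff[OF sqf sqf]])
  \<comment> \<open>The weight \<open>2 ^ n\<close> is affordable because the squared increments
    decay like \<open>(1/4) ^ n\<close>; finiteness of \<open>S x\<close> then makes the increments
    at \<open>x\<close> decay geometrically.\<close>
  define S where "S x = (\<Sum>n. ennreal (2 ^ n * (cmod (f (Suc n) x - f n x))\<^sup>2))" for x
  have [measurable]: "S \<in> borel_measurable borel" unfolding S_def by measurable
  have "(\<integral>\<^sup>+x. S x \<partial>lborel) = (\<Sum>n. (\<integral>\<^sup>+x. ennreal (2 ^ n * (cmod (f (Suc n) x - f n x))\<^sup>2) \<partial>lborel))"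
    unfolding S_def by (rule nn_integral_suminf) simp
  also have "\<dots> = (\<Sum>n. ennreal (2 ^ n * (norm (X (Suc n) - X n))\<^sup>2))"
    by (simp add: ennreal_mult nn_integral_cmult diff)
  also have "\<dots> \<le> (\<Sum>n. ennreal ((1/2) ^ n))"
  proof (intro suminf_le allI)
    fix n
    have "2 ^ n * (norm (X (Suc n) - X n))\<^sup>2 \<le> 2 ^ n * (1/4) ^ n"
      by (intro mult_left_mono X) auto
    also have "\<dots> = (1/2 :: real) ^ n" by (simp flip: power_mult_distrib)
    finally show "ennreal (2 ^ n * (norm (X (Suc n) - X n))\<^sup>2) \<le> ennreal ((1/2) ^ n)"
      by (rule ennreal_leI)
  qed auto
  also have "\<dots> < \<infinity>"
    by (subst suminf_ennreal2) (auto intro: summable_geometric)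
  finally have "(\<integral>\<^sup>+x. S x \<partial>lborel) \<noteq> \<infinity>" by simp
  then have AE_S: "AE x in lborel. S x \<noteq> \<infinity>"
    by (intro nn_integral_PInf_AE) auto
  have AE_conv: "AE x in lborel. convergent (\<lambda>n. f n x)"
    using AE_S
  proof eventually_elim
    fix x assume "S x \<noteq> \<infinity>"
    then obtain c where c: "S x = ennreal c" "c \<ge> 0" by (cases "S x") auto
    have "ennreal (2 ^ n * (cmod (f (Suc n) x - f n x))\<^sup>2) \<le> ennreal c" for n
    proof -
      have "(\<Sum>n\<in>{n}. ennreal (2 ^ n * (cmod (f (Suc n) x - f n x))\<^sup>2)) \<le> S x"
        unfolding S_def by (rule sum_le_suminf) simp_all
      then show ?thesis by (simp only: sum.insert sum.empty finite.emptyI empty_iff c) simp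
    qed
    then have b: "2 ^ n * (cmod (f (Suc n) x - f n x))\<^sup>2 \<le> c" for n
      using c(2) by (simp add: ennreal_le_iff)
    have d: "cmod (f (Suc n) x - f n x) \<le> sqrt c * (sqrt (1/2)) ^ n" for n
    proof (rule power2_le_imp_le)
      have "(cmod (f (Suc n) x - f n x))\<^sup>2 \<le> c * (1/2) ^ n"
        using b[of n] by (simp add: field_simps)
      also have "\<dots> = (sqrt c * (sqrt (1/2)) ^ n)\<^sup>2"
      proof -
        have "((sqrt (1/2)) ^ n)\<^sup>2 = ((sqrt (1/2 :: real))\<^sup>2) ^ n"
          by (simp only: power_mult[symmetric] mult.commute)
        then show ?thesis using c(2) by (simp add: power_mult_distrib)
      qed
      finally show "(cmod (f (Suc n) x - f n x))\<^sup>2 \<le> (sqrt c * (sqrt (1/2)) ^ n)\<^sup>2" .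
    qed (use c(2) in auto)
    have "summable (\<lambda>n. sqrt c * (sqrt (1/2)) ^ n)"
      by (intro summable_mult summable_geometric) (auto simp: real_sqrt_lt_1_iff)
    then have "summable (\<lambda>n. f (Suc n) x - f n x)"
      by (rule summable_comparison_test'[where N = 0]) (rule d)
    then have "convergent (\<lambda>n. \<Sum>i<n. f (Suc i) x - f i x)"
      by (simp only: summable_iff_convergent)
    then have "convergent (\<lambda>n. f n x - f 0 x)"
      by (simp only: sum_lessThan_telescope[of "\<lambda>i. f i x"])
    then have "convergent (\<lambda>n. (f n x - f 0 x) + f 0 x)"
      by (intro convergent_add convergent_const)
    then show "convergent (\<lambda>n. f n x)" by simp
  qed
  define g where "g x = lim (\<lambda>n. f n x)" for x
  have gm [measurable]: "g \<in> borel_measurable borel" unfolding g_def by measurable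
  have lim: "AE x in lborel. (\<lambda>n. f n x) \<longlonglongrightarrow> g x"
    using AE_conv by eventually_elim (simp add: g_def convergent_LIMSEQ_iff)
  \<comment> \<open>Fatou's lemma: a bound for the distances from \<open>X n\<close> to all later
    terms passes to the pointwise limit.\<close>
  have fat: "(\<integral>\<^sup>+x. ennreal ((cmod (g x - f n x))\<^sup>2) \<partial>lborel) \<le> ennreal e"
    if e: "\<And>m. m \<ge> n \<Longrightarrow> (norm (X m - X n))\<^sup>2 \<le> e" for n e
  proof -
    have "(\<integral>\<^sup>+x. ennreal ((cmod (g x - f n x))\<^sup>2) \<partial>lborel)
        = (\<integral>\<^sup>+x. liminf (\<lambda>m. ennreal ((cmod (f m x - f n x))\<^sup>2)) \<partial>lborel)"
      using lim
    proof (intro nn_integral_cong_AE, eventually_elim)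
      fix x assume "(\<lambda>n. f n x) \<longlonglongrightarrow> g x"
      then have "(\<lambda>m. ennreal ((cmod (f m x - f n x))\<^sup>2)) \<longlonglongrightarrow> ennreal ((cmod (g x - f n x))\<^sup>2)"
        by (intro tendsto_ennrealI tendsto_intros)
      then show "ennreal ((cmod (g x - f n x))\<^sup>2) = liminf (\<lambda>m. ennreal ((cmod (f m x - f n x))\<^sup>2))"
        by (metis lim_imp_Liminf trivial_limit_sequentially)
    qed
    also have "\<dots> \<le> liminf (\<lambda>m. ennreal ((norm (X m - X n))\<^sup>2))"
      unfolding diff by (rule nn_integral_liminf) simp
    also have "\<dots> \<le> ennreal e"
    proof (rule Liminf_le)
      show "\<forall>\<^sub>F m in sequentially. ennreal ((norm (X m - X n))\<^sup>2) \<le> ennreal e"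
        using eventually_ge_at_top[of n] by eventually_elim (intro ennreal_leI e)
    qed simp
    finally show ?thesis .
  qed
  have key: "\<exists>N. \<forall>n\<ge>N. sq_integrable (\<lambda>x. g x - f n x) \<and> (norm (abs_L2R (\<lambda>x. g x - f n x)))\<^sup>2 \<le> e"
    if "e > 0" for e
  proof -
    have "0 < sqrt e" using that by simp
    from CauchyD[OF C this] obtain N
      where N: "\<And>m n. m \<ge> N \<Longrightarrow> n \<ge> N \<Longrightarrow> norm (X m - X n) < sqrt e" by blast
    have N2: "(norm (X m - X n))\<^sup>2 \<le> e" if "m \<ge> N" "n \<ge> N" for m n
      using power_mono[OF less_imp_le[OF N[OF that]], of 2] \<open>e > 0\<close> by auto
    show ?thesis
    proof (intro exI[of _ N] allI impI)
      fix n assume n: "n \<ge> N"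
      have le: "(\<integral>\<^sup>+x. ennreal ((cmod (g x - f n x))\<^sup>2) \<partial>lborel) \<le> ennreal e"
        using N2 n by (intro fat) auto
      then have sq: "sq_integrable (\<lambda>x. g x - f n x)"
        by (intro sq_integrable_nn) (auto simp: le_less_trans[OF _ ennreal_less_top])
      then show "sq_integrable (\<lambda>x. g x - f n x) \<and> (norm (abs_L2R (\<lambda>x. g x - f n x)))\<^sup>2 \<le> e"
        using le that by (simp add: norm_abs_L2R_nn[symmetric] ennreal_le_iff)
    qed
  qed
  obtain N where "sq_integrable (\<lambda>x. g x - f N x)" using key[of 1] by auto
  then have sqg: "sq_integrable g"
    using sq_integrable_add[OF _ sqf[of N], of "\<lambda>x. g x - f N x"] by simp
  have "X \<longlonglongrightarrow> abs_L2R g"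
  proof (rule LIMSEQ_I)
    fix r :: real assume r: "0 < r"
    obtain N where N: "\<And>n. n \<ge> N \<Longrightarrow> (norm (abs_L2R (\<lambda>x. g x - f n x)))\<^sup>2 \<le> (r/2)\<^sup>2"
      using key[of "(r/2)\<^sup>2"] r by auto
    have "norm (X n - abs_L2R g) < r" if "n \<ge> N" for n
    proof -
      have "norm (abs_L2R g - X n) \<le> r/2"
        unfolding Xf abs_L2R_diff[OF sqg sqf]
        by (rule power2_le_imp_le[OF N[OF that]]) (use r in simp)
      then show ?thesis using r by (simp add: norm_minus_commute)
    qed
    then show "\<exists>no. \<forall>n\<ge>no. norm (X n - abs_L2R g) < r" by blast
  qed
  then show ?thesis by (auto simp: convergent_def)
qed

instance L2R :: complete_space
proof
  fix X :: "nat \<Rightarrow> L2R" assume X: "Cauchy X"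
  have "\<exists>N. \<forall>m\<ge>N. \<forall>n\<ge>N. (norm (X m - X n))\<^sup>2 \<le> (1/4) ^ k" for k
  proof -
    have "0 < (1/2 :: real) ^ k" by simp
    from CauchyD[OF X this] obtain N
      where "\<And>m n. m \<ge> N \<Longrightarrow> n \<ge> N \<Longrightarrow> norm (X m - X n) < (1/2) ^ k" by blast
    then have "(norm (X m - X n))\<^sup>2 \<le> ((1/2) ^ k)\<^sup>2" if "m \<ge> N" "n \<ge> N" for m n
      using that by (intro power_mono) (auto intro: less_imp_le)
    moreover have "((1/2) ^ k)\<^sup>2 = (1/4 :: real) ^ k"
      unfolding power2_eq_square power_mult_distrib[symmetric] by simp
    ultimately show ?thesis by auto
  qed
  then obtain N where N: "\<And>k m n. m \<ge> N k \<Longrightarrow> n \<ge> N k \<Longrightarrow> (norm (X m - X n))\<^sup>2 \<le> (1/4) ^ k"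
    by metis
  \<comment> \<open>The sum dominates each single \<open>N k\<close>, and the summand
    \<open>k\<close> makes the sequence strictly increasing.\<close>
  define r where "r k = (\<Sum>i\<le>k. N i) + k" for k
  have r1: "strict_mono r"
    by (intro strict_mono_Suc_iff[THEN iffD2]) (auto simp: r_def)
  have r2: "r k \<ge> N k" for k
    unfolding r_def using member_le_sum[of k "{..k}" N] by auto
  have "convergent (X \<circ> r)"
  proof (rule L2R_fast_Cauchy_convergent)
    show "Cauchy (X \<circ> r)" by (rule Cauchy_subseq_Cauchy[OF X r1])
    show "(norm ((X \<circ> r) (Suc n) - (X \<circ> r) n))\<^sup>2 \<le> (1/4) ^ n" for n
      unfolding o_def
      by (rule N) (use r2[of n] strict_monoD[OF r1, of n "Suc n"] in auto)
  qed
  then obtain l where "(X \<circ> r) \<longlonglongrightarrow> l" by (auto simp: convergent_def)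
  then have "X \<longlonglongrightarrow> l" by (rule Cauchy_converges_subseq[OF X r1])
  then show "convergent X" by (auto simp: convergent_def)
qed

instance L2R :: banach ..

subsection \<open>Riesz representation and square roots\<close>

lemma norm_minimal_orthogonal:
  fixes x y :: "'a::real_inner"
  assumes "\<And>t. norm x \<le> norm (x + t *\<^sub>R y)"
  shows "inner x y = 0"
proof (cases "y = 0")
  case False
  \<comment> \<open>The minimiser in \<open>t\<close> of the quadratic polynomial |x + t
    y|^2.\<close>
  define t where "t = - inner x y / (norm y)\<^sup>2"
  have y: "(norm y)\<^sup>2 > 0" using False by simp
  have "(norm x)\<^sup>2 \<le> (norm (x + t *\<^sub>R y))\<^sup>2"
    using assms[of t] by (intro power_mono) auto
  also have "\<dots> = (norm x)\<^sup>2 + 2 * t * inner x y + t\<^sup>2 * (norm y)\<^sup>2"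
    unfolding power2_norm_eq_inner by (simp add: algebra_simps inner_commute[of y x] power2_eq_square)
  also have "\<dots> = (norm x)\<^sup>2 - (inner x y)\<^sup>2 / (norm y)\<^sup>2"
    using y by (simp add: t_def field_simps power2_eq_square)
  finally have "(inner x y)\<^sup>2 / (norm y)\<^sup>2 \<le> 0" by simp
  then have "(inner x y)\<^sup>2 \<le> 0" using y by (simp add: field_simps)
  then show ?thesis by simp
qed auto

text \<open>Midpoints of a minimising sequence stay in \<open>S\<close> and so have squared norm at
  least the infimum; by the parallelogram law the sequence is Cauchy.\<close>

lemma closed_convex_norm_minimal:
  fixes S :: "'a::{real_inner,banach} set"
  assumes "closed S" "convex S" "S \<noteq> {}"
  shows "\<exists>x\<in>S. \<forall>y\<in>S. norm x \<le> norm y"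
proof -
  define D where "D = Inf ((\<lambda>x. (norm x)\<^sup>2) ` S)"
  have bdd: "bdd_below ((\<lambda>x. (norm x)\<^sup>2) ` S)" by (intro bdd_belowI[of _ 0]) auto
  have D: "D \<le> (norm y)\<^sup>2" if "y \<in> S" for y
    unfolding D_def using bdd that by (intro cInf_lower) auto
  have "\<exists>x\<in>S. (norm x)\<^sup>2 < D + 1 / real (Suc n)" for n
  proof -
    have "Inf ((\<lambda>x. (norm x)\<^sup>2) ` S) < D + 1 / real (Suc n)" by (simp add: D_def)
    then show ?thesis using cInf_lessD[of "(\<lambda>x. (norm x)\<^sup>2) ` S"] assms(3) by blast
  qed
  then obtain X where XS: "\<And>n. X n \<in> S" and X: "\<And>n. (norm (X n))\<^sup>2 < D + 1 / real (Suc n)"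
    by metis
  have dX: "(norm (X m - X n))\<^sup>2 \<le> 2 / real (Suc m) + 2 / real (Suc n)" for m n
  proof -
    have "(1/2) *\<^sub>R X m + (1/2) *\<^sub>R X n \<in> S"
      using assms(2) XS unfolding convex_def by simp
    then have "D \<le> (norm ((1/2) *\<^sub>R X m + (1/2) *\<^sub>R X n))\<^sup>2" by (rule D)
    also have "\<dots> = (norm (X m + X n))\<^sup>2 / 4"
      by (simp add: power_divide flip: scaleR_add_right)
    finally have "4 * D \<le> (norm (X m + X n))\<^sup>2" by simp
    moreover have "(norm (X m - X n))\<^sup>2 = 2 * (norm (X m))\<^sup>2 + 2 * (norm (X n))\<^sup>2 - (norm (X m + X n))\<^sup>2"
      unfolding power2_norm_eq_inner by (simp add: algebra_simps)
    ultimately show ?thesis using X[of m] X[of n] by simp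
  qed
  have "Cauchy X"
  proof (rule CauchyI)
    fix e :: real assume e: "0 < e"
    obtain N where N: "inverse (real (Suc N)) < e\<^sup>2 / 4"
      using reals_Archimedean[of "e\<^sup>2 / 4"] e by auto
    have "norm (X m - X n) < e" if "m \<ge> N" "n \<ge> N" for m n
    proof (rule power2_less_imp_less)
      have "2 / real (Suc m) \<le> 2 / real (Suc N)" "2 / real (Suc n) \<le> 2 / real (Suc N)"
        using that by (intro divide_left_mono; simp)+
      then have "(norm (X m - X n))\<^sup>2 \<le> 4 * inverse (real (Suc N))"
        using dX[of m n] unfolding divide_inverse by linarith
      then show "(norm (X m - X n))\<^sup>2 < e\<^sup>2" using N by simp
    qed (use e in simp)
    then show "\<exists>M. \<forall>m\<ge>M. \<forall>n\<ge>M. norm (X m - X n) < e" by blast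
  qed
  then obtain x where x: "X \<longlonglongrightarrow> x"
    using Cauchy_convergent convergent_def by blast
  have xS: "x \<in> S" using closed_sequentially[OF assms(1) XS x] .
  have "(\<lambda>n. (norm (X n))\<^sup>2) \<longlonglongrightarrow> (norm x)\<^sup>2" by (intro tendsto_intros x)
  moreover have "(\<lambda>n. D + 1 / real (Suc n)) \<longlonglongrightarrow> D + 0"
    using LIMSEQ_inverse_real_of_nat by (intro tendsto_intros) (simp add: inverse_eq_divide)
  ultimately have "(norm x)\<^sup>2 \<le> D + 0"
    using X by (intro LIMSEQ_le[where X = "\<lambda>n. (norm (X n))\<^sup>2"]) (auto intro: less_imp_le)
  then have "norm x \<le> norm y" if "y \<in> S" for y
    using D[OF that] by (intro power2_le_imp_le[of "norm x" "norm y"] norm_ge_zero) linarith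
  then show ?thesis using xS by blast
qed

text \<open>The element of least norm in the translate \<open>z + M\<close> is orthogonal to
  \<open>M\<close>, hence zero, which puts \<open>z\<close> into \<open>M\<close>.\<close>

lemma closed_subspace_eq_UNIV:
  fixes M :: "'a::{real_inner,banach} set"
  assumes M: "closed M" "subspace M" and perp: "\<And>y. (\<And>x. x \<in> M \<Longrightarrow> inner y x = 0) \<Longrightarrow> y = 0"
  shows "M = UNIV"
proof -
  have "z \<in> M" for z
  proof -
    have "closed ((+) z ` M)" using M by (simp add: closed_translation)
    moreover have "convex ((+) z ` M)" using M subspace_imp_convex by (simp add: convex_translation)
    moreover have "(+) z ` M \<noteq> {}" using M(2) subspace_0 by auto
    ultimately obtain x where x: "x \<in> (+) z ` M" "\<And>y. y \<in> (+) z ` M \<Longrightarrow> norm x \<le> norm y"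
      using closed_convex_norm_minimal[of "(+) z ` M"] by blast
    then obtain m where m: "m \<in> M" "x = z + m" by auto
    have "inner x y = 0" if "y \<in> M" for y
    proof (rule norm_minimal_orthogonal)
      fix t
      have "m + t *\<^sub>R y \<in> M" using m that M(2) by (simp add: subspace_add subspace_scale)
      then show "norm x \<le> norm (x + t *\<^sub>R y)"
        by (intro x(2)) (auto simp: m add.assoc)
    qed
    then have "x = 0" by (rule perp)
    then have "z = - m" using m(2) by (simp add: eq_neg_iff_add_eq_0)
    then show ?thesis using m(1) M(2) subspace_neg by blast
  qed
  then show ?thesis by auto
qed

text \<open>The element of least norm in the hyperplane where \<open>\<phi>\<close> equals 1 is
  orthogonal to the kernel of \<open>\<phi>\<close>; a rescaling of it represents
  \<open>\<phi>\<close>.\<close>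

lemma riesz_representation:
  fixes \<phi> :: "'a::{real_inner,banach} \<Rightarrow> real"
  assumes "bounded_linear \<phi>"
  obtains x where "\<And>y. \<phi> y = inner y x"
proof (cases "\<forall>y. \<phi> y = 0")
  case True
  then show ?thesis using that[of 0] by simp
next
  case False
  interpret bounded_linear \<phi> by (rule assms)
  from False obtain u where u: "\<phi> u \<noteq> 0" by auto
  let ?S = "{x. \<phi> x = 1}"
  have "closed ?S"
    by (intro closed_Collect_eq continuous_intros linear_continuous_on[OF assms])
  moreover have "convex ?S" by (auto simp: convex_def add scaleR)
  moreover have "(1 / \<phi> u) *\<^sub>R u \<in> ?S" using u by (simp add: scaleR)
  then have "?S \<noteq> {}" by blast
  ultimately obtain x where x: "\<phi> x = 1" "\<And>y. \<phi> y = 1 \<Longrightarrow> norm x \<le> norm y"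
    using closed_convex_norm_minimal[of ?S] by blast
  have perp: "inner x y = 0" if "\<phi> y = 0" for y
    by (rule norm_minimal_orthogonal) (rule x(2), simp add: add scaleR that x(1))
  have x0: "x \<noteq> 0" using x(1) zero by auto
  have "\<phi> y = inner y ((1 / (norm x)\<^sup>2) *\<^sub>R x)" for y
  proof -
    have "inner x (y - \<phi> y *\<^sub>R x) = 0" by (rule perp) (simp add: diff scaleR x(1))
    then have "inner y x = \<phi> y * (norm x)\<^sup>2"
      by (simp add: inner_diff_right power2_norm_eq_inner inner_commute[of x y])
    then show ?thesis using x0 by simp
  qed
  then show ?thesis using that by blast
qed

lemma bounded_bilinear_form_operator:
  fixes b :: "'a::{real_inner,banach} \<Rightarrow> 'a \<Rightarrow> real"
  assumes b: "bounded_bilinear b"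
  obtains W where "bounded_linear W" "\<And>f g. b f g = inner f (W g)"
proof -
  interpret bounded_bilinear b by (rule b)
  have "\<exists>x. \<forall>y. b y g = inner y x" for g
    using riesz_representation[OF bounded_linear_left] by metis
  then obtain W where W: "\<And>f g. b f g = inner f (W g)" by metis
  obtain K where K: "\<And>f g. norm (b f g) \<le> norm f * norm g * K" using bounded by blast
  have "bounded_linear W"
  proof (rule bounded_linear_intro[where K = "\<bar>K\<bar>"])
    show "W (f + g) = W f + W g" for f g
    proof (rule vector_eq_ldot[THEN iffD1, rule_format])
      show "inner z (W (f + g)) = inner z (W f + W g)" for z
        by (simp add: W[symmetric] inner_add_right add_right)
    qed
    show "W (r *\<^sub>R f) = r *\<^sub>R W f" for r f
    proof (rule vector_eq_ldot[THEN iffD1, rule_format])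
      show "inner z (W (r *\<^sub>R f)) = inner z (r *\<^sub>R W f)" for z
        by (simp add: W[symmetric] scaleR_right)
    qed
    show "norm (W f) \<le> norm f * \<bar>K\<bar>" for f
    proof (cases "W f = 0")
      case False
      have "norm (W f) * norm (W f) = b (W f) f" by (simp add: W power2_norm_eq_inner flip: power2_eq_square)
      also have "\<dots> \<le> norm (W f) * norm f * K" using K[of "W f" f] by simp
      also have "\<dots> \<le> norm (W f) * (norm f * \<bar>K\<bar>)" by (simp add: mult.assoc mult_left_mono)
      finally show ?thesis using False by simp
    qed simp
  qed
  then show ?thesis using that W by blast
qed

text \<open>Polarisation with \<open>g\<close> equal to \<open>Z f\<close> rescaled to the length of
  \<open>f\<close>: positivity discards the form at \<open>f - g\<close>, and the upper bound at
  \<open>f + g\<close> leaves exactly the constant \<open>\<rho>\<close>.\<close>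

lemma norm_le_of_quadratic_form:
  fixes Z :: "'a::real_inner \<Rightarrow> 'a"
  assumes "linear Z" and sym: "\<And>f g. inner (Z f) g = inner f (Z g)"
    and pos: "\<And>f. 0 \<le> inner (Z f) f" and le: "\<And>f. inner (Z f) f \<le> \<rho> * (norm f)\<^sup>2"
  shows "norm (Z f) \<le> \<rho> * norm f"
proof (cases "Z f = 0 \<or> f = 0")
  case True
  have "0 \<le> \<rho> * (norm f)\<^sup>2" using pos[of f] le[of f] by simp
  then show ?thesis
    using True assms(1) by (cases "f = 0") (auto simp: linear_0 zero_le_mult_iff)
next
  case False
  interpret linear Z by (rule assms)
  define g where "g = (norm f / norm (Z f)) *\<^sub>R Z f"
  have g: "norm g = norm f" using False by (simp add: g_def)
  have \<rho>: "0 \<le> \<rho>"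
    using order_trans[OF pos le, of f] False by (simp add: zero_le_mult_iff)
  have "4 * inner (Z f) g = inner (Z (f + g)) (f + g) - inner (Z (f - g)) (f - g)"
    by (simp add: add diff inner_add_left inner_add_right inner_diff_left inner_diff_right
        sym[of g f] inner_commute[of g "Z f"] sym[of f g])
  also have "\<dots> \<le> \<rho> * (norm (f + g))\<^sup>2" using le[of "f + g"] pos[of "f - g"] by simp
  also have "\<dots> \<le> \<rho> * (norm f + norm g)\<^sup>2"
    using \<rho> by (intro mult_left_mono power_mono norm_triangle_ineq) auto
  also have "\<dots> = 4 * (\<rho> * (norm f)\<^sup>2)" by (simp add: g power2_eq_square)
  finally have "inner (Z f) g \<le> \<rho> * (norm f)\<^sup>2" by simp
  moreover have "inner (Z f) g = norm f * norm (Z f)"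
    using False by (simp add: g_def power2_norm_eq_inner[symmetric] power2_eq_square)
  ultimately have "norm f * norm (Z f) \<le> norm f * (\<rho> * norm f)"
    by (simp add: power2_eq_square mult_ac)
  then show ?thesis using False by simp
qed

text \<open>With \<open>V = 1 - Y\<close>, the equation \<open>V V = 1 - Z\<close> says that
  \<open>Y\<close> is a fixed point of \<open>(Z + Y Y) / 2\<close>. On the ball of radius
  \<open>\<rho>\<close> this map is a contraction with constant \<open>\<rho>\<close>. Symmetry and
  commutation with the family \<open>\<C>\<close> are closed conditions preserved by the map, so the
  fixed point inherits them.\<close>

lemma symmetric_square_root:
  fixes Z :: "'a::{real_inner,banach} \<Rightarrow>\<^sub>L 'a"
  assumes Z: "norm Z \<le> \<rho>" "\<rho> < 1" and sym: "\<And>f g. inner (Z f) g = inner f (Z g)"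
    and bl: "\<And>C. C \<in> \<C> \<Longrightarrow> bounded_linear C" and comm: "\<And>C f. C \<in> \<C> \<Longrightarrow> Z (C f) = C (Z f)"
  obtains V :: "'a \<Rightarrow>\<^sub>L 'a"
  where "\<And>f g. inner (V f) g = inner f (V g)" "\<And>f. V (V f) = f - Z f"
    "\<And>C f. C \<in> \<C> \<Longrightarrow> V (C f) = C (V f)" "\<And>f. (1 - \<rho>) * norm f \<le> norm (V f)" "surj V"
proof -
  define S where "S = {Y :: 'a \<Rightarrow>\<^sub>L 'a. norm Y \<le> \<rho>} \<inter> (\<Inter>f. \<Inter>g. {Y :: 'a \<Rightarrow>\<^sub>L 'a. inner (Y f) g = inner f (Y g)}) \<inter>
    (\<Inter>C\<in>\<C>. \<Inter>f. {Y :: 'a \<Rightarrow>\<^sub>L 'a. Y (C f) = C (Y f)})"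
  have S: "Y \<in> S \<longleftrightarrow> norm Y \<le> \<rho> \<and> (\<forall>f g. inner (Y f) g = inner f (Y g)) \<and>
    (\<forall>C\<in>\<C>. \<forall>f. Y (C f) = C (Y f))" for Y by (auto simp: S_def)
  define F where "F Y = (1/2) *\<^sub>R (Z + (Y o\<^sub>L Y))" for Y
  have F: "F Y f = (1/2) *\<^sub>R (Z f + Y (Y f))" for Y f
    by (simp add: F_def blinfun.add_left blinfun.scaleR_left)
  have \<rho>: "0 \<le> \<rho>" using Z(1) norm_ge_zero order_trans by blast
  have ev: "continuous_on UNIV (\<lambda>Y :: 'a \<Rightarrow>\<^sub>L 'a. blinfun_apply Y f)" for f
    by (intro linear_continuous_on blinfun.bounded_linear_left)
  have evC: "continuous_on UNIV (\<lambda>Y :: 'a \<Rightarrow>\<^sub>L 'a. C (blinfun_apply Y f))" if "C \<in> \<C>" for C f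
    by (rule bounded_linear.continuous_on[OF bl[OF that] ev])
  have "closed {Y :: 'a \<Rightarrow>\<^sub>L 'a. norm Y \<le> \<rho>}"
    by (intro closed_Collect_le continuous_intros)
  moreover have "closed {Y :: 'a \<Rightarrow>\<^sub>L 'a. inner (Y f) g = inner f (Y g)}" for f g
    by (intro closed_Collect_eq continuous_on_inner continuous_on_const ev)
  moreover have "closed {Y :: 'a \<Rightarrow>\<^sub>L 'a. Y (C f) = C (Y f)}" if "C \<in> \<C>" for C f
    by (intro closed_Collect_eq evC[OF that] ev)
  ultimately have "closed S" unfolding S_def
    by (intro closed_Int closed_INT ballI) auto
  then have "complete S" by (simp add: complete_eq_closed)
  moreover have "Z \<in> S" using Z sym comm by (simp add: S)
  then have "S \<noteq> {}" by blast
  moreover have "F ` S \<subseteq> S"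
  proof (rule image_subsetI)
    fix Y assume Y: "Y \<in> S"
    have "norm (F Y) \<le> (1/2) * (norm Z + norm Y * norm Y)"
      unfolding F_def norm_scaleR
      using norm_triangle_ineq[of Z "Y o\<^sub>L Y"] norm_blinfun_compose[of Y Y] by simp
    also have "\<dots> \<le> (1/2) * (\<rho> + 1 * \<rho>)"
      using Y Z by (intro mult_mono add_mono) (auto simp: S)
    finally have "norm (F Y) \<le> \<rho>" by simp
    then show "F Y \<in> S"
      using Y sym comm bounded_linear.linear[OF bl]
      by (auto simp: S F inner_add_left inner_add_right linear_add linear_scale)
  qed
  moreover have "\<forall>x\<in>S. \<forall>y\<in>S. dist (F x) (F y) \<le> \<rho> * dist x y"
  proof (intro ballI)
    fix X Y assume XY: "X \<in> S" "Y \<in> S"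
    have "F X - F Y = (1/2) *\<^sub>R ((X o\<^sub>L (X - Y)) + ((X - Y) o\<^sub>L Y))"
      by (intro blinfun_eqI) (simp add: F blinfun.bilinear_simps algebra_simps)
    then have "norm (F X - F Y) \<le> (1/2) * (norm X * norm (X - Y) + norm (X - Y) * norm Y)"
      using norm_triangle_ineq[of "X o\<^sub>L (X - Y)" "(X - Y) o\<^sub>L Y"]
        norm_blinfun_compose[of X "X - Y"] norm_blinfun_compose[of "X - Y" Y] by simp
    also have "\<dots> \<le> (1/2) * (\<rho> * norm (X - Y) + norm (X - Y) * \<rho>)"
      using XY by (intro mult_left_mono add_mono mult_right_mono) (auto simp: S)
    finally show "dist (F X) (F Y) \<le> \<rho> * dist X Y" by (simp add: dist_norm mult.commute)
  qed
  ultimately obtain Y where Y: "Y \<in> S" "F Y = Y"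
    using Banach_fix[of S \<rho> F] \<rho> Z(2) by blast
  have YY: "Z f + Y (Y f) = 2 *\<^sub>R Y f" for f
    using arg_cong[OF Y(2), of "\<lambda>B. 2 *\<^sub>R blinfun_apply B f"] by (simp add: F)
  have nY: "norm (Y f) \<le> \<rho> * norm f" for f
    using Y norm_blinfun[of Y f] mult_right_mono[of "norm Y" \<rho> "norm f"] by (auto simp: S)
  define V where "V = id_blinfun - Y"
  have V: "V f = f - Y f" for f by (simp add: V_def blinfun.diff_left)
  show ?thesis
  proof (rule that[of V])
    show "inner (V f) g = inner f (V g)" for f g
      using Y by (simp add: V S inner_diff_left inner_diff_right)
    show "V (V f) = f - Z f" for f
      using YY[of f] by (simp add: V blinfun.bilinear_simps algebra_simps scaleR_2)
    show "V (C f) = C (V f)" if "C \<in> \<C>" for C f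
      using Y that bounded_linear.linear[OF bl[OF that]] by (simp add: V S linear_diff)
    show "(1 - \<rho>) * norm f \<le> norm (V f)" for f
      using nY[of f] norm_triangle_ineq2[of f "Y f"] by (simp add: V algebra_simps)
    \<comment> \<open>\<open>V x = g\<close> reads \<open>x = g + Y x\<close>, again a contraction
      since \<open>Y\<close> has norm at most \<open>\<rho>\<close>.\<close>
    have "\<exists>x. V x = g" for g
    proof -
      have "\<exists>!x. g + Y x = x"
      proof (rule banach_fix_type[OF \<rho> Z(2)], intro allI)
        show "dist (g + Y x) (g + Y y) \<le> \<rho> * dist x y" for x y
          using nY[of "x - y"] by (simp add: dist_norm blinfun.diff_right)
      qed
      then show ?thesis by (metis V add_diff_cancel_right')
    qed
    then show "surj V" by (metis surjI surj_def)
  qed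
qed

section \<open>Mean square growth of powers, invariant inner products and similarity\<close>

subsection \<open>Comparing power series by averaging over roots of unity\<close>

definition complex_linear :: "(L2R \<Rightarrow> L2R) \<Rightarrow> bool" where
  "complex_linear U \<longleftrightarrow> (\<forall>f g. U (f + g) = U f + U g) \<and> (\<forall>a f. U (scaleC a f) = scaleC a (U f))"

lemma complex_linear_add: "complex_linear U \<Longrightarrow> U (f + g) = U f + U g"
  and complex_linear_scale: "complex_linear U \<Longrightarrow> U (scaleC a f) = scaleC a (U f)"
  by (auto simp: complex_linear_def)


lemma complex_linear_diff: "complex_linear U \<Longrightarrow> U (f - g) = U f - U g"
  by (metis complex_linear_add diff_add_cancel eq_diff_eq)

lemma complex_linear_funpow: "complex_linear U \<Longrightarrow> complex_linear (U ^^ n)"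
  by (induction n) (auto simp: complex_linear_def)


lemma cinner_sum_left: "cinner (\<Sum>i\<in>I. f i) g = (\<Sum>i\<in>I. cinner (f i) g)"
  by (induction I rule: infinite_finite_induct) (auto simp: cinner_simps)

lemma cinner_sum_right: "cinner g (\<Sum>i\<in>I. f i) = (\<Sum>i\<in>I. cinner g (f i))"
  by (induction I rule: infinite_finite_induct) (auto simp: cinner_simps)

text \<open>Orthogonality of the characters of the cyclic group of order \<open>N\<close>. This
  finite form of Parseval's identity replaces the integral of a vector-valued function over a
  circle.\<close>

lemma roots_of_unity_parseval:
  fixes x :: "nat \<Rightarrow> L2R" and N :: nat
  defines "e \<equiv> \<lambda>k. cis (2 * pi * real k / real N)"
  assumes N: "N > 0"
  shows "(\<Sum>k<N. (norm (\<Sum>n<N. scaleC (e k ^ n) (x n)))\<^sup>2) = real N * (\<Sum>n<N. (norm (x n))\<^sup>2)"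
proof -
  have ekn: "e k ^ n = e n ^ k" for k n
    unfolding e_def Complex.DeMoivre by (rule arg_cong[of _ _ cis]) simp
  have e1: "cmod (e k) = 1" for k by (simp add: e_def)
  have eN: "e k ^ N = 1" for k
  proof -
    have "real N * (2 * pi * real k / real N) = 2 * pi * real k" using N by simp
    then show ?thesis unfolding e_def Complex.DeMoivre by (simp add: cis_multiple_2pi)
  qed
  have inj: "inj_on e {..<N}"
    using Complex.bij_betw_roots_unity[OF N] by (simp add: bij_betw_def e_def)
  have orth: "(\<Sum>k<N. (e n ^ k) * cnj (e m ^ k)) = (if n = m then of_nat N else 0)"
    if "n < N" "m < N" for n m
  proof -
    define z where "z = e n * cnj (e m)"
    have s: "(\<Sum>k<N. (e n ^ k) * cnj (e m ^ k)) = (\<Sum>k<N. z ^ k)"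
      by (simp add: z_def power_mult_distrib)
    have c: "e k * cnj (e k) = 1" for k
      using complex_norm_square[of "e k"] e1[of k] by simp
    show ?thesis
    proof (cases "n = m")
      case True
      then show ?thesis unfolding s by (simp add: z_def c)
    next
      case False
      have "z * e m = e n" by (metis z_def c mult.assoc mult.commute mult.left_neutral)
      then have "z \<noteq> 1" using False inj that by (auto simp: inj_on_def)
      moreover have "z ^ N = 1" using eN by (simp add: z_def power_mult_distrib flip: complex_cnj_power)
      ultimately show ?thesis unfolding s using False by (simp add: geometric_sum)
    qed
  qed
  have "complex_of_real (\<Sum>k<N. (norm (\<Sum>n<N. scaleC (e k ^ n) (x n)))\<^sup>2)
      = (\<Sum>k<N. cinner (\<Sum>n<N. scaleC (e n ^ k) (x n)) (\<Sum>m<N. scaleC (e m ^ k) (x m)))"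
    by (simp add: cinner_self ekn)
  also have "\<dots> = (\<Sum>k<N. \<Sum>n<N. \<Sum>m<N. (e n ^ k) * cnj (e m ^ k) * cinner (x n) (x m))"
    unfolding cinner_sum_left cinner_sum_right cinner_scale_left cinner_scale_right
    by (simp add: mult_ac sum_distrib_left) (rule sum.cong[OF refl], rule sum.swap)
  also have "\<dots> = (\<Sum>n<N. \<Sum>m<N. \<Sum>k<N. (e n ^ k) * cnj (e m ^ k) * cinner (x n) (x m))"
    by (subst sum.swap) (intro sum.cong refl sum.swap)
  also have "\<dots> = (\<Sum>n<N. \<Sum>m<N. (if n = m then of_nat N else 0) * cinner (x n) (x m))"
    by (intro sum.cong refl) (simp only: sum_distrib_right[symmetric] orth lessThan_iff)
  also have "\<dots> = (\<Sum>n<N. of_nat N * cinner (x n) (x n))"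
    by (intro sum.cong refl) (simp add: if_distrib[of "\<lambda>c. c * _"] sum.delta cong: if_cong)
  also have "\<dots> = complex_of_real (real N * (\<Sum>n<N. (norm (x n))\<^sup>2))"
    by (simp add: cinner_self sum_distrib_left)
  finally show ?thesis using of_real_eq_iff by blast
qed

text \<open>Both series are cut after \<open>N\<close> terms and evaluated at the
  \<open>N\<close>-th roots of unity, where Parseval is exact. The tails are uniformly small on the
  circle and vanish as \<open>N\<close> grows. The factor 4 comes from splitting off a tail twice
  with |a + b|^2 \<le> 2 |a|^2 + 2 |b|^2.\<close>

lemma power_series_square_sum_compare:
  fixes x y :: "nat \<Rightarrow> L2R"
  assumes x: "summable (\<lambda>n. norm (x n))" and y: "summable (\<lambda>n. norm (y n))"
    and le: "\<And>\<zeta>. cmod \<zeta> = 1 \<Longrightarrow> norm (\<Sum>n. scaleC (\<zeta> ^ n) (x n)) \<le> C * norm (\<Sum>n. scaleC (\<zeta> ^ n) (y n))"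
    and Q: "\<And>N. (\<Sum>n<N. (norm (y n))\<^sup>2) \<le> Q" and C: "C \<ge> 0"
  shows "(\<Sum>n<M. (norm (x n))\<^sup>2) \<le> 4 * C\<^sup>2 * Q"
proof -
  define tl where "tl z N = (\<Sum>n. norm (z (n + N)))" for z :: "nat \<Rightarrow> L2R" and N
  have tl0: "(tl z) \<longlonglongrightarrow> 0" if "summable (\<lambda>n. norm (z n))" for z :: "nat \<Rightarrow> L2R"
    unfolding tl_def by (rule suminf_exist_split2[OF that])
  have split: "norm ((\<Sum>n. scaleC (\<zeta> ^ n) (z n)) - (\<Sum>n<N. scaleC (\<zeta> ^ n) (z n))) \<le> tl z N"
    if z: "summable (\<lambda>n. norm (z n))" and \<zeta>: "cmod \<zeta> = 1" for z :: "nat \<Rightarrow> L2R" and \<zeta> N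
  proof -
    have n: "norm (scaleC (\<zeta> ^ n) (z n)) = norm (z n)" for n
      by (simp add: norm_scaleC norm_power \<zeta>)
    have s: "summable (\<lambda>n. scaleC (\<zeta> ^ n) (z n))"
      by (rule summable_norm_cancel) (simp only: n z)
    have "norm (\<Sum>n. scaleC (\<zeta> ^ (n + N)) (z (n + N))) \<le> (\<Sum>n. norm (scaleC (\<zeta> ^ (n + N)) (z (n + N))))"
      by (intro summable_norm) (simp only: n summable_ignore_initial_segment[OF z])
    also have "\<dots> = tl z N" by (simp only: n tl_def)
    finally show ?thesis by (simp add: suminf_split_initial_segment[OF s, of N])
  qed
  have step: "(\<Sum>n<M. (norm (x n))\<^sup>2) \<le> 4 * C\<^sup>2 * Q + 4 * C\<^sup>2 * (tl y N)\<^sup>2 + 2 * (tl x N)\<^sup>2"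
    if N: "N > 0" "M \<le> N" for N
  proof -
    define e where "e k = cis (2 * pi * real k / real N)" for k
    define X where "X k = (\<Sum>n<N. scaleC (e k ^ n) (x n))" for k
    define Y where "Y k = (\<Sum>n<N. scaleC (e k ^ n) (y n))" for k
    have p: "(norm (X k))\<^sup>2 \<le> 4 * C\<^sup>2 * (norm (Y k))\<^sup>2 + (4 * C\<^sup>2 * (tl y N)\<^sup>2 + 2 * (tl x N)\<^sup>2)" for k
    proof -
      define X' where "X' = (\<Sum>n. scaleC (e k ^ n) (x n))"
      define Y' where "Y' = (\<Sum>n. scaleC (e k ^ n) (y n))"
      have e1: "cmod (e k) = 1" by (simp add: e_def)
      have dx: "(norm (X k - X'))\<^sup>2 \<le> (tl x N)\<^sup>2"
        using split[OF x e1, of N] by (intro power_mono) (simp_all add: X_def X'_def norm_minus_commute)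
      have dy: "(norm (Y' - Y k))\<^sup>2 \<le> (tl y N)\<^sup>2"
        using split[OF y e1, of N] by (intro power_mono) (simp_all add: Y_def Y'_def)
      have "(norm (X k))\<^sup>2 \<le> 2 * (norm X')\<^sup>2 + 2 * (norm (X k - X'))\<^sup>2"
        using norm_add_sq_le[of X' "X k - X'"] by simp
      moreover have "(norm X')\<^sup>2 \<le> (C * norm Y')\<^sup>2"
        using le[OF e1] by (intro power_mono) (simp_all add: X'_def Y'_def)
      moreover have "(norm Y')\<^sup>2 \<le> 2 * (norm (Y k))\<^sup>2 + 2 * (norm (Y' - Y k))\<^sup>2"
        using norm_add_sq_le[of "Y k" "Y' - Y k"] by simp
      then have "(norm Y')\<^sup>2 \<le> 2 * (norm (Y k))\<^sup>2 + 2 * (tl y N)\<^sup>2" using dy by linarith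
      then have "C\<^sup>2 * (norm Y')\<^sup>2 \<le> C\<^sup>2 * (2 * (norm (Y k))\<^sup>2 + 2 * (tl y N)\<^sup>2)"
        by (rule mult_left_mono) simp
      ultimately show ?thesis using dx by (simp add: power_mult_distrib algebra_simps)
    qed
    have "real N * (\<Sum>n<M. (norm (x n))\<^sup>2) \<le> real N * (\<Sum>n<N. (norm (x n))\<^sup>2)"
      using N by (intro mult_left_mono sum_mono2) auto
    also have "\<dots> = (\<Sum>k<N. (norm (X k))\<^sup>2)"
      unfolding X_def e_def by (rule roots_of_unity_parseval[symmetric, OF N(1)])
    also have "\<dots> \<le> (\<Sum>k<N. 4 * C\<^sup>2 * (norm (Y k))\<^sup>2 + (4 * C\<^sup>2 * (tl y N)\<^sup>2 + 2 * (tl x N)\<^sup>2))"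
      by (intro sum_mono p)
    also have "\<dots> = 4 * C\<^sup>2 * (\<Sum>k<N. (norm (Y k))\<^sup>2) + real N * (4 * C\<^sup>2 * (tl y N)\<^sup>2 + 2 * (tl x N)\<^sup>2)"
      by (simp add: sum.distrib sum_distrib_left)
    also have "(\<Sum>k<N. (norm (Y k))\<^sup>2) = real N * (\<Sum>n<N. (norm (y n))\<^sup>2)"
      unfolding Y_def e_def by (rule roots_of_unity_parseval[OF N(1)])
    also have "4 * C\<^sup>2 * (real N * (\<Sum>n<N. (norm (y n))\<^sup>2)) \<le> 4 * C\<^sup>2 * (real N * Q)"
      by (intro mult_left_mono Q) auto
    finally have "real N * (\<Sum>n<M. (norm (x n))\<^sup>2)
        \<le> real N * (4 * C\<^sup>2 * Q + 4 * C\<^sup>2 * (tl y N)\<^sup>2 + 2 * (tl x N)\<^sup>2)"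
      by (simp add: algebra_simps)
    then show ?thesis using N(1) by simp
  qed
  have "(\<lambda>N. 4 * C\<^sup>2 * Q + 4 * C\<^sup>2 * (tl y N)\<^sup>2 + 2 * (tl x N)\<^sup>2) \<longlonglongrightarrow> 4 * C\<^sup>2 * Q + 4 * C\<^sup>2 * 0\<^sup>2 + 2 * 0\<^sup>2"
    by (intro tendsto_intros tl0 x y)
  then have "(\<Sum>n<M. (norm (x n))\<^sup>2) \<le> 4 * C\<^sup>2 * Q + 4 * C\<^sup>2 * 0\<^sup>2 + 2 * 0\<^sup>2"
    by (rule LIMSEQ_le_const) (intro exI[of _ "Suc M"] allI impI step, auto)
  then show ?thesis by simp
qed

subsection \<open>Growth of the powers of an operator from its resolvent in the unit disc\<close>

text \<open>\<open>S \<zeta>\<close> is the inverse of 1 - \<zeta> U, so its Taylor coefficients at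
  0 are the powers of \<open>U\<close>; Cauchy's inequality on the circle of radius \<open>r\<close>
  bounds them. The bound is crude, but with \<open>r\<close> close to 1 it makes the power series
  converge absolutely in the whole disc.\<close>

lemma resolvent_power_bound:
  fixes U :: "L2R \<Rightarrow> L2R" and S :: "complex \<Rightarrow> L2R \<Rightarrow> L2R"
  assumes U: "complex_linear U"
    and S: "\<And>\<zeta> g. cmod \<zeta> < 1 \<Longrightarrow> S \<zeta> g - scaleC \<zeta> (U (S \<zeta> g)) = g"
    and S': "\<And>\<zeta> s. cmod \<zeta> < 1 \<Longrightarrow> S \<zeta> (s - scaleC \<zeta> (U s)) = s"
    and bd: "\<And>\<zeta> g. cmod \<zeta> < 1 \<Longrightarrow> norm (S \<zeta> g) \<le> K / (1 - cmod \<zeta>) * norm g"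
    and r: "0 < r" "r < 1"
  shows "norm ((U ^^ n) g) \<le> K / (1 - r) / r ^ n * norm g"
proof -
  have K: "0 \<le> K" if "u \<noteq> 0" for u :: L2R
    using order_trans[OF norm_ge_zero bd[of 0 u]] that by (simp add: zero_le_mult_iff)
  \<comment> \<open>The resolvent identity, obtained by checking that the claimed right-hand side
    solves the equation that determines \<open>S \<zeta> g\<close>. It gives continuity and the
    derivative of the resolvent.\<close>
  have diff: "S \<zeta> g - S \<xi> g = scaleC (\<zeta> - \<xi>) (S \<zeta> (U (S \<xi> g)))" if "cmod \<zeta> < 1" "cmod \<xi> < 1" for \<zeta> \<xi> g
  proof -
    let ?a = "S \<zeta> g" and ?b = "S \<xi> g" and ?c = "S \<zeta> (U (S \<xi> g))"
    have c: "?c - scaleC \<zeta> (U ?c) = U ?b" by (rule S[OF that(1)])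
    define d where "d = \<zeta> - \<xi>"
    have "?b + scaleC d ?c - scaleC \<zeta> (U (?b + scaleC d ?c))
        = ?b + scaleC d (?c - scaleC \<zeta> (U ?c)) - scaleC \<zeta> (U ?b)"
      unfolding complex_linear_add[OF U] complex_linear_scale[OF U] L2R.scale_right_distrib
        L2R.scale_right_diff_distrib by (simp add: mult.commute)
    also have "\<dots> = ?b - scaleC \<xi> (U ?b)"
      unfolding c by (simp add: d_def L2R.scale_left_diff_distrib)
    also have "\<dots> = g" by (rule S[OF that(2)])
    finally have "S \<zeta> g = ?b + scaleC d ?c" using S'[OF that(1)] by metis
    then show ?thesis by (simp add: d_def)
  qed
  have comm: "S \<zeta> (U g) = U (S \<zeta> g)" if "cmod \<zeta> < 1" for \<zeta> g
  proof -
    have "U (S \<zeta> g) - scaleC \<zeta> (U (U (S \<zeta> g))) = U g"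
      using arg_cong[OF S[OF that, of g], of U]
      by (simp add: complex_linear_diff[OF U] complex_linear_scale[OF U])
    then show ?thesis using S'[OF that] by metis
  qed
  \<comment> \<open>Within half the distance of \<open>\<xi>\<close> to the unit circle the bound at
    most doubles, so it is locally uniform.\<close>
  have nbd: "norm (S \<zeta> g) \<le> 2 * K / (1 - cmod \<xi>) * norm g"
    if "cmod \<xi> < 1" "dist \<zeta> \<xi> < (1 - cmod \<xi>) / 2" for \<zeta> \<xi> g
  proof (cases "g = 0")
    case True
    have "cmod \<zeta> < 1"
      using that norm_triangle_sub[of \<zeta> \<xi>] by (simp add: dist_norm field_simps)
    then show ?thesis using bd[of \<zeta> 0] True by simp
  next
    case False
    have *: "cmod \<zeta> < 1" "(1 - cmod \<xi>) / 2 \<le> 1 - cmod \<zeta>"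
      using that norm_triangle_sub[of \<zeta> \<xi>] by (simp_all add: dist_norm field_simps)
    have "norm (S \<zeta> g) \<le> K / (1 - cmod \<zeta>) * norm g" by (rule bd[OF *(1)])
    also have "\<dots> \<le> K / ((1 - cmod \<xi>) / 2) * norm g"
      using * that K[OF False] by (intro mult_right_mono divide_left_mono mult_pos_pos) auto
    finally show ?thesis by (simp add: mult.commute)
  qed
  have cont: "((\<lambda>\<zeta>. S \<zeta> g) \<longlongrightarrow> S \<xi> g) (at \<xi>)" if \<xi>: "cmod \<xi> < 1" for \<xi> g
  proof -
    have "((\<lambda>\<zeta>. S \<zeta> g - S \<xi> g) \<longlongrightarrow> 0) (at \<xi>)"
    proof (rule Lim_null_comparison)
      have "\<forall>\<^sub>F \<zeta> in at \<xi>. dist \<zeta> \<xi> < (1 - cmod \<xi>) / 2"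
        unfolding eventually_at using \<xi> by (intro exI[of _ "(1 - cmod \<xi>) / 2"]) auto
      then show "\<forall>\<^sub>F \<zeta> in at \<xi>. norm (S \<zeta> g - S \<xi> g)
          \<le> cmod (\<zeta> - \<xi>) * (2 * K / (1 - cmod \<xi>) * norm (U (S \<xi> g)))"
      proof eventually_elim
        case (elim \<zeta>)
        have "cmod \<zeta> < 1"
          using elim \<xi> norm_triangle_sub[of \<zeta> \<xi>] by (simp add: dist_norm field_simps)
        then have "norm (S \<zeta> g - S \<xi> g) = cmod (\<zeta> - \<xi>) * norm (S \<zeta> (U (S \<xi> g)))"
          using diff \<xi> by (simp add: norm_scaleC)
        also have "\<dots> \<le> cmod (\<zeta> - \<xi>) * (2 * K / (1 - cmod \<xi>) * norm (U (S \<xi> g)))"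
          by (intro mult_left_mono nbd[OF \<xi> elim]) simp
        finally show ?case .
      qed
      have "((\<lambda>\<zeta>. cmod (\<zeta> - \<xi>) * (2 * K / (1 - cmod \<xi>) * norm (U (S \<xi> g)))) \<longlongrightarrow>
          cmod (\<xi> - \<xi>) * (2 * K / (1 - cmod \<xi>) * norm (U (S \<xi> g)))) (at \<xi>)"
        by (intro tendsto_intros)
      then show "((\<lambda>\<zeta>. cmod (\<zeta> - \<xi>) * (2 * K / (1 - cmod \<xi>) * norm (U (S \<xi> g)))) \<longlongrightarrow> 0) (at \<xi>)"
        by simp
    qed
    then show ?thesis by (simp add: LIM_zero_iff)
  qed
  define F where "F g h \<zeta> = cinner (S \<zeta> g) h" for g h \<zeta>
  have hol: "F g h holomorphic_on ball 0 1" for g h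
  proof (rule holomorphic_onI)
    fix \<xi> :: complex assume "\<xi> \<in> ball 0 1"
    then have \<xi>: "cmod \<xi> < 1" by simp
    have "((\<lambda>\<zeta>. cinner (S \<zeta> (U (S \<xi> g))) h) \<longlongrightarrow> cinner (S \<xi> (U (S \<xi> g))) h) (at \<xi>)"
      by (intro tendsto_cinner cont \<xi> tendsto_const)
    moreover have "\<forall>\<^sub>F \<zeta> in at \<xi>. cinner (S \<zeta> (U (S \<xi> g))) h = (F g h \<zeta> - F g h \<xi>) / (\<zeta> - \<xi>)"
    proof -
      have "\<forall>\<^sub>F \<zeta> in at \<xi>. \<zeta> \<in> ball 0 1" using \<xi> by (intro eventually_at_in_open') auto
      moreover have "\<forall>\<^sub>F \<zeta> in at \<xi>. \<zeta> \<noteq> \<xi>" by (rule eventually_neq_at_within)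
      ultimately show ?thesis
      proof eventually_elim
        case (elim \<zeta>)
        have "F g h \<zeta> - F g h \<xi> = cinner (S \<zeta> g - S \<xi> g) h" by (simp add: F_def cinner_simps)
        also have "\<dots> = (\<zeta> - \<xi>) * cinner (S \<zeta> (U (S \<xi> g))) h"
          using elim \<xi> by (simp add: diff cinner_simps)
        finally show ?case using elim by simp
      qed
    qed
    ultimately have "(F g h has_field_derivative cinner (S \<xi> (U (S \<xi> g))) h) (at \<xi>)"
      unfolding has_field_derivative_iff by (rule Lim_transform_eventually)
    then show "F g h field_differentiable at \<xi> within ball 0 1"
      by (meson field_differentiable_def has_field_derivative_at_within)
  qed
  have S0: "S 0 g = g" for g using S[of 0 g] by simp
  \<comment> \<open>Induction through F g = (g, h) + \<zeta> F (U g): in the Leibniz rule at 0 only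
    the first derivative of the factor \<zeta> survives, which contributes \<open>Suc n\<close>
    times the previous coefficient for \<open>U g\<close>.\<close>
  have coeff: "(deriv ^^ n) (F g h) 0 = fact n * cinner ((U ^^ n) g) h" for n g h
  proof (induction n arbitrary: g)
    case 0
    then show ?case by (simp add: F_def S0)
  next
    case (Suc n)
    have eq: "F g h \<zeta> = cinner g h + \<zeta> * F (U g) h \<zeta>" if "\<zeta> \<in> ball 0 1" for \<zeta>
    proof -
      have "S \<zeta> g = g + scaleC \<zeta> (S \<zeta> (U g))"
        using S[of \<zeta> g] comm[of \<zeta> g] that by (simp add: algebra_simps)
      then show ?thesis by (simp add: F_def cinner_simps)
    qed
    have hid: "(\<lambda>\<zeta>. \<zeta>) holomorphic_on ball (0 :: complex) 1" by (intro holomorphic_intros)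
    have "(deriv ^^ Suc n) (F g h) 0 = (deriv ^^ Suc n) (\<lambda>\<zeta>. cinner g h + \<zeta> * F (U g) h \<zeta>) 0"
      by (intro higher_deriv_cong_ev refl eventually_nhds_in_open[THEN eventually_mono, of "ball 0 1"] eq) auto
    also have "\<dots> = (deriv ^^ Suc n) (\<lambda>\<zeta>. cinner g h) 0 + (deriv ^^ Suc n) (\<lambda>\<zeta>. \<zeta> * F (U g) h \<zeta>) 0"
      by (rule higher_deriv_add[of _ "ball 0 1"]) (auto intro!: holomorphic_intros hol)
    also have "(deriv ^^ Suc n) (\<lambda>\<zeta>. cinner g h) 0 = 0"
      by (simp add: higher_deriv_const)
    also have "(deriv ^^ Suc n) (\<lambda>\<zeta>. \<zeta> * F (U g) h \<zeta>) 0 =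
        (\<Sum>i = 0..Suc n. of_nat (Suc n choose i) * (deriv ^^ i) (\<lambda>\<zeta>. \<zeta>) 0 * (deriv ^^ (Suc n - i)) (F (U g) h) 0)"
      by (rule higher_deriv_mult[OF hid hol]) auto
    also have "\<dots> = (\<Sum>i = 0..Suc n. if i = 1 then of_nat (Suc n) * (deriv ^^ n) (F (U g) h) 0 else 0)"
      by (intro sum.cong refl) (auto simp: higher_deriv_id)
    also have "\<dots> = of_nat (Suc n) * (deriv ^^ n) (F (U g) h) 0"
      by (subst sum.delta) auto
    also have "\<dots> = fact (Suc n) * cinner ((U ^^ Suc n) g) h"
      unfolding Suc by (simp add: funpow_swap1 algebra_simps)
    finally show ?case by simp
  qed
  \<comment> \<open>Testing against \<open>h = U^n g\<close> itself turns the bound on the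
    coefficient into a bound on the norm.\<close>
  define u where "u = (U ^^ n) g"
  have "cmod ((deriv ^^ n) (F g u) 0) \<le> fact n * (K / (1 - r) * norm g * norm u) / r ^ n"
  proof (rule Cauchy_inequality)
    show "F g u holomorphic_on ball 0 r" by (rule holomorphic_on_subset[OF hol]) (use r in auto)
    show "continuous_on (cball 0 r) (F g u)"
      by (rule holomorphic_on_imp_continuous_on[OF holomorphic_on_subset[OF hol]]) (use r in auto)
    show "cmod (F g u x) \<le> K / (1 - r) * norm g * norm u" if "cmod (0 - x) = r" for x
    proof -
      have "cmod (F g u x) \<le> norm (S x g) * norm u" unfolding F_def by (rule cinner_norm_bound)
      also have "\<dots> \<le> (K / (1 - r) * norm g) * norm u"
        using bd[of x g] that r by (intro mult_right_mono) auto
      finally show ?thesis .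
    qed
  qed (use r in simp)
  then have "fact n * cmod (cinner u u) \<le> fact n * (K / (1 - r) * norm g * norm u / r ^ n)"
    unfolding coeff by (simp add: norm_mult u_def[symmetric])
  then have "cmod (cinner u u) \<le> K / (1 - r) * norm g * norm u / r ^ n"
    by (rule mult_left_le_imp_le) simp
  then have "norm u * norm u \<le> (K / (1 - r) / r ^ n * norm g) * norm u"
    by (simp add: cinner_self power2_eq_square norm_mult mult_ac)
  then have *: "norm u \<le> K / (1 - r) / r ^ n * norm g" if "u \<noteq> 0"
    using that by (intro mult_right_le_imp_le[of "norm u" "norm u"]) auto
  have "0 \<le> K / (1 - r) / r ^ n * norm g"
    using K[of g] r by (cases "g = 0") auto
  then show ?thesis using * by (cases "u = 0") (auto simp: u_def)
qed

text \<open>The partial sums of the Neumann series telescope to \<open>s\<close> minus a remainder,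
  so no bound on the operator norm is needed, only decay of that remainder.\<close>

lemma resolvent_sums:
  assumes U: "complex_linear U" and s: "s - scaleC \<zeta> (U s) = g"
    and lim: "(\<lambda>n. cmod \<zeta> ^ n * norm ((U ^^ n) s)) \<longlonglongrightarrow> 0"
  shows "(\<lambda>n. scaleC (\<zeta> ^ n) ((U ^^ n) g)) sums s"
proof -
  have "(\<Sum>k<n. scaleC (\<zeta> ^ k) ((U ^^ k) g)) = s - scaleC (\<zeta> ^ n) ((U ^^ n) s)" for n
  proof (induction n)
    case (Suc n)
    have "(U ^^ n) g = (U ^^ n) s - scaleC \<zeta> ((U ^^ Suc n) s)"
      unfolding s[symmetric] using complex_linear_funpow[OF U, of n]
      by (simp add: complex_linear_diff complex_linear_scale funpow_swap1)
    then show ?case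
      by (simp add: Suc L2R.scale_right_diff_distrib mult.commute)
  qed simp
  moreover have "(\<lambda>n. scaleC (\<zeta> ^ n) ((U ^^ n) s)) \<longlonglongrightarrow> 0"
    by (rule tendsto_norm_zero_cancel) (simp add: norm_scaleC norm_power lim)
  then have "(\<lambda>n. s - scaleC (\<zeta> ^ n) ((U ^^ n) s)) \<longlonglongrightarrow> s - 0"
    by (intro tendsto_intros)
  ultimately show ?thesis by (simp add: sums_def)
qed

lemma contraction_series:
  assumes U: "complex_linear U" and c: "\<And>g. norm (U g) \<le> norm g"
  shows "norm ((U ^^ n) g) \<le> norm g"
proof (induction n)
  case (Suc n)
  then show ?case using c[of "(U ^^ n) g"] by simp
qed simp

lemma sum_power_sq_le:
  assumes "0 \<le> r" "r < (1::real)"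
  shows "(\<Sum>n<N. (r ^ n)\<^sup>2) \<le> 1 / (1 - r\<^sup>2)"
proof -
  have r: "r\<^sup>2 < 1" using assms by (simp add: power_less_one_iff abs_square_less_1)
  have "(\<Sum>n<N. (r ^ n)\<^sup>2) = (\<Sum>n<N. (r\<^sup>2) ^ n)" by (simp add: power_mult[symmetric] mult.commute)
  also have "\<dots> = (1 - (r\<^sup>2) ^ N) / (1 - r\<^sup>2)" using r by (simp add: sum_gp_strict)
  also have "\<dots> \<le> 1 / (1 - r\<^sup>2)" using r by (intro divide_right_mono) auto
  finally show ?thesis .
qed

text \<open>\<open>S\<close>, \<open>S0\<close>, \<open>S1\<close> are the resolvents of
  \<open>U\<close> and of the contractions \<open>U0\<close>, \<open>U1\<close>. For data in
  \<open>P\<close> the coefficients \<open>U^n g - U0^n g\<close> are compared in mean square with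
  \<open>U1^n g - U0^n g\<close>, which have norm at most \<open>2 |g|\<close>. This gives 4 C^2 *
  4; adding back the powers of \<open>U0\<close> doubles and adds 2, hence
  \<open>32 * C^2 + 2\<close> on \<open>P\<close>; a general \<open>g\<close> splits into two pieces
  from \<open>P\<close>, which costs another factor 4.\<close>

lemma resolvent_compare_powers:
  fixes U U0 U1 :: "L2R \<Rightarrow> L2R" and S S0 S1 :: "complex \<Rightarrow> L2R \<Rightarrow> L2R"
  assumes U: "complex_linear U" "complex_linear U0" "complex_linear U1"
    and c: "\<And>g. norm (U0 g) \<le> norm g" "\<And>g. norm (U1 g) \<le> norm g"
    and S: "\<And>\<zeta> g. cmod \<zeta> < 1 \<Longrightarrow> S \<zeta> g - scaleC \<zeta> (U (S \<zeta> g)) = g"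
    and S': "\<And>\<zeta> s. cmod \<zeta> < 1 \<Longrightarrow> S \<zeta> (s - scaleC \<zeta> (U s)) = s"
    and S0: "\<And>\<zeta> g. cmod \<zeta> < 1 \<Longrightarrow> S0 \<zeta> g - scaleC \<zeta> (U0 (S0 \<zeta> g)) = g"
    and S1: "\<And>\<zeta> g. cmod \<zeta> < 1 \<Longrightarrow> S1 \<zeta> g - scaleC \<zeta> (U1 (S1 \<zeta> g)) = g"
    and C: "C \<ge> 0" and P: "\<And>g. \<exists>g1\<in>P. \<exists>g2\<in>P. g = g1 + g2 \<and> norm g1 \<le> norm g \<and> norm g2 \<le> norm g"
    and le: "\<And>\<zeta> g. cmod \<zeta> < 1 \<Longrightarrow> g \<in> P \<Longrightarrow> norm (S \<zeta> g - S0 \<zeta> g) \<le> C * norm (S1 \<zeta> g - S0 \<zeta> g)"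
    and r: "0 < r" "r < 1"
  shows "summable (\<lambda>n. (r ^ n)\<^sup>2 * (norm ((U ^^ n) g))\<^sup>2)"
    and "(1 - r\<^sup>2) * (\<Sum>n<N. (r ^ n)\<^sup>2 * (norm ((U ^^ n) g))\<^sup>2) \<le> (128 * C\<^sup>2 + 8) * (norm g)\<^sup>2"
proof -
  have contr: "norm (T \<zeta> g) \<le> norm g / (1 - cmod \<zeta>)"
    if "\<And>g. norm (W g) \<le> norm g" "T \<zeta> g - scaleC \<zeta> (W (T \<zeta> g)) = g" "cmod \<zeta> < 1"
    for T W \<zeta> and g :: L2R
  proof -
    have "norm (T \<zeta> g) - cmod \<zeta> * norm (W (T \<zeta> g)) \<le> norm g"
      using norm_triangle_ineq2[of "T \<zeta> g" "scaleC \<zeta> (W (T \<zeta> g))"] by (simp add: that norm_scaleC)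
    moreover have "cmod \<zeta> * norm (W (T \<zeta> g)) \<le> cmod \<zeta> * norm (T \<zeta> g)"
      by (intro mult_left_mono that) auto
    ultimately have "norm (T \<zeta> g) * (1 - cmod \<zeta>) \<le> norm g" by (simp add: algebra_simps)
    then show ?thesis using that(3) by (simp add: pos_le_divide_eq)
  qed
  have Slin: "S \<zeta> (g + h) = S \<zeta> g + S \<zeta> h" if "cmod \<zeta> < 1" for \<zeta> g h
  proof -
    have "(S \<zeta> g + S \<zeta> h) - scaleC \<zeta> (U (S \<zeta> g + S \<zeta> h)) =
        (S \<zeta> g - scaleC \<zeta> (U (S \<zeta> g))) + (S \<zeta> h - scaleC \<zeta> (U (S \<zeta> h)))"
      by (simp add: complex_linear_add[OF U(1)] L2R.scale_right_distrib)
    then show ?thesis using S'[OF that, of "S \<zeta> g + S \<zeta> h"] by (simp add: S[OF that])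
  qed
  have bdP: "norm (S \<zeta> g) \<le> (1 + 2 * C) / (1 - cmod \<zeta>) * norm g" if \<zeta>: "cmod \<zeta> < 1" and g: "g \<in> P" for \<zeta> g
  proof -
    have c0: "norm (S0 \<zeta> g) \<le> norm g / (1 - cmod \<zeta>)"
      by (rule contr[where W = U0 and T = S0, OF c(1) S0[OF \<zeta>] \<zeta>])
    have c1: "norm (S1 \<zeta> g) \<le> norm g / (1 - cmod \<zeta>)"
      by (rule contr[where W = U1 and T = S1, OF c(2) S1[OF \<zeta>] \<zeta>])
    have "norm (S \<zeta> g) \<le> norm (S0 \<zeta> g) + norm (S \<zeta> g - S0 \<zeta> g)"
      using norm_triangle_ineq[of "S0 \<zeta> g" "S \<zeta> g - S0 \<zeta> g"] by simp
    also have "norm (S \<zeta> g - S0 \<zeta> g) \<le> C * norm (S1 \<zeta> g - S0 \<zeta> g)" by (rule le[OF \<zeta> g])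
    also have "norm (S1 \<zeta> g - S0 \<zeta> g) \<le> norm g / (1 - cmod \<zeta>) + norm g / (1 - cmod \<zeta>)"
      using norm_triangle_ineq4[of "S1 \<zeta> g" "S0 \<zeta> g"] c0 c1 by linarith
    finally have "norm (S \<zeta> g) \<le> norm (S0 \<zeta> g) + C * (norm g / (1 - cmod \<zeta>) + norm g / (1 - cmod \<zeta>))"
      using C by (simp add: mult_left_mono)
    also have "\<dots> \<le> norm g / (1 - cmod \<zeta>) + C * (norm g / (1 - cmod \<zeta>) + norm g / (1 - cmod \<zeta>))"
      using c0 by simp
    also have "\<dots> = (1 + 2 * C) / (1 - cmod \<zeta>) * norm g" by (simp add: divide_inverse algebra_simps)
    finally show ?thesis .
  qed
  \<comment> \<open>The constant for data in \<open>P\<close>, doubled for the two pieces of a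
    general vector.\<close>
  define B where "B = 2 * (1 + 2 * C)"
  have bd: "norm (S \<zeta> g) \<le> B / (1 - cmod \<zeta>) * norm g" if \<zeta>: "cmod \<zeta> < 1" for \<zeta> g
  proof -
    obtain g1 g2 where g: "g1 \<in> P" "g2 \<in> P" "g = g1 + g2" "norm g1 \<le> norm g" "norm g2 \<le> norm g"
      using P by blast
    have k: "0 \<le> (1 + 2 * C) / (1 - cmod \<zeta>)" using C \<zeta> by simp
    have "norm (S \<zeta> g) \<le> norm (S \<zeta> g1) + norm (S \<zeta> g2)"
      unfolding g(3) Slin[OF \<zeta>] by (rule norm_triangle_ineq)
    also have "\<dots> \<le> (1 + 2 * C) / (1 - cmod \<zeta>) * norm g + (1 + 2 * C) / (1 - cmod \<zeta>) * norm g"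
      using order_trans[OF bdP[OF \<zeta> g(1)] mult_left_mono[OF g(4) k]]
        order_trans[OF bdP[OF \<zeta> g(2)] mult_left_mono[OF g(5) k]] by (rule add_mono)
    also have "\<dots> = B / (1 - cmod \<zeta>) * norm g" by (simp add: B_def divide_inverse algebra_simps)
    finally show ?thesis .
  qed
  \<comment> \<open>A radius strictly between \<open>r\<close> and 1: powers growing at most like
    \<open>\<rho>^(-n)\<close> are summable against \<open>r^n\<close>.\<close>
  define \<rho> where "\<rho> = (1 + r) / 2"
  have \<rho>: "0 < \<rho>" "\<rho> < 1" "r < \<rho>" using r by (auto simp: \<rho>_def)
  have growth: "norm ((U ^^ n) g) \<le> B / (1 - \<rho>) / \<rho> ^ n * norm g" for n g
    using \<rho>(1,2) by (intro resolvent_power_bound[where S = S] U(1) S S' bd)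
  have sm: "summable (\<lambda>n. norm (scaleC (complex_of_real r ^ n) ((U ^^ n) g)))" for g
  proof (rule summable_comparison_test')
    show "summable (\<lambda>n. (r / \<rho>) ^ n * (B / (1 - \<rho>) * norm g))"
      using \<rho> r by (intro summable_mult2 summable_geometric) simp
    show "norm (norm (scaleC (complex_of_real r ^ n) ((U ^^ n) g))) \<le> (r / \<rho>) ^ n * (B / (1 - \<rho>) * norm g)"
      if "n \<ge> 0" for n
    proof -
      have "norm (scaleC (complex_of_real r ^ n) ((U ^^ n) g)) = r ^ n * norm ((U ^^ n) g)"
        using r by (simp add: norm_scaleC norm_power)
      also have "\<dots> \<le> r ^ n * (B / (1 - \<rho>) / \<rho> ^ n * norm g)"
        using growth[of n g] r by (intro mult_left_mono) auto
      finally show ?thesis by (simp add: power_divide mult.commute)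
    qed
  qed
  have lim: "(\<lambda>n. cmod \<zeta> ^ n * norm ((U ^^ n) s)) \<longlonglongrightarrow> 0" if "cmod \<zeta> = r" for \<zeta> s
    using summable_LIMSEQ_zero[OF sm[of s]] r that by (simp add: norm_scaleC norm_power)
  have limc: "(\<lambda>n. cmod \<zeta> ^ n * norm ((W ^^ n) s)) \<longlonglongrightarrow> 0"
    if "complex_linear W" "\<And>g. norm (W g) \<le> norm g" "cmod \<zeta> = r" for W \<zeta> and s :: L2R
  proof (rule tendsto_sandwich[OF always_eventually always_eventually tendsto_const])
    show "\<forall>n. cmod \<zeta> ^ n * norm ((W ^^ n) s) \<le> r ^ n * norm s"
      using contraction_series[OF that(1,2)] r that(3) by (auto intro!: mult_left_mono)
    show "(\<lambda>n. r ^ n * norm s) \<longlonglongrightarrow> 0"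
      using r by (intro tendsto_mult_left_zero LIMSEQ_power_zero) simp
  qed auto
  have smc: "summable (\<lambda>n. norm (scaleC (complex_of_real r ^ n) ((W ^^ n) g)))"
    if "complex_linear W" "\<And>g. norm (W g) \<le> norm g" for W and g :: L2R
  proof (rule summable_comparison_test'[where N = 0])
    show "summable (\<lambda>n. r ^ n * norm g)" using r by (intro summable_mult2 summable_geometric) simp
    show "norm (norm (scaleC (complex_of_real r ^ n) ((W ^^ n) g))) \<le> r ^ n * norm g" for n
      using contraction_series[OF that, of n g] r by (simp add: norm_scaleC norm_power mult_left_mono)
  qed
  have key: "(\<Sum>n<N. (norm (scaleC (complex_of_real r ^ n) ((U ^^ n) g - (U0 ^^ n) g)))\<^sup>2)
      \<le> 4 * C\<^sup>2 * (4 * (norm g)\<^sup>2 / (1 - r\<^sup>2))" if g: "g \<in> P" for g N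
  proof (rule power_series_square_sum_compare[OF _ _ _ _ C,
        where y = "\<lambda>n. scaleC (complex_of_real r ^ n) ((U1 ^^ n) g - (U0 ^^ n) g)"])
    have sd: "summable (\<lambda>n. norm (scaleC (complex_of_real r ^ n) (a n - b n)))"
      if "summable (\<lambda>n. norm (scaleC (complex_of_real r ^ n) (a n)))"
        "summable (\<lambda>n. norm (scaleC (complex_of_real r ^ n) (b n)))" for a b :: "nat \<Rightarrow> L2R"
      by (rule summable_comparison_test'[OF summable_add[OF that], of 0])
         (simp add: L2R.scale_right_diff_distrib norm_triangle_ineq4)
    show "summable (\<lambda>n. norm (scaleC (complex_of_real r ^ n) ((U ^^ n) g - (U0 ^^ n) g)))"
      by (intro sd sm smc U c)
    show "summable (\<lambda>n. norm (scaleC (complex_of_real r ^ n) ((U1 ^^ n) g - (U0 ^^ n) g)))"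
      by (intro sd smc U c)
    fix \<xi> :: complex assume \<xi>: "cmod \<xi> = 1"
    define \<zeta> where "\<zeta> = \<xi> * complex_of_real r"
    have \<zeta>: "cmod \<zeta> = r" using r \<xi> by (simp add: \<zeta>_def norm_mult)
    then have \<zeta>1: "cmod \<zeta> < 1" using r by simp
    have s: "(\<lambda>n. scaleC (\<zeta> ^ n) ((U ^^ n) g)) sums S \<zeta> g"
      "(\<lambda>n. scaleC (\<zeta> ^ n) ((U0 ^^ n) g)) sums S0 \<zeta> g"
      "(\<lambda>n. scaleC (\<zeta> ^ n) ((U1 ^^ n) g)) sums S1 \<zeta> g"
      using U c \<zeta> S[OF \<zeta>1] S0[OF \<zeta>1] S1[OF \<zeta>1] by (auto intro!: resolvent_sums lim limc)
    have "(\<Sum>n. scaleC (\<xi> ^ n) (scaleC (complex_of_real r ^ n) ((U ^^ n) g - (U0 ^^ n) g))) = S \<zeta> g - S0 \<zeta> g"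
      using sums_unique[OF sums_diff[OF s(1,2)]]
      by (simp add: \<zeta>_def power_mult_distrib L2R.scale_right_diff_distrib)
    moreover have "(\<Sum>n. scaleC (\<xi> ^ n) (scaleC (complex_of_real r ^ n) ((U1 ^^ n) g - (U0 ^^ n) g))) = S1 \<zeta> g - S0 \<zeta> g"
      using sums_unique[OF sums_diff[OF s(3,2)]]
      by (simp add: \<zeta>_def power_mult_distrib L2R.scale_right_diff_distrib)
    ultimately show "norm (\<Sum>n. scaleC (\<xi> ^ n) (scaleC (complex_of_real r ^ n) ((U ^^ n) g - (U0 ^^ n) g)))
        \<le> C * norm (\<Sum>n. scaleC (\<xi> ^ n) (scaleC (complex_of_real r ^ n) ((U1 ^^ n) g - (U0 ^^ n) g)))"
      using le[OF \<zeta>1 g] by simp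
  next
    fix N
    have "(norm (scaleC (complex_of_real r ^ n) ((U1 ^^ n) g - (U0 ^^ n) g)))\<^sup>2 \<le> (r ^ n)\<^sup>2 * (4 * (norm g)\<^sup>2)" for n
    proof -
      have "norm ((U1 ^^ n) g - (U0 ^^ n) g) \<le> 2 * norm g"
        using norm_triangle_ineq4[of "(U1 ^^ n) g" "(U0 ^^ n) g"]
          contraction_series[OF U(2) c(1), of n g] contraction_series[OF U(3) c(2), of n g] by linarith
      then have "(norm ((U1 ^^ n) g - (U0 ^^ n) g))\<^sup>2 \<le> (2 * norm g)\<^sup>2" by (rule power_mono) simp
      then show ?thesis
        using r by (simp add: norm_scaleC norm_power power_mult_distrib mult_left_mono)
    qed
    then have "(\<Sum>n<N. (norm (scaleC (complex_of_real r ^ n) ((U1 ^^ n) g - (U0 ^^ n) g)))\<^sup>2)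
        \<le> (\<Sum>n<N. (r ^ n)\<^sup>2) * (4 * (norm g)\<^sup>2)"
      unfolding sum_distrib_right by (intro sum_mono)
    also have "\<dots> \<le> 1 / (1 - r\<^sup>2) * (4 * (norm g)\<^sup>2)"
      by (intro mult_right_mono sum_power_sq_le) (use r in auto)
    finally show "(\<Sum>n<N. (norm (scaleC (complex_of_real r ^ n) ((U1 ^^ n) g - (U0 ^^ n) g)))\<^sup>2)
        \<le> 4 * (norm g)\<^sup>2 / (1 - r\<^sup>2)" by simp
  qed
  have r2: "r\<^sup>2 < 1" using r by (simp add: power_less_one_iff abs_square_less_1)
  have bP: "(1 - r\<^sup>2) * (\<Sum>n<N. (r ^ n)\<^sup>2 * (norm ((U ^^ n) g))\<^sup>2) \<le> (32 * C\<^sup>2 + 2) * (norm g)\<^sup>2"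
    if g: "g \<in> P" for g N
  proof -
    have "(r ^ n)\<^sup>2 * (norm ((U ^^ n) g))\<^sup>2 \<le>
        2 * (norm (scaleC (complex_of_real r ^ n) ((U ^^ n) g - (U0 ^^ n) g)))\<^sup>2 + 2 * ((r ^ n)\<^sup>2 * (norm g)\<^sup>2)" for n
    proof -
      have "(norm ((U ^^ n) g))\<^sup>2 \<le> 2 * (norm ((U ^^ n) g - (U0 ^^ n) g))\<^sup>2 + 2 * (norm ((U0 ^^ n) g))\<^sup>2"
        using norm_add_sq_le[of "(U ^^ n) g - (U0 ^^ n) g" "(U0 ^^ n) g"] by simp
      also have "(norm ((U0 ^^ n) g))\<^sup>2 \<le> (norm g)\<^sup>2"
        by (intro power_mono contraction_series U c) simp
      finally have "(norm ((U ^^ n) g))\<^sup>2 \<le> 2 * (norm ((U ^^ n) g - (U0 ^^ n) g))\<^sup>2 + 2 * (norm g)\<^sup>2" by simp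
      moreover have "(norm (scaleC (complex_of_real r ^ n) w))\<^sup>2 = (r ^ n)\<^sup>2 * (norm w)\<^sup>2" for w
        using r by (simp add: norm_scaleC norm_power power_mult_distrib)
      ultimately show ?thesis
        using mult_left_mono[of "(norm ((U ^^ n) g))\<^sup>2" _ "(r ^ n)\<^sup>2"]
        by (simp only: distrib_left[symmetric] mult.left_commute[of 2] zero_le_power2)
    qed
    then have "(\<Sum>n<N. (r ^ n)\<^sup>2 * (norm ((U ^^ n) g))\<^sup>2) \<le>
        (\<Sum>n<N. 2 * (norm (scaleC (complex_of_real r ^ n) ((U ^^ n) g - (U0 ^^ n) g)))\<^sup>2 + 2 * ((r ^ n)\<^sup>2 * (norm g)\<^sup>2))"
      by (intro sum_mono)
    also have "\<dots> = 2 * (\<Sum>n<N. (norm (scaleC (complex_of_real r ^ n) ((U ^^ n) g - (U0 ^^ n) g)))\<^sup>2)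
        + 2 * ((\<Sum>n<N. (r ^ n)\<^sup>2) * (norm g)\<^sup>2)"
      by (simp only: sum.distrib sum_distrib_left sum_distrib_right)
    also have "\<dots> \<le> 2 * (4 * C\<^sup>2 * (4 * (norm g)\<^sup>2 / (1 - r\<^sup>2))) + 2 * (1 / (1 - r\<^sup>2) * (norm g)\<^sup>2)"
      by (intro add_mono mult_left_mono mult_right_mono sum_power_sq_le key g) (use r in auto)
    also have "\<dots> = (32 * C\<^sup>2 + 2) * (norm g)\<^sup>2 / (1 - r\<^sup>2)"
      by (simp add: divide_inverse algebra_simps)
    finally show ?thesis using r2 by (simp add: pos_le_divide_eq mult.commute)
  qed
  show "(1 - r\<^sup>2) * (\<Sum>n<N. (r ^ n)\<^sup>2 * (norm ((U ^^ n) g))\<^sup>2) \<le> (128 * C\<^sup>2 + 8) * (norm g)\<^sup>2"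
  proof -
    obtain g1 g2 where g: "g1 \<in> P" "g2 \<in> P" "g = g1 + g2" "norm g1 \<le> norm g" "norm g2 \<le> norm g"
      using P by blast
    have "(r ^ n)\<^sup>2 * (norm ((U ^^ n) g))\<^sup>2 \<le>
        2 * ((r ^ n)\<^sup>2 * (norm ((U ^^ n) g1))\<^sup>2) + 2 * ((r ^ n)\<^sup>2 * (norm ((U ^^ n) g2))\<^sup>2)" for n
      using mult_left_mono[OF norm_add_sq_le[of "(U ^^ n) g1" "(U ^^ n) g2"], of "(r ^ n)\<^sup>2"]
      by (simp add: g(3) complex_linear_add[OF complex_linear_funpow[OF U(1)]] algebra_simps)
    then have "(\<Sum>n<N. (r ^ n)\<^sup>2 * (norm ((U ^^ n) g))\<^sup>2) \<le>
        (\<Sum>n<N. 2 * ((r ^ n)\<^sup>2 * (norm ((U ^^ n) g1))\<^sup>2) + 2 * ((r ^ n)\<^sup>2 * (norm ((U ^^ n) g2))\<^sup>2))"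
      by (intro sum_mono)
    also have "\<dots> = 2 * (\<Sum>n<N. (r ^ n)\<^sup>2 * (norm ((U ^^ n) g1))\<^sup>2) + 2 * (\<Sum>n<N. (r ^ n)\<^sup>2 * (norm ((U ^^ n) g2))\<^sup>2)"
      by (simp only: sum.distrib sum_distrib_left)
    finally have "(1 - r\<^sup>2) * (\<Sum>n<N. (r ^ n)\<^sup>2 * (norm ((U ^^ n) g))\<^sup>2) \<le> (1 - r\<^sup>2) *
        (2 * (\<Sum>n<N. (r ^ n)\<^sup>2 * (norm ((U ^^ n) g1))\<^sup>2) + 2 * (\<Sum>n<N. (r ^ n)\<^sup>2 * (norm ((U ^^ n) g2))\<^sup>2))"
      using r2 by (intro mult_left_mono) auto
    also have "\<dots> \<le> 2 * ((32 * C\<^sup>2 + 2) * (norm g1)\<^sup>2) + 2 * ((32 * C\<^sup>2 + 2) * (norm g2)\<^sup>2)"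
      using bP[OF g(1), of N] bP[OF g(2), of N] unfolding distrib_left mult.left_commute[of "1 - r\<^sup>2" 2]
      by linarith
    also have "\<dots> \<le> 2 * ((32 * C\<^sup>2 + 2) * (norm g)\<^sup>2) + 2 * ((32 * C\<^sup>2 + 2) * (norm g)\<^sup>2)"
      using g by (intro add_mono mult_left_mono power_mono) auto
    finally show ?thesis by (simp add: algebra_simps)
  qed
  show "summable (\<lambda>n. (r ^ n)\<^sup>2 * (norm ((U ^^ n) g))\<^sup>2)"
  proof -
    have "summable (\<lambda>n. (norm (scaleC (complex_of_real r ^ n) ((U ^^ n) g)))\<^sup>2)"
    proof (rule summable_comparison_test_ev[OF _ sm[of g]])
      have "\<forall>\<^sub>F n in sequentially. norm (scaleC (complex_of_real r ^ n) ((U ^^ n) g)) < 1"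
        using order_tendstoD(2)[OF summable_LIMSEQ_zero[OF sm[of g]], of 1] by simp
      then show "\<forall>\<^sub>F n in sequentially. norm ((norm (scaleC (complex_of_real r ^ n) ((U ^^ n) g)))\<^sup>2)
          \<le> norm (scaleC (complex_of_real r ^ n) ((U ^^ n) g))"
        by eventually_elim (simp add: power2_eq_square mult_left_le)
    qed
    then show ?thesis using r by (simp add: norm_scaleC norm_power power_mult_distrib)
  qed
qed

subsection \<open>An invariant inner product\<close>

text \<open>By Tychonoff the functions \<open>p k\<close> lie in a compact product of intervals and
  so have a cluster point. A filter is used instead of a subsequence because the index type may be
  uncountable; it will be the set of all pairs of vectors.\<close>

lemma pointwise_cluster_filter:
  fixes p :: "nat \<Rightarrow> 'a \<Rightarrow> real"
  assumes "\<And>k i. \<bar>p k i\<bar> \<le> c i"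
  obtains x G where "G \<noteq> bot" "G \<le> sequentially" "\<And>i. ((\<lambda>k. p k i) \<longlongrightarrow> x i) G"
proof -
  let ?K = "PiE UNIV (\<lambda>i. {- c i..c i})"
  have "compactin (product_topology (\<lambda>_. euclidean) UNIV) ?K"
    unfolding compactin_PiE by simp
  then have "compact ?K" by (simp add: euclidean_product_topology)
  moreover have "filtermap p sequentially \<noteq> bot" by (simp add: filtermap_bot_iff)
  moreover have "p k \<in> ?K" for k
    using assms[of k] by (auto simp: abs_le_iff minus_le_iff)
  then have "eventually (\<lambda>f. f \<in> ?K) (filtermap p sequentially)"
    by (simp add: eventually_filtermap)
  ultimately obtain x where x: "inf (nhds x) (filtermap p sequentially) \<noteq> bot"
    unfolding compact_filter by blast
  \<comment> \<open>Pulling back the neighbourhoods of the cluster point along \<open>p\<close> and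
    intersecting with the tails gives a filter on indices along which \<open>p\<close> converges to
    \<open>x\<close>.\<close>
  define G where "G = inf (filtercomap p (nhds x)) sequentially"
  have "G \<noteq> bot"
  proof
    assume "G = bot"
    then have "eventually (\<lambda>_. False) G" by simp
    then obtain P Q where PQ: "eventually P (filtercomap p (nhds x))" "eventually Q sequentially"
      "\<And>k. P k \<Longrightarrow> Q k \<Longrightarrow> False"
      unfolding G_def eventually_inf by blast
    then obtain R where R: "eventually R (nhds x)" "\<And>k. R (p k) \<Longrightarrow> P k"
      unfolding eventually_filtercomap by blast
    have "eventually (\<lambda>f. \<not> R f) (filtermap p sequentially)"
      using PQ(2) unfolding eventually_filtermap by eventually_elim (use PQ(3) R(2) in blast)
    with R(1) have "eventually (\<lambda>_. False) (inf (nhds x) (filtermap p sequentially))"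
      unfolding eventually_inf by blast
    then show False using x by (simp add: eventually_False)
  qed
  moreover have "G \<le> sequentially" by (simp add: G_def)
  moreover have "((\<lambda>k. p k i) \<longlongrightarrow> x i) G" for i
  proof -
    have "filterlim p (nhds x) G"
      unfolding G_def by (rule filterlim_mono[OF filterlim_filtercomap order_refl]) simp
    moreover have "((\<lambda>f. f i) \<longlongrightarrow> x i) (nhds x)"
    proof (rule topological_tendstoI)
      fix S :: "real set" assume S: "open S" "x i \<in> S"
      have "open ((\<lambda>f. f i) -` S)"
        by (rule open_vimage[OF S(1) continuous_on_product_coordinates])
      then show "eventually (\<lambda>f. f i \<in> S) (nhds x)"
        unfolding eventually_nhds using S(2) by (intro exI[of _ "(\<lambda>f. f i) -` S"]) auto
    qed
    ultimately show ?thesis by (rule filterlim_compose[rotated])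
  qed
  ultimately show ?thesis using that by blast
qed

lemma inner_scaleC_right: "inner f (scaleC a g) = inner (scaleC (cnj a) f) g"
  by (simp add: inner_L2R_def cinner_simps)

lemma abs_inner_le_squares:
  fixes f g :: "'a::real_inner"
  shows "\<bar>inner f g\<bar> \<le> ((norm f)\<^sup>2 + (norm g)\<^sup>2) / 2"
  using Cauchy_Schwarz_ineq2[of f g] sum_squares_bound[of "norm f" "norm g"]
  by (simp add: mult.assoc)

text \<open>The forms (1 - r^2) \<Sigma> r^(2n) (U^n f, U^n g) are bounded by hypothesis, and
  shifting the index changes them by a term of size 1 - r^2. Any cluster point as r tends to 1 is
  therefore invariant under \<open>U\<close>. Complex homogeneity, symmetry and both bounds pass to
  the limit.\<close>

lemma invariant_form:
  assumes U: "complex_linear U"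
    and sm: "\<And>r f. 0 < r \<Longrightarrow> r < 1 \<Longrightarrow> summable (\<lambda>n. (r ^ n)\<^sup>2 * (norm ((U ^^ n) f))\<^sup>2)"
    and bd: "\<And>r f N. 0 < r \<Longrightarrow> r < 1 \<Longrightarrow>
      (1 - r\<^sup>2) * (\<Sum>n<N. (r ^ n)\<^sup>2 * (norm ((U ^^ n) f))\<^sup>2) \<le> K * (norm f)\<^sup>2"
    and K: "K > 0"
    and J: "\<And>f. norm (J f) = norm f" "\<And>f g. inner (J (U f)) (U g) = inner (J f) g"
  obtains b :: "L2R \<Rightarrow> L2R \<Rightarrow> real"
  where "bounded_bilinear b" "\<And>f g. b f g = b g f" "\<And>f g. b (U f) (U g) = b f g"
    "\<And>a f g. b f (scaleC a g) = b (scaleC (cnj a) f) g"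
    "\<And>f. (norm f)\<^sup>2 \<le> K * b f f" "\<And>f. b f f \<le> K * (norm f)\<^sup>2"
proof -
  define r where "r k = 1 - 1 / (real k + 2)" for k
  have r: "0 < r k" "r k < 1" for k by (auto simp: r_def field_simps)
  have r2: "(r k)\<^sup>2 < 1" for k using r[of k] by (simp add: power_less_one_iff abs_square_less_1)
  have rlim: "r \<longlonglongrightarrow> 1" unfolding r_def by real_asymp
  define p where "p k = (\<lambda>(f, g). (1 - (r k)\<^sup>2) * (\<Sum>n. (r k ^ n)\<^sup>2 * inner ((U ^^ n) f) ((U ^^ n) g)))" for k
  have Un: "complex_linear (U ^^ n)" for n by (rule complex_linear_funpow[OF U])
  have smi: "summable (\<lambda>n. (r k ^ n)\<^sup>2 * inner ((U ^^ n) f) ((U ^^ n) g))" for k f g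
  proof (rule summable_comparison_test'[where N = 0])
    show "summable (\<lambda>n. ((r k ^ n)\<^sup>2 * (norm ((U ^^ n) f))\<^sup>2 + (r k ^ n)\<^sup>2 * (norm ((U ^^ n) g))\<^sup>2) / 2)"
      by (intro summable_divide summable_add sm r)
    show "norm ((r k ^ n)\<^sup>2 * inner ((U ^^ n) f) ((U ^^ n) g))
        \<le> ((r k ^ n)\<^sup>2 * (norm ((U ^^ n) f))\<^sup>2 + (r k ^ n)\<^sup>2 * (norm ((U ^^ n) g))\<^sup>2) / 2" for n
      using mult_left_mono[OF abs_inner_le_squares[of "(U ^^ n) f" "(U ^^ n) g"], of "(r k ^ n)\<^sup>2"]
      by (simp add: abs_mult algebra_simps)
  qed
  define q where "q k f = p k (f, f)" for k f
  have q: "q k f = (1 - (r k)\<^sup>2) * (\<Sum>n. (r k ^ n)\<^sup>2 * (norm ((U ^^ n) f))\<^sup>2)" for k f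
    by (simp add: q_def p_def power2_norm_eq_inner)
  have q_le: "q k f \<le> K * (norm f)\<^sup>2" for k f
  proof -
    have "(\<Sum>n. (r k ^ n)\<^sup>2 * (norm ((U ^^ n) f))\<^sup>2) \<le> K * (norm f)\<^sup>2 / (1 - (r k)\<^sup>2)"
      by (rule suminf_le_const[OF sm]) (use r[of k] r2[of k] bd[of "r k" f] in \<open>auto simp: pos_le_divide_eq mult.commute\<close>)
    then show ?thesis unfolding q using r2[of k] by (simp add: pos_le_divide_eq mult.commute)
  qed
  have p_abs: "\<bar>p k (f, g)\<bar> \<le> (q k f + q k g) / 2" for k f g
  proof -
    have "norm (\<Sum>n. (r k ^ n)\<^sup>2 * inner ((U ^^ n) f) ((U ^^ n) g))
        \<le> (\<Sum>n. ((r k ^ n)\<^sup>2 * (norm ((U ^^ n) f))\<^sup>2 + (r k ^ n)\<^sup>2 * (norm ((U ^^ n) g))\<^sup>2) / 2)"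
    proof (rule norm_suminf_le)
      show "norm ((r k ^ n)\<^sup>2 * inner ((U ^^ n) f) ((U ^^ n) g))
          \<le> ((r k ^ n)\<^sup>2 * (norm ((U ^^ n) f))\<^sup>2 + (r k ^ n)\<^sup>2 * (norm ((U ^^ n) g))\<^sup>2) / 2" for n
        using mult_left_mono[OF abs_inner_le_squares[of "(U ^^ n) f" "(U ^^ n) g"], of "(r k ^ n)\<^sup>2"]
        by (simp add: abs_mult algebra_simps)
    qed (intro summable_divide summable_add sm r)
    also have "\<dots> = ((\<Sum>n. (r k ^ n)\<^sup>2 * (norm ((U ^^ n) f))\<^sup>2) + (\<Sum>n. (r k ^ n)\<^sup>2 * (norm ((U ^^ n) g))\<^sup>2)) / 2"
      by (subst suminf_divide) (intro summable_add sm r, subst suminf_add, intro sm r, intro sm r, rule refl)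
    finally have "\<bar>\<Sum>n. (r k ^ n)\<^sup>2 * inner ((U ^^ n) f) ((U ^^ n) g)\<bar>
        \<le> ((\<Sum>n. (r k ^ n)\<^sup>2 * (norm ((U ^^ n) f))\<^sup>2) + (\<Sum>n. (r k ^ n)\<^sup>2 * (norm ((U ^^ n) g))\<^sup>2)) / 2" by simp
    from mult_left_mono[OF this, of "1 - (r k)\<^sup>2"] show ?thesis
      using r2[of k] by (simp add: p_def q abs_mult distrib_left)
  qed
  have p_bd: "\<bar>p k i\<bar> \<le> (\<lambda>(f, g). K * ((norm f)\<^sup>2 + (norm g)\<^sup>2) / 2) i" for k i
  proof (cases i)
    case (Pair f g)
    then show ?thesis
      using p_abs[of k f g] q_le[of k f] q_le[of k g] by (simp add: algebra_simps)
  qed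
  obtain x G where G: "G \<noteq> bot" "G \<le> sequentially" and x: "\<And>i. ((\<lambda>k. p k i) \<longlongrightarrow> x i) G"
    using pointwise_cluster_filter[of p, OF p_bd] by blast
  define b where "b f g = x (f, g)" for f g
  have b: "((\<lambda>k. p k (f, g)) \<longlongrightarrow> b f g) G" for f g unfolding b_def by (rule x)
  have rG: "(r \<longlongrightarrow> 1) G" by (rule tendsto_mono[OF G(2) rlim])
  note uniq = tendsto_unique[OF G(1)]
  have p_sym: "p k (f, g) = p k (g, f)" for k f g by (simp add: p_def inner_commute)
  have b_sym: "b f g = b g f" for f g
    using b[of f g] b[of g f] by (simp add: p_sym[of _ f g] uniq)
  have b_add: "b (f + g) h = b f h + b g h" for f g h
  proof (rule uniq[OF b])
    have "p k (f + g, h) = p k (f, h) + p k (g, h)" for k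
      using suminf_add[OF smi[of k f h] smi[of k g h]]
      by (simp add: p_def complex_linear_add[OF Un] inner_add_left distrib_left flip: distrib_left)
    then show "((\<lambda>k. p k (f + g, h)) \<longlongrightarrow> b f h + b g h) G" by (simp add: tendsto_add b)
  qed
  have b_scaleC: "b f (scaleC a g) = b (scaleC (cnj a) f) g" for a f g
    by (rule uniq[OF b]) (use b[of "scaleC (cnj a) f" g] in
      \<open>simp add: p_def complex_linear_scale[OF Un] inner_scaleC_right\<close>)
  have b_scale: "b (c *\<^sub>R f) g = c * b f g" for c f g
  proof (rule uniq[OF b])
    have "p k (c *\<^sub>R f, g) = c * p k (f, g)" for k
      using suminf_mult[OF smi[of k f g], of c]
      by (simp add: p_def complex_linear_scale[OF Un] mult_ac flip: scaleC_of_real)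
         (simp add: scaleC_of_real mult_ac)
    then show "((\<lambda>k. p k (c *\<^sub>R f, g)) \<longlongrightarrow> c * b f g) G" by (simp add: tendsto_mult_left b)
  qed
  have b_U: "b (U f) (U g) = b f g" for f g
  proof -
    \<comment> \<open>Removing the term \<open>n = 0\<close> and shifting the index: invariance up
      to a defect that vanishes as \<open>r k\<close> tends to 1.\<close>
    have rec: "(r k)\<^sup>2 * p k (U f, U g) = p k (f, g) - (1 - (r k)\<^sup>2) * inner f g" for k
    proof -
      have "(\<Sum>n. (r k ^ Suc n)\<^sup>2 * inner ((U ^^ Suc n) f) ((U ^^ Suc n) g))
          = (\<Sum>n. (r k ^ n)\<^sup>2 * inner ((U ^^ n) f) ((U ^^ n) g)) - inner f g"
        using suminf_split_head[OF smi[of k f g]] by simp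
      moreover have "(\<Sum>n. (r k ^ Suc n)\<^sup>2 * inner ((U ^^ Suc n) f) ((U ^^ Suc n) g))
          = (r k)\<^sup>2 * (\<Sum>n. (r k ^ n)\<^sup>2 * inner ((U ^^ n) (U f)) ((U ^^ n) (U g)))"
        by (subst suminf_mult[symmetric, OF smi]) (simp add: power_mult_distrib funpow_swap1 mult.assoc)
      ultimately have e: "(r k)\<^sup>2 * (\<Sum>n. (r k ^ n)\<^sup>2 * inner ((U ^^ n) (U f)) ((U ^^ n) (U g)))
          = (\<Sum>n. (r k ^ n)\<^sup>2 * inner ((U ^^ n) f) ((U ^^ n) g)) - inner f g" by simp
      show ?thesis
        unfolding p_def prod.case mult.left_commute[of "(r k)\<^sup>2"] e by (simp add: right_diff_distrib)
    qed
    have "((\<lambda>k. (r k)\<^sup>2 * p k (U f, U g)) \<longlongrightarrow> 1\<^sup>2 * b (U f) (U g)) G"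
      by (intro tendsto_intros rG b)
    moreover have "((\<lambda>k. p k (f, g) - (1 - (r k)\<^sup>2) * inner f g) \<longlongrightarrow> b f g - (1 - 1\<^sup>2) * inner f g) G"
      by (intro tendsto_intros rG b)
    ultimately show ?thesis unfolding rec using uniq by fastforce
  qed
  have JUn: "inner (J ((U ^^ n) f)) ((U ^^ n) g) = inner (J f) g" for n f g
    by (induction n) (auto simp: J(2))
  \<comment> \<open>The indefinite form is preserved, so |f|^2 is its value at \<open>U^n f\<close>
    and \<open>U^n (J f)\<close> for every \<open>n\<close>; averaging over \<open>n\<close> bounds
    the mean of |U^n f|^2 from below.\<close>
  have low: "(norm f)\<^sup>2 \<le> K * q k f" for k f
  proof -
    have t: "(r k ^ n)\<^sup>2 * (norm f)\<^sup>2 \<le>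
        (K / 2) * ((r k ^ n)\<^sup>2 * (norm ((U ^^ n) f))\<^sup>2) + (1 / (2 * K)) * ((r k ^ n)\<^sup>2 * (norm ((U ^^ n) (J f)))\<^sup>2)" for n
    proof -
      define u where "u = norm ((U ^^ n) f)" define v where "v = norm ((U ^^ n) (J f))"
      have "(norm f)\<^sup>2 = inner (J ((U ^^ n) f)) ((U ^^ n) (J f))"
        by (simp add: JUn J(1) flip: power2_norm_eq_inner)
      also have "\<dots> \<le> u * v"
        using norm_cauchy_schwarz[of "J ((U ^^ n) f)" "(U ^^ n) (J f)"] by (simp add: u_def v_def J(1))
      \<comment> \<open>Young's inequality with weights chosen so that the averaged term in
        \<open>J f\<close>, at most \<open>K |f|^2\<close>, contributes only
        \<open>|f|^2 / 2\<close> and can be absorbed on the left.\<close>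
      also have "\<dots> \<le> (K / 2) * u\<^sup>2 + (1 / (2 * K)) * v\<^sup>2"
      proof -
        have "0 \<le> (K * u - v)\<^sup>2" by simp
        then have "2 * K * (u * v) \<le> K\<^sup>2 * u\<^sup>2 + v\<^sup>2" by (simp add: power2_eq_square algebra_simps)
        then show ?thesis using K by (simp add: field_simps power2_eq_square)
      qed
      finally have "(norm f)\<^sup>2 \<le> (K / 2) * u\<^sup>2 + (1 / (2 * K)) * v\<^sup>2" .
      from mult_left_mono[OF this, of "(r k ^ n)\<^sup>2"] show ?thesis
        by (simp add: u_def v_def distrib_left mult.left_commute)
    qed
    have geo: "(\<lambda>n. (r k ^ n)\<^sup>2) sums (1 / (1 - (r k)\<^sup>2))"
      using geometric_sums[of "(r k)\<^sup>2"] r2[of k] by (simp add: power_mult[symmetric] mult.commute)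
    have "(\<Sum>n. (r k ^ n)\<^sup>2 * (norm f)\<^sup>2) \<le> (\<Sum>n. (K / 2) * ((r k ^ n)\<^sup>2 * (norm ((U ^^ n) f))\<^sup>2) +
        (1 / (2 * K)) * ((r k ^ n)\<^sup>2 * (norm ((U ^^ n) (J f)))\<^sup>2))"
      by (intro suminf_le t summable_mult2 summable_add summable_mult sm r sums_summable[OF geo])
    also have "\<dots> = (K / 2) * (\<Sum>n. (r k ^ n)\<^sup>2 * (norm ((U ^^ n) f))\<^sup>2) +
        (1 / (2 * K)) * (\<Sum>n. (r k ^ n)\<^sup>2 * (norm ((U ^^ n) (J f)))\<^sup>2)"
      by (simp only: suminf_add[symmetric] suminf_mult summable_mult sm[OF r])
    also have "(\<Sum>n. (r k ^ n)\<^sup>2 * (norm f)\<^sup>2) = (norm f)\<^sup>2 / (1 - (r k)\<^sup>2)"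
      using sums_unique[OF sums_mult2[OF geo, of "(norm f)\<^sup>2"]] by simp
    finally have "(norm f)\<^sup>2 \<le> (1 - (r k)\<^sup>2) * ((K / 2) * (\<Sum>n. (r k ^ n)\<^sup>2 * (norm ((U ^^ n) f))\<^sup>2) +
        (1 / (2 * K)) * (\<Sum>n. (r k ^ n)\<^sup>2 * (norm ((U ^^ n) (J f)))\<^sup>2))"
      using r2[of k] by (simp add: pos_divide_le_eq mult.commute)
    also have "\<dots> = (K / 2) * q k f + (1 / (2 * K)) * q k (J f)"
      unfolding q distrib_left by (simp only: mult.left_commute)
    also have "\<dots> \<le> (K / 2) * q k f + (1 / (2 * K)) * (K * (norm (J f))\<^sup>2)"
      by (intro add_left_mono mult_left_mono q_le) (use K in simp)
    also have "\<dots> = (K * q k f + (norm f)\<^sup>2) / 2" using K by (simp add: J(1) field_simps)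
    finally show ?thesis by simp
  qed
  have b_low: "(norm f)\<^sup>2 \<le> K * b f f" for f
    by (rule tendsto_lowerbound[OF tendsto_mult_left[OF b] _ G(1)]) (use low in \<open>simp add: q_def\<close>)
  have b_up: "b f f \<le> K * (norm f)\<^sup>2" for f
    by (rule tendsto_upperbound[OF b _ G(1)]) (use q_le in \<open>simp add: q_def\<close>)
  have b_abs: "\<bar>b f g\<bar> \<le> K * ((norm f)\<^sup>2 + (norm g)\<^sup>2) / 2" for f g
    by (rule tendsto_upperbound[OF tendsto_rabs[OF b] _ G(1)]) (use p_bd[of _ "(f, g)"] in simp)
  have "bounded_bilinear b"
  proof
    show "b (f + g) h = b f h + b g h" for f g h by (rule b_add)
    show "b h (f + g) = b h f + b h g" for f g h by (simp add: b_sym[of h] b_add)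
    show "b (c *\<^sub>R f) g = c *\<^sub>R b f g" for c f g by (simp add: b_scale)
    show "b f (c *\<^sub>R g) = c *\<^sub>R b f g" for c f g by (simp add: b_sym[of f] b_scale)
    \<comment> \<open>\<open>b_abs\<close> is additive in the squared norms; normalising both
      arguments turns it into a product bound.\<close>
    show "\<exists>M. \<forall>f g. norm (b f g) \<le> norm f * norm g * M"
    proof (intro exI[of _ K] allI)
      fix f g :: L2R
      have z: "b 0 h = 0" for h using b_scale[of 0 0 h] by simp
      show "norm (b f g) \<le> norm f * norm g * K"
      proof (cases "f = 0 \<or> g = 0")
        case True
        then show ?thesis using z b_sym[of f g] by auto
      next
        case False
        let ?f = "(1 / norm f) *\<^sub>R f" and ?g = "(1 / norm g) *\<^sub>R g"
        have "b f ?g = (1 / norm g) * b f g"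
          unfolding b_sym[of f] by (rule b_scale)
        then have "b ?f ?g = (1 / norm f) * ((1 / norm g) * b f g)"
          by (simp only: b_scale[of _ f])
        moreover have "\<bar>b ?f ?g\<bar> \<le> K" using b_abs[of ?f ?g] False by simp
        ultimately have "\<bar>b f g\<bar> / (norm f * norm g) \<le> K" by (simp add: abs_mult)
        then show ?thesis using False by (simp add: pos_divide_le_eq mult.commute)
      qed
    qed
  qed
  then show ?thesis using that b_sym b_U b_scaleC b_low b_up by blast
qed

subsection \<open>Operators symmetric in an equivalent inner product\<close>

text \<open>Lets symmetry of an operator be checked with the real inner product alone, provided its
  graph is closed under multiplication by \<open>\<i>\<close>.\<close>

lemma cinner_eq_inner: "cinner f g = Complex (inner f g) (inner f (scaleC \<i> g))"
  by (simp add: inner_L2R_def cinner_simps complex_eq_iff)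

lemma subspace_closure:
  fixes S :: "'a::real_normed_vector set"
  assumes S: "subspace S"
  shows "subspace (closure S)"
  unfolding subspace_def
proof (intro conjI ballI allI)
  show "0 \<in> closure S" using subspace_0[OF S] closure_subset by blast
next
  fix x y assume "x \<in> closure S" "y \<in> closure S"
  then obtain a b where "\<And>n. a n \<in> S" "a \<longlonglongrightarrow> x" "\<And>n. b n \<in> S" "b \<longlonglongrightarrow> y"
    unfolding closure_sequential by blast
  then have "(\<lambda>n. a n + b n) \<longlonglongrightarrow> x + y" "\<And>n. a n + b n \<in> S"
    using S by (auto intro: tendsto_add subspace_add)
  then show "x + y \<in> closure S"
    unfolding closure_sequential by (intro exI[of _ "\<lambda>n. a n + b n"]) auto
next
  fix c :: real and x assume "x \<in> closure S"
  then obtain a where "\<And>n. a n \<in> S" "a \<longlonglongrightarrow> x" unfolding closure_sequential by blast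
  then have "(\<lambda>n. c *\<^sub>R a n) \<longlonglongrightarrow> c *\<^sub>R x" "\<And>n. c *\<^sub>R a n \<in> S"
    using S by (auto intro: tendsto_scaleR subspace_scale)
  then show "c *\<^sub>R x \<in> closure S"
    unfolding closure_sequential by (intro exI[of _ "\<lambda>n. c *\<^sub>R a n"]) auto
qed

text \<open>The basic criterion for selfadjointness: a symmetric \<open>T\<close> is selfadjoint
  once \<open>T - \<i>\<close> and \<open>T + \<i>\<close> are onto. Density of the domain is a
  consequence and not assumed.\<close>

lemma symmetric_onto_selfadjoint:
  assumes T: "(0, 0) \<in> T" "\<And>f h g k. (f, h) \<in> T \<Longrightarrow> (g, k) \<in> T \<Longrightarrow> (f + g, h + k) \<in> T"
      "\<And>a f h. (f, h) \<in> T \<Longrightarrow> (scaleC a f, scaleC a h) \<in> T" "single_valued T"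
    and sym: "\<And>f h g k. (f, h) \<in> T \<Longrightarrow> (g, k) \<in> T \<Longrightarrow> inner h g = inner f k"
    and onto: "\<And>g. \<exists>f. (f, g + scaleC \<i> f) \<in> T" "\<And>g. \<exists>f. (f, g - scaleC \<i> f) \<in> T"
  shows "selfadjoint T"
proof -
  have csym: "cinner h g = cinner f k" if "(f, h) \<in> T" "(g, k) \<in> T" for f h g k
    using sym[OF that] sym[OF that(1) T(3)[OF that(2), of \<i>]] by (simp add: cinner_eq_inner)
  have "adjoint_in UNIV T = T"
  proof (intro equalityI subsetI)
    fix x assume "x \<in> T"
    then show "x \<in> adjoint_in UNIV T"
      by (cases x) (auto simp: adjoint_in_def csym)
  next
    fix x assume x: "x \<in> adjoint_in UNIV T"
    obtain g k where gk: "x = (g, k)" by (cases x)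
    then have adj: "cinner h g = cinner f k" if "(f, h) \<in> T" for f h
      using x that by (auto simp: adjoint_in_def)
    \<comment> \<open>\<open>f\<close> in the domain solves
      \<open>(T - \<i>) f = k - \<i> g\<close>; the defect \<open>u = g - f\<close> is then
      orthogonal to the range of \<open>T + \<i>\<close>, and \<open>f'\<close> below shows that
      \<open>u\<close> itself lies in that range.\<close>
    obtain f where f: "(f, (k - scaleC \<i> g) + scaleC \<i> f) \<in> T" using onto(1) by blast
    define u where "u = g - f"
    obtain f' where f': "(f', u - scaleC \<i> f') \<in> T" using onto(2) by blast
    have "cinner (u - scaleC \<i> f') g = cinner f' k" by (rule adj[OF f'])
    moreover have "cinner (u - scaleC \<i> f') f = cinner f' ((k - scaleC \<i> g) + scaleC \<i> f)"
      by (rule csym[OF f' f])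
    ultimately have "cinner u u = 0"
      by (simp add: u_def cinner_simps algebra_simps)
    then have "g = f" by (simp add: u_def cinner_self)
    then show "x \<in> T" using f gk by simp
  qed
  moreover have "closure (Domain T) = UNIV"
  proof (rule closed_subspace_eq_UNIV)
    have "subspace (Domain T)"
      unfolding subspace_def
    proof (intro conjI ballI allI)
      show "0 \<in> Domain T" using T(1) by blast
      show "f + g \<in> Domain T" if "f \<in> Domain T" "g \<in> Domain T" for f g using that T(2) by blast
      show "c *\<^sub>R f \<in> Domain T" if "f \<in> Domain T" for c f
        using that T(3)[of f _ "complex_of_real c"] by (auto simp: scaleC_of_real)
    qed
    then show "subspace (closure (Domain T))" by (rule subspace_closure)
  next
    fix y :: L2R assume y: "\<And>x. x \<in> closure (Domain T) \<Longrightarrow> inner y x = 0"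
    \<comment> \<open>If \<open>y\<close> is orthogonal to the domain and
      \<open>(T - \<i>) f = y\<close>, then symmetry at \<open>f\<close> makes
      \<open>\<i> |f|^2\<close> real, so \<open>f = 0\<close>; single-valuedness at 0 gives
      \<open>y = 0\<close>.\<close>
    obtain f where f: "(f, y + scaleC \<i> f) \<in> T" using onto(1) by blast
    have "inner y f = 0" "inner y (scaleC \<i> f) = 0"
      using y closure_subset[of "Domain T"] f T(3)[OF f, of \<i>] by blast+
    then have "cinner y f = 0" by (simp add: cinner_eq_inner complex_eq_iff)
    moreover have "cinner (y + scaleC \<i> f) f = cinner f (y + scaleC \<i> f)" by (rule csym[OF f f])
    ultimately have "cinner f f = 0" using cinner_commute[of f y] by (simp add: cinner_simps)
    then have "f = 0" by (simp add: cinner_self)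
    then show "y = 0" using f T(1,4) by (auto simp: single_valued_def)
  qed simp
  ultimately show ?thesis by (simp add: selfadjoint_def)
qed

lemma closed_adjoint_in: "closed (adjoint_in UNIV T)"
proof -
  have "adjoint_in UNIV T = (\<Inter>(f, h)\<in>T. {x. cinner h (fst x) = cinner f (snd x)})"
    by (auto simp: adjoint_in_def)
  also have "closed \<dots>"
    by (intro closed_INT ballI) (auto split: prod.split intro!: closed_Collect_eq continuous_on_cinner continuous_intros)
  finally show ?thesis .
qed

text \<open>Write \<open>b f g = (f, W g)\<close>. The square root \<open>V\<close> of
  \<open>W / K\<close> satisfies \<open>(V f, V g) = b f g / K\<close>, so it carries an operator
  symmetric for \<open>b\<close> into one symmetric for the original inner product, and ranges of
  \<open>A - \<i>\<close> and \<open>A + \<i>\<close> are carried along.\<close>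

lemma similar_selfadjoint_of_form:
  assumes A: "(0, 0) \<in> A" "\<And>f h g k. (f, h) \<in> A \<Longrightarrow> (g, k) \<in> A \<Longrightarrow> (f + g, h + k) \<in> A"
      "\<And>a f h. (f, h) \<in> A \<Longrightarrow> (scaleC a f, scaleC a h) \<in> A" "single_valued A"
    and onto: "\<And>g. \<exists>f. (f, g + scaleC \<i> f) \<in> A" "\<And>g. \<exists>f. (f, g - scaleC \<i> f) \<in> A"
    and b: "bounded_bilinear b" "\<And>f g. b f g = b g f"
      "\<And>a f g. b f (scaleC a g) = b (scaleC (cnj a) f) g"
      "\<And>f. (norm f)\<^sup>2 \<le> K * b f f" "\<And>f. b f f \<le> K * (norm f)\<^sup>2" and K: "K \<ge> 1"
    and sym: "\<And>f h g k. (f, h) \<in> A \<Longrightarrow> (g, k) \<in> A \<Longrightarrow> b h g = b f k"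
  shows "\<exists>T. selfadjoint T \<and> similar_operators A T"
proof -
  obtain W where W: "bounded_linear W" "\<And>f g. b f g = inner f (W g)"
    using bounded_bilinear_form_operator[OF b(1)] by blast
  have Wsym: "inner (W f) g = inner f (W g)" for f g
    by (metis W(2) b(2) inner_commute)
  have WC: "W (scaleC a f) = scaleC a (W f)" for a f
  proof (rule vector_eq_ldot[THEN iffD1, rule_format])
    show "inner z (W (scaleC a f)) = inner z (scaleC a (W f))" for z
      by (simp add: W(2)[symmetric] b(3) inner_scaleC_right)
  qed
  \<comment> \<open>The upper bound on \<open>b\<close> gives W / K \<le> 1 and the lower bound
    gives W / K \<ge> 1 / K^2. Hence \<open>1 - W / K\<close>, which is \<open>Z0\<close> below,
    lies between 0 and \<open>\<rho>\<close>.\<close>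
  define \<rho> where "\<rho> = 1 - 1 / K\<^sup>2"
  have \<rho>: "0 \<le> \<rho>" "\<rho> < 1" using K by (auto simp: \<rho>_def)
  define Z0 where "Z0 f = f - (1 / K) *\<^sub>R W f" for f
  have Z0_bl: "bounded_linear Z0"
    unfolding Z0_def by (intro bounded_linear_sub bounded_linear_ident bounded_linear_const_scaleR W(1))
  have Z0_sym: "inner (Z0 f) g = inner f (Z0 g)" for f g
    by (simp add: Z0_def inner_diff_left inner_diff_right Wsym)
  have Z0_q: "inner (Z0 f) f = (norm f)\<^sup>2 - b f f / K" for f
    by (simp add: Z0_def inner_diff_left W(2) Wsym power2_norm_eq_inner)
  have Z0_norm: "norm (Z0 f) \<le> \<rho> * norm f" for f
  proof (rule norm_le_of_quadratic_form[OF bounded_linear.linear[OF Z0_bl] Z0_sym])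
    show "0 \<le> inner (Z0 f) f" for f
      unfolding Z0_q using b(5)[of f] K by (simp add: pos_divide_le_eq mult.commute)
    show "inner (Z0 f) f \<le> \<rho> * (norm f)\<^sup>2" for f
    proof -
      have "(norm f)\<^sup>2 / K\<^sup>2 \<le> b f f / K"
        using b(4)[of f] K by (simp add: field_simps power2_eq_square)
      then show ?thesis unfolding Z0_q \<rho>_def by (simp add: left_diff_distrib)
    qed
  qed
  define Z where "Z = Blinfun Z0"
  have Z: "blinfun_apply Z = Z0" by (simp add: Z_def bounded_linear_Blinfun_apply Z0_bl)
  have "norm Z \<le> \<rho>" by (rule norm_blinfun_bound[OF \<rho>(1)]) (simp add: Z Z0_norm)
  then obtain V :: "L2R \<Rightarrow>\<^sub>L L2R" where V: "\<And>f g. inner (V f) g = inner f (V g)" "\<And>f. V (V f) = f - Z f"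
    "\<And>C f. C \<in> range scaleC \<Longrightarrow> V (C f) = C (V f)" "\<And>f. (1 - \<rho>) * norm f \<le> norm (V f)" "surj V"
  \<comment> \<open>The commuting family is that of all complex scalars: this is what makes the
    square root of a real symmetric operator complex linear.\<close>
  proof (rule symmetric_square_root[OF _ \<rho>(2), where \<C> = "range scaleC"])
    show "inner (Z f) g = inner f (Z g)" for f g by (simp add: Z Z0_sym)
    show "bounded_linear C" if "C \<in> range scaleC" for C using that bounded_linear_scaleC by auto
    show "Z (C f) = C (Z f)" if "C \<in> range scaleC" for C f
      using that by (auto simp: Z Z0_def WC L2R.scale_right_diff_distrib mult.commute simp flip: scaleC_of_real)
  qed blast+
  have VC: "V (scaleC a f) = scaleC a (V f)" for a f by (rule V(3)) simp
  have VV: "inner (V f) (V g) = b f g / K" for f g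
    by (simp add: V(1,2) Z Z0_def W(2))
  have Vbl: "bounded_linear V" by (rule blinfun.bounded_linear_right)
  have Vinj: "inj V"
  proof (rule injI)
    fix f g assume "V f = V g"
    then have "V (f - g) = 0" by (simp add: blinfun.diff_right)
    then have "(1 - \<rho>) * norm (f - g) \<le> 0" using V(4)[of "f - g"] by simp
    then show "f = g" using \<rho>(2) by (simp add: mult_le_0_iff)
  qed
  have Vbij: "bij V" using Vinj V(5) by (simp add: bij_def)
  have Vinv: "V (inv V g) = g" "inv V (V g) = g" for g
    using V(5) Vinj by (simp_all add: surj_f_inv_f)
  have inv_bl: "bounded_linear (inv V)"
  proof (rule bounded_linear_intro[where K = "1 / (1 - \<rho>)"])
    show "inv V (f + g) = inv V f + inv V g" for f g
      by (rule injD[OF Vinj]) (simp add: Vinv blinfun.add_right)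
    show "inv V (r *\<^sub>R f) = r *\<^sub>R inv V f" for r f
      by (rule injD[OF Vinj]) (simp add: Vinv blinfun.scaleR_right)
    show "norm (inv V f) \<le> norm f * (1 / (1 - \<rho>))" for f
      using V(4)[of "inv V f"] \<rho>(2) by (simp add: Vinv pos_le_divide_eq mult.commute)
  qed
  define T where "T = map_prod V V ` A"
  have T_mem: "(f, h) \<in> T \<longleftrightarrow> (\<exists>f' h'. (f', h') \<in> A \<and> f = V f' \<and> h = V h')" for f h
    by (auto simp: T_def)
  have T: "(0, 0) \<in> T" "\<And>f h g k. (f, h) \<in> T \<Longrightarrow> (g, k) \<in> T \<Longrightarrow> (f + g, h + k) \<in> T"
      "\<And>a f h. (f, h) \<in> T \<Longrightarrow> (scaleC a f, scaleC a h) \<in> T" "single_valued T"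
  proof -
    show "(0, 0) \<in> T" using A(1) by (force simp: T_mem blinfun.zero_right)
    show "(f + g, h + k) \<in> T" if "(f, h) \<in> T" "(g, k) \<in> T" for f h g k
      using that A(2) unfolding T_mem by (metis blinfun.add_right)
    show "(scaleC a f, scaleC a h) \<in> T" if "(f, h) \<in> T" for a f h
      using that A(3) unfolding T_mem by (metis VC)
    show "single_valued T"
      using A(4) unfolding single_valued_def T_mem by (metis Vinv(2))
  qed
  have onto_T: "\<exists>f. (f, g + scaleC \<i> f) \<in> T" "\<exists>f. (f, g - scaleC \<i> f) \<in> T" for g
  proof -
    obtain f where "(f, inv V g + scaleC \<i> f) \<in> A" using onto(1) by blast
    then have "(V f, V (inv V g + scaleC \<i> f)) \<in> T" unfolding T_mem by blast
    then show "\<exists>f. (f, g + scaleC \<i> f) \<in> T" by (auto simp: blinfun.add_right VC Vinv)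
    obtain f where "(f, inv V g - scaleC \<i> f) \<in> A" using onto(2) by blast
    then have "(V f, V (inv V g - scaleC \<i> f)) \<in> T" unfolding T_mem by blast
    then show "\<exists>f. (f, g - scaleC \<i> f) \<in> T" by (auto simp: blinfun.diff_right VC Vinv)
  qed
  have sa: "selfadjoint T"
  proof (rule symmetric_onto_selfadjoint[OF T _ onto_T])
    show "inner h g = inner f k" if "(f, h) \<in> T" "(g, k) \<in> T" for f h g k
      using that sym unfolding T_mem by (metis VV)
  qed
  have clT: "closed T" using sa closed_adjoint_in[of T] by (simp add: selfadjoint_def)
  \<comment> \<open>Closedness of \<open>A\<close> is pulled back from \<open>T\<close>, which is
    closed as its own adjoint.\<close>
  have "A = map_prod V V -` T"
    unfolding T_def using Vinj by (intro inj_vimage_image_eq[symmetric] map_prod_inj_on[of V UNIV V UNIV, simplified])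
  moreover have "closed (map_prod V V -` T)"
    by (rule closed_vimage[OF clT])
       (auto simp: map_prod_def case_prod_beta intro!: continuous_intros linear_continuous_on[OF Vbl]
          bounded_linear.continuous_on[OF Vbl])
  ultimately have clA: "closed A" by simp
  have "similar_operators A T"
    unfolding similar_operators_def
  proof (intro conjI exI[of _ "blinfun_apply V"])
    show "closed_operator A" using A clA by (auto simp: closed_operator_def)
    show "closed_operator T" using T clT by (auto simp: closed_operator_def)
    show "V ` Domain A = Domain T" by (simp add: T_def Domain_fst image_image)
  qed (use Vbl VC Vbij inv_bl T_def in auto)
  then show ?thesis using sa by blast
qed

section \<open>Sturm-Liouville theory on a half-line\<close>

subsection \<open>Solutions of the Sturm--Liouville equation\<close>

lemma has_vector_derivative_series:
  fixes f :: "nat \<Rightarrow> real \<Rightarrow> 'a::banach"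
  assumes S: "convex S" "x \<in> S"
    and f: "\<And>n x. x \<in> S \<Longrightarrow> (f n has_vector_derivative f' n x) (at x within S)"
    and B: "summable B" "\<And>n x. x \<in> S \<Longrightarrow> norm (f n x) \<le> B n" "\<And>n x. x \<in> S \<Longrightarrow> norm (f' n x) \<le> B n"
  shows "((\<lambda>x. \<Sum>n. f n x) has_vector_derivative (\<Sum>n. f' n x)) (at x within S)"
proof -
  have "uniform_limit S (\<lambda>n x. \<Sum>i<n. f' i x) (\<lambda>x. \<Sum>i. f' i x) sequentially"
    by (rule Weierstrass_m_test[OF B(3) B(1)])
  then have ul: "\<forall>\<^sub>F n in sequentially. \<forall>x\<in>S. dist (\<Sum>i<n. f' i x) (\<Sum>i. f' i x) < e" if "e > 0" for e
    using that by (simp add: uniform_limit_iff)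
  have "\<exists>g. \<forall>x\<in>S. (\<lambda>n. f n x) sums g x \<and> (g has_derivative (\<lambda>h. h *\<^sub>R (\<Sum>i. f' i x))) (at x within S)"
  proof (rule has_derivative_series[OF S(1), where f' = "\<lambda>n x h. h *\<^sub>R f' n x" and x = x])
    show "(f n has_derivative (\<lambda>h. h *\<^sub>R f' n y)) (at y within S)" if "y \<in> S" for n y
      using f[OF that] by (simp add: has_vector_derivative_def)
    show "\<forall>\<^sub>F n in sequentially. \<forall>x\<in>S. \<forall>h. norm ((\<Sum>i<n. h *\<^sub>R f' i x) - h *\<^sub>R (\<Sum>i. f' i x)) \<le> e * norm h"
      if "e > 0" for e
      using ul[OF that]
    proof eventually_elim
      case (elim n)
      show ?case
      proof (intro ballI allI)
        fix y h assume "y \<in> S"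
        then have "norm ((\<Sum>i<n. f' i y) - (\<Sum>i. f' i y)) \<le> e" using elim by (auto simp: dist_norm less_imp_le)
        then show "norm ((\<Sum>i<n. h *\<^sub>R f' i y) - h *\<^sub>R (\<Sum>i. f' i y)) \<le> e * norm h"
          unfolding scaleR_sum_right[symmetric] scaleR_diff_right[symmetric] norm_scaleR real_norm_def
          by (subst mult.commute) (rule mult_right_mono, simp_all)
      qed
    qed
    show "x \<in> S" by (rule S(2))
    show "(\<lambda>n. f n x) sums (\<Sum>n. f n x)"
      by (intro summable_sums summable_comparison_test'[OF B(1), of 0] B(2) S(2))
  qed
  then obtain g where g: "\<And>x. x \<in> S \<Longrightarrow> (\<lambda>n. f n x) sums g x"
    "\<And>x. x \<in> S \<Longrightarrow> (g has_vector_derivative (\<Sum>i. f' i x)) (at x within S)"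
    by (auto simp: has_vector_derivative_def)
  show ?thesis
    by (rule has_vector_derivative_transform[OF S(2) _ g(2)[OF S(2)]]) (simp add: sums_unique[OF g(1)])
qed

text \<open>Integration from 0 shrinks the weighted supremum norm with weight exp (- k |t|) by the
  factor \<open>1 / k\<close>. With \<open>k\<close> large the Picard iteration contracts on an
  interval of any length.\<close>

lemma exp_growth_bound:
  fixes F :: "real \<Rightarrow> 'a::real_normed_vector"
  assumes F: "\<And>t. \<bar>t\<bar> \<le> N \<Longrightarrow> (F has_vector_derivative f t) (at t)" "F 0 = 0"
    and f: "\<And>t. \<bar>t\<bar> \<le> N \<Longrightarrow> norm (f t) \<le> C * exp (k * \<bar>t\<bar>)"
    and k: "k > 0" and C: "C \<ge> 0" and x: "\<bar>x\<bar> \<le> N"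
  shows "norm (F x) \<le> C / k * exp (k * \<bar>x\<bar>)"
proof -
  have pos: "norm (G y) \<le> C / k * exp (k * y)"
    if y: "0 \<le> y" "y \<le> N" and G0: "G 0 = 0"
      and G: "\<And>t. 0 \<le> t \<Longrightarrow> t \<le> N \<Longrightarrow> (G has_vector_derivative g t) (at t)"
      and g: "\<And>t. 0 \<le> t \<Longrightarrow> t \<le> N \<Longrightarrow> norm (g t) \<le> C * exp (k * t)"
    for y and G g :: "real \<Rightarrow> 'a"
  proof (cases "y = 0")
    case False
    have "norm (G y - G 0) \<le> C / k * exp (k * y) - C / k * exp (k * 0)"
    proof (rule differentiable_bound_general[where f' = g and \<phi>' = "\<lambda>t. C * exp (k * t)"])
      show "continuous_on {0..y} G"
        by (rule continuous_on_vector_derivative[OF has_vector_derivative_at_within[OF G]]) (use y in auto)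
      show "((\<lambda>t. C / k * exp (k * t)) has_vector_derivative C * exp (k * t)) (at t)" for t
        using k by (auto intro!: derivative_eq_intros simp flip: has_real_derivative_iff_has_vector_derivative)
    qed (use y False G g k in \<open>auto intro!: continuous_intros\<close>)
    moreover have "0 \<le> C / k" using k C by simp
    ultimately show ?thesis using G0 by simp
  qed (use G0 k C in simp)
  show ?thesis
  proof (cases "0 \<le> x")
    case True
    have "norm (F x) \<le> C / k * exp (k * x)"
    proof (rule pos[of x F f])
      show "norm (f t) \<le> C * exp (k * t)" if "0 \<le> t" "t \<le> N" for t using f[of t] that by simp
    qed (use True x F in auto)
    then show ?thesis using True by simp
  next
    case False
    have "norm (F (- (- x))) \<le> C / k * exp (k * (- x))"
    proof (rule pos[of "- x" "\<lambda>t. F (- t)" "\<lambda>t. - f (- t)"])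
      fix t assume t: "0 \<le> t" "t \<le> N"
      have "((\<lambda>t. F (- t)) has_vector_derivative (- 1) *\<^sub>R f (- t)) (at t)"
        using vector_diff_chain_at[OF has_vector_derivative_minus[OF has_vector_derivative_id], of F "f (- t)" t]
          F(1)[of "- t"] t by (simp add: o_def)
      then show "((\<lambda>t. F (- t)) has_vector_derivative - f (- t)) (at t)" by simp
      show "norm (- f (- t)) \<le> C * exp (k * t)" using f[of "- t"] t by simp
    qed (use False x F in auto)
    then show ?thesis using False by simp
  qed
qed

lemma antiderivative_exists:
  fixes f :: "real \<Rightarrow> complex"
  assumes "continuous_on UNIV f"
  shows "\<exists>F. F 0 = 0 \<and> (\<forall>x. (F has_vector_derivative f x) (at x))"
proof (intro exI[of _ "\<lambda>u :: real. LBINT y=ereal 0..ereal u. f y"] conjI allI)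
  fix x :: real
  define N where "N = \<bar>x\<bar> + 1"
  have "((\<lambda>u. LBINT y=ereal 0..ereal u. f y) has_vector_derivative f x) (at x within {- N..N})"
    by (rule interval_integral_FTC2) (auto simp: N_def intro: continuous_on_subset[OF assms])
  moreover have "at x within {- N..N} = at x"
    by (rule at_within_interior) (auto simp: N_def)
  ultimately show "((\<lambda>u. LBINT y=ereal 0..ereal u. f y) has_vector_derivative f x) (at x)" by simp
qed simp

definition antiderivative :: "(real \<Rightarrow> complex) \<Rightarrow> real \<Rightarrow> complex" where
  "antiderivative f = (SOME F. F 0 = 0 \<and> (\<forall>x. (F has_vector_derivative f x) (at x)))"

lemma antiderivative:
  assumes "continuous_on UNIV f"
  shows "antiderivative f 0 = 0" "(antiderivative f has_vector_derivative f x) (at x)"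
    "continuous_on UNIV (antiderivative f)"
proof -
  have *: "antiderivative f 0 = 0 \<and> (\<forall>x. (antiderivative f has_vector_derivative f x) (at x))"
    unfolding antiderivative_def by (rule someI_ex[OF antiderivative_exists[OF assms]])
  then show "antiderivative f 0 = 0" "(antiderivative f has_vector_derivative f x) (at x)" by auto
  show "continuous_on UNIV (antiderivative f)"
    using * by (intro continuous_at_imp_continuous_on ballI) (auto intro: has_vector_derivative_continuous)
qed

text \<open>The solution is the sum of the iterates \<open>Y n\<close>: \<open>Y 0\<close> is affine
  and carries the initial data, and \<open>Y (Suc n)\<close> has second derivative \<open>p\<close>
  times \<open>Y n\<close> with zero initial data. \<open>V n\<close> is the derivative of
  \<open>Y n\<close>.\<close>

lemma linear_ode_solution_exists:
  fixes p :: "real \<Rightarrow> complex"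
  assumes p: "continuous_on UNIV p"
  shows "\<exists>y v. (\<forall>x. (y has_vector_derivative v x) (at x)) \<and> (\<forall>x. (v has_vector_derivative p x * y x) (at x)) \<and>
    y 0 = a \<and> v 0 = b"
proof -
  define Y where "Y = rec_nat (\<lambda>x. a + of_real x * b) (\<lambda>n Yn. antiderivative (antiderivative (\<lambda>x. p x * Yn x)))"
  define V where "V n = (case n of 0 \<Rightarrow> (\<lambda>x. b) | Suc n \<Rightarrow> antiderivative (\<lambda>x. p x * Y n x))" for n
  have Y0: "Y 0 = (\<lambda>x. a + of_real x * b)" and YS: "Y (Suc n) = antiderivative (V (Suc n))" for n
    by (simp_all add: Y_def V_def)
  have V0: "V 0 = (\<lambda>x. b)" and VS: "V (Suc n) = antiderivative (\<lambda>x. p x * Y n x)" for n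
    by (simp_all add: V_def)
  have cY: "continuous_on UNIV (Y n)" for n
  proof (induction n)
    case 0
    then show ?case by (auto simp: Y0 intro!: continuous_intros)
  next
    case (Suc n)
    then show ?case unfolding YS VS by (intro antiderivative continuous_intros p)
  qed
  have cV: "continuous_on UNIV (V n)" for n
    by (cases n) (auto simp: V0 VS intro!: antiderivative continuous_intros p cY)
  have dY: "(Y n has_vector_derivative V n x) (at x)" for n x
  proof (cases n)
    case 0
    have "((\<lambda>x. a + of_real x * b) has_vector_derivative (0 + of_real 1 * b)) (at x)"
      by (intro has_vector_derivative_add has_vector_derivative_const has_vector_derivative_mult_left
          has_vector_derivative_of_real) (auto intro!: derivative_eq_intros)
    then show ?thesis by (simp add: 0 Y0 V0)
  next
    case (Suc m)
    show ?thesis unfolding Suc YS by (rule antiderivative(2)[OF cV])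
  qed
  have dV: "(V (Suc n) has_vector_derivative p x * Y n x) (at x)" for n x
    unfolding VS by (rule antiderivative(2)) (intro continuous_intros p cY)
  have z: "Y (Suc n) 0 = 0" "V (Suc n) 0 = 0" for n
    unfolding YS VS by (intro antiderivative continuous_intros p cY)+
  have loc: "((\<lambda>x. \<Sum>n. Y n x) has_vector_derivative (\<Sum>n. V n x)) (at x) \<and>
      ((\<lambda>x. \<Sum>n. V n x) has_vector_derivative p x * (\<Sum>n. Y n x)) (at x)" for x
  proof -
    define N where "N = \<bar>x\<bar> + 1"
    have "compact (p ` {- N..N})"
      by (intro compact_continuous_image continuous_on_subset[OF p]) auto
    then obtain K where "\<forall>t\<in>{- N..N}. cmod (p t) \<le> K"
      by (auto dest!: compact_imp_bounded simp: bounded_iff)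
    moreover have "t \<in> {- N..N}" if "\<bar>t\<bar> \<le> N" for t using that by auto
    ultimately have K: "\<And>t. \<bar>t\<bar> \<le> N \<Longrightarrow> cmod (p t) \<le> K" by blast
    have K0: "0 \<le> K" using order_trans[OF norm_ge_zero K, of 0] by (simp add: N_def)
    \<comment> \<open>Chosen so that K / k \<le> 1 / 2: each iteration halves the weighted bound,
      and k \<ge> 2 makes the further integration from \<open>V\<close> to \<open>Y\<close>
      harmless.\<close>
    define k where "k = 2 * (K + 1)"
    have k: "k > 0" "k \<ge> 2" "K / k \<le> 1 / 2" using K0 by (auto simp: k_def field_simps)
    define M where "M = cmod a + N * cmod b + cmod b"
    have M: "0 \<le> M" by (simp add: M_def N_def)
    have bnd: "\<bar>t\<bar> \<le> N \<Longrightarrow> cmod (Y n t) \<le> M * (1/2) ^ n * exp (k * \<bar>t\<bar>) \<and>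
        cmod (V n t) \<le> M * (1/2) ^ n * exp (k * \<bar>t\<bar>)" for n t
    proof (induction n arbitrary: t)
      case 0
      have e: "1 \<le> exp (k * \<bar>t\<bar>)" using k by simp
      have "cmod (Y 0 t) \<le> cmod a + \<bar>t\<bar> * cmod b"
        unfolding Y0 using norm_triangle_ineq[of a "of_real t * b"] by (simp add: norm_mult)
      also have "\<dots> \<le> M" unfolding M_def using mult_right_mono[OF 0, of "cmod b"] norm_ge_zero[of b] by linarith
      also have "\<dots> \<le> M * exp (k * \<bar>t\<bar>)" using mult_left_mono[OF e M] by simp
      finally have 1: "cmod (Y 0 t) \<le> M * exp (k * \<bar>t\<bar>)" .
      have "cmod (V 0 t) \<le> M" by (simp add: V0 M_def N_def)
      also have "\<dots> \<le> M * exp (k * \<bar>t\<bar>)" using mult_left_mono[OF e M] by simp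
      finally show ?case using 1 by simp
    next
      case (Suc n)
      let ?B = "M * (1/2) ^ n"
      have B: "0 \<le> ?B" using M by simp
      have Vb: "cmod (V (Suc n) s) \<le> (1/2) * ?B * exp (k * \<bar>s\<bar>)" if s: "\<bar>s\<bar> \<le> N" for s
      proof -
        have "cmod (V (Suc n) s) \<le> (K * ?B) / k * exp (k * \<bar>s\<bar>)"
        proof (rule exp_growth_bound[OF dV z(2) _ k(1) _ s])
          show "cmod (p t * Y n t) \<le> K * ?B * exp (k * \<bar>t\<bar>)" if "\<bar>t\<bar> \<le> N" for t
            unfolding norm_mult mult.assoc[of K]
            by (intro mult_mono K that conjunct1[OF Suc.IH[OF that]] K0) auto
        qed (use K0 B in simp)
        also have "\<dots> = (K / k) * ?B * exp (k * \<bar>s\<bar>)" by simp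
        also have "\<dots> \<le> (1/2) * ?B * exp (k * \<bar>s\<bar>)"
          by (intro mult_right_mono k(3) B) auto
        finally show ?thesis .
      qed
      have "cmod (Y (Suc n) t) \<le> ((1/2) * ?B) / k * exp (k * \<bar>t\<bar>)"
        by (rule exp_growth_bound[OF dY z(1) Vb k(1) _ Suc.prems]) (use B in auto)
      also have "\<dots> \<le> ((1/2) * ?B) / 1 * exp (k * \<bar>t\<bar>)"
        using k B by (intro mult_right_mono divide_left_mono) auto
      finally show ?case using Vb[OF Suc.prems] by simp
    qed
    define E where "E = M * exp (k * N)"
    \<comment> \<open>One geometric majorant for the iterates, their derivatives and the products
      with \<open>p\<close>; the factor \<open>K + 1\<close> accounts for the latter.\<close>
    define D where "D n = (K + 1) * E * (1/2) ^ n" for n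
    have E: "0 \<le> E" using M by (simp add: E_def)
    have b1: "cmod (Y n t) \<le> E * (1/2) ^ n" "cmod (V n t) \<le> E * (1/2) ^ n" if "\<bar>t\<bar> \<le> N" for n t
    proof -
      have "M * (1/2) ^ n * exp (k * \<bar>t\<bar>) \<le> M * (1/2) ^ n * exp (k * N)"
        using that k M by (intro mult_left_mono) auto
      then show "cmod (Y n t) \<le> E * (1/2) ^ n" "cmod (V n t) \<le> E * (1/2) ^ n"
        using bnd[OF that, of n] by (auto simp: E_def mult_ac)
    qed
    have ED: "E * (1/2) ^ n \<le> D n" for n
      using K0 E by (simp add: D_def algebra_simps)
    have smD: "summable (\<lambda>n. 2 * D n)" unfolding D_def by (intro summable_mult summable_geometric) simp
    have D0: "0 \<le> D n" for n using K0 E by (simp add: D_def)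
    have atx: "at x within {- N..N} = at x"
      by (rule at_within_interior) (auto simp: N_def)
    have 1: "((\<lambda>x. \<Sum>n. Y n x) has_vector_derivative (\<Sum>n. V n x)) (at x within {- N..N})"
    proof (rule has_vector_derivative_series[OF _ _ _ smD])
      show "(Y n has_vector_derivative V n t) (at t within {- N..N})" for n t
        by (rule has_vector_derivative_at_within[OF dY])
      show "cmod (Y n t) \<le> 2 * D n" "cmod (V n t) \<le> 2 * D n" if "t \<in> {- N..N}" for n t
        using b1[of t n] ED[of n] D0[of n] that by (auto simp: abs_le_iff)
    qed (auto simp: N_def)
    \<comment> \<open>The index is shifted because the constant \<open>V 0\<close> has no preceding
      iterate; \<open>b\<close> is added back afterwards.\<close>
    have 2: "((\<lambda>x. \<Sum>n. V (Suc n) x) has_vector_derivative (\<Sum>n. p x * Y n x)) (at x within {- N..N})"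
    proof (rule has_vector_derivative_series[OF _ _ _ smD])
      show "(V (Suc n) has_vector_derivative p t * Y n t) (at t within {- N..N})" for n t
        by (rule has_vector_derivative_at_within[OF dV])
      show "cmod (V (Suc n) t) \<le> 2 * D n" if "t \<in> {- N..N}" for n t
        using b1(2)[of t "Suc n"] ED[of n] D0[of n] that E
          mult_right_mono[of "1/2" 1 "E * (1/2) ^ n"] by (auto simp: abs_le_iff)
      show "cmod (p t * Y n t) \<le> 2 * D n" if "t \<in> {- N..N}" for n t
      proof -
        have "cmod (p t * Y n t) \<le> K * (E * (1/2) ^ n)"
          unfolding norm_mult using that K0 by (intro mult_mono K b1) (auto simp: abs_le_iff)
        also have "\<dots> \<le> D n" using E by (simp add: D_def algebra_simps)
        finally show ?thesis using D0[of n] by simp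
      qed
    qed (auto simp: N_def)
    have smV: "summable (\<lambda>n. V n t)" if "\<bar>t\<bar> \<le> N" for t
      by (rule summable_comparison_test'[of "\<lambda>n. E * (1/2) ^ n" 0])
        (auto intro!: summable_mult summable_geometric b1 that)
    have smY: "summable (\<lambda>n. Y n x)"
      by (rule summable_comparison_test'[of "\<lambda>n. E * (1/2) ^ n" 0])
        (auto intro!: summable_mult summable_geometric b1 simp: N_def)
    have "((\<lambda>x. b + (\<Sum>n. V (Suc n) x)) has_vector_derivative (0 + (\<Sum>n. p x * Y n x))) (at x within {- N..N})"
      by (intro has_vector_derivative_add has_vector_derivative_const 2)
    then have "((\<lambda>x. \<Sum>n. V n x) has_vector_derivative (0 + (\<Sum>n. p x * Y n x))) (at x within {- N..N})"
      by (rule has_vector_derivative_transform[rotated 2])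
         (use suminf_split_head[OF smV] in \<open>auto simp: N_def V0 abs_le_iff algebra_simps\<close>)
    then show ?thesis using 1 suminf_mult[OF smY, of "p x"] by (simp add: atx)
  qed
  have "(\<Sum>n. Y n 0) = a" "(\<Sum>n. V n 0) = b"
    using suminf_finite[of "{0}" "\<lambda>n. Y n 0"] suminf_finite[of "{0}" "\<lambda>n. V n 0"] z
    by (auto simp: Y0 V0 gr0_conv_Suc elim: not0_implies_Suc)
  with loc show ?thesis by (intro exI[of _ "\<lambda>x. \<Sum>n. Y n x"] exI[of _ "\<lambda>x. \<Sum>n. V n x"]) auto
qed

subsection \<open>Calculus with locally absolutely continuous functions on the half-line\<close>

definition loc_integrable :: "(real \<Rightarrow> complex) \<Rightarrow> bool" where
  "loc_integrable f \<longleftrightarrow> (\<forall>X. set_integrable lborel {0..X} f)"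

lemma loc_integrable_subinterval:
  "loc_integrable f \<Longrightarrow> 0 \<le> a \<Longrightarrow> set_integrable lborel {a..b} f"
  unfolding loc_integrable_def by (rule set_integrable_subset[of lborel "{0..b}"]) auto

lemma loc_integrable_HK: "loc_integrable f \<Longrightarrow> 0 \<le> a \<Longrightarrow> f integrable_on {a..b}"
  by (rule set_borel_integral_eq_integral(1)[OF loc_integrable_subinterval])

lemma loc_integrable_LINT:
  "loc_integrable f \<Longrightarrow> 0 \<le> a \<Longrightarrow> (LINT t:{a..b}|lborel. f t) = integral {a..b} f"
  by (rule set_borel_integral_eq_integral(2)[OF loc_integrable_subinterval])

lemma loc_integrable_norm_HK:
  "loc_integrable f \<Longrightarrow> 0 \<le> a \<Longrightarrow> (\<lambda>t. norm (f t)) integrable_on {a..b}"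
  by (rule set_borel_integral_eq_integral(1)[OF set_integrable_norm[OF loc_integrable_subinterval]])

lemma loc_integrable_add:
  "loc_integrable f \<Longrightarrow> loc_integrable g \<Longrightarrow> loc_integrable (\<lambda>t. f t + g t)"
  unfolding loc_integrable_def by (auto intro: set_integral_add)

lemma loc_integrable_diff:
  "loc_integrable f \<Longrightarrow> loc_integrable g \<Longrightarrow> loc_integrable (\<lambda>t. f t - g t)"
  unfolding loc_integrable_def by (auto intro: set_integral_diff)

lemma loc_integrable_scale: "loc_integrable f \<Longrightarrow> loc_integrable (\<lambda>t. a * f t)"
  unfolding loc_integrable_def by auto


lemma loc_integrable_cnj: "loc_integrable f \<Longrightarrow> loc_integrable (\<lambda>t. cnj (f t))"
  unfolding loc_integrable_def set_integrable_def
  using integrable_cnj[of lborel "\<lambda>x. indicator {0.._} x *\<^sub>R f x"] by simp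

lemma loc_integrable_continuous: "continuous_on {0..} f \<Longrightarrow> loc_integrable f"
  unfolding loc_integrable_def
  by (auto intro!: borel_integrable_atLeastAtMost' intro: continuous_on_subset)

lemma continuous_half_line_bounded:
  fixes g :: "real \<Rightarrow> complex"
  assumes "continuous_on {0..} g"
  obtains B where "B \<ge> 0" "\<And>t. 0 \<le> t \<Longrightarrow> t \<le> X \<Longrightarrow> cmod (g t) \<le> B"
proof -
  have "compact (g ` {0..X})"
    by (intro compact_continuous_image continuous_on_subset[OF assms]) auto
  then obtain B where B: "\<forall>t\<in>{0..X}. cmod (g t) \<le> B"
    by (auto dest!: compact_imp_bounded simp: bounded_iff)
  then have "cmod (g t) \<le> \<bar>B\<bar>" if "0 \<le> t" "t \<le> X" for t using that by force
  then show ?thesis using that[of "\<bar>B\<bar>"] by auto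
qed

lemma loc_integrable_mult_continuous:
  assumes f: "loc_integrable f" and g: "continuous_on {0..} g"
  shows "loc_integrable (\<lambda>t. f t * g t)"
  unfolding loc_integrable_def
proof
  fix X :: real
  obtain B where B: "B \<ge> 0" "\<And>t. 0 \<le> t \<Longrightarrow> t \<le> X \<Longrightarrow> cmod (g t) \<le> B"
    using continuous_half_line_bounded[OF g] by blast
  have fi: "integrable lborel (\<lambda>t. indicator {0..X} t *\<^sub>R f t)"
    using f by (simp add: loc_integrable_def set_integrable_def)
  have gm: "(\<lambda>t. indicator {0..X} t *\<^sub>R g t) \<in> borel_measurable borel"
    by (intro borel_measurable_continuous_on_indicator continuous_on_subset[OF g]) auto
  show "set_integrable lborel {0..X} (\<lambda>t. f t * g t)"
    unfolding set_integrable_def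
  proof (rule Bochner_Integration.integrable_bound)
    show "integrable lborel (\<lambda>t. B *\<^sub>R (indicator {0..X} t *\<^sub>R f t))"
      using fi by (rule integrable_scaleR_right)
    have "(\<lambda>t. (indicator {0..X} t *\<^sub>R f t) * (indicator {0..X} t *\<^sub>R g t)) \<in> borel_measurable lborel"
      using fi gm by (intro borel_measurable_times) auto
    then show "(\<lambda>t. indicator {0..X} t *\<^sub>R (f t * g t)) \<in> borel_measurable lborel"
      by (rule measurable_cong[THEN iffD1, rotated]) (auto simp: indicator_def)
    show "AE t in lborel. norm (indicator {0..X} t *\<^sub>R (f t * g t)) \<le> norm (B *\<^sub>R (indicator {0..X} t *\<^sub>R f t))"
    proof (intro AE_I2)
      fix t
      have "cmod (f t) * cmod (g t) \<le> cmod (f t) * B" if "0 \<le> t" "t \<le> X"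
        using B(2)[OF that] by (rule mult_left_mono) simp
      then show "norm (indicator {0..X} t *\<^sub>R (f t * g t)) \<le> norm (B *\<^sub>R (indicator {0..X} t *\<^sub>R f t))"
        using B(1) by (auto simp: indicator_def norm_mult mult.commute)
    qed
  qed
qed

text \<open>After division by \<open>y - x\<close> there remains \<open>c\<close> times an increment
  of the continuous \<open>\<Phi>\<close>, which tends to 0. So \<open>P\<close> has derivative zero
  at every point, even though \<open>\<Phi>\<close> need not be differentiable.\<close>

lemma constant_of_product_bound:
  fixes P :: "real \<Rightarrow> complex" and \<Phi> :: "real \<Rightarrow> real"
  assumes \<Phi>: "continuous_on {0..X} \<Phi>" and X: "0 \<le> X"
    and P: "\<And>x y. 0 \<le> x \<Longrightarrow> x \<le> y \<Longrightarrow> y \<le> X \<Longrightarrow> norm (P y - P x) \<le> c * (y - x) * \<bar>\<Phi> y - \<Phi> x\<bar>"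
  shows "P X = P 0"
proof -
  have P': "norm (P y - P x) \<le> \<bar>c\<bar> * \<bar>y - x\<bar> * \<bar>\<Phi> y - \<Phi> x\<bar>" if "x \<in> {0..X}" "y \<in> {0..X}" for x y
  proof (cases "x \<le> y")
    case True
    then have "norm (P y - P x) \<le> c * (y - x) * \<bar>\<Phi> y - \<Phi> x\<bar>" using P that by auto
    also have "\<dots> \<le> \<bar>c\<bar> * \<bar>y - x\<bar> * \<bar>\<Phi> y - \<Phi> x\<bar>" using True by (intro mult_right_mono mult_mono) auto
    finally show ?thesis .
  next
    case False
    then have "norm (P x - P y) \<le> c * (x - y) * \<bar>\<Phi> x - \<Phi> y\<bar>" using P that by auto
    also have "\<dots> \<le> \<bar>c\<bar> * \<bar>y - x\<bar> * \<bar>\<Phi> y - \<Phi> x\<bar>"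
      unfolding abs_minus_commute[of "\<Phi> x"] using False by (intro mult_right_mono mult_mono) auto
    finally show ?thesis by (simp add: norm_minus_commute)
  qed
  have "(P has_derivative (\<lambda>_. 0)) (at x within {0..X})" if x: "x \<in> {0..X}" for x
    unfolding has_derivative_within_alt
  proof (intro conjI allI impI)
    fix e :: real assume e: "0 < e"
    then have "0 < e / (\<bar>c\<bar> + 1)" by simp
    then obtain d where d: "d > 0" "\<And>y. y \<in> {0..X} \<Longrightarrow> dist y x < d \<Longrightarrow> dist (\<Phi> y) (\<Phi> x) < e / (\<bar>c\<bar> + 1)"
      using \<Phi> x unfolding continuous_on_iff by blast
    have "norm (P y - P x - 0) \<le> e * norm (y - x)" if y: "y \<in> {0..X}" "norm (y - x) < d" for y
    proof -
      have "\<bar>\<Phi> y - \<Phi> x\<bar> \<le> e / (\<bar>c\<bar> + 1)"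
        using d(2)[of y] y by (simp add: dist_real_def)
      then have "\<bar>c\<bar> * \<bar>\<Phi> y - \<Phi> x\<bar> \<le> \<bar>c\<bar> * (e / (\<bar>c\<bar> + 1))" by (intro mult_left_mono) auto
      also have "\<dots> \<le> e" using e by (simp add: field_simps)
      finally have "\<bar>y - x\<bar> * (\<bar>c\<bar> * \<bar>\<Phi> y - \<Phi> x\<bar>) \<le> \<bar>y - x\<bar> * e" by (intro mult_left_mono) auto
      then show ?thesis using P'[OF x y(1)] by (simp add: mult_ac)
    qed
    then show "\<exists>d>0. \<forall>y\<in>{0..X}. norm (y - x) < d \<longrightarrow> norm (P y - P x - 0) \<le> e * norm (y - x)"
      using d(1) by blast
  qed simp
  then obtain k where "\<And>x. x \<in> {0..X} \<Longrightarrow> P x = k"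
    using has_derivative_zero_constant[OF convex_real_interval(5), of 0 X P] by blast
  then show ?thesis using X by simp
qed

lemma indefinite_integral_continuous:
  assumes "loc_integrable w" "\<And>x. 0 \<le> x \<Longrightarrow> u x = u 0 + integral {0..x} w"
  shows "continuous_on {0..} u"
proof -
  have c: "continuous_on {0..X} u" for X
  proof (rule continuous_on_eq)
    show "continuous_on {0..X} (\<lambda>x. u 0 + integral {0..x} w)"
      by (intro continuous_on_add continuous_on_const indefinite_integral_continuous_1 loc_integrable_HK assms(1)) simp
    show "u 0 + integral {0..x} w = u x" if "x \<in> {0..X}" for x
      using that by (intro assms(2)[symmetric]) simp
  qed
  show ?thesis
    unfolding continuous_on_eq_continuous_within
  proof
    fix x :: real assume x: "x \<in> {0..}"
    have "continuous (at x within {0..x + 1}) u"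
      using c[of "x + 1"] x by (simp add: continuous_on_eq_continuous_within)
    moreover have "at x within {0..} = at x within {0..x + 1}"
      by (rule at_within_nhd[of x "{..<x + 1}"]) auto
    ultimately show "continuous (at x within {0..}) u" by simp
  qed
qed

text \<open>The derivative of an absolutely continuous function exists only almost everywhere, but the
  difference of the two sides has derivative zero everywhere, since its increment over
  \<open>[x, y]\<close> is at most a constant times \<open>(y - x) \<integral> \<bar>w\<bar>\<close>.\<close>

lemma AC_product_rule:
  fixes u w g g' :: "real \<Rightarrow> complex"
  assumes w: "loc_integrable w" and u: "\<And>x. 0 \<le> x \<Longrightarrow> u x = u 0 + integral {0..x} w"
    and g: "\<And>x. 0 \<le> x \<Longrightarrow> (g has_vector_derivative g' x) (at x within {0..})"
    and g': "continuous_on {0..} g'" and X: "0 \<le> X"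
  shows "u X * g X = u 0 * g 0 + integral {0..X} (\<lambda>t. w t * g t + u t * g' t)"
proof -
  have cu: "continuous_on {0..} u" by (rule indefinite_integral_continuous[OF w u])
  have cg: "continuous_on {0..} g" by (rule continuous_on_vector_derivative) (use g in auto)
  define D where "D t = w t * g t + u t * g' t" for t
  have D: "loc_integrable D" unfolding D_def
    by (intro loc_integrable_add loc_integrable_mult_continuous w cg loc_integrable_continuous
        continuous_on_mult cu g')
  define \<Phi> where "\<Phi> x = integral {0..x} (\<lambda>t. norm (w t))" for x
  define P where "P x = u x * g x - integral {0..x} D" for x
  obtain B where B: "B \<ge> 0" "\<And>t. 0 \<le> t \<Longrightarrow> t \<le> X \<Longrightarrow> cmod (g' t) \<le> B"
    using continuous_half_line_bounded[OF g'] by blast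
  have wi: "w integrable_on {x..y}" if "0 \<le> x" for x y using loc_integrable_HK[OF w that] .
  have uu: "u y - u x = integral {x..y} w" if "0 \<le> x" "x \<le> y" for x y
  proof -
    have "u y - u x = integral {0..y} w - integral {0..x} w" using u[of x] u[of y] that by simp
    then show ?thesis
      using Henstock_Kurzweil_Integration.integral_combine[OF that wi[OF order_refl]]
      by (metis add_diff_cancel_left')
  qed
  have \<Phi>: "\<Phi> y - \<Phi> x = integral {x..y} (\<lambda>t. norm (w t))" if "0 \<le> x" "x \<le> y" for x y
    using Henstock_Kurzweil_Integration.integral_combine[OF that loc_integrable_norm_HK[OF w order_refl]]
    by (simp add: \<Phi>_def)
  have gg: "(g' has_integral (g y - g x)) {x..y}" if "0 \<le> x" "x \<le> y" for x y
    by (rule fundamental_theorem_of_calculus[OF that(2)], rule has_vector_derivative_within_subset[OF g])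
       (use that in auto)
  have gd: "norm (g y - g t) \<le> B * (y - t)" if "0 \<le> t" "t \<le> y" "y \<le> X" for t y
    using has_integral_bound_real[OF B(1) finite.emptyI gg[OF that(1,2)]] B(2) that by simp
  have "P X = P 0"
  proof (rule constant_of_product_bound[OF _ X])
    show "continuous_on {0..X} \<Phi>"
      unfolding \<Phi>_def by (rule indefinite_integral_continuous_1[OF loc_integrable_norm_HK[OF w order_refl]])
  next
    fix x y assume xy: "0 \<le> x" "x \<le> y" "y \<le> X"
    \<comment> \<open>The product increment is split as (u y - u x) g y + u x (g y - g x), with
      \<open>g\<close> frozen at the right end and \<open>u\<close> at the left; \<open>E\<close> is
      the error of this freezing against the true integrand.\<close>
    define E where "E t = (w t * g y + u x * g' t) - D t" for t
    have Ei: "E integrable_on {x..y}"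
      unfolding E_def
      by (intro integrable_diff integrable_add integrable_on_mult_left integrable_on_mult_right wi[OF xy(1)]
          has_integral_integrable[OF gg[OF xy(1,2)]] loc_integrable_HK[OF D xy(1)])
    have \<Phi>m: "\<Phi> x \<le> \<Phi> y"
      using \<Phi>[OF xy(1,2)] Henstock_Kurzweil_Integration.integral_nonneg[OF loc_integrable_norm_HK[OF w xy(1)], of y]
      by simp
    have "P y - P x = ((u y - u x) * g y + u x * (g y - g x)) - integral {x..y} D"
      using Henstock_Kurzweil_Integration.integral_combine[OF xy(1,2) loc_integrable_HK[OF D order_refl]]
      by (simp add: P_def algebra_simps)
    also have "\<dots> = integral {x..y} E"
      unfolding E_def
      by (subst Henstock_Kurzweil_Integration.integral_diff, intro integrable_add integrable_on_mult_left
            integrable_on_mult_right wi[OF xy(1)] has_integral_integrable[OF gg[OF xy(1,2)]],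
          rule loc_integrable_HK[OF D xy(1)], subst Henstock_Kurzweil_Integration.integral_add,
          intro integrable_on_mult_left wi[OF xy(1)],
          intro integrable_on_mult_right has_integral_integrable[OF gg[OF xy(1,2)]])
         (simp add: uu[OF xy(1,2)] integral_unique[OF gg[OF xy(1,2)]])
    also have "norm \<dots> \<le> integral {x..y} (\<lambda>t. norm (w t) * (B * (y - x)) + (\<Phi> y - \<Phi> x) * B)"
    proof (rule integral_norm_bound_integral[OF Ei])
      show "(\<lambda>t. norm (w t) * (B * (y - x)) + (\<Phi> y - \<Phi> x) * B) integrable_on {x..y}"
        by (intro integrable_add integrable_on_mult_left loc_integrable_norm_HK[OF w xy(1)] integrable_const_ivl)
      fix t assume t: "t \<in> {x..y}"
      have E: "E t = w t * (g y - g t) + (u x - u t) * g' t" by (simp add: E_def D_def algebra_simps)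
      have 1: "norm (g y - g t) \<le> B * (y - x)"
        using gd[of t y] t xy B(1) mult_left_mono[of "y - t" "y - x" B] by auto
      have "norm (u t - u x) \<le> \<Phi> t - \<Phi> x"
        using t xy by (subst uu) (auto simp: \<Phi> intro!: integral_norm_bound_integral wi loc_integrable_norm_HK[OF w])
      also have "\<dots> \<le> \<Phi> y - \<Phi> x"
      proof -
        have "0 \<le> \<Phi> y - \<Phi> t" using t xy by (subst \<Phi>) (auto intro!: Henstock_Kurzweil_Integration.integral_nonneg loc_integrable_norm_HK[OF w])
        then show ?thesis by simp
      qed
      finally have 2: "norm (u x - u t) \<le> \<Phi> y - \<Phi> x" by (simp add: norm_minus_commute)
      have 3: "norm (g' t) \<le> B" using B(2) t xy by auto
      show "norm (E t) \<le> norm (w t) * (B * (y - x)) + (\<Phi> y - \<Phi> x) * B"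
        unfolding E
        by (rule order_trans[OF norm_triangle_ineq], unfold norm_mult)
           (intro add_mono mult_mono 1 2 3 order_refl, simp_all add: \<Phi>m)
    qed
    also have "\<dots> = (\<Phi> y - \<Phi> x) * (B * (y - x)) + (y - x) * ((\<Phi> y - \<Phi> x) * B)"
      by (subst Henstock_Kurzweil_Integration.integral_add)
         (use xy in \<open>auto intro!: integrable_on_mult_left loc_integrable_norm_HK[OF w] simp: \<Phi>\<close>)
    also have "\<dots> = (2 * B) * (y - x) * (\<Phi> y - \<Phi> x)" by (simp add: algebra_simps)
    also have "\<dots> \<le> (2 * B) * (y - x) * \<bar>\<Phi> y - \<Phi> x\<bar>"
      using B(1) xy by (intro mult_left_mono) auto
    finally show "norm (P y - P x) \<le> (2 * B) * (y - x) * \<bar>\<Phi> y - \<Phi> x\<bar>" .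
  qed
  then have "u X * g X = u 0 * g 0 + integral {0..X} D"
    unfolding P_def by (simp add: diff_eq_eq)
  then show ?thesis by (simp only: D_def[abs_def])
qed

subsection \<open>The Sturm--Liouville expression on the half-line\<close>

text \<open>\<open>y' = v\<close> and \<open>- v' + q y = h\<close> on \<open>[0, \<infinity>)\<close>.\<close>

definition SL_pair :: "(real \<Rightarrow> real) \<Rightarrow> (real \<Rightarrow> complex) \<Rightarrow> (real \<Rightarrow> complex) \<Rightarrow> (real \<Rightarrow> complex) \<Rightarrow> bool" where
  "SL_pair q y v h \<longleftrightarrow>
     (\<forall>x\<ge>0. (y has_vector_derivative v x) (at x within {0..})) \<and> loc_integrable h \<and>
     (\<forall>x\<ge>0. v x = v 0 + integral {0..x} (\<lambda>t. of_real (q t) * y t - h t))"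

lemma SL_pairD:
  assumes "SL_pair q y v h"
  shows "0 \<le> x \<Longrightarrow> (y has_vector_derivative v x) (at x within {0..})" "loc_integrable h"
    "0 \<le> x \<Longrightarrow> v x = v 0 + integral {0..x} (\<lambda>t. of_real (q t) * y t - h t)"
  using assms unfolding SL_pair_def by blast+

lemma SL_pair_continuous: "SL_pair q y v h \<Longrightarrow> continuous_on {0..} y"
  by (rule continuous_on_vector_derivative[where f' = v]) (simp add: SL_pairD(1))

lemma continuous_on_complex_of_real:
  "continuous_on S q \<Longrightarrow> continuous_on S (\<lambda>x. complex_of_real (q x))"
  by (intro continuous_intros)

lemma SL_pair_loc_integrable:
  assumes "continuous_on UNIV q" "SL_pair q y v h"
  shows "loc_integrable (\<lambda>t. of_real (q t) * y t - h t)"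
  by (intro loc_integrable_diff loc_integrable_continuous continuous_on_mult continuous_on_complex_of_real
      continuous_on_subset[OF assms(1)] SL_pair_continuous[OF assms(2)] SL_pairD(2)[OF assms(2)]) auto

lemma SL_pair_continuous_deriv:
  assumes "continuous_on UNIV q" "SL_pair q y v h"
  shows "continuous_on {0..} v"
  by (rule indefinite_integral_continuous[OF SL_pair_loc_integrable[OF assms] SL_pairD(3)[OF assms(2)]])

lemma SL_pair_cnj:
  assumes "SL_pair q y v h"
  shows "SL_pair q (\<lambda>x. cnj (y x)) (\<lambda>x. cnj (v x)) (\<lambda>x. cnj (h x))"
  unfolding SL_pair_def
proof (intro conjI allI impI)
  fix x :: real assume x: "0 \<le> x"
  show "((\<lambda>x. cnj (y x)) has_vector_derivative cnj (v x)) (at x within {0..})"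
    by (rule bounded_linear.has_vector_derivative[OF bounded_linear_cnj SL_pairD(1)[OF assms x]])
  have "cnj (v x) = cnj (v 0) + integral {0..x} (\<lambda>t. cnj (of_real (q t) * y t - h t))"
    unfolding integral_cnj[symmetric] by (subst SL_pairD(3)[OF assms x]) simp
  then show "cnj (v x) = cnj (v 0) + integral {0..x} (\<lambda>t. complex_of_real (q t) * cnj (y t) - cnj (h t))"
    by simp
qed (intro loc_integrable_cnj SL_pairD(2)[OF assms])

lemma SL_pair_combine:
  assumes q: "continuous_on UNIV q" and 1: "SL_pair q y1 v1 h1" and 2: "SL_pair q y2 v2 h2"
  shows "SL_pair q (\<lambda>x. a * y1 x + b * y2 x) (\<lambda>x. a * v1 x + b * v2 x) (\<lambda>x. a * h1 x + b * h2 x)"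
  unfolding SL_pair_def
proof (intro conjI allI impI)
  fix x :: real assume x: "0 \<le> x"
  show "((\<lambda>x. a * y1 x + b * y2 x) has_vector_derivative a * v1 x + b * v2 x) (at x within {0..})"
    by (intro has_vector_derivative_add has_vector_derivative_mult_right SL_pairD(1)[OF 1 x] SL_pairD(1)[OF 2 x])
  have "integral {0..x} (\<lambda>t. of_real (q t) * (a * y1 t + b * y2 t) - (a * h1 t + b * h2 t)) =
      integral {0..x} (\<lambda>t. a * (of_real (q t) * y1 t - h1 t) + b * (of_real (q t) * y2 t - h2 t))"
    by (simp add: algebra_simps)
  also have "\<dots> = a * integral {0..x} (\<lambda>t. of_real (q t) * y1 t - h1 t) + b * integral {0..x} (\<lambda>t. of_real (q t) * y2 t - h2 t)"
    by (subst Henstock_Kurzweil_Integration.integral_add)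
       (auto intro!: integrable_on_mult_right loc_integrable_HK SL_pair_loc_integrable[OF q] 1 2)
  finally show "a * v1 x + b * v2 x = a * v1 0 + b * v2 0 +
      integral {0..x} (\<lambda>t. of_real (q t) * (a * y1 t + b * y2 t) - (a * h1 t + b * h2 t))"
    by (simp add: SL_pairD(3)[OF 1 x] SL_pairD(3)[OF 2 x] algebra_simps)
qed (intro loc_integrable_add loc_integrable_scale SL_pairD(2)[OF 1] SL_pairD(2)[OF 2])

lemma SL_pair_lagrange:
  assumes q: "continuous_on UNIV q" and 1: "SL_pair q y1 v1 h1" and 2: "SL_pair q y2 v2 h2" and X: "0 \<le> X"
  shows "v1 X * y2 X - y1 X * v2 X = v1 0 * y2 0 - y1 0 * v2 0 + integral {0..X} (\<lambda>t. y1 t * h2 t - h1 t * y2 t)"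
proof -
  note c = SL_pair_continuous[OF 1] SL_pair_continuous[OF 2] SL_pair_continuous_deriv[OF q 1]
    SL_pair_continuous_deriv[OF q 2]
  note w1 = SL_pair_loc_integrable[OF q 1] and w2 = SL_pair_loc_integrable[OF q 2]
  have e1: "v1 X * y2 X = v1 0 * y2 0 + integral {0..X} (\<lambda>t. (of_real (q t) * y1 t - h1 t) * y2 t + v1 t * v2 t)"
    by (rule AC_product_rule[OF w1 SL_pairD(3)[OF 1] SL_pairD(1)[OF 2] c(4) X])
  have e2: "v2 X * y1 X = v2 0 * y1 0 + integral {0..X} (\<lambda>t. (of_real (q t) * y2 t - h2 t) * y1 t + v2 t * v1 t)"
    by (rule AC_product_rule[OF w2 SL_pairD(3)[OF 2] SL_pairD(1)[OF 1] c(3) X])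
  have i1: "(\<lambda>t. (of_real (q t) * y1 t - h1 t) * y2 t + v1 t * v2 t) integrable_on {0..X}"
    by (intro loc_integrable_HK loc_integrable_add loc_integrable_mult_continuous w1 c
        loc_integrable_continuous continuous_on_mult) simp
  have i2: "(\<lambda>t. (of_real (q t) * y2 t - h2 t) * y1 t + v2 t * v1 t) integrable_on {0..X}"
    by (intro loc_integrable_HK loc_integrable_add loc_integrable_mult_continuous w2 c
        loc_integrable_continuous continuous_on_mult) simp
  have "v1 X * y2 X - y1 X * v2 X = v1 0 * y2 0 - y1 0 * v2 0 +
      (integral {0..X} (\<lambda>t. (of_real (q t) * y1 t - h1 t) * y2 t + v1 t * v2 t) -
       integral {0..X} (\<lambda>t. (of_real (q t) * y2 t - h2 t) * y1 t + v2 t * v1 t))"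
    using e1 e2 by (simp add: mult.commute algebra_simps)
  also have "integral {0..X} (\<lambda>t. (of_real (q t) * y1 t - h1 t) * y2 t + v1 t * v2 t) -
       integral {0..X} (\<lambda>t. (of_real (q t) * y2 t - h2 t) * y1 t + v2 t * v1 t) =
       integral {0..X} (\<lambda>t. y1 t * h2 t - h1 t * y2 t)"
    by (subst Henstock_Kurzweil_Integration.integral_diff[OF i1 i2, symmetric]) (simp add: algebra_simps)
  finally show ?thesis .
qed

text \<open>Lagrange's identity for \<open>y\<close> and its conjugate; both integrands are
  differences of conjugates, and the real potential drops out.\<close>

lemma SL_pair_energy:
  assumes q: "continuous_on UNIV q" and y: "SL_pair q y v h" and X: "0 \<le> X"
  shows "Im (v X * cnj (y X)) = Im (v 0 * cnj (y 0)) - integral {0..X} (\<lambda>t. Im (h t * cnj (y t)))"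
proof -
  have i: "(\<lambda>t. h t * cnj (y t)) integrable_on {0..X}"
    by (intro loc_integrable_HK loc_integrable_mult_continuous SL_pairD(2)[OF y] continuous_on_cnj
        SL_pair_continuous[OF y]) simp
  define g where "g t = Im (h t * cnj (y t))" for t
  have gi: "g integrable_on {0..X}"
    unfolding g_def using integrable_linear[OF i bounded_linear_Im] by (simp add: o_def)
  have "y t * cnj (h t) - h t * cnj (y t) = - 2 * \<i> * of_real (g t)" for t
    by (simp add: g_def complex_eq_iff)
  then have e: "v X * cnj (y X) - y X * cnj (v X) = v 0 * cnj (y 0) - y 0 * cnj (v 0) +
      integral {0..X} (\<lambda>t. - 2 * \<i> * of_real (g t))"
    using SL_pair_lagrange[OF q y SL_pair_cnj[OF y] X] by simp
  have "integral {0..X} (\<lambda>t. - 2 * \<i> * complex_of_real (g t)) = - 2 * \<i> * of_real (integral {0..X} g)"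
    using integral_linear[OF gi bounded_linear_of_real[where 'a = complex]] by (simp add: o_def)
  then have "Im (v X * cnj (y X)) = Im (v 0 * cnj (y 0)) - integral {0..X} g"
    using arg_cong[OF e, of Im] by (simp add: algebra_simps)
  then show ?thesis by (simp only: g_def[abs_def])
qed

subsection \<open>Classical solutions\<close>

definition SL_classical :: "(real \<Rightarrow> real) \<Rightarrow> complex \<Rightarrow> (real \<Rightarrow> complex) \<Rightarrow> (real \<Rightarrow> complex) \<Rightarrow> bool" where
  "SL_classical q z y v \<longleftrightarrow> (\<forall>x. (y has_vector_derivative v x) (at x)) \<and>
     (\<forall>x. (v has_vector_derivative (of_real (q x) - z) * y x) (at x))"

lemma SL_classical_wronskian:
  assumes 1: "SL_classical q z y1 v1" and 2: "SL_classical q z y2 v2"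
  shows "v1 x * y2 x - y1 x * v2 x = v1 0 * y2 0 - y1 0 * v2 0"
proof -
  have "((\<lambda>x. v1 x * y2 x - y1 x * v2 x) has_vector_derivative 0) (at x within UNIV)" for x
  proof -
    have "((\<lambda>x. v1 x * y2 x - y1 x * v2 x) has_vector_derivative
        (v1 x * v2 x + ((of_real (q x) - z) * y1 x) * y2 x) -
        (y1 x * ((of_real (q x) - z) * y2 x) + v1 x * v2 x)) (at x)"
      using 1 2 unfolding SL_classical_def
      by (intro has_vector_derivative_diff has_vector_derivative_mult) auto
    then show ?thesis by (simp add: algebra_simps)
  qed
  then obtain c where "\<And>x. x \<in> UNIV \<Longrightarrow> v1 x * y2 x - y1 x * v2 x = c"
    using has_vector_derivative_zero_constant[OF convex_UNIV] by blast
  then show ?thesis by simp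
qed

lemma SL_classical_exists:
  assumes "continuous_on UNIV q"
  obtains y v where "SL_classical q z y v" "y 0 = a" "v 0 = b"
  using linear_ode_solution_exists[of "\<lambda>x. of_real (q x) - z" a b] assms
  unfolding SL_classical_def by (force intro!: continuous_intros)

text \<open>Cramer's rule, with the constant Wronskians evaluated at 0.\<close>

lemma SL_classical_eq_combination:
  assumes c: "SL_classical q z c c'" "c 0 = 1" "c' 0 = 0"
    and s: "SL_classical q z s s'" "s 0 = 0" "s' 0 = 1" and y: "SL_classical q z y v"
  shows "y x = y 0 * c x + v 0 * s x" "v x = y 0 * c' x + v 0 * s' x"
proof -
  have 1: "s' x * c x - s x * c' x = 1"
    using SL_classical_wronskian[OF s(1) c(1), of x] c s by simp
  have 2: "v x * s x - y x * s' x = - y 0"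
    using SL_classical_wronskian[OF y s(1), of x] s by simp
  have 3: "v x * c x - y x * c' x = v 0"
    using SL_classical_wronskian[OF y c(1), of x] c by simp
  have "y x * (s' x * c x - s x * c' x) = - (v x * s x - y x * s' x) * c x + (v x * c x - y x * c' x) * s x"
    by (simp add: algebra_simps)
  then show "y x = y 0 * c x + v 0 * s x" unfolding 1 2 3 by simp
  have "v x * (s' x * c x - s x * c' x) = - (v x * s x - y x * s' x) * c' x + (v x * c x - y x * c' x) * s' x"
    by (simp add: algebra_simps)
  then show "v x = y 0 * c' x + v 0 * s' x" unfolding 1 2 3 by simp
qed

lemma SL_classical_unique:
  assumes q: "continuous_on UNIV q" and 1: "SL_classical q z y1 v1" and 2: "SL_classical q z y2 v2"
    and "y1 0 = y2 0" "v1 0 = v2 0"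
  shows "y1 = y2"
proof -
  obtain c c' where c: "SL_classical q z c c'" "c 0 = 1" "c' 0 = 0"
    by (rule SL_classical_exists[OF q])
  obtain s s' where s: "SL_classical q z s s'" "s 0 = 0" "s' 0 = 1"
    by (rule SL_classical_exists[OF q])
  show ?thesis
  proof
    fix x
    show "y1 x = y2 x"
      by (subst SL_classical_eq_combination(1)[OF c s 1], subst SL_classical_eq_combination(1)[OF c s 2])
         (simp only: assms(4,5))
  qed
qed

definition SL_dsolution :: "(real \<Rightarrow> real) \<Rightarrow> complex \<Rightarrow> complex \<Rightarrow> complex \<Rightarrow> real \<Rightarrow> complex" where
  "SL_dsolution q a b z x = vector_derivative (SL_solution q a b z) (at x)"

lemma SL_classical_iff:
  "SL_classical q z y v \<longleftrightarrow> (\<exists>w. (\<forall>x. (y has_vector_derivative v x) (at x)) \<and>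
     (\<forall>x. (v has_vector_derivative w x) (at x)) \<and> (\<forall>x. - w x + complex_of_real (q x) * y x = z * y x))"
proof
  assume "SL_classical q z y v"
  then show "\<exists>w. (\<forall>x. (y has_vector_derivative v x) (at x)) \<and>
     (\<forall>x. (v has_vector_derivative w x) (at x)) \<and> (\<forall>x. - w x + complex_of_real (q x) * y x = z * y x)"
    by (intro exI[of _ "\<lambda>x. (of_real (q x) - z) * y x"]) (auto simp: SL_classical_def algebra_simps)
next
  assume "\<exists>w. (\<forall>x. (y has_vector_derivative v x) (at x)) \<and>
     (\<forall>x. (v has_vector_derivative w x) (at x)) \<and> (\<forall>x. - w x + complex_of_real (q x) * y x = z * y x)"
  then obtain w where w: "\<And>x. (y has_vector_derivative v x) (at x)" "\<And>x. (v has_vector_derivative w x) (at x)"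
    "\<And>x. - w x + complex_of_real (q x) * y x = z * y x" by blast
  have "w x = (of_real (q x) - z) * y x" for x using w(3)[of x] by (simp add: algebra_simps)
  then show "SL_classical q z y v" unfolding SL_classical_def using w by simp
qed

lemma SL_solution:
  assumes q: "continuous_on UNIV q"
  shows "SL_classical q z (SL_solution q a b z) (SL_dsolution q a b z)"
    "SL_solution q a b z 0 = a" "SL_dsolution q a b z 0 = b"
proof -
  obtain y v where y: "SL_classical q z y v" "y 0 = a" "v 0 = b" by (rule SL_classical_exists[OF q])
  have "SL_solution q a b z = y"
    unfolding SL_solution_def
  proof (rule the_equality)
    show "\<exists>y' y''. (\<forall>x. (y has_vector_derivative y' x) (at x)) \<and> (\<forall>x. (y' has_vector_derivative y'' x) (at x)) \<and>
        (\<forall>x. - y'' x + complex_of_real (q x) * y x = z * y x) \<and> y 0 = a \<and> y' 0 = b"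
      using y unfolding SL_classical_iff by blast
  next
    fix u assume "\<exists>y' y''. (\<forall>x. (u has_vector_derivative y' x) (at x)) \<and> (\<forall>x. (y' has_vector_derivative y'' x) (at x)) \<and>
        (\<forall>x. - y'' x + complex_of_real (q x) * u x = z * u x) \<and> u 0 = a \<and> y' 0 = b"
    then obtain u' where "SL_classical q z u u'" "u 0 = a" "u' 0 = b"
      unfolding SL_classical_iff by blast
    then show "u = y" using SL_classical_unique[OF q _ y(1)] y by simp
  qed
  moreover have "SL_dsolution q a b z = v"
    unfolding SL_dsolution_def calculation
    using y(1) by (auto simp: SL_classical_def intro!: ext vector_derivative_at)
  ultimately show "SL_classical q z (SL_solution q a b z) (SL_dsolution q a b z)"
    "SL_solution q a b z 0 = a" "SL_dsolution q a b z 0 = b" using y by auto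
qed

lemma SL_solution_unique:
  assumes "continuous_on UNIV q" "SL_classical q z y v"
  shows "SL_solution q (y 0) (v 0) z = y"
  using SL_classical_unique[OF assms(1) SL_solution(1)[OF assms(1)] assms(2)] SL_solution(2,3)[OF assms(1)]
  by simp

lemma SL_classical_pair:
  assumes q: "continuous_on UNIV q" and y: "SL_classical q z y v"
  shows "SL_pair q y v (\<lambda>x. z * y x)"
  unfolding SL_pair_def
proof (intro conjI allI impI)
  show "(y has_vector_derivative v x) (at x within {0..})" for x
    using y by (simp add: SL_classical_def has_vector_derivative_at_within)
  have "continuous_on {0..} y"
    using y by (intro continuous_on_vector_derivative[where f' = v])
      (auto simp: SL_classical_def has_vector_derivative_at_within)
  then show "loc_integrable (\<lambda>x. z * y x)" by (intro loc_integrable_scale loc_integrable_continuous)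
  fix x :: real assume x: "0 \<le> x"
  have "((\<lambda>t. (of_real (q t) - z) * y t) has_integral (v x - v 0)) {0..x}"
    using y by (intro fundamental_theorem_of_calculus[OF x]) (auto simp: SL_classical_def has_vector_derivative_at_within)
  then show "v x = v 0 + integral {0..x} (\<lambda>t. complex_of_real (q t) * y t - z * y t)"
    by (simp add: integral_unique left_diff_distrib)
qed

lemma SL_classical_cnj:
  assumes "SL_classical q z y v"
  shows "SL_classical q (cnj z) (\<lambda>x. cnj (y x)) (\<lambda>x. cnj (v x))"
proof -
  have "((\<lambda>x. cnj (v x)) has_vector_derivative cnj ((of_real (q x) - z) * y x)) (at x)"
    "((\<lambda>x. cnj (y x)) has_vector_derivative cnj (v x)) (at x)" for x
    using assms by (auto simp: SL_classical_def intro!: bounded_linear.has_vector_derivative[OF bounded_linear_cnj]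
      simp del: complex_cnj_mult complex_cnj_diff)
  then show ?thesis by (simp add: SL_classical_def)
qed

lemma SL_solution_cnj:
  assumes q: "continuous_on UNIV q"
  shows "SL_solution q (cnj a) (cnj b) (cnj z) x = cnj (SL_solution q a b z x)"
  using SL_solution_unique[OF q SL_classical_cnj[OF SL_solution(1)[OF q, of z a b]]] SL_solution(2,3)[OF q, of a b z]
  by simp

text \<open>Cramer's rule again, now for functions whose second derivative is known only through an
  integral: for equal \<open>z\<close> the integrand in Lagrange's identity vanishes, so brackets
  are constant.\<close>

lemma SL_pair_homogeneous:
  assumes q: "continuous_on UNIV q" and y: "SL_pair q y v (\<lambda>x. z * y x)"
    and 1: "SL_pair q f f' (\<lambda>x. z * f x)" and 2: "SL_pair q g g' (\<lambda>x. z * g x)"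
    and w: "g' 0 * f 0 - g 0 * f' 0 = 1" and x: "0 \<le> x"
  shows "y x = (v 0 * f 0 - y 0 * f' 0) * g x - (v 0 * g 0 - y 0 * g' 0) * f x"
    "v x = (v 0 * f 0 - y 0 * f' 0) * g' x - (v 0 * g 0 - y 0 * g' 0) * f' x"
proof -
  have c: "v1 x * y2 x - y1 x * v2 x = v1 0 * y2 0 - y1 0 * v2 0"
    if "SL_pair q y1 v1 (\<lambda>x. z * y1 x)" "SL_pair q y2 v2 (\<lambda>x. z * y2 x)" for y1 v1 y2 v2
    using SL_pair_lagrange[OF q that x] by (simp add: mult.left_commute)
  have 3: "g' x * f x - g x * f' x = 1" using c[OF 2 1] w by simp
  have "y x * (g' x * f x - g x * f' x) = (v x * f x - y x * f' x) * g x - (v x * g x - y x * g' x) * f x"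
    by (simp add: algebra_simps)
  then show "y x = (v 0 * f 0 - y 0 * f' 0) * g x - (v 0 * g 0 - y 0 * g' 0) * f x"
    unfolding 3 c[OF y 1] c[OF y 2] by simp
  have "v x * (g' x * f x - g x * f' x) = (v x * f x - y x * f' x) * g' x - (v x * g x - y x * g' x) * f' x"
    by (simp add: algebra_simps)
  then show "v x = (v 0 * f 0 - y 0 * f' 0) * g' x - (v 0 * g 0 - y 0 * g' 0) * f' x"
    unfolding 3 c[OF y 1] c[OF y 2] by simp
qed

subsection \<open>Square integrable functions on the half-line\<close>

lemma sq_integrable_on_iff:
  "sq_integrable_on f S \<longleftrightarrow> sq_integrable (\<lambda>x. indicator S x *\<^sub>R f x)"
proof -
  have "(\<lambda>x. indicator S x *\<^sub>R (cmod (f x))\<^sup>2) = (\<lambda>x. (cmod (indicator S x *\<^sub>R f x))\<^sup>2)"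
    by (auto simp: indicator_def)
  then show ?thesis
    by (simp add: sq_integrable_on_def sq_integrable_def set_borel_measurable_def set_integrable_def)
qed

lemma sq_integrable_on_combine:
  assumes "sq_integrable_on f S" "sq_integrable_on g S"
  shows "sq_integrable_on (\<lambda>x. a * f x + b * g x) S"
proof -
  have "(\<lambda>x. indicator S x *\<^sub>R (a * f x + b * g x)) = (\<lambda>x. a * (indicator S x *\<^sub>R f x) + b * (indicator S x *\<^sub>R g x))"
    by (auto simp: indicator_def)
  then show ?thesis
    using assms unfolding sq_integrable_on_iff by (simp only:) (intro sq_integrable_add sq_integrable_scale)
qed

lemma sq_integrable_on_scale: "sq_integrable_on f S \<Longrightarrow> sq_integrable_on (\<lambda>x. a * f x) S"
  using sq_integrable_on_combine[of f S f a 0] by simp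

lemma sq_integrable_on_diff:
  "sq_integrable_on f S \<Longrightarrow> sq_integrable_on g S \<Longrightarrow> sq_integrable_on (\<lambda>x. f x - g x) S"
  using sq_integrable_on_combine[of f S g 1 "-1"] by simp

lemma sq_integrable_cnj: "sq_integrable f \<Longrightarrow> sq_integrable (\<lambda>x. cnj (f x))"
proof -
  have "cnj \<in> borel_measurable borel" by (intro borel_measurable_continuous_onI continuous_intros)
  then show "sq_integrable f \<Longrightarrow> sq_integrable (\<lambda>x. cnj (f x))"
    unfolding sq_integrable_def using measurable_compose[of f lborel borel cnj borel] by auto
qed

lemma sq_integrable_on_cnj: "sq_integrable_on f S \<Longrightarrow> sq_integrable_on (\<lambda>x. cnj (f x)) S"
  unfolding sq_integrable_on_iff by (drule sq_integrable_cnj) simp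

lemma sq_integrable_on_cong:
  "(\<And>x. x \<in> S \<Longrightarrow> f x = g x) \<Longrightarrow> sq_integrable_on f S \<longleftrightarrow> sq_integrable_on g S"
  unfolding sq_integrable_on_iff by (rule arg_cong[of _ _ sq_integrable]) (auto simp: indicator_def intro!: ext)

lemma sq_integrable_loc_integrable:
  assumes "sq_integrable_on f {0..}"
  shows "loc_integrable f"
  unfolding loc_integrable_def set_integrable_def
proof
  fix X :: real
  let ?F = "\<lambda>x. indicator {0..} x *\<^sub>R f x"
  have F: "?F \<in> borel_measurable lborel" "integrable lborel (\<lambda>x. (cmod (?F x))\<^sup>2)"
    using assms by (auto simp: sq_integrable_on_iff sq_integrable_def)
  have e: "(\<lambda>x. indicator {0..X} x *\<^sub>R f x) = (\<lambda>x. indicator {0..X} x *\<^sub>R ?F x)"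
    by (auto simp: indicator_def)
  show "integrable lborel (\<lambda>x. indicator {0..X} x *\<^sub>R f x)"
    unfolding e
  proof (rule Bochner_Integration.integrable_bound)
    show "integrable lborel (\<lambda>x. indicator {0..X} x + (cmod (?F x))\<^sup>2)"
      by (intro Bochner_Integration.integrable_add F integrable_real_indicator)
         (simp_all add: emeasure_lborel_Icc_eq)
    show "(\<lambda>x. indicator {0..X} x *\<^sub>R ?F x) \<in> borel_measurable lborel"
      by (rule borel_measurable_scaleR[OF _ F(1)]) simp
    have "a \<le> 1 + a\<^sup>2" for a :: real
      using sum_squares_bound[of 1 a] zero_le_power2[of a] by (simp, linarith)
    then show "AE x in lborel. norm (indicator {0..X} x *\<^sub>R ?F x) \<le> norm (indicator {0..X} x + (cmod (?F x))\<^sup>2)"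
      by (auto simp: indicator_def)
  qed
qed

lemma sq_integrable_on_mult:
  assumes "sq_integrable_on f S" "sq_integrable_on g S"
  shows "set_integrable lborel S (\<lambda>x. f x * g x)"
proof -
  have "integrable lborel (\<lambda>x. (indicator S x *\<^sub>R f x) * cnj (indicator S x *\<^sub>R cnj (g x)))"
    using assms sq_integrable_on_cnj[OF assms(2)] unfolding sq_integrable_on_iff by (intro sq_integrable_mult_cnj)
  moreover have "(\<lambda>x. (indicator S x *\<^sub>R f x) * cnj (indicator S x *\<^sub>R cnj (g x))) = (\<lambda>x. indicator S x *\<^sub>R (f x * g x))"
    by (auto simp: indicator_def)
  ultimately show ?thesis by (simp add: set_integrable_def)
qed

lemma set_integral_tendsto_half_line:
  fixes f :: "real \<Rightarrow> 'a::euclidean_space"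
  assumes "set_integrable lborel {0..} f"
  shows "((\<lambda>X. integral {0..X} f) \<longlongrightarrow> (LINT t:{0..}|lborel. f t)) at_top"
proof -
  have i: "integrable lborel (\<lambda>x. indicator {0..} x *\<^sub>R f x)" using assms by (simp add: set_integrable_def)
  have "((\<lambda>X. LINT x|lborel. indicator {..X} x *\<^sub>R (indicator {0..} x *\<^sub>R f x)) \<longlongrightarrow> (LINT t:{0..}|lborel. f t)) at_top"
    unfolding set_lebesgue_integral_def by (rule tendsto_integral_at_top[OF _ i]) simp
  moreover have "(LINT x|lborel. indicator {..X} x *\<^sub>R (indicator {0..} x *\<^sub>R f x)) = integral {0..X} f" for X
  proof -
    have "(\<lambda>x. indicator {..X} x *\<^sub>R (indicator {0..} x *\<^sub>R f x)) = (\<lambda>x. indicator {0..X} x *\<^sub>R f x)"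
      by (auto simp: indicator_def)
    then show ?thesis
      using set_borel_integral_eq_integral(2)[OF set_integrable_subset[OF assms, of "{0..X}"]]
      by (simp add: set_lebesgue_integral_def)
  qed
  ultimately show ?thesis by simp
qed

lemma sq_integral_le:
  assumes "sq_integrable_on f {0..}"
  shows "(\<lambda>t. (cmod (f t))\<^sup>2) integrable_on {0..X}"
    "integral {0..X} (\<lambda>t. (cmod (f t))\<^sup>2) \<le> (LINT t:{0..}|lborel. (cmod (f t))\<^sup>2)"
proof -
  have s: "set_integrable lborel {0..} (\<lambda>t. (cmod (f t))\<^sup>2)" using assms by (simp add: sq_integrable_on_def)
  have s': "set_integrable lborel {0..X} (\<lambda>t. (cmod (f t))\<^sup>2)" by (rule set_integrable_subset[OF s]) auto
  show "(\<lambda>t. (cmod (f t))\<^sup>2) integrable_on {0..X}" by (rule set_borel_integral_eq_integral(1)[OF s'])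
  show "integral {0..X} (\<lambda>t. (cmod (f t))\<^sup>2) \<le> (LINT t:{0..}|lborel. (cmod (f t))\<^sup>2)"
    unfolding set_borel_integral_eq_integral(2)[OF s', symmetric]
    using s s' unfolding set_lebesgue_integral_def set_integrable_def
    by (intro integral_mono) (auto simp: indicator_def)
qed

lemma sq_integrable_on_half_line_bounded:
  fixes y :: "real \<Rightarrow> complex"
  assumes y: "continuous_on {0..} y" and B: "\<And>X. 0 \<le> X \<Longrightarrow> integral {0..X} (\<lambda>t. (cmod (y t))\<^sup>2) \<le> B"
  shows "sq_integrable_on y {0..}" "(LINT t:{0..}|lborel. (cmod (y t))\<^sup>2) \<le> B"
proof -
  define f where "f n x = indicator {0..real n} x *\<^sub>R (cmod (y x))\<^sup>2" for n :: nat and x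
  have cy: "continuous_on {0..} (\<lambda>t. (cmod (y t))\<^sup>2)" by (intro continuous_intros y)
  have si: "set_integrable lborel {0..real n} (\<lambda>t. (cmod (y t))\<^sup>2)" for n
    by (intro borel_integrable_atLeastAtMost' continuous_on_subset[OF cy]) auto
  have fi: "integrable lborel (f n)" for n using si[of n] by (simp add: set_integrable_def f_def[abs_def])
  have fI: "integral\<^sup>L lborel (f n) = integral {0..real n} (\<lambda>t. (cmod (y t))\<^sup>2)" for n
    using set_borel_integral_eq_integral(2)[OF si[of n]] by (simp add: set_lebesgue_integral_def f_def[abs_def])
  have mono: "f m x \<le> f n x" if "m \<le> n" for m n x using that by (auto simp: f_def indicator_def)
  have inc: "incseq (\<lambda>n. integral\<^sup>L lborel (f n))"
    by (intro incseq_SucI integral_mono fi mono) simp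
  moreover have "bdd_above (range (\<lambda>n. integral\<^sup>L lborel (f n)))"
    by (rule bdd_aboveI[of _ B]) (auto simp: fI B)
  ultimately have L: "(\<lambda>n. integral\<^sup>L lborel (f n)) \<longlonglongrightarrow> (SUP n. integral\<^sup>L lborel (f n))"
    by (intro LIMSEQ_incseq_SUP)
  let ?u = "\<lambda>x. indicator {0..} x *\<^sub>R (cmod (y x))\<^sup>2"
  have lim: "(\<lambda>n. f n x) \<longlonglongrightarrow> ?u x" for x
  proof (rule tendsto_eventually)
    obtain N :: nat where N: "x \<le> real N" using real_arch_simple by blast
    show "\<forall>\<^sub>F n in sequentially. f n x = ?u x"
      using eventually_ge_at_top[of N] by eventually_elim (use N in \<open>auto simp: f_def indicator_def\<close>)
  qed
  have ym: "(\<lambda>x. indicator {0..} x *\<^sub>R y x) \<in> borel_measurable borel"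
    by (intro borel_measurable_continuous_on_indicator y) auto
  have um: "?u \<in> borel_measurable lborel"
    using borel_measurable_continuous_on_indicator[OF _ cy] by simp
  note mc = integrable_monotone_convergence[OF fi _ _ L um] integral_monotone_convergence[OF fi _ _ L um]
  have u: "integrable lborel ?u" by (rule mc) (use mono lim in \<open>auto simp: mono_def\<close>)
  have uI: "integral\<^sup>L lborel ?u = (SUP n. integral\<^sup>L lborel (f n))"
    by (rule mc) (use mono lim in \<open>auto simp: mono_def\<close>)
  show "sq_integrable_on y {0..}"
    using u ym by (simp add: sq_integrable_on_def set_borel_measurable_def set_integrable_def)
  show "(LINT t:{0..}|lborel. (cmod (y t))\<^sup>2) \<le> B"
    unfolding set_lebesgue_integral_def uI by (rule cSUP_least) (auto simp: fI B)
qed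

lemma integral_norm_sq_pos:
  fixes y :: "real \<Rightarrow> complex"
  assumes y: "continuous_on {0..} y" "y 0 \<noteq> 0" and X: "0 < X"
  shows "0 < integral {0..X} (\<lambda>t. (cmod (y t))\<^sup>2)"
proof -
  have cy: "continuous_on {0..X} (\<lambda>t. (cmod (y t))\<^sup>2)"
    by (intro continuous_intros continuous_on_subset[OF y(1)]) auto
  have "integral {0..X} (\<lambda>t. (cmod (y t))\<^sup>2) \<noteq> 0"
    using integral_eq_0_iff[OF cy X] y(2) X by force
  moreover have "0 \<le> integral {0..X} (\<lambda>t. (cmod (y t))\<^sup>2)"
    by (intro Henstock_Kurzweil_Integration.integral_nonneg integrable_continuous_real cy) simp
  ultimately show ?thesis by simp
qed

subsection \<open>Weyl solutions\<close>

lemma cauchy_schwarz_half_line: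
  assumes "sq_integrable_on f {0..}" "sq_integrable_on g {0..}"
  shows "cmod (LINT t:{0..}|lborel. f t * g t) \<le>
    sqrt (LINT t:{0..}|lborel. (cmod (f t))\<^sup>2) * sqrt (LINT t:{0..}|lborel. (cmod (g t))\<^sup>2)"
proof -
  define F where "F x = indicator {0..} x *\<^sub>R f x" for x :: real
  define G where "G x = indicator {0..} x *\<^sub>R cnj (g x)" for x :: real
  have sq: "sq_integrable F" "sq_integrable G"
    using assms(1) sq_integrable_on_cnj[OF assms(2)] by (simp_all add: sq_integrable_on_iff F_def[abs_def] G_def[abs_def])
  have "(\<lambda>x. F x * cnj (G x)) = (\<lambda>x. indicator {0..} x *\<^sub>R (f x * g x))"
    by (auto simp: F_def G_def indicator_def)
  then have 1: "cinner (abs_L2R F) (abs_L2R G) = (LINT t:{0..}|lborel. f t * g t)"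
    using sq by (simp add: cinner_abs set_lebesgue_integral_def)
  have "(\<lambda>x. (cmod (F x))\<^sup>2) = (\<lambda>x. indicator {0..} x *\<^sub>R (cmod (f x))\<^sup>2)"
    "(\<lambda>x. (cmod (G x))\<^sup>2) = (\<lambda>x. indicator {0..} x *\<^sub>R (cmod (g x))\<^sup>2)"
    by (auto simp: F_def G_def indicator_def)
  then have "(norm (abs_L2R F))\<^sup>2 = (LINT t:{0..}|lborel. (cmod (f t))\<^sup>2)"
    "(norm (abs_L2R G))\<^sup>2 = (LINT t:{0..}|lborel. (cmod (g t))\<^sup>2)"
    using sq by (simp_all add: norm_abs_L2R set_lebesgue_integral_def)
  then have "norm (abs_L2R F) = sqrt (LINT t:{0..}|lborel. (cmod (f t))\<^sup>2)"
    "norm (abs_L2R G) = sqrt (LINT t:{0..}|lborel. (cmod (g t))\<^sup>2)"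
    by (metis norm_ge_zero real_sqrt_abs abs_of_nonneg)+
  then show ?thesis using cinner_norm_bound[of "abs_L2R F" "abs_L2R G"] 1 by simp
qed

locale SL_half =
  fixes q :: "real \<Rightarrow> real"
  assumes q: "continuous_on UNIV q"
begin

abbreviation "\<phi> \<equiv> SL_solution q 1 0"
abbreviation "\<phi>' \<equiv> SL_dsolution q 1 0"
abbreviation "\<sigma> \<equiv> SL_solution q 0 1"
abbreviation "\<sigma>' \<equiv> SL_dsolution q 0 1"

definition \<psi> :: "complex \<Rightarrow> complex \<Rightarrow> real \<Rightarrow> complex" where
  "\<psi> z m x = \<sigma> z x - m * \<phi> z x"

definition \<psi>' :: "complex \<Rightarrow> complex \<Rightarrow> real \<Rightarrow> complex" where
  "\<psi>' z m x = \<sigma>' z x - m * \<phi>' z x"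

lemma at0 [simp]: "\<phi> z 0 = 1" "\<phi>' z 0 = 0" "\<sigma> z 0 = 0" "\<sigma>' z 0 = 1" "\<psi> z m 0 = - m" "\<psi>' z m 0 = 1"
  by (simp_all add: SL_solution[OF q] \<psi>_def \<psi>'_def)

lemma pair_\<phi>: "SL_pair q (\<phi> z) (\<phi>' z) (\<lambda>x. z * \<phi> z x)"
  and pair_\<sigma>: "SL_pair q (\<sigma> z) (\<sigma>' z) (\<lambda>x. z * \<sigma> z x)"
  by (intro SL_classical_pair SL_solution q)+

lemma pair_\<psi>: "SL_pair q (\<psi> z m) (\<psi>' z m) (\<lambda>x. z * \<psi> z m x)"
  using SL_pair_combine[OF q pair_\<sigma>[of z] pair_\<phi>[of z], of 1 "- m"]
  by (simp add: \<psi>_def[abs_def] \<psi>'_def[abs_def] algebra_simps)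

lemmas cont_\<phi> = SL_pair_continuous[OF pair_\<phi>] and cont_\<psi> = SL_pair_continuous[OF pair_\<psi>]
  and cont_\<sigma> = SL_pair_continuous[OF pair_\<sigma>]

lemma wronskian: "0 \<le> x \<Longrightarrow> \<psi>' z m x * \<phi> z x - \<psi> z m x * \<phi>' z x = 1"
  using SL_pair_lagrange[OF q pair_\<psi> pair_\<phi>, of x z m z] by (simp add: mult.left_commute)

lemma energy:
  assumes y: "SL_pair q y v (\<lambda>x. z * y x)" and X: "0 \<le> X"
  shows "Im (v X * cnj (y X)) = Im (v 0 * cnj (y 0)) - Im z * integral {0..X} (\<lambda>t. (cmod (y t))\<^sup>2)"
proof -
  have "Im (z * y t * cnj (y t)) = Im z * (cmod (y t))\<^sup>2" for t
    by (simp add: mult.assoc flip: complex_norm_square of_real_power)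
  then show ?thesis using SL_pair_energy[OF q y X] by simp
qed

text \<open>A zero at \<open>X\<close> would make the nonreal \<open>z\<close> an eigenvalue of the
  symmetric problem on \<open>[0, X]\<close> with Neumann condition at 0 and Dirichlet condition at
  \<open>X\<close>.\<close>

lemma \<phi>_nonzero:
  assumes "Im z \<noteq> 0" "0 < X"
  shows "\<phi> z X \<noteq> 0"
proof
  assume "\<phi> z X = 0"
  then have "Im z * integral {0..X} (\<lambda>t. (cmod (\<phi> z t))\<^sup>2) = 0"
    using energy[OF pair_\<phi>, of X z] assms by simp
  moreover have "0 < integral {0..X} (\<lambda>t. (cmod (\<phi> z t))\<^sup>2)"
    by (rule integral_norm_sq_pos[OF cont_\<phi>]) (use assms in auto)
  ultimately show False using assms by simp
qed

text \<open>Makes the dependence on \<open>m\<close> explicit, so that a limit in \<open>m\<close>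
  can be taken on a fixed interval without exchanging limit and integral.\<close>

lemma integral_norm_sq_quadratic:
  fixes f g :: "real \<Rightarrow> complex"
  assumes f: "continuous_on {0..} f" and g: "continuous_on {0..} g"
  shows "integral {0..X} (\<lambda>t. (cmod (f t - m * g t))\<^sup>2) = integral {0..X} (\<lambda>t. (cmod (f t))\<^sup>2)
    - 2 * Re (m * integral {0..X} (\<lambda>t. g t * cnj (f t))) + (cmod m)\<^sup>2 * integral {0..X} (\<lambda>t. (cmod (g t))\<^sup>2)"
proof -
  have c: "continuous_on {0..X} f" "continuous_on {0..X} g"
    using f g by (auto intro: continuous_on_subset)
  have i: "(\<lambda>t. g t * cnj (f t)) integrable_on {0..X}"
    by (intro integrable_continuous_real continuous_intros c)
  have e: "(cmod (a - m * b))\<^sup>2 = (cmod a)\<^sup>2 - 2 * Re (m * (b * cnj a)) + (cmod m)\<^sup>2 * (cmod b)\<^sup>2" for a b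
    unfolding cmod_power2 by (simp add: power2_eq_square algebra_simps)
  have mi: "integral {0..X} (\<lambda>t. Re (m * (g t * cnj (f t)))) = Re (m * integral {0..X} (\<lambda>t. g t * cnj (f t)))"
    using integral_linear[OF integrable_on_mult_right[OF i, of m] bounded_linear_Re] by (simp add: o_def)
  have i1: "(\<lambda>t. (cmod (f t))\<^sup>2) integrable_on {0..X}" "(\<lambda>t. 2 * Re (m * (g t * cnj (f t)))) integrable_on {0..X}"
    "(\<lambda>t. (cmod m)\<^sup>2 * (cmod (g t))\<^sup>2) integrable_on {0..X}"
    by (intro integrable_continuous_real continuous_intros c)+
  show ?thesis
    unfolding e
    by (subst Henstock_Kurzweil_Integration.integral_add[OF integrable_diff[OF i1(1,2)] i1(3)],
        subst Henstock_Kurzweil_Integration.integral_diff[OF i1(1,2)]) (simp only: integral_mult_right mi)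
qed

text \<open>For \<open>Im z > 0\<close> this says that \<open>m\<close> lies in all Weyl discs: by
  the energy identity it is equivalent to the imaginary part of \<open>\<psi>'\<close> times the
  conjugate of \<open>\<psi>\<close> being nonnegative at every \<open>X\<close>.\<close>

definition weyl_bound :: "complex \<Rightarrow> complex \<Rightarrow> bool" where
  "weyl_bound z m \<longleftrightarrow> (\<forall>X\<ge>0. integral {0..X} (\<lambda>t. (cmod (\<psi> z m t))\<^sup>2) \<le> Im m / Im z)"

text \<open>The Weyl discs: \<open>m = \<sigma>(X) / \<phi>(X)\<close> makes the energy on \<open>[0, X]\<close> equal to \<open>Im m / Im z\<close>, so
  these points stay in a compact set, and the bound survives in a limit point as \<open>X \<rightarrow> \<infinity>\<close>.\<close>

lemma weyl_bound_exists:
  assumes z: "Im z > 0"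
  shows "\<exists>m. weyl_bound z m"
proof -
  define N where "N m X = integral {0..X} (\<lambda>t. (cmod (\<psi> z m t))\<^sup>2)" for m X
  \<comment> \<open>The shift by 1 keeps \<open>[0, 1]\<close> inside every interval, so that the
    integral over \<open>[0, 1]\<close> can be used to bound all the \<open>M k\<close>, and avoids
    the point 0.\<close>
  define M where "M k = \<sigma> z (real k + 1) / \<phi> z (real k + 1)" for k :: nat
  have Nmono: "N m X \<le> N m Y" if "0 \<le> X" "X \<le> Y" for m X Y
    unfolding N_def
    by (intro integral_subset_le integrable_continuous_real continuous_intros continuous_on_subset[OF cont_\<psi>])
       (use that in auto)
  have NM: "N (M k) (real k + 1) = Im (M k) / Im z" for k
  proof -
    have "\<psi> z (M k) (real k + 1) = 0"
      using \<phi>_nonzero[of z "real k + 1"] z by (simp add: \<psi>_def M_def)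
    then have "0 = Im (M k) - Im z * N (M k) (real k + 1)"
      using energy[OF pair_\<psi>, of "real k + 1" z "M k"] by (simp add: N_def)
    then show ?thesis using z by (simp add: field_simps)
  qed
  define a where "a = N 0 1"
  define d where "d = integral {0..1} (\<lambda>t. (cmod (\<phi> z t))\<^sup>2)"
  have d: "0 < d" unfolding d_def by (rule integral_norm_sq_pos[OF cont_\<phi>]) auto
  have a: "0 \<le> a" unfolding a_def N_def by (intro Henstock_Kurzweil_Integration.integral_nonneg
      integrable_continuous_real continuous_intros continuous_on_subset[OF cont_\<psi>]) auto
  \<comment> \<open>On \<open>[0, 1]\<close> the energy grows quadratically in |m|, while at
    \<open>M k\<close> it is at most Im (M k) / Im z, which is linear; together these bound
    \<open>M k\<close>.\<close>
  have low: "(cmod m)\<^sup>2 * d \<le> 2 * N m 1 + 2 * a" for m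
  proof -
    have "(cmod m)\<^sup>2 * d = integral {0..1} (\<lambda>t. (cmod m)\<^sup>2 * (cmod (\<phi> z t))\<^sup>2)" by (simp add: d_def)
    also have "\<dots> \<le> integral {0..1} (\<lambda>t. 2 * (cmod (\<psi> z m t))\<^sup>2 + 2 * (cmod (\<psi> z 0 t))\<^sup>2)"
    proof (rule integral_le)
      show "(\<lambda>t. (cmod m)\<^sup>2 * (cmod (\<phi> z t))\<^sup>2) integrable_on {0..1}"
        "(\<lambda>t. 2 * (cmod (\<psi> z m t))\<^sup>2 + 2 * (cmod (\<psi> z 0 t))\<^sup>2) integrable_on {0..1}"
        by (intro integrable_continuous_real continuous_intros continuous_on_subset[OF cont_\<psi>]
            continuous_on_subset[OF cont_\<phi>]; simp)+
      fix t :: real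
      have "m * \<phi> z t = - \<psi> z m t + \<psi> z 0 t" by (simp add: \<psi>_def)
      then have "(cmod (m * \<phi> z t))\<^sup>2 \<le> 2 * (cmod (- \<psi> z m t))\<^sup>2 + 2 * (cmod (\<psi> z 0 t))\<^sup>2"
        using norm_add_sq_le[of "- \<psi> z m t" "\<psi> z 0 t"] by simp
      then show "(cmod m)\<^sup>2 * (cmod (\<phi> z t))\<^sup>2 \<le> 2 * (cmod (\<psi> z m t))\<^sup>2 + 2 * (cmod (\<psi> z 0 t))\<^sup>2"
        by (simp add: norm_mult power_mult_distrib)
    qed
    also have "\<dots> = 2 * N m 1 + 2 * a"
      unfolding N_def a_def
      by (subst Henstock_Kurzweil_Integration.integral_add)
         (auto intro!: integrable_continuous_real continuous_intros continuous_on_subset[OF cont_\<psi>])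
    finally show ?thesis .
  qed
  define B where "B = 1 + (2 / Im z + 2 * a) / d"
  have Mb: "cmod (M k) \<le> B" for k
  proof (cases "cmod (M k) \<le> 1")
    case True
    have "0 \<le> (2 / Im z + 2 * a) / d" using z a d by simp
    then show ?thesis using True by (simp add: B_def)
  next
    case False
    have "N (M k) 1 \<le> Im (M k) / Im z" unfolding NM[symmetric] by (rule Nmono) auto
    also have "\<dots> \<le> cmod (M k) / Im z" using z abs_Im_le_cmod[of "M k"] by (simp add: divide_right_mono)
    finally have "(cmod (M k))\<^sup>2 * d \<le> 2 * (cmod (M k) / Im z) + 2 * a" using low[of "M k"] by simp
    also have "\<dots> \<le> 2 * (cmod (M k) / Im z) + 2 * a * cmod (M k)"
      using False a mult_left_mono[of 1 "cmod (M k)" "2 * a"] by simp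
    also have "\<dots> = cmod (M k) * (2 / Im z + 2 * a)" by (simp add: algebra_simps)
    finally have "cmod (M k) * (cmod (M k) * d) \<le> cmod (M k) * (2 / Im z + 2 * a)"
      by (simp add: power2_eq_square mult.assoc)
    then have "cmod (M k) * d \<le> 2 / Im z + 2 * a"
      by (rule mult_left_le_imp_le) (use False in linarith)
    then have "cmod (M k) \<le> (2 / Im z + 2 * a) / d" using d by (simp add: pos_le_divide_eq)
    then show ?thesis by (simp add: B_def)
  qed
  then have "\<forall>k. M k \<in> cball 0 B" by simp
  then obtain m r where r: "strict_mono r" "(M \<circ> r) \<longlonglongrightarrow> m"
    using compact_cball[of "0 :: complex" B] unfolding compact_def by blast
  have "N m X \<le> Im m / Im z" if X: "0 \<le> X" for X
  proof (rule LIMSEQ_le)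
    show "(\<lambda>k. N ((M \<circ> r) k) X) \<longlonglongrightarrow> N m X"
      unfolding N_def \<psi>_def integral_norm_sq_quadratic[OF cont_\<sigma> cont_\<phi>]
      by (intro tendsto_intros r(2))
    show "(\<lambda>k. Im ((M \<circ> r) k) / Im z) \<longlonglongrightarrow> Im m / Im z"
      using z by (intro tendsto_intros r(2)) auto
    obtain K :: nat where K: "X \<le> real K" using real_arch_simple by blast
    show "\<exists>K. \<forall>k\<ge>K. N ((M \<circ> r) k) X \<le> Im ((M \<circ> r) k) / Im z"
    proof (intro exI[of _ K] allI impI)
      fix k assume "K \<le> k"
      then have "X \<le> real (r k) + 1" using K seq_suble[OF r(1), of k] by linarith
      then show "N ((M \<circ> r) k) X \<le> Im ((M \<circ> r) k) / Im z"
        using Nmono[OF X, of "real (r k) + 1" "M (r k)"] NM[of "r k"] by simp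
    qed
  qed
  then show ?thesis unfolding weyl_bound_def N_def by blast
qed

lemma weyl_bound_sq_integrable: "weyl_bound z m \<Longrightarrow> sq_integrable_on (\<psi> z m) {0..}"
  unfolding weyl_bound_def by (rule sq_integrable_on_half_line_bounded[OF cont_\<psi>]) blast

lemma cnj_solutions: "\<phi> (cnj z) x = cnj (\<phi> z x)" "\<sigma> (cnj z) x = cnj (\<sigma> z x)"
  "\<psi> (cnj z) (cnj m) x = cnj (\<psi> z m x)"
  using SL_solution_cnj[OF q, of 1 0 z x] SL_solution_cnj[OF q, of 0 1 z x] by (simp_all add: \<psi>_def)

lemma weyl_solution_exists:
  assumes z: "Im z \<noteq> 0"
  shows "\<exists>m. sq_integrable_on (\<psi> z m) {0..}"
proof (cases "Im z > 0")
  case True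
  then show ?thesis using weyl_bound_exists weyl_bound_sq_integrable by blast
next
  case False
  then have "Im (cnj z) > 0" using z by simp
  then obtain m where "sq_integrable_on (\<psi> (cnj z) m) {0..}"
    using weyl_bound_exists weyl_bound_sq_integrable by blast
  then have "sq_integrable_on (\<lambda>x. \<psi> (cnj (cnj z)) (cnj m) x) {0..}"
    unfolding cnj_solutions(3) by (rule sq_integrable_on_cnj)
  then show ?thesis by auto
qed

subsection \<open>The resolvent of the Neumann problem on the half-line\<close>

text \<open>Variation of constants with a free multiple of \<open>\<phi>\<close>. For \<kappa> equal
  to the integral of f \<psi> over the half-line, the coefficient of \<open>\<phi>\<close> is minus
  the integral from \<open>x\<close> to infinity, and this is the Neumann Green function. Finite
  cutoffs of \<kappa> serve as approximations.\<close>

definition green :: "complex \<Rightarrow> complex \<Rightarrow> (real \<Rightarrow> complex) \<Rightarrow> complex \<Rightarrow> real \<Rightarrow> complex" where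
  "green z m f \<kappa> x = (integral {0..x} (\<lambda>t. f t * \<psi> z m t) - \<kappa>) * \<phi> z x - integral {0..x} (\<lambda>t. f t * \<phi> z t) * \<psi> z m x"

definition green' :: "complex \<Rightarrow> complex \<Rightarrow> (real \<Rightarrow> complex) \<Rightarrow> complex \<Rightarrow> real \<Rightarrow> complex" where
  "green' z m f \<kappa> x = (integral {0..x} (\<lambda>t. f t * \<psi> z m t) - \<kappa>) * \<phi>' z x - integral {0..x} (\<lambda>t. f t * \<phi> z t) * \<psi>' z m x"

lemma green_0 [simp]: "green z m f \<kappa> 0 = - \<kappa>" "green' z m f \<kappa> 0 = 0"
  by (simp_all add: green_def green'_def)

text \<open>On differentiating, the terms with \<open>f\<close> cancel in the first derivative and
  combine to \<open>- f\<close> in the second by \<open>wronskian\<close>. Since \<open>f\<close> is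
  only locally integrable, both steps go through the integrated product rule.\<close>

lemma SL_pair_green:
  assumes f: "loc_integrable f"
  shows "SL_pair q (green z m f \<kappa>) (green' z m f \<kappa>) (\<lambda>x. f x + z * green z m f \<kappa> x)"
proof -
  define b where "b x = integral {0..x} (\<lambda>t. f t * \<psi> z m t) - \<kappa>" for x
  define a where "a x = integral {0..x} (\<lambda>t. f t * \<phi> z t)" for x
  have lb: "loc_integrable (\<lambda>t. f t * \<psi> z m t)" and la: "loc_integrable (\<lambda>t. f t * \<phi> z t)"
    by (intro loc_integrable_mult_continuous f cont_\<psi> cont_\<phi>)+
  have b: "b x = b 0 + integral {0..x} (\<lambda>t. f t * \<psi> z m t)" and a: "a x = a 0 + integral {0..x} (\<lambda>t. f t * \<phi> z t)" for x
    by (simp_all add: a_def b_def)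
  have cb: "continuous_on {0..} b" and ca: "continuous_on {0..} a"
    by (rule indefinite_integral_continuous[OF lb b], rule indefinite_integral_continuous[OF la a])
  note c\<phi>' = SL_pair_continuous_deriv[OF q pair_\<phi>[of z]] and c\<psi>' = SL_pair_continuous_deriv[OF q pair_\<psi>[of z m]]
  have cq: "continuous_on {0..} (\<lambda>x. complex_of_real (q x))"
    by (intro continuous_on_complex_of_real continuous_on_subset[OF q]) auto
  define G where "G x = green z m f \<kappa> x" for x
  define G' where "G' x = green' z m f \<kappa> x" for x
  have G: "G x = b x * \<phi> z x - a x * \<psi> z m x" and G': "G' x = b x * \<phi>' z x - a x * \<psi>' z m x" for x
    by (simp_all add: G_def G'_def green_def green'_def a_def b_def)
  have cG: "continuous_on {0..} G" and cG': "continuous_on {0..} G'"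
    unfolding G[abs_def] G'[abs_def] by (intro continuous_intros ca cb cont_\<phi> cont_\<psi> c\<phi>' c\<psi>')+
  have d\<phi>': "(\<phi>' z has_vector_derivative (of_real (q x) - z) * \<phi> z x) (at x within {0..})"
    and d\<psi>': "(\<psi>' z m has_vector_derivative (of_real (q x) - z) * \<psi> z m x) (at x within {0..})" for x
  proof -
    have s: "(\<phi>' z has_vector_derivative (of_real (q x) - z) * \<phi> z x) (at x)"
      "(\<sigma>' z has_vector_derivative (of_real (q x) - z) * \<sigma> z x) (at x)"
      using SL_solution(1)[OF q] by (auto simp: SL_classical_def)
    show "(\<phi>' z has_vector_derivative (of_real (q x) - z) * \<phi> z x) (at x within {0..})"
      by (rule has_vector_derivative_at_within[OF s(1)])
    have "(\<psi>' z m has_vector_derivative (of_real (q x) - z) * \<sigma> z x - m * ((of_real (q x) - z) * \<phi> z x)) (at x)"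
      unfolding \<psi>'_def[abs_def] by (intro has_vector_derivative_diff has_vector_derivative_mult_right s)
    moreover have "(of_real (q x) - z) * \<sigma> z x - m * ((of_real (q x) - z) * \<phi> z x) = (of_real (q x) - z) * \<psi> z m x"
      by (simp add: \<psi>_def algebra_simps)
    ultimately have "(\<psi>' z m has_vector_derivative (of_real (q x) - z) * \<psi> z m x) (at x)" by (simp only:)
    then show "(\<psi>' z m has_vector_derivative (of_real (q x) - z) * \<psi> z m x) (at x within {0..})"
      by (rule has_vector_derivative_at_within)
  qed
  have GI: "G x = G 0 + integral {0..x} G'" if x: "0 \<le> x" for x
  proof -
    have "b x * \<phi> z x = b 0 * \<phi> z 0 + integral {0..x} (\<lambda>t. (f t * \<psi> z m t) * \<phi> z t + b t * \<phi>' z t)"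
      by (rule AC_product_rule[OF lb b SL_pairD(1)[OF pair_\<phi>] c\<phi>' x])
    moreover have "a x * \<psi> z m x = a 0 * \<psi> z m 0 + integral {0..x} (\<lambda>t. (f t * \<phi> z t) * \<psi> z m t + a t * \<psi>' z m t)"
      by (rule AC_product_rule[OF la a SL_pairD(1)[OF pair_\<psi>] c\<psi>' x])
    moreover have "integral {0..x} (\<lambda>t. (f t * \<psi> z m t) * \<phi> z t + b t * \<phi>' z t) -
        integral {0..x} (\<lambda>t. (f t * \<phi> z t) * \<psi> z m t + a t * \<psi>' z m t) = integral {0..x} G'"
      by (subst Henstock_Kurzweil_Integration.integral_diff[symmetric];
          (intro loc_integrable_HK loc_integrable_add loc_integrable_mult_continuous la lb cont_\<phi> cont_\<psi>
            loc_integrable_continuous continuous_on_mult ca cb c\<phi>' c\<psi>' order_refl)?)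
         (simp add: G'[abs_def] algebra_simps)
    ultimately show ?thesis by (simp add: G algebra_simps)
  qed
  have GI': "G' x = G' 0 + integral {0..x} (\<lambda>t. of_real (q t) * G t - (f t + z * G t))" if x: "0 \<le> x" for x
  proof -
    have "b x * \<phi>' z x = b 0 * \<phi>' z 0 + integral {0..x} (\<lambda>t. (f t * \<psi> z m t) * \<phi>' z t + b t * ((of_real (q t) - z) * \<phi> z t))"
      by (rule AC_product_rule[OF lb b d\<phi>' _ x]) (intro continuous_intros cq cont_\<phi>)
    moreover have "a x * \<psi>' z m x = a 0 * \<psi>' z m 0 + integral {0..x} (\<lambda>t. (f t * \<phi> z t) * \<psi>' z m t + a t * ((of_real (q t) - z) * \<psi> z m t))"
      by (rule AC_product_rule[OF la a d\<psi>' _ x]) (intro continuous_intros cq cont_\<psi>)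
    moreover have "integral {0..x} (\<lambda>t. (f t * \<psi> z m t) * \<phi>' z t + b t * ((of_real (q t) - z) * \<phi> z t)) -
        integral {0..x} (\<lambda>t. (f t * \<phi> z t) * \<psi>' z m t + a t * ((of_real (q t) - z) * \<psi> z m t)) =
        integral {0..x} (\<lambda>t. (f t * \<psi> z m t) * \<phi>' z t + b t * ((of_real (q t) - z) * \<phi> z t) -
          ((f t * \<phi> z t) * \<psi>' z m t + a t * ((of_real (q t) - z) * \<psi> z m t)))"
      by (rule Henstock_Kurzweil_Integration.integral_diff[symmetric];
          intro loc_integrable_HK loc_integrable_add loc_integrable_mult_continuous la lb cont_\<phi> cont_\<psi>
            loc_integrable_continuous continuous_on_mult continuous_on_diff continuous_on_const ca cb c\<phi>' c\<psi>' cq order_refl)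
    moreover have "\<dots> = integral {0..x} (\<lambda>t. of_real (q t) * G t - (f t + z * G t))"
    proof (rule Henstock_Kurzweil_Integration.integral_cong)
      fix t assume t: "t \<in> {0..x}"
      have "(f t * \<psi> z m t) * \<phi>' z t - (f t * \<phi> z t) * \<psi>' z m t = - (f t * (\<psi>' z m t * \<phi> z t - \<psi> z m t * \<phi>' z t))"
        by (simp add: algebra_simps)
      also have "\<dots> = - f t" using wronskian[of t z m] t by simp
      finally show "(f t * \<psi> z m t) * \<phi>' z t + b t * ((of_real (q t) - z) * \<phi> z t) -
          ((f t * \<phi> z t) * \<psi>' z m t + a t * ((of_real (q t) - z) * \<psi> z m t)) = of_real (q t) * G t - (f t + z * G t)"
        by (simp add: G algebra_simps)
    qed
    ultimately show ?thesis by (simp add: G' algebra_simps)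
  qed
  show ?thesis
    unfolding SL_pair_def G_def[symmetric] G'_def[symmetric]
  proof (intro conjI allI impI)
    show "loc_integrable (\<lambda>x. f x + z * G x)"
      by (intro loc_integrable_add f loc_integrable_scale loc_integrable_continuous cG)
    fix x :: real assume x: "0 \<le> x"
    show "G' x = G' 0 + integral {0..x} (\<lambda>t. of_real (q t) * G t - (f t + z * G t))" by (rule GI'[OF x])
    have "((\<lambda>u. integral {0..u} G') has_vector_derivative G' x) (at x within {0..x + 1})"
      by (rule integral_has_vector_derivative) (use x in \<open>auto intro: continuous_on_subset[OF cG']\<close>)
    then have "((\<lambda>u. G 0 + integral {0..u} G') has_vector_derivative (0 + G' x)) (at x within {0..x + 1})"
      by (intro has_vector_derivative_add has_vector_derivative_const)
    then have "(G has_vector_derivative (0 + G' x)) (at x within {0..x + 1})"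
      by (rule has_vector_derivative_transform[rotated 2]) (use x in \<open>auto intro: GI[symmetric] GI\<close>)
    moreover have "at x within {0..} = at x within {0..x + 1}"
      by (rule at_within_nhd[of x "{..<x + 1}"]) auto
    ultimately show "(G has_vector_derivative G' x) (at x within {0..})" by simp
  qed
qed

end

context SL_half
begin

text \<open>With this \<kappa> the solution agrees at \<open>n\<close> with a multiple of
  \<open>\<psi>\<close>, derivative included. The Weyl bound then gives the boundary term at
  \<open>n\<close> a favourable sign, and the energy identity yields the estimate of a dissipative
  operator, uniformly in \<open>n\<close>.\<close>

lemma green_cutoff_bound:
  assumes z: "Im z > 0" and m: "weyl_bound z m" and f: "sq_integrable_on f {0..}" and n: "0 \<le> n"
  defines "\<kappa> \<equiv> integral {0..n} (\<lambda>t. f t * \<psi> z m t)"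
  shows "integral {0..n} (\<lambda>t. (cmod (green z m f \<kappa> t))\<^sup>2) \<le> (LINT t:{0..}|lborel. (cmod (f t))\<^sup>2) / (Im z)\<^sup>2"
proof -
  define y where "y = green z m f \<kappa>"
  define v where "v = green' z m f \<kappa>"
  have lf: "loc_integrable f" by (rule sq_integrable_loc_integrable[OF f])
  have pair: "SL_pair q y v (\<lambda>x. f x + z * y x)" unfolding y_def v_def by (rule SL_pair_green[OF lf])
  note cy = SL_pair_continuous[OF pair]
  define a where "a = integral {0..n} (\<lambda>t. f t * \<phi> z t)"
  have end_n: "y n = - a * \<psi> z m n" "v n = - a * \<psi>' z m n"
    by (simp_all add: y_def v_def green_def green'_def \<kappa>_def a_def)
  have "v n * cnj (y n) = (a * cnj a) * (\<psi>' z m n * cnj (\<psi> z m n))"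
    unfolding end_n by (simp add: mult_ac)
  also have "a * cnj a = of_real ((cmod a)\<^sup>2)" using complex_norm_square[of a] by simp
  finally have "Im (v n * cnj (y n)) = (cmod a)\<^sup>2 * Im (\<psi>' z m n * cnj (\<psi> z m n))"
    by (simp only: times_complex.sel Re_complex_of_real Im_complex_of_real)
  also have "\<dots> \<ge> 0"
  proof -
    have "Im z * integral {0..n} (\<lambda>t. (cmod (\<psi> z m t))\<^sup>2) \<le> Im m"
      using m n z by (simp add: weyl_bound_def pos_le_divide_eq mult.commute)
    then show ?thesis using energy[OF pair_\<psi> n, of z m] by simp
  qed
  finally have "integral {0..n} (\<lambda>t. Im ((f t + z * y t) * cnj (y t))) \<le> 0"
    using SL_pair_energy[OF q pair n] by (simp add: y_def v_def)
  moreover have "integral {0..n} (\<lambda>t. Im z / 2 * (cmod (y t))\<^sup>2 - (cmod (f t))\<^sup>2 / (2 * Im z))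
      \<le> integral {0..n} (\<lambda>t. Im ((f t + z * y t) * cnj (y t)))"
  proof (rule integral_le)
    show "(\<lambda>t. Im z / 2 * (cmod (y t))\<^sup>2 - (cmod (f t))\<^sup>2 / (2 * Im z)) integrable_on {0..n}"
      by (intro integrable_diff integrable_on_mult_right integrable_on_divide sq_integral_le(1)[OF f]
          integrable_continuous_real continuous_intros continuous_on_subset[OF cy]) auto
    have "(\<lambda>t. (f t + z * y t) * cnj (y t)) integrable_on {0..n}"
      by (intro loc_integrable_HK loc_integrable_mult_continuous SL_pairD(2)[OF pair] continuous_on_cnj cy) simp
    from integrable_linear[OF this bounded_linear_Im]
    show "(\<lambda>t. Im ((f t + z * y t) * cnj (y t))) integrable_on {0..n}" by (simp add: o_def)
    fix t
    have "Im (z * y t * cnj (y t)) = Im z * (cmod (y t))\<^sup>2"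
      by (simp add: mult.assoc flip: complex_norm_square of_real_power)
    then have 1: "Im ((f t + z * y t) * cnj (y t)) = Im (f t * cnj (y t)) + Im z * (cmod (y t))\<^sup>2"
      by (simp only: distrib_right plus_complex.sel)
    have "- Im (f t * cnj (y t)) \<le> cmod (f t) * cmod (y t)"
      using abs_Im_le_cmod[of "f t * cnj (y t)"] by (simp add: norm_mult)
    \<comment> \<open>Young's inequality weighted by \<open>Im z\<close>, so that exactly half of
      the dissipation \<open>Im z |y|^2\<close> is used up.\<close>
    also have "\<dots> \<le> (cmod (f t))\<^sup>2 / (2 * Im z) + Im z / 2 * (cmod (y t))\<^sup>2"
    proof -
      have "0 \<le> (cmod (f t) - Im z * cmod (y t))\<^sup>2" by simp
      then have "2 * Im z * (cmod (f t) * cmod (y t)) \<le> (cmod (f t))\<^sup>2 + (Im z)\<^sup>2 * (cmod (y t))\<^sup>2"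
        by (simp add: power2_eq_square algebra_simps)
      then show ?thesis using z by (simp add: field_simps power2_eq_square)
    qed
    finally show "Im z / 2 * (cmod (y t))\<^sup>2 - (cmod (f t))\<^sup>2 / (2 * Im z) \<le> Im ((f t + z * y t) * cnj (y t))"
      unfolding 1 by linarith
  qed
  moreover have "integral {0..n} (\<lambda>t. Im z / 2 * (cmod (y t))\<^sup>2 - (cmod (f t))\<^sup>2 / (2 * Im z)) =
      Im z / 2 * integral {0..n} (\<lambda>t. (cmod (y t))\<^sup>2) - integral {0..n} (\<lambda>t. (cmod (f t))\<^sup>2) / (2 * Im z)"
  proof -
    have "(\<lambda>t. Im z / 2 * (cmod (y t))\<^sup>2) integrable_on {0..n}"
      by (intro integrable_continuous_real continuous_intros continuous_on_subset[OF cy]) auto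
    moreover have "(\<lambda>t. (cmod (f t))\<^sup>2 / (2 * Im z)) integrable_on {0..n}"
      by (intro integrable_on_divide sq_integral_le(1)[OF f])
    ultimately show ?thesis by (subst Henstock_Kurzweil_Integration.integral_diff) simp_all
  qed
  ultimately have "Im z / 2 * integral {0..n} (\<lambda>t. (cmod (y t))\<^sup>2) \<le> integral {0..n} (\<lambda>t. (cmod (f t))\<^sup>2) / (2 * Im z)"
    by linarith
  also have "\<dots> \<le> (LINT t:{0..}|lborel. (cmod (f t))\<^sup>2) / (2 * Im z)"
    using z sq_integral_le(2)[OF f] by (intro divide_right_mono) auto
  finally show ?thesis using z by (simp add: y_def field_simps power2_eq_square)
qed

text \<open>For fixed \<open>X\<close> the cutoff solutions converge on \<open>[0, X]\<close>
  because they depend quadratically on the constant \<open>kn n\<close>; the uniform bound then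
  passes first to the limit in \<open>n\<close> and then to the half-line.\<close>

lemma green_sq_integrable:
  assumes z: "Im z > 0" and m: "weyl_bound z m" and f: "sq_integrable_on f {0..}"
  defines "\<kappa> \<equiv> (LINT t:{0..}|lborel. f t * \<psi> z m t)"
  shows "sq_integrable_on (green z m f \<kappa>) {0..}"
    "(LINT t:{0..}|lborel. (cmod (green z m f \<kappa> t))\<^sup>2) \<le> (LINT t:{0..}|lborel. (cmod (f t))\<^sup>2) / (Im z)\<^sup>2"
proof -
  let ?F = "(LINT t:{0..}|lborel. (cmod (f t))\<^sup>2) / (Im z)\<^sup>2"
  have lf: "loc_integrable f" by (rule sq_integrable_loc_integrable[OF f])
  have cg: "continuous_on {0..} (green z m f k)" for k by (rule SL_pair_continuous[OF SL_pair_green[OF lf]])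
  have dec: "green z m f k = (\<lambda>t. green z m f 0 t - k * \<phi> z t)" for k
    by (auto simp: green_def algebra_simps)
  define kn where "kn n = integral {0..real n} (\<lambda>t. f t * \<psi> z m t)" for n
  have "((\<lambda>X. integral {0..X} (\<lambda>t. f t * \<psi> z m t)) \<longlongrightarrow> \<kappa>) at_top"
    unfolding \<kappa>_def by (intro set_integral_tendsto_half_line sq_integrable_on_mult f weyl_bound_sq_integrable m)
  then have kn: "kn \<longlonglongrightarrow> \<kappa>"
    unfolding kn_def by (rule filterlim_compose[OF _ filterlim_real_sequentially])
  have bound: "integral {0..X} (\<lambda>t. (cmod (green z m f \<kappa> t))\<^sup>2) \<le> ?F" if X: "0 \<le> X" for X
  proof (rule LIMSEQ_le_const2)
    show "(\<lambda>n. integral {0..X} (\<lambda>t. (cmod (green z m f (kn n) t))\<^sup>2)) \<longlonglongrightarrow> integral {0..X} (\<lambda>t. (cmod (green z m f \<kappa> t))\<^sup>2)"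
      unfolding dec[of "kn _"] dec[of \<kappa>] integral_norm_sq_quadratic[OF cg cont_\<phi>] by (intro tendsto_intros kn)
    obtain K :: nat where K: "X \<le> real K" using real_arch_simple by blast
    show "\<exists>K. \<forall>n\<ge>K. integral {0..X} (\<lambda>t. (cmod (green z m f (kn n) t))\<^sup>2) \<le> ?F"
    proof (intro exI[of _ K] allI impI)
      fix n assume "K \<le> n"
      then have n: "X \<le> real n" using K by linarith
      have "integral {0..X} (\<lambda>t. (cmod (green z m f (kn n) t))\<^sup>2) \<le> integral {0..real n} (\<lambda>t. (cmod (green z m f (kn n) t))\<^sup>2)"
        by (intro integral_subset_le integrable_continuous_real continuous_intros continuous_on_subset[OF cg])
           (use n in auto)
      also have "\<dots> \<le> ?F" unfolding kn_def by (rule green_cutoff_bound[OF z m f]) simp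
      finally show "integral {0..X} (\<lambda>t. (cmod (green z m f (kn n) t))\<^sup>2) \<le> ?F" .
    qed
  qed
  show "sq_integrable_on (green z m f \<kappa>) {0..}" "(LINT t:{0..}|lborel. (cmod (green z m f \<kappa> t))\<^sup>2) \<le> ?F"
    by (rule sq_integrable_on_half_line_bounded[OF cg bound]; assumption)+
qed

lemma neumann_solvable:
  assumes z: "Im z \<noteq> 0" and f: "sq_integrable_on f {0..}"
  shows "\<exists>y v. SL_pair q y v (\<lambda>x. f x + z * y x) \<and> v 0 = 0 \<and> sq_integrable_on y {0..}"
proof -
  have pos: "\<exists>y v. SL_pair q y v (\<lambda>x. f x + z * y x) \<and> v 0 = 0 \<and> sq_integrable_on y {0..}"
    if z: "Im z > 0" and f: "sq_integrable_on f {0..}" for z f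
  proof -
    obtain m where m: "weyl_bound z m" using weyl_bound_exists[OF z] by blast
    show ?thesis
      using SL_pair_green[OF sq_integrable_loc_integrable[OF f]] green_sq_integrable(1)[OF z m f] green_0 by blast
  qed
  show ?thesis
  proof (cases "Im z > 0")
    case False
    then have "Im (cnj z) > 0" using z by simp
    then obtain y v where y: "SL_pair q y v (\<lambda>x. cnj (f x) + cnj z * y x)" "v 0 = 0" "sq_integrable_on y {0..}"
      using pos[OF _ sq_integrable_on_cnj[OF f]] by blast
    show ?thesis
      using SL_pair_cnj[OF y(1)] y(2) sq_integrable_on_cnj[OF y(3)]
      by (intro exI[of _ "\<lambda>x. cnj (y x)"] exI[of _ "\<lambda>x. cnj (v x)"]) simp
  qed (use pos f in blast)
qed

lemma green_diff:
  assumes f: "loc_integrable f" and g: "loc_integrable g" and x: "0 \<le> x"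
  shows "green z m (\<lambda>t. f t - g t) (\<kappa> - \<kappa>') x = green z m f \<kappa> x - green z m g \<kappa>' x"
    "green' z m (\<lambda>t. f t - g t) (\<kappa> - \<kappa>') x = green' z m f \<kappa> x - green' z m g \<kappa>' x"
proof -
  have "integral {0..x} (\<lambda>t. (f t - g t) * u t) = integral {0..x} (\<lambda>t. f t * u t) - integral {0..x} (\<lambda>t. g t * u t)"
    if "continuous_on {0..} u" for u
    unfolding left_diff_distrib
    by (intro Henstock_Kurzweil_Integration.integral_diff loc_integrable_HK loc_integrable_mult_continuous f g that order_refl)
  note e = this[OF cont_\<phi>[of z]] this[OF cont_\<psi>[of z m]]
  show "green z m (\<lambda>t. f t - g t) (\<kappa> - \<kappa>') x = green z m f \<kappa> x - green z m g \<kappa>' x"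
    "green' z m (\<lambda>t. f t - g t) (\<kappa> - \<kappa>') x = green' z m f \<kappa> x - green' z m g \<kappa>' x"
    unfolding green_def green'_def e by (simp_all add: algebra_simps)
qed

subsection \<open>The limit point case\<close>

definition max_dom :: "(real \<Rightarrow> complex) \<Rightarrow> (real \<Rightarrow> complex) \<Rightarrow> (real \<Rightarrow> complex) \<Rightarrow> bool" where
  "max_dom y v h \<longleftrightarrow> SL_pair q y v h \<and> sq_integrable_on y {0..} \<and> sq_integrable_on h {0..}"

lemma bracket_tendsto:
  assumes 1: "max_dom y1 v1 h1" and 2: "max_dom y2 v2 h2"
  shows "((\<lambda>X. v1 X * y2 X - y1 X * v2 X) \<longlongrightarrow> v1 0 * y2 0 - y1 0 * v2 0 +
    ((LINT t:{0..}|lborel. y1 t * h2 t) - (LINT t:{0..}|lborel. h1 t * y2 t))) at_top"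
proof -
  have sq: "sq_integrable_on y1 {0..}" "sq_integrable_on h1 {0..}" "sq_integrable_on y2 {0..}" "sq_integrable_on h2 {0..}"
    using 1 2 by (auto simp: max_dom_def)
  have s: "set_integrable lborel {0..} (\<lambda>t. y1 t * h2 t)" "set_integrable lborel {0..} (\<lambda>t. h1 t * y2 t)"
    by (intro sq_integrable_on_mult sq)+
  have "((\<lambda>X. v1 0 * y2 0 - y1 0 * v2 0 + integral {0..X} (\<lambda>t. y1 t * h2 t - h1 t * y2 t)) \<longlongrightarrow>
      v1 0 * y2 0 - y1 0 * v2 0 + (LINT t:{0..}|lborel. y1 t * h2 t - h1 t * y2 t)) at_top"
    by (intro tendsto_intros set_integral_tendsto_half_line set_integral_diff(1) s)
  moreover have "\<forall>\<^sub>F X in at_top. v1 0 * y2 0 - y1 0 * v2 0 + integral {0..X} (\<lambda>t. y1 t * h2 t - h1 t * y2 t) =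
      v1 X * y2 X - y1 X * v2 X"
    using eventually_ge_at_top[of 0]
    by eventually_elim (rule SL_pair_lagrange[OF q, symmetric], use 1 2 in \<open>auto simp: max_dom_def\<close>)
  ultimately show ?thesis
    by (simp only: set_integral_diff(2)[OF s, symmetric]) (rule Lim_transform_eventually)
qed

end

text \<open>Since some \<open>\<psi>\<close> at \<open>\<i>\<close> is always square integrable,
  excluding \<open>\<phi>\<close> means that the square integrable solutions at \<open>\<i>\<close>
  form a line. The condition at one point spreads to all nonreal \<open>z\<close> in
  \<open>\<phi>_not_sq_integrable\<close>.\<close>

locale SL_limit_point = SL_half +
  assumes lp: "\<not> sq_integrable_on (\<phi> \<i>) {0..}"
begin

definition \<mu> :: complex where "\<mu> = (SOME m. weyl_bound \<i> m)"

lemma \<mu>: "weyl_bound \<i> \<mu>"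
  unfolding \<mu>_def by (rule someI_ex[OF weyl_bound_exists]) simp

abbreviation "\<psi>\<^sub>0 \<equiv> \<psi> \<i> \<mu>"
abbreviation "\<psi>\<^sub>0' \<equiv> \<psi>' \<i> \<mu>"

lemma sq_\<psi>\<^sub>0: "sq_integrable_on \<psi>\<^sub>0 {0..}"
  by (rule weyl_bound_sq_integrable[OF \<mu>])

lemma max_dom_\<psi>\<^sub>0: "max_dom \<psi>\<^sub>0 \<psi>\<^sub>0' (\<lambda>x. \<i> * \<psi>\<^sub>0 x)"
  unfolding max_dom_def by (intro conjI pair_\<psi> sq_\<psi>\<^sub>0 sq_integrable_on_scale)

text \<open>The Neumann resolvent at \<open>\<i>\<close>: \<open>R F\<close> solves - y'' + q y -
  \<i> y = F with \<open>y'(0) = 0\<close> and is square integrable.\<close>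

definition R :: "(real \<Rightarrow> complex) \<Rightarrow> real \<Rightarrow> complex" where
  "R F = green \<i> \<mu> F (LINT t:{0..}|lborel. F t * \<psi>\<^sub>0 t)"

definition R' :: "(real \<Rightarrow> complex) \<Rightarrow> real \<Rightarrow> complex" where
  "R' F = green' \<i> \<mu> F (LINT t:{0..}|lborel. F t * \<psi>\<^sub>0 t)"

lemma R_0: "R F 0 = - (LINT t:{0..}|lborel. F t * \<psi>\<^sub>0 t)" "R' F 0 = 0"
  by (simp_all add: R_def R'_def)

lemma R:
  assumes F: "sq_integrable_on F {0..}"
  shows "max_dom (R F) (R' F) (\<lambda>x. F x + \<i> * R F x)" "sq_integrable_on (R F) {0..}"
    "(LINT t:{0..}|lborel. (cmod (R F t))\<^sup>2) \<le> (LINT t:{0..}|lborel. (cmod (F t))\<^sup>2)"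
proof -
  show sq: "sq_integrable_on (R F) {0..}" "(LINT t:{0..}|lborel. (cmod (R F t))\<^sup>2) \<le> (LINT t:{0..}|lborel. (cmod (F t))\<^sup>2)"
    using green_sq_integrable[OF _ \<mu> F] by (simp_all add: R_def)
  show "max_dom (R F) (R' F) (\<lambda>x. F x + \<i> * R F x)"
    unfolding max_dom_def
    using SL_pair_green[OF sq_integrable_loc_integrable[OF F], of \<i> \<mu> "LINT t:{0..}|lborel. F t * \<psi>\<^sub>0 t"]
      sq_integrable_on_combine[OF F sq(1), of 1 \<i>] sq(1) by (simp add: R_def R'_def)
qed

text \<open>By Lagrange's identity the limit is minus the value of \<open>R F\<close> at 0 minus the
  integral of F \<psi>, and these cancel by the choice of the constant in \<open>R\<close>.\<close>

lemma bracket_R_\<psi>\<^sub>0: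
  assumes F: "sq_integrable_on F {0..}"
  shows "((\<lambda>X. R' F X * \<psi>\<^sub>0 X - R F X * \<psi>\<^sub>0' X) \<longlongrightarrow> 0) at_top"
proof -
  have s: "set_integrable lborel {0..} (\<lambda>t. F t * \<psi>\<^sub>0 t)" "set_integrable lborel {0..} (\<lambda>t. \<i> * (R F t * \<psi>\<^sub>0 t))"
    by (intro sq_integrable_on_mult F sq_\<psi>\<^sub>0 set_integrable_mult_right R(2))+
  have "(LINT t:{0..}|lborel. (F t + \<i> * R F t) * \<psi>\<^sub>0 t) = (LINT t:{0..}|lborel. F t * \<psi>\<^sub>0 t) + (LINT t:{0..}|lborel. \<i> * (R F t * \<psi>\<^sub>0 t))"
    using set_integral_add(2)[OF s] by (simp add: algebra_simps)
  then show ?thesis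
    using bracket_tendsto[OF R(1)[OF F] max_dom_\<psi>\<^sub>0] by (simp add: R_0 mult.left_commute)
qed

lemma R_cutoff:
  assumes F: "sq_integrable_on F {0..}" and n: "0 \<le> n" "\<And>t. n < t \<Longrightarrow> F t = 0"
  shows "\<exists>a. \<forall>x\<ge>n. R F x = a * \<psi>\<^sub>0 x \<and> R' F x = a * \<psi>\<^sub>0' x"
proof -
  have lF: "loc_integrable F" by (rule sq_integrable_loc_integrable[OF F])
  have c: "integral {0..x} (\<lambda>t. F t * u t) = integral {0..n} (\<lambda>t. F t * u t)"
    if u: "continuous_on {0..} u" and x: "n \<le> x" for u x
  proof -
    have "integral {n..x} (\<lambda>t. F t * u t) = integral {n..x} (\<lambda>t. 0)"
      by (rule integral_spike[of "{n}"]) (use n(2) in auto)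
    moreover have "integral {0..n} (\<lambda>t. F t * u t) + integral {n..x} (\<lambda>t. F t * u t) = integral {0..x} (\<lambda>t. F t * u t)"
      by (rule Henstock_Kurzweil_Integration.integral_combine[OF n(1) x])
         (intro loc_integrable_HK loc_integrable_mult_continuous lF u order_refl)
    ultimately show ?thesis by simp
  qed
  have "((\<lambda>X. integral {0..X} (\<lambda>t. F t * \<psi>\<^sub>0 t)) \<longlongrightarrow> (LINT t:{0..}|lborel. F t * \<psi>\<^sub>0 t)) at_top"
    by (intro set_integral_tendsto_half_line sq_integrable_on_mult F sq_\<psi>\<^sub>0)
  moreover have "((\<lambda>X. integral {0..X} (\<lambda>t. F t * \<psi>\<^sub>0 t)) \<longlongrightarrow> integral {0..n} (\<lambda>t. F t * \<psi>\<^sub>0 t)) at_top"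
    by (rule tendsto_eventually, rule eventually_mono[OF eventually_ge_at_top[of n]], rule c[OF cont_\<psi>])
  ultimately have k: "(LINT t:{0..}|lborel. F t * \<psi>\<^sub>0 t) = integral {0..n} (\<lambda>t. F t * \<psi>\<^sub>0 t)"
    by (rule tendsto_unique[rotated]) simp
  show ?thesis
  proof (intro exI[of _ "- integral {0..n} (\<lambda>t. F t * \<phi> \<i> t)"] allI impI)
    fix x assume x: "n \<le> x"
    show "R F x = - integral {0..n} (\<lambda>t. F t * \<phi> \<i> t) * \<psi>\<^sub>0 x \<and> R' F x = - integral {0..n} (\<lambda>t. F t * \<phi> \<i> t) * \<psi>\<^sub>0' x"
      unfolding R_def R'_def green_def green'_def k c[OF cont_\<psi> x] c[OF cont_\<phi> x] by simp
  qed
qed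

text \<open>\<open>F\<close> is cut at \<open>n\<close>. Beyond \<open>n\<close> the compactly
  supported part contributes a multiple of \<open>\<psi>\<^sub>0\<close>, whose bracket with
  \<open>R G\<close> tends to 0. The tail contributes a limit \<open>\<epsilon> n\<close> controlled
  by Cauchy-Schwarz and the contractivity of \<open>R\<close>, and it becomes small with the
  tail.\<close>

lemma bracket_R_R:
  assumes F: "sq_integrable_on F {0..}" and G: "sq_integrable_on G {0..}"
  shows "((\<lambda>X. R' F X * R G X - R F X * R' G X) \<longlongrightarrow> 0) at_top"
proof -
  define F1 where "F1 n t = (if t \<le> real n then F t else 0)" for n :: nat and t
  define F2 where "F2 n t = F t - F1 n t" for n t
  have sq1: "sq_integrable_on (F1 n) {0..}" for n
  proof -
    have "(\<lambda>x. indicator {0..} x *\<^sub>R F1 n x) = (\<lambda>x. indicator {..real n} x * (indicator {0..} x *\<^sub>R F x))"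
      by (auto simp: F1_def indicator_def)
    then show ?thesis
      using F unfolding sq_integrable_on_iff
      by (simp only:) (rule sq_integrable_bounded_mult[where C = 1], auto simp: indicator_def)
  qed
  have sq2: "sq_integrable_on (F2 n) {0..}" for n
    unfolding F2_def[abs_def] by (rule sq_integrable_on_diff[OF F sq1])
  define T where "T n = (LINT t:{0..}|lborel. (cmod (F2 n t))\<^sup>2)" for n
  have T: "T \<longlonglongrightarrow> 0"
  proof -
    have s: "set_integrable lborel {0..} (\<lambda>t. (cmod (F t))\<^sup>2)" using F by (simp add: sq_integrable_on_def)
    have s': "set_integrable lborel {0..real n} (\<lambda>t. (cmod (F t))\<^sup>2)" for n by (rule set_integrable_subset[OF s]) auto
    have "T = (\<lambda>n. (LINT t:{0..}|lborel. (cmod (F t))\<^sup>2) - integral {0..real n} (\<lambda>t. (cmod (F t))\<^sup>2))"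
    proof
      fix n
      have "T n = (LINT t|lborel. indicator {0..} t *\<^sub>R (cmod (F t))\<^sup>2 - indicator {0..real n} t *\<^sub>R (cmod (F t))\<^sup>2)"
        unfolding T_def set_lebesgue_integral_def
        by (rule Bochner_Integration.integral_cong) (auto simp: F2_def F1_def indicator_def)
      also have "\<dots> = (LINT t:{0..}|lborel. (cmod (F t))\<^sup>2) - (LINT t:{0..real n}|lborel. (cmod (F t))\<^sup>2)"
        using s s'[of n] unfolding set_lebesgue_integral_def set_integrable_def
        by (rule Bochner_Integration.integral_diff)
      finally show "T n = (LINT t:{0..}|lborel. (cmod (F t))\<^sup>2) - integral {0..real n} (\<lambda>t. (cmod (F t))\<^sup>2)"
        using set_borel_integral_eq_integral(2)[OF s'] by simp
    qed
    moreover have "(\<lambda>n. (LINT t:{0..}|lborel. (cmod (F t))\<^sup>2) - integral {0..real n} (\<lambda>t. (cmod (F t))\<^sup>2)) \<longlonglongrightarrow>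
        (LINT t:{0..}|lborel. (cmod (F t))\<^sup>2) - (LINT t:{0..}|lborel. (cmod (F t))\<^sup>2)"
      by (intro tendsto_intros filterlim_compose[OF set_integral_tendsto_half_line[OF s] filterlim_real_sequentially])
    ultimately show ?thesis by simp
  qed
  have split: "R F x = R (F1 n) x + R (F2 n) x" "R' F x = R' (F1 n) x + R' (F2 n) x" if "0 \<le> x" for n x
  proof -
    have "(LINT t:{0..}|lborel. F2 n t * \<psi>\<^sub>0 t) = (LINT t:{0..}|lborel. F t * \<psi>\<^sub>0 t) - (LINT t:{0..}|lborel. F1 n t * \<psi>\<^sub>0 t)"
      unfolding F2_def left_diff_distrib
      by (intro set_integral_diff(2) sq_integrable_on_mult F sq1 sq_\<psi>\<^sub>0)
    then show "R F x = R (F1 n) x + R (F2 n) x" "R' F x = R' (F1 n) x + R' (F2 n) x"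
      unfolding R_def R'_def
      using green_diff[OF sq_integrable_loc_integrable[OF F] sq_integrable_loc_integrable[OF sq1[of n]] that, of \<i> \<mu>]
      by (simp_all add: F2_def[abs_def])
  qed
  define \<epsilon> where "\<epsilon> n = (LINT t:{0..}|lborel. R (F2 n) t * G t) - (LINT t:{0..}|lborel. F2 n t * R G t)" for n
  have lim2: "((\<lambda>X. R' (F2 n) X * R G X - R (F2 n) X * R' G X) \<longlongrightarrow> \<epsilon> n) at_top" for n
  proof -
    have s: "set_integrable lborel {0..} (\<lambda>t. R (F2 n) t * G t)" "set_integrable lborel {0..} (\<lambda>t. \<i> * (R (F2 n) t * R G t))"
      "set_integrable lborel {0..} (\<lambda>t. F2 n t * R G t)"
      by (intro sq_integrable_on_mult G sq2 set_integrable_mult_right R(2))+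
    have "(LINT t:{0..}|lborel. R (F2 n) t * (G t + \<i> * R G t)) = (LINT t:{0..}|lborel. R (F2 n) t * G t) + (LINT t:{0..}|lborel. \<i> * (R (F2 n) t * R G t))"
      using set_integral_add(2)[OF s(1,2)] by (simp add: algebra_simps)
    moreover have "(LINT t:{0..}|lborel. (F2 n t + \<i> * R (F2 n) t) * R G t) = (LINT t:{0..}|lborel. F2 n t * R G t) + (LINT t:{0..}|lborel. \<i> * (R (F2 n) t * R G t))"
      using set_integral_add(2)[OF s(3,2)] by (simp add: algebra_simps)
    ultimately show ?thesis
      using bracket_tendsto[OF R(1)[OF sq2[of n]] R(1)[OF G]] by (simp add: R_0 \<epsilon>_def)
  qed
  have lim1: "((\<lambda>X. R' (F1 n) X * R G X - R (F1 n) X * R' G X) \<longlongrightarrow> 0) at_top" for n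
  proof -
    obtain a where a: "\<forall>x\<ge>real n. R (F1 n) x = a * \<psi>\<^sub>0 x \<and> R' (F1 n) x = a * \<psi>\<^sub>0' x"
      using R_cutoff[OF sq1[of n], of "real n"] by (auto simp: F1_def)
    have "((\<lambda>X. - a * (R' G X * \<psi>\<^sub>0 X - R G X * \<psi>\<^sub>0' X)) \<longlongrightarrow> - a * 0) at_top"
      by (intro tendsto_intros bracket_R_\<psi>\<^sub>0 G)
    moreover have "\<forall>\<^sub>F X in at_top. - a * (R' G X * \<psi>\<^sub>0 X - R G X * \<psi>\<^sub>0' X) = R' (F1 n) X * R G X - R (F1 n) X * R' G X"
      using eventually_ge_at_top[of "real n"] by eventually_elim (use a in \<open>simp add: algebra_simps\<close>)
    ultimately show ?thesis by (simp add: Lim_transform_eventually)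
  qed
  have lim: "((\<lambda>X. R' F X * R G X - R F X * R' G X) \<longlongrightarrow> \<epsilon> n) at_top" for n
  proof -
    have "((\<lambda>X. (R' (F1 n) X * R G X - R (F1 n) X * R' G X) + (R' (F2 n) X * R G X - R (F2 n) X * R' G X)) \<longlongrightarrow> 0 + \<epsilon> n) at_top"
      by (intro tendsto_add lim1 lim2)
    moreover have "\<forall>\<^sub>F X in at_top. (R' (F1 n) X * R G X - R (F1 n) X * R' G X) + (R' (F2 n) X * R G X - R (F2 n) X * R' G X)
        = R' F X * R G X - R F X * R' G X"
      using eventually_ge_at_top[of 0] by eventually_elim (simp add: split[where n = n] algebra_simps)
    ultimately show ?thesis by (simp add: Lim_transform_eventually)
  qed
  \<comment> \<open>Every \<open>\<epsilon> n\<close> is the limit of the same bracket, so a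
    constant sequence tends to 0.\<close>
  have "\<epsilon> n = \<epsilon> 0" for n by (rule tendsto_unique[OF _ lim lim]) simp
  moreover have "\<epsilon> \<longlonglongrightarrow> 0"
  proof (rule Lim_null_comparison)
    let ?c = "sqrt (LINT t:{0..}|lborel. (cmod (G t))\<^sup>2)" and ?d = "sqrt (LINT t:{0..}|lborel. (cmod (R G t))\<^sup>2)"
    show "\<forall>\<^sub>F n in sequentially. norm (\<epsilon> n) \<le> sqrt (T n) * ?c + sqrt (T n) * ?d"
    proof (intro always_eventually allI)
      fix n
      have "norm (\<epsilon> n) \<le> cmod (LINT t:{0..}|lborel. R (F2 n) t * G t) + cmod (LINT t:{0..}|lborel. F2 n t * R G t)"
        unfolding \<epsilon>_def by (rule norm_triangle_ineq4)
      also have "\<dots> \<le> sqrt (LINT t:{0..}|lborel. (cmod (R (F2 n) t))\<^sup>2) * ?c + sqrt (T n) * ?d"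
        unfolding T_def by (intro add_mono cauchy_schwarz_half_line R(2) sq2 G)
      also have "\<dots> \<le> sqrt (T n) * ?c + sqrt (T n) * ?d"
        using R(3)[OF sq2[of n]] unfolding T_def
        by (intro add_mono mult_right_mono) (auto intro!: real_sqrt_ge_zero Bochner_Integration.integral_nonneg simp: set_lebesgue_integral_def)
      finally show "norm (\<epsilon> n) \<le> sqrt (T n) * ?c + sqrt (T n) * ?d" .
    qed
    have "(\<lambda>n. sqrt (T n) * ?c + sqrt (T n) * ?d) \<longlonglongrightarrow> sqrt 0 * ?c + sqrt 0 * ?d"
      by (intro tendsto_intros T)
    then show "(\<lambda>n. sqrt (T n) * ?c + sqrt (T n) * ?d) \<longlonglongrightarrow> 0" by simp
  qed
  ultimately have "\<epsilon> 0 = 0"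
    using LIMSEQ_unique[of \<epsilon> 0 "\<epsilon> 0"] by (metis (no_types, lifting) LIMSEQ_const_iff tendsto_cong always_eventually ext)
  then show ?thesis using lim[of 0] by simp
qed

text \<open>Subtracting \<open>R (h - \<i> y)\<close> leaves a square integrable solution at
  \<open>\<i>\<close>. Here the limit point condition enters: such a solution can have no component
  along \<open>\<phi>\<close>.\<close>

lemma max_dom_decomposition:
  assumes y: "max_dom y v h"
  shows "\<exists>F \<kappa>. sq_integrable_on F {0..} \<and> (\<forall>x\<ge>0. y x = R F x + \<kappa> * \<psi>\<^sub>0 x \<and> v x = R' F x + \<kappa> * \<psi>\<^sub>0' x)"
proof -
  define F where "F x = h x - \<i> * y x" for x
  have F: "sq_integrable_on F {0..}"
    unfolding F_def using y by (intro sq_integrable_on_diff sq_integrable_on_scale) (auto simp: max_dom_def)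
  define w where "w x = y x - R F x" for x
  define w' where "w' x = v x - R' F x" for x
  have w: "SL_pair q w w' (\<lambda>x. \<i> * w x)"
    using SL_pair_combine[OF q, of y v h "R F" "R' F" "\<lambda>x. F x + \<i> * R F x" 1 "-1"] y R(1)[OF F]
    by (simp add: max_dom_def w_def[abs_def] w'_def[abs_def] F_def algebra_simps)
  have sqw: "sq_integrable_on w {0..}"
    unfolding w_def using y by (intro sq_integrable_on_diff R(2) F) (simp add: max_dom_def)
  define c where "c = w' 0 * \<mu> + w 0"
  have dec: "w x = w' 0 * \<psi>\<^sub>0 x + c * \<phi> \<i> x" "w' x = w' 0 * \<psi>\<^sub>0' x + c * \<phi>' \<i> x" if "0 \<le> x" for x
    using SL_pair_homogeneous[OF q w pair_\<phi> pair_\<psi> _ that, of \<mu>] by (simp_all add: c_def algebra_simps)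
  have "c = 0"
  proof (rule ccontr)
    assume c: "c \<noteq> 0"
    have "sq_integrable_on (\<lambda>x. (1 / c) * w x + (- w' 0 / c) * \<psi>\<^sub>0 x) {0..}"
      by (intro sq_integrable_on_combine sqw sq_\<psi>\<^sub>0)
    moreover have "(1 / c) * w x + (- w' 0 / c) * \<psi>\<^sub>0 x = \<phi> \<i> x" if "x \<in> {0..}" for x
      using dec(1)[of x] that c by (simp add: field_simps)
    ultimately have "sq_integrable_on (\<phi> \<i>) {0..}"
      using sq_integrable_on_cong[of "{0..}" "\<lambda>x. (1 / c) * w x + (- w' 0 / c) * \<psi>\<^sub>0 x" "\<phi> \<i>"] by blast
    then show False using lp by blast
  qed
  then show ?thesis
    using F dec by (intro exI[of _ F] exI[of _ "w' 0"]) (simp add: w_def w'_def algebra_simps)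
qed

lemma bracket_tendsto_0:
  assumes 1: "max_dom y1 v1 h1" and 2: "max_dom y2 v2 h2"
  shows "((\<lambda>X. v1 X * y2 X - y1 X * v2 X) \<longlongrightarrow> 0) at_top"
proof -
  obtain F k where F: "sq_integrable_on F {0..}" "\<And>x. 0 \<le> x \<Longrightarrow> y1 x = R F x + k * \<psi>\<^sub>0 x \<and> v1 x = R' F x + k * \<psi>\<^sub>0' x"
    using max_dom_decomposition[OF 1] by blast
  obtain G l where G: "sq_integrable_on G {0..}" "\<And>x. 0 \<le> x \<Longrightarrow> y2 x = R G x + l * \<psi>\<^sub>0 x \<and> v2 x = R' G x + l * \<psi>\<^sub>0' x"
    using max_dom_decomposition[OF 2] by blast
  have "((\<lambda>X. (R' F X * R G X - R F X * R' G X) + l * (R' F X * \<psi>\<^sub>0 X - R F X * \<psi>\<^sub>0' X)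
      - k * (R' G X * \<psi>\<^sub>0 X - R G X * \<psi>\<^sub>0' X)) \<longlongrightarrow> 0 + l * 0 - k * 0) at_top"
    by (intro tendsto_intros bracket_R_R bracket_R_\<psi>\<^sub>0 F(1) G(1))
  moreover have "\<forall>\<^sub>F X in at_top. (R' F X * R G X - R F X * R' G X) + l * (R' F X * \<psi>\<^sub>0 X - R F X * \<psi>\<^sub>0' X)
      - k * (R' G X * \<psi>\<^sub>0 X - R G X * \<psi>\<^sub>0' X) = v1 X * y2 X - y1 X * v2 X"
    using eventually_ge_at_top[of 0] by eventually_elim (simp add: F(2) G(2) algebra_simps)
  ultimately show ?thesis by (simp add: Lim_transform_eventually)
qed

lemma max_dom_cnj: "max_dom y v h \<Longrightarrow> max_dom (\<lambda>x. cnj (y x)) (\<lambda>x. cnj (v x)) (\<lambda>x. cnj (h x))"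
  unfolding max_dom_def by (intro conjI SL_pair_cnj sq_integrable_on_cnj) auto

lemma green_identity:
  assumes 1: "max_dom y1 v1 h1" and 2: "max_dom y2 v2 h2"
  shows "(LINT t:{0..}|lborel. h1 t * cnj (y2 t)) - (LINT t:{0..}|lborel. y1 t * cnj (h2 t)) =
    v1 0 * cnj (y2 0) - y1 0 * cnj (v2 0)"
  using tendsto_unique[OF _ bracket_tendsto[OF 1 max_dom_cnj[OF 2]] bracket_tendsto_0[OF 1 max_dom_cnj[OF 2]]]
  by (simp add: algebra_simps)

text \<open>Otherwise \<open>\<phi> z\<close> would be an eigenfunction of the Neumann operator,
  symmetric by \<open>green_identity\<close>, for a nonreal eigenvalue.\<close>

lemma \<phi>_not_sq_integrable:
  assumes z: "Im z \<noteq> 0"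
  shows "\<not> sq_integrable_on (\<phi> z) {0..}"
proof
  assume sq: "sq_integrable_on (\<phi> z) {0..}"
  then have "max_dom (\<phi> z) (\<phi>' z) (\<lambda>x. z * \<phi> z x)"
    unfolding max_dom_def by (intro conjI pair_\<phi> sq_integrable_on_scale)
  from green_identity[OF this this]
  have e: "(LINT t:{0..}|lborel. z * (\<phi> z t * cnj (\<phi> z t))) - (LINT t:{0..}|lborel. cnj z * (\<phi> z t * cnj (\<phi> z t))) = 0"
    by (simp add: mult_ac)
  have "(LINT t:{0..}|lborel. \<phi> z t * cnj (\<phi> z t)) = of_real (LINT t:{0..}|lborel. (cmod (\<phi> z t))\<^sup>2)"
    unfolding complex_norm_square[symmetric] of_real_power[symmetric] set_lebesgue_integral_def
    by (subst integral_complex_of_real[symmetric]) (simp add: scaleR_conv_of_real)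
  then have "(z - cnj z) * of_real (LINT t:{0..}|lborel. (cmod (\<phi> z t))\<^sup>2) = 0"
    using e by (simp add: left_diff_distrib)
  moreover have "z - cnj z \<noteq> 0" using z by (simp add: complex_eq_iff)
  moreover have "0 < integral {0..1} (\<lambda>t. (cmod (\<phi> z t))\<^sup>2)"
    by (rule integral_norm_sq_pos[OF cont_\<phi>]) auto
  ultimately show False using sq_integral_le(2)[OF sq, of 1] by simp
qed

lemma weyl_m_plus_eq:
  assumes z: "Im z \<noteq> 0" and m: "sq_integrable_on (\<psi> z m) {0..}"
  shows "weyl_m_plus q z = m"
  unfolding weyl_m_plus_def SL_s_def SL_c_def \<psi>_def[symmetric]
proof (rule the_equality)
  show "sq_integrable_on (\<lambda>x. \<psi> z m x) {0..}" by (rule m)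
  fix k assume "sq_integrable_on (\<lambda>x. \<psi> z k x) {0..}"
  from sq_integrable_on_diff[OF m this]
  have d: "sq_integrable_on (\<lambda>x. (k - m) * \<phi> z x) {0..}" by (simp add: \<psi>_def algebra_simps)
  show "k = m"
  proof (rule ccontr)
    assume "k \<noteq> m"
    then show False
      using sq_integrable_on_scale[OF d, of "1 / (k - m)"] \<phi>_not_sq_integrable[OF z] by simp
  qed
qed

lemma max_dom_weyl:
  assumes z: "Im z \<noteq> 0"
  shows "max_dom (\<psi> z (weyl_m_plus q z)) (\<psi>' z (weyl_m_plus q z)) (\<lambda>x. z * \<psi> z (weyl_m_plus q z) x)"
proof -
  obtain m where m: "sq_integrable_on (\<psi> z m) {0..}" using weyl_solution_exists[OF z] by blast
  then show ?thesis
    unfolding weyl_m_plus_eq[OF z m] max_dom_def by (intro conjI pair_\<psi> sq_integrable_on_scale)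
qed

end

section \<open>Cayley transforms and coupled boundary relations\<close>

subsection \<open>Cayley transforms\<close>

definition resolvent :: "(L2R \<times> L2R) set \<Rightarrow> complex \<Rightarrow> L2R \<Rightarrow> L2R" where
  "resolvent T z g = (THE f. (f, g + scaleC z f) \<in> T)"

definition cayley :: "(L2R \<times> L2R) set \<Rightarrow> L2R \<Rightarrow> L2R" where
  "cayley T g = g + scaleC (2 * \<i>) (resolvent T \<i> g)"

text \<open>The inverse of the map z |-> (z - \<i>) / (z + \<i>).\<close>

definition disc_to_plane :: "complex \<Rightarrow> complex" where
  "disc_to_plane \<zeta> = \<i> * (1 + \<zeta>) / (1 - \<zeta>)"

text \<open>For \<open>U = cayley T\<close> and \<open>z = disc_to_plane \<zeta>\<close> one has 1 -
  \<zeta> U = (1 - \<zeta>) (T - z) (T - \<i>)^(-1). Inverting and writing T - \<i> = (T - z) + (z -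
  \<i>) gives this formula for the inverse of 1 - \<zeta> U.\<close>

definition disc_resolvent :: "(L2R \<times> L2R) set \<Rightarrow> complex \<Rightarrow> L2R \<Rightarrow> L2R" where
  "disc_resolvent T \<zeta> g = scaleC (1 / (1 - \<zeta>)) (g + scaleC (disc_to_plane \<zeta> - \<i>) (resolvent T (disc_to_plane \<zeta>) g))"

lemma Im_disc_to_plane:
  assumes "cmod \<zeta> < 1"
  shows "Im (disc_to_plane \<zeta>) > 0" "\<zeta> \<noteq> 1"
proof -
  show ne: "\<zeta> \<noteq> 1" using assms by auto
  have n: "of_real ((cmod (1 - \<zeta>))\<^sup>2) = (1 - \<zeta>) * cnj (1 - \<zeta>)"
    using complex_norm_square[of "1 - \<zeta>"] by (simp only: of_real_power)
  define w where "w = cnj (1 - \<zeta>)"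
  have "w \<noteq> 0" using ne unfolding w_def by (metis complex_cnj_zero_iff right_minus_eq)
  then have "disc_to_plane \<zeta> = \<i> * ((1 + \<zeta>) * w) / ((1 - \<zeta>) * w)"
    by (simp add: disc_to_plane_def mult.assoc[symmetric])
  then have "disc_to_plane \<zeta> = \<i> * ((1 + \<zeta>) * cnj (1 - \<zeta>)) / of_real ((cmod (1 - \<zeta>))\<^sup>2)"
    by (simp only: n w_def)
  also have "Im \<dots> = Re ((1 + \<zeta>) * cnj (1 - \<zeta>)) / (cmod (1 - \<zeta>))\<^sup>2"
    by (simp only: Im_divide_of_real) simp
  also have "Re ((1 + \<zeta>) * cnj (1 - \<zeta>)) = 1 - (cmod \<zeta>)\<^sup>2"
    unfolding cmod_power2 by (simp add: power2_eq_square algebra_simps)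
  finally have "Im (disc_to_plane \<zeta>) = (1 - (cmod \<zeta>)\<^sup>2) / (cmod (1 - \<zeta>))\<^sup>2" .
  moreover have "(cmod \<zeta>)\<^sup>2 < 1" using assms by (simp add: abs_square_less_1)
  ultimately show "Im (disc_to_plane \<zeta>) > 0" using ne by simp
qed

text \<open>Bijectivity of \<open>T - z\<close> is asked for in the upper half-plane only. So
  \<open>cayley T\<close> is defined everywhere, but nothing is claimed about its range.\<close>

locale upper_resolvent =
  fixes T :: "(L2R \<times> L2R) set"
  assumes add: "(f, h) \<in> T \<Longrightarrow> (g, k) \<in> T \<Longrightarrow> (f + g, h + k) \<in> T"
    and scale: "(f, h) \<in> T \<Longrightarrow> (scaleC a f, scaleC a h) \<in> T"
    and onto: "Im z > 0 \<Longrightarrow> \<exists>f. (f, g + scaleC z f) \<in> T"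
    and inj: "Im z > 0 \<Longrightarrow> (f, scaleC z f) \<in> T \<Longrightarrow> f = 0"
begin

lemma diff: "(f, h) \<in> T \<Longrightarrow> (g, k) \<in> T \<Longrightarrow> (f - g, h - k) \<in> T"
  using add[of f h "scaleC (-1) g" "scaleC (-1) k"] scale[of g k "-1"] by simp

lemma resolvent_unique:
  assumes z: "Im z > 0" and f: "(f, g + scaleC z f) \<in> T"
  shows "resolvent T z g = f"
  unfolding resolvent_def
proof (rule the_equality)
  show "(f, g + scaleC z f) \<in> T" by (rule f)
  fix f' assume f': "(f', g + scaleC z f') \<in> T"
  have "(f' - f, scaleC z (f' - f)) \<in> T"
    using diff[OF f' f] by (simp add: L2R.scale_right_diff_distrib)
  then show "f' = f" using inj[OF z] by fastforce
qed

lemma resolvent_mem: "Im z > 0 \<Longrightarrow> (resolvent T z g, g + scaleC z (resolvent T z g)) \<in> T"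
  using onto[of z g] resolvent_unique by metis

lemma cayley_eq: "(f, g + scaleC \<i> f) \<in> T \<Longrightarrow> cayley T g = g + scaleC (2 * \<i>) f"
  using resolvent_unique[of \<i>] by (simp add: cayley_def)

lemma cayley_graph:
  assumes "(f, h) \<in> T"
  shows "cayley T (h - scaleC \<i> f) = h + scaleC \<i> f"
proof -
  have "cayley T (h - scaleC \<i> f) = (h - scaleC \<i> f) + scaleC (2 * \<i>) f"
    by (rule cayley_eq) (simp add: assms)
  also have "scaleC (2 * \<i>) f = scaleC \<i> f + scaleC \<i> f"
    by (simp only: L2R.scale_left_distrib[symmetric] mult_2)
  finally show ?thesis by simp
qed

lemma cayley_obtain:
  obtains f h where "(f, h) \<in> T" "g = h - scaleC \<i> f" "cayley T g = h + scaleC \<i> f"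
proof -
  obtain f where f: "(f, g + scaleC \<i> f) \<in> T" using onto[of \<i>] by auto
  show ?thesis
    by (rule that[OF f]) (use cayley_graph[OF f] in simp_all)
qed

lemma complex_linear_cayley: "complex_linear (cayley T)"
  unfolding complex_linear_def
proof (intro conjI allI)
  fix f g :: L2R and a :: complex
  note m = resolvent_mem[of \<i>, simplified]
  have "(resolvent T \<i> f + resolvent T \<i> g, (f + g) + scaleC \<i> (resolvent T \<i> f + resolvent T \<i> g)) \<in> T"
    using add[OF m m, of f g] by (simp add: L2R.scale_right_distrib algebra_simps)
  then show "cayley T (f + g) = cayley T f + cayley T g"
    by (simp add: cayley_eq) (simp add: cayley_def L2R.scale_right_distrib algebra_simps)
  have "(scaleC a (resolvent T \<i> f), scaleC a f + scaleC \<i> (scaleC a (resolvent T \<i> f))) \<in> T"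
    using scale[OF m, of a f] by (simp add: L2R.scale_right_distrib mult.commute)
  then have "cayley T (scaleC a f) = scaleC a f + scaleC (2 * \<i>) (scaleC a (resolvent T \<i> f))"
    by (rule cayley_eq)
  then show "cayley T (scaleC a f) = scaleC a (cayley T f)"
    by (simp add: cayley_def L2R.scale_right_distrib mult_ac)
qed

lemma disc_resolvent_right:
  assumes \<zeta>: "cmod \<zeta> < 1"
  shows "disc_resolvent T \<zeta> g - scaleC \<zeta> (cayley T (disc_resolvent T \<zeta> g)) = g"
proof -
  define z where "z = disc_to_plane \<zeta>"
  note z = Im_disc_to_plane[OF \<zeta>]
  have z\<zeta>: "(z - \<i>) * (1 - \<zeta>) = 2 * \<i> * \<zeta>" "z * (1 - \<zeta>) = \<i> * (1 + \<zeta>)"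
    using z(2) by (simp_all add: z_def disc_to_plane_def field_simps)
  define f where "f = resolvent T z g"
  define c where "c = 1 / (1 - \<zeta>)"
  define s where "s = scaleC c (g + scaleC (z - \<i>) f)"
  have c: "c * (1 - \<zeta>) = 1" using z(2) by (simp add: c_def)
  have "(scaleC c f, scaleC c (g + scaleC z f)) \<in> T"
    unfolding f_def by (rule scale[OF resolvent_mem]) (simp add: z_def z)
  moreover have "scaleC c (g + scaleC z f) = s + scaleC \<i> (scaleC c f)"
    by (simp add: s_def L2R.scale_right_distrib L2R.scale_left_diff_distrib L2R.scale_right_diff_distrib mult.commute)
  ultimately have "cayley T s = s + scaleC (2 * \<i>) (scaleC c f)" by (simp only: cayley_eq)
  then have "s - scaleC \<zeta> (cayley T s) = scaleC (1 - \<zeta>) s - scaleC (\<zeta> * (2 * \<i>) * c) f"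
    by (simp add: L2R.scale_right_distrib L2R.scale_left_diff_distrib mult.assoc)
  also have "scaleC (1 - \<zeta>) s = g + scaleC (z - \<i>) f"
    using c by (simp add: s_def mult.commute)
  also have "\<zeta> * (2 * \<i>) * c = z - \<i>"
    using z\<zeta>(1) c by (metis mult.assoc mult.commute mult.right_neutral)
  finally have "s - scaleC \<zeta> (cayley T s) = g" by simp
  then show ?thesis by (simp add: s_def c_def f_def z_def disc_resolvent_def)
qed

lemma disc_resolvent_left:
  assumes \<zeta>: "cmod \<zeta> < 1"
  shows "disc_resolvent T \<zeta> (s - scaleC \<zeta> (cayley T s)) = s"
proof -
  note z = Im_disc_to_plane[OF \<zeta>]
  note U = complex_linear_cayley
  \<comment> \<open>In terms of the graph, a kernel vector of 1 - \<zeta> U comes from an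
    eigenvector of \<open>T\<close> at \<open>disc_to_plane \<zeta>\<close>, which lies in the upper
    half-plane.\<close>
  have ker: "u = 0" if u: "u - scaleC \<zeta> (cayley T u) = 0" for u
  proof -
    obtain f h where fh: "(f, h) \<in> T" "u = h - scaleC \<i> f" "cayley T u = h + scaleC \<i> f"
      by (rule cayley_obtain)
    have "scaleC (1 - \<zeta>) h = scaleC (\<i> * (1 + \<zeta>)) f"
    proof -
      have "(h - scaleC \<i> f) - scaleC \<zeta> (h + scaleC \<i> f) = 0" using u fh by simp
      moreover have "(h - scaleC \<i> f) - scaleC \<zeta> (h + scaleC \<i> f) = scaleC (1 - \<zeta>) h - scaleC (\<i> * (1 + \<zeta>)) f"
        by (simp add: L2R.scale_right_distrib L2R.scale_left_diff_distrib L2R.scale_left_distrib distrib_left mult.commute algebra_simps)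
      ultimately show ?thesis by simp
    qed
    then have "scaleC (1 / (1 - \<zeta>)) (scaleC (1 - \<zeta>) h) = scaleC (1 / (1 - \<zeta>)) (scaleC (\<i> * (1 + \<zeta>)) f)" by (simp only:)
    then have h: "h = scaleC (disc_to_plane \<zeta>) f" using z(2) by (simp add: disc_to_plane_def)
    then have "f = 0" using inj[OF z(1)] fh(1) by simp
    then show "u = 0" using fh h by simp
  qed
  define s' where "s' = disc_resolvent T \<zeta> (s - scaleC \<zeta> (cayley T s))"
  have "s' - scaleC \<zeta> (cayley T s') = s - scaleC \<zeta> (cayley T s)"
    unfolding s'_def by (rule disc_resolvent_right[OF \<zeta>])
  then have "(s' - s) - scaleC \<zeta> (cayley T (s' - s)) = 0"
    by (simp add: complex_linear_diff[OF U] L2R.scale_right_diff_distrib algebra_simps)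
  then have "s' - s = 0" by (rule ker)
  then show ?thesis by (simp add: s'_def)
qed

lemma cayley_isometric:
  assumes sym: "\<And>f h. (f, h) \<in> T \<Longrightarrow> Im (cinner h f) = 0"
  shows "norm (cayley T g) = norm g"
proof -
  obtain f h where fh: "(f, h) \<in> T" "g = h - scaleC \<i> f" "cayley T g = h + scaleC \<i> f"
    by (rule cayley_obtain)
  have "(norm (h + scaleC \<i> f))\<^sup>2 = (norm (h + scaleC (- \<i>) f))\<^sup>2"
    using sym[OF fh(1)] unfolding norm_add_sq norm_scaleC cinner_scale_right by simp
  then have "(norm (cayley T g))\<^sup>2 = (norm g)\<^sup>2" using fh by simp
  then show ?thesis by (simp add: power2_eq_iff_nonneg)
qed

end

subsection \<open>Boundary relations\<close>

text \<open>The graph of a maximal operator in \<open>H\<close>, with the two boundary values of each element of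
  its domain, and the Weyl function \<open>M\<close>.\<close>

locale boundary_relation =
  fixes H :: "L2R set" and G :: "(L2R \<times> L2R \<times> complex \<times> complex) set" and M :: "complex \<Rightarrow> complex"
  assumes H0: "0 \<in> H" and Hadd: "f \<in> H \<Longrightarrow> g \<in> H \<Longrightarrow> f + g \<in> H" and Hscale: "f \<in> H \<Longrightarrow> scaleC c f \<in> H"
    and zero: "(0, 0, 0, 0) \<in> G"
    and add: "(f, h, a, b) \<in> G \<Longrightarrow> (f', h', a', b') \<in> G \<Longrightarrow> (f + f', h + h', a + a', b + b') \<in> G"
    and scale: "(f, h, a, b) \<in> G \<Longrightarrow> (scaleC c f, scaleC c h, c * a, c * b) \<in> G"
    and mem: "(f, h, a, b) \<in> G \<Longrightarrow> f \<in> H \<and> h \<in> H"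
    and green: "(f, h, a, b) \<in> G \<Longrightarrow> (f', h', a', b') \<in> G \<Longrightarrow> cinner h f' - cinner f h' = b * cnj a' - a * cnj b'"
    and solvable: "Im z \<noteq> 0 \<Longrightarrow> g \<in> H \<Longrightarrow> \<exists>f a. (f, g + scaleC z f, a, 0) \<in> G"
    and weyl: "Im z \<noteq> 0 \<Longrightarrow> \<exists>p. p \<noteq> 0 \<and> (p, scaleC z p, - M z, 1) \<in> G"
begin

text \<open>Subtracting \<open>b\<close> times the Weyl element leaves one whose second boundary
  value is 0. There the Green identity expresses symmetry, so the nonreal eigenvalue forces it to
  vanish.\<close>

lemma kernel:
  assumes z: "Im z \<noteq> 0" and f: "(f, scaleC z f, a, b) \<in> G"
  shows "a = - M z * b" "b = 0 \<Longrightarrow> f = 0"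
proof -
  obtain p where p: "(p, scaleC z p, - M z, 1) \<in> G" using weyl[OF z] by blast
  define u where "u = f + scaleC (- b) p"
  define c where "c = a + b * M z"
  have u: "(u, scaleC z u, c, 0) \<in> G"
    using add[OF f scale[OF p, of "- b"]]
    by (simp add: u_def c_def L2R.scale_right_distrib L2R.scale_right_diff_distrib mult.commute)
  have "(z - cnj z) * cinner u u = 0"
    using green[OF u u] by (simp add: cinner_simps left_diff_distrib)
  moreover have "z - cnj z \<noteq> 0" using z by (simp add: complex_eq_iff)
  ultimately have u0: "u = 0" by (simp add: cinner_self)
  have "c = 0" using green[OF u p] by (simp add: u0)
  then show "a = - M z * b" by (simp add: c_def eq_neg_iff_add_eq_0 mult.commute)
  show "f = 0" if "b = 0" using u0 that by (simp add: u_def)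
qed

lemma M_cnj:
  assumes z: "Im z \<noteq> 0"
  shows "M (cnj z) = cnj (M z)"
proof -
  obtain p where p: "(p, scaleC z p, - M z, 1) \<in> G" using weyl[OF z] by blast
  obtain p' where p': "(p', scaleC (cnj z) p', - M (cnj z), 1) \<in> G" using weyl[of "cnj z"] z by auto
  have "cnj (M (cnj z)) = M z" using green[OF p p'] by (simp add: cinner_simps)
  then show ?thesis by (metis complex_cnj_cnj)
qed

text \<open>The Green identity for the Weyl element with itself says that Im z |p|^2 = Im (M z).
  Strict positivity is what later keeps \<open>M1 + M2\<close> away from 0.\<close>

lemma Im_M_pos:
  assumes z: "Im z > 0"
  shows "Im (M z) > 0"
proof -
  obtain p where p: "p \<noteq> 0" "(p, scaleC z p, - M z, 1) \<in> G" using weyl[of z] z by auto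
  have "(z - cnj z) * cinner p p = M z - cnj (M z)"
    using green[OF p(2) p(2)] by (simp add: cinner_simps left_diff_distrib)
  then have "2 * Im z * (norm p)\<^sup>2 = 2 * Im (M z)"
    unfolding cinner_self by (auto dest: arg_cong[of _ _ Im])
  then show ?thesis using z p(1) by (metis mult_pos_pos zero_less_power zero_less_norm_iff zero_less_mult_pos zero_less_numeral)
qed

end

locale boundary_relation_pair =
  B1: boundary_relation H1 G1 M1 + B2: boundary_relation H2 G2 M2
  for H1 G1 M1 H2 G2 M2 +
  fixes J :: "L2R \<Rightarrow> L2R" and C :: real
  assumes orth: "f \<in> H1 \<Longrightarrow> g \<in> H2 \<Longrightarrow> cinner f g = 0"
    and decomp: "\<exists>g1\<in>H1. \<exists>g2\<in>H2. g = g1 + g2"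
    and J: "f \<in> H1 \<Longrightarrow> g \<in> H2 \<Longrightarrow> J (f + g) = f - g"
    and C: "0 \<le> C"
    and M_neq: "Im z > 0 \<Longrightarrow> M1 z \<noteq> M2 z"
    and M_le: "Im z > 0 \<Longrightarrow> cmod (M1 z + M2 z) \<le> C * cmod (M1 z - M2 z)"
begin

lemma orth': "f \<in> H1 \<Longrightarrow> g \<in> H2 \<Longrightarrow> cinner g f = 0"
  using orth[of f g] cinner_commute[of g f] by simp

lemma H_disjoint: "f \<in> H1 \<Longrightarrow> f \<in> H2 \<Longrightarrow> f = 0"
  using orth[of f f] by (simp add: cinner_self)

lemma norm_decomp:
  assumes "f \<in> H1" "g \<in> H2"
  shows "(norm (f + g))\<^sup>2 = (norm f)\<^sup>2 + (norm g)\<^sup>2"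
  using orth[OF assms] by (simp add: norm_add_sq)

text \<open>The coupling \<open>a\<^sub>2 = s a\<^sub>1\<close>, \<open>b\<^sub>2 = b\<^sub>1\<close>: \<open>s = 1\<close> is the operator under study and
  \<open>s = -1\<close> is a selfadjoint extension of the same minimal operator.\<close>

definition coupled :: "complex \<Rightarrow> (L2R \<times> L2R) set" where
  "coupled s = {(f1 + f2, h1 + h2) |f1 f2 h1 h2 a b. (f1, h1, a, b) \<in> G1 \<and> (f2, h2, s * a, b) \<in> G2}"

text \<open>The Neumann condition on both sides: a common reference operator from which
  \<open>s = 1\<close> and \<open>s = -1\<close> are both rank-one perturbations of the
  resolvent.\<close>

definition decoupled :: "(L2R \<times> L2R) set" where
  "decoupled = {(f1 + f2, h1 + h2) |f1 f2 h1 h2 a a'. (f1, h1, a, 0) \<in> G1 \<and> (f2, h2, a', 0) \<in> G2}"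

lemma coupledI: "(f1, h1, a, b) \<in> G1 \<Longrightarrow> (f2, h2, s * a, b) \<in> G2 \<Longrightarrow> (f1 + f2, h1 + h2) \<in> coupled s"
  unfolding coupled_def by blast

lemma decoupledI: "(f1, h1, a, 0) \<in> G1 \<Longrightarrow> (f2, h2, a', 0) \<in> G2 \<Longrightarrow> (f1 + f2, h1 + h2) \<in> decoupled"
  unfolding decoupled_def by blast

lemma coupled_zero: "(0, 0) \<in> coupled s"
  using coupledI[OF B1.zero, of 0 0 s] B2.zero by simp

lemma coupled_add:
  assumes "(f, h) \<in> coupled s" "(g, k) \<in> coupled s"
  shows "(f + g, h + k) \<in> coupled s"
proof -
  obtain f1 f2 h1 h2 a b where 1: "f = f1 + f2" "h = h1 + h2" "(f1, h1, a, b) \<in> G1" "(f2, h2, s * a, b) \<in> G2"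
    using assms(1) unfolding coupled_def by blast
  obtain g1 g2 k1 k2 c d where 2: "g = g1 + g2" "k = k1 + k2" "(g1, k1, c, d) \<in> G1" "(g2, k2, s * c, d) \<in> G2"
    using assms(2) unfolding coupled_def by blast
  have "((f1 + g1) + (f2 + g2), (h1 + k1) + (h2 + k2)) \<in> coupled s"
    by (rule coupledI[OF B1.add[OF 1(3) 2(3)]]) (use B2.add[OF 1(4) 2(4)] in \<open>simp add: distrib_left\<close>)
  then show ?thesis by (simp add: 1 2 add_ac)
qed

lemma coupled_scale:
  assumes "(f, h) \<in> coupled s"
  shows "(scaleC c f, scaleC c h) \<in> coupled s"
proof -
  obtain f1 f2 h1 h2 a b where 1: "f = f1 + f2" "h = h1 + h2" "(f1, h1, a, b) \<in> G1" "(f2, h2, s * a, b) \<in> G2"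
    using assms(1) unfolding coupled_def by blast
  have "(scaleC c f1 + scaleC c f2, scaleC c h1 + scaleC c h2) \<in> coupled s"
    by (rule coupledI[OF B1.scale[OF 1(3)]]) (use B2.scale[OF 1(4), of c] in \<open>simp add: mult.left_commute\<close>)
  then show ?thesis by (simp add: 1 L2R.scale_right_distrib)
qed

lemma decoupled_add:
  assumes "(f, h) \<in> decoupled" "(g, k) \<in> decoupled"
  shows "(f + g, h + k) \<in> decoupled"
proof -
  obtain f1 f2 h1 h2 a b where 1: "f = f1 + f2" "h = h1 + h2" "(f1, h1, a, 0) \<in> G1" "(f2, h2, b, 0) \<in> G2"
    using assms(1) unfolding decoupled_def by blast
  obtain g1 g2 k1 k2 c d where 2: "g = g1 + g2" "k = k1 + k2" "(g1, k1, c, 0) \<in> G1" "(g2, k2, d, 0) \<in> G2"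
    using assms(2) unfolding decoupled_def by blast
  have "((f1 + g1) + (f2 + g2), (h1 + k1) + (h2 + k2)) \<in> decoupled"
    by (rule decoupledI) (use B1.add[OF 1(3) 2(3)] B2.add[OF 1(4) 2(4)] in simp_all)
  then show ?thesis by (simp add: 1 2 add_ac)
qed

lemma decoupled_scale:
  assumes "(f, h) \<in> decoupled"
  shows "(scaleC c f, scaleC c h) \<in> decoupled"
proof -
  obtain f1 f2 h1 h2 a b where 1: "f = f1 + f2" "h = h1 + h2" "(f1, h1, a, 0) \<in> G1" "(f2, h2, b, 0) \<in> G2"
    using assms(1) unfolding decoupled_def by blast
  have "(scaleC c f1 + scaleC c f2, scaleC c h1 + scaleC c h2) \<in> decoupled"
    by (rule decoupledI) (use B1.scale[OF 1(3), of c] B2.scale[OF 1(4), of c] in simp_all)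
  then show ?thesis by (simp add: 1 L2R.scale_right_distrib)
qed

text \<open>Krein's formula: adding \<alpha> times \<open>p1 + p2\<close> to the two Neumann
  solutions gives both second boundary values \<alpha>, and the equation for \<alpha> is the
  remaining condition \<open>a2 = s a1\<close>.\<close>

lemma coupled_solution:
  assumes 1: "(y1, g1 + scaleC z y1, a1, 0) \<in> G1" "(p1, scaleC z p1, - M1 z, 1) \<in> G1"
    and 2: "(y2, g2 + scaleC z y2, a2, 0) \<in> G2" "(p2, scaleC z p2, - M2 z, 1) \<in> G2"
    and \<alpha>: "\<alpha> * (s * M1 z - M2 z) = s * a1 - a2"
  defines "f \<equiv> (y1 + y2) + scaleC \<alpha> (p1 + p2)"
  shows "(f, (g1 + g2) + scaleC z f) \<in> coupled s"
proof -
  have 3: "(y1 + scaleC \<alpha> p1, (g1 + scaleC z y1) + scaleC \<alpha> (scaleC z p1), a1 + \<alpha> * (- M1 z), 0 + \<alpha> * 1) \<in> G1"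
    by (rule B1.add[OF 1(1) B1.scale[OF 1(2)]])
  have 4: "(y2 + scaleC \<alpha> p2, (g2 + scaleC z y2) + scaleC \<alpha> (scaleC z p2), a2 + \<alpha> * (- M2 z), 0 + \<alpha> * 1) \<in> G2"
    by (rule B2.add[OF 2(1) B2.scale[OF 2(2)]])
  have e: "a2 + \<alpha> * (- M2 z) = s * (a1 + \<alpha> * (- M1 z))" using \<alpha> by (simp add: algebra_simps)
  have "((y1 + scaleC \<alpha> p1) + (y2 + scaleC \<alpha> p2),
      ((g1 + scaleC z y1) + scaleC \<alpha> (scaleC z p1)) + ((g2 + scaleC z y2) + scaleC \<alpha> (scaleC z p2))) \<in> coupled s"
    using coupledI[OF 3 4[unfolded e]] .
  then show ?thesis by (simp add: f_def L2R.scale_right_distrib add_ac mult.commute)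
qed

lemma coupled_onto:
  assumes z: "Im z \<noteq> 0" and D: "s * M1 z \<noteq> M2 z"
  shows "\<exists>f. (f, g + scaleC z f) \<in> coupled s"
proof -
  obtain g1 g2 where g: "g1 \<in> H1" "g2 \<in> H2" "g = g1 + g2" using decomp by blast
  obtain y1 a1 where 1: "(y1, g1 + scaleC z y1, a1, 0) \<in> G1" using B1.solvable[OF z g(1)] by blast
  obtain y2 a2 where 2: "(y2, g2 + scaleC z y2, a2, 0) \<in> G2" using B2.solvable[OF z g(2)] by blast
  obtain p1 where p1: "(p1, scaleC z p1, - M1 z, 1) \<in> G1" using B1.weyl[OF z] by blast
  obtain p2 where p2: "(p2, scaleC z p2, - M2 z, 1) \<in> G2" using B2.weyl[OF z] by blast
  have "(s * a1 - a2) / (s * M1 z - M2 z) * (s * M1 z - M2 z) = s * a1 - a2" using D by simp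
  from coupled_solution[OF 1 p1 2 p2 this] show ?thesis unfolding g(3) by blast
qed

lemma split_eigen:
  assumes 1: "(f1, h1, a, b) \<in> G1" and 2: "(f2, h2, c, d) \<in> G2" and e: "h1 + h2 = scaleC z (f1 + f2)"
  shows "h1 = scaleC z f1" "h2 = scaleC z f2"
proof -
  note m = B1.mem[OF 1] B2.mem[OF 2]
  define u where "u = h1 + scaleC (- z) f1"
  have u1: "u \<in> H1" unfolding u_def using m by (intro B1.Hadd B1.Hscale) auto
  have e': "h1 + h2 = scaleC z f1 + scaleC z f2" using e by (simp add: L2R.scale_right_distrib)
  then have "u = scaleC z f2 + scaleC (- 1) h2" by (simp add: u_def algebra_simps)
  then have "u \<in> H2" using m by (simp only:) (intro B2.Hadd B2.Hscale, auto)
  then have "u = 0" using H_disjoint u1 by blast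
  then show h1: "h1 = scaleC z f1" by (simp add: u_def)
  show "h2 = scaleC z f2" using e' h1 by simp
qed

lemma coupled_inj:
  assumes z: "Im z \<noteq> 0" and D: "s * M1 z \<noteq> M2 z" and f: "(f, scaleC z f) \<in> coupled s"
  shows "f = 0"
proof -
  obtain f1 f2 h1 h2 a b where 1: "f = f1 + f2" "scaleC z f = h1 + h2" "(f1, h1, a, b) \<in> G1" "(f2, h2, s * a, b) \<in> G2"
    using f unfolding coupled_def by blast
  have h: "h1 = scaleC z f1" "h2 = scaleC z f2" using split_eigen[OF 1(3,4)] 1(1,2) by auto
  note k1 = B1.kernel[OF z 1(3)[unfolded h]] and k2 = B2.kernel[OF z 1(4)[unfolded h]]
  have "(s * M1 z - M2 z) * b = 0" using k1(1) k2(1) by (simp add: algebra_simps)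
  then have "b = 0" using D by simp
  then show ?thesis using k1(2) k2(2) 1(1) by simp
qed

lemma decoupled_onto:
  assumes z: "Im z \<noteq> 0"
  shows "\<exists>f. (f, g + scaleC z f) \<in> decoupled"
proof -
  obtain g1 g2 where g: "g1 \<in> H1" "g2 \<in> H2" "g = g1 + g2" using decomp by blast
  obtain y1 a1 where 1: "(y1, g1 + scaleC z y1, a1, 0) \<in> G1" using B1.solvable[OF z g(1)] by blast
  obtain y2 a2 where 2: "(y2, g2 + scaleC z y2, a2, 0) \<in> G2" using B2.solvable[OF z g(2)] by blast
  have "(y1 + y2, (g1 + g2) + scaleC z (y1 + y2)) \<in> decoupled"
    using decoupledI[OF 1 2] by (simp add: L2R.scale_right_distrib add_ac)
  then show ?thesis unfolding g(3) by blast
qed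

lemma decoupled_inj:
  assumes z: "Im z \<noteq> 0" and f: "(f, scaleC z f) \<in> decoupled"
  shows "f = 0"
proof -
  obtain f1 f2 h1 h2 a b where 1: "f = f1 + f2" "scaleC z f = h1 + h2" "(f1, h1, a, 0) \<in> G1" "(f2, h2, b, 0) \<in> G2"
    using f unfolding decoupled_def by blast
  have h: "h1 = scaleC z f1" "h2 = scaleC z f2" using split_eigen[OF 1(3,4)] 1(1,2) by auto
  show ?thesis using B1.kernel(2)[OF z 1(3)[unfolded h]] B2.kernel(2)[OF z 1(4)[unfolded h]] 1(1) by simp
qed

lemma M_sum_neq: "Im z > 0 \<Longrightarrow> - 1 * M1 z \<noteq> M2 z"
  using B1.Im_M_pos[of z] B2.Im_M_pos[of z] by (auto simp: complex_eq_iff)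

sublocale A: upper_resolvent "coupled 1"
proof
  show "\<exists>f. (f, g + scaleC z f) \<in> coupled 1" if "0 < Im z" for z g
    using that M_neq[OF that] by (intro coupled_onto) auto
  show "f = 0" if "0 < Im z" "(f, scaleC z f) \<in> coupled 1" for z f
    using that(1) M_neq[OF that(1)] by (intro coupled_inj[OF _ _ that(2)]) auto
qed (rule coupled_add coupled_scale; assumption)+

sublocale A1: upper_resolvent "coupled (- 1)"
proof
  show "\<exists>f. (f, g + scaleC z f) \<in> coupled (- 1)" if "0 < Im z" for z g
    using that by (intro coupled_onto M_sum_neq) auto
  show "f = 0" if "0 < Im z" "(f, scaleC z f) \<in> coupled (- 1)" for z f
    using that(1) by (intro coupled_inj[OF _ M_sum_neq that(2)]) auto
qed (rule coupled_add coupled_scale; assumption)+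

sublocale A0: upper_resolvent decoupled
proof
  show "\<exists>f. (f, g + scaleC z f) \<in> decoupled" if "0 < Im z" for z g
    using that by (intro decoupled_onto) auto
  show "f = 0" if "0 < Im z" "(f, scaleC z f) \<in> decoupled" for z f
    using that(1) by (intro decoupled_inj[OF _ that(2)]) auto
qed (rule decoupled_add decoupled_scale; assumption)+

lemma cinner_parts:
  assumes "(f1, h1, a, b) \<in> G1" "(f2, h2, c, d) \<in> G2" "(g1, k1, a', b') \<in> G1" "(g2, k2, c', d') \<in> G2"
  shows "cinner (h1 + h2) (g1 + g2) = cinner h1 g1 + cinner h2 g2"
    "cinner (f1 + f2) (k1 + k2) = cinner f1 k1 + cinner f2 k2"
    "cinner (J (h1 + h2)) (g1 + g2) = cinner h1 g1 - cinner h2 g2"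
    "cinner (J (f1 + f2)) (k1 + k2) = cinner f1 k1 - cinner f2 k2"
  using B1.mem[OF assms(1)] B2.mem[OF assms(2)] B1.mem[OF assms(3)] B2.mem[OF assms(4)]
  by (simp_all add: J cinner_simps orth orth')

lemma Im_cinner_zero:
  assumes "cinner h f = cinner f h"
  shows "Im (cinner h f) = 0"
  using assms cinner_commute[of f h] by (metis Im_complex_of_real Reals_cnj_iff Reals_cases)

lemma coupled_minus_symmetric:
  assumes "(f, h) \<in> coupled (- 1)"
  shows "Im (cinner h f) = 0"
proof (rule Im_cinner_zero)
  obtain f1 f2 h1 h2 a b where 1: "f = f1 + f2" "h = h1 + h2" "(f1, h1, a, b) \<in> G1" "(f2, h2, - 1 * a, b) \<in> G2"
    using assms unfolding coupled_def by blast
  have "cinner h f - cinner f h = (cinner h1 f1 - cinner f1 h1) + (cinner h2 f2 - cinner f2 h2)"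
    unfolding 1(1,2) cinner_parts(1,2)[OF 1(3,4,3,4)] by simp
  also have "\<dots> = 0" unfolding B1.green[OF 1(3,3)] B2.green[OF 1(4,4)] by simp
  finally show "cinner h f = cinner f h" by simp
qed

lemma decoupled_symmetric:
  assumes "(f, h) \<in> decoupled"
  shows "Im (cinner h f) = 0"
proof (rule Im_cinner_zero)
  obtain f1 f2 h1 h2 a b where 1: "f = f1 + f2" "h = h1 + h2" "(f1, h1, a, 0) \<in> G1" "(f2, h2, b, 0) \<in> G2"
    using assms unfolding decoupled_def by blast
  have "cinner h f - cinner f h = (cinner h1 f1 - cinner f1 h1) + (cinner h2 f2 - cinner f2 h2)"
    unfolding 1(1,2) cinner_parts(1,2)[OF 1(3,4,3,4)] by simp
  also have "\<dots> = 0" unfolding B1.green[OF 1(3,3)] B2.green[OF 1(4,4)] by simp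
  finally show "cinner h f = cinner f h" by simp
qed

text \<open>For \<open>s = 1\<close> the boundary forms of the two halves are equal and cancel in
  the difference produced by \<open>J\<close>; for \<open>s = -1\<close> they are opposite and
  cancel in the ordinary inner product.\<close>

lemma coupled_J_symmetric:
  assumes "(f, h) \<in> coupled 1" "(g, k) \<in> coupled 1"
  shows "cinner (J h) g = cinner (J f) k"
proof -
  obtain f1 f2 h1 h2 a b where 1: "f = f1 + f2" "h = h1 + h2" "(f1, h1, a, b) \<in> G1" "(f2, h2, 1 * a, b) \<in> G2"
    using assms(1) unfolding coupled_def by blast
  obtain g1 g2 k1 k2 c d where 2: "g = g1 + g2" "k = k1 + k2" "(g1, k1, c, d) \<in> G1" "(g2, k2, 1 * c, d) \<in> G2"
    using assms(2) unfolding coupled_def by blast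
  have "cinner (J h) g - cinner (J f) k = (cinner h1 g1 - cinner f1 k1) - (cinner h2 g2 - cinner f2 k2)"
    unfolding 1(1,2) 2(1,2) cinner_parts(3,4)[OF 1(3,4) 2(3,4)] by simp
  also have "\<dots> = 0" unfolding B1.green[OF 1(3) 2(3)] B2.green[OF 1(4) 2(4)] by simp
  finally show ?thesis by simp
qed

lemma J_linear: "complex_linear J" and J_norm: "norm (J f) = norm f"
proof -
  show "complex_linear J"
    unfolding complex_linear_def
  proof (intro conjI allI)
    fix f g :: L2R and a :: complex
    obtain f1 f2 where f: "f1 \<in> H1" "f2 \<in> H2" "f = f1 + f2" using decomp by blast
    obtain g1 g2 where g: "g1 \<in> H1" "g2 \<in> H2" "g = g1 + g2" using decomp by blast
    have "J ((f1 + g1) + (f2 + g2)) = (f1 + g1) - (f2 + g2)" by (intro J B1.Hadd B2.Hadd f g)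
    moreover have "f + g = (f1 + g1) + (f2 + g2)" by (simp add: f(3) g(3) add_ac)
    moreover have "J f = f1 - f2" "J g = g1 - g2" using J[OF f(1,2)] J[OF g(1,2)] by (simp_all add: f(3) g(3))
    ultimately show "J (f + g) = J f + J g" by (simp only:) simp
    have "J (scaleC a f1 + scaleC a f2) = scaleC a f1 - scaleC a f2" by (intro J B1.Hscale B2.Hscale f)
    then show "J (scaleC a f) = scaleC a (J f)"
      using J[OF f(1,2)] by (simp add: f(3) L2R.scale_right_distrib L2R.scale_right_diff_distrib)
  qed
  obtain f1 f2 where f: "f1 \<in> H1" "f2 \<in> H2" "f = f1 + f2" using decomp by blast
  have "(norm (f1 + scaleC (- 1) f2))\<^sup>2 = (norm (f1 + f2))\<^sup>2"
    using norm_decomp[OF f(1,2)] norm_decomp[OF f(1) B2.Hscale[OF f(2), of "- 1"]] by simp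
  then show "norm (J f) = norm f"
    using J[OF f(1,2)] by (simp add: f(3) power2_eq_iff_nonneg)
qed

text \<open>Both differences are multiples of the same vector \<open>p1 + p2\<close>, so only the
  scalar coefficients have to be compared; for \<open>g\<close> in one half their numerators have
  equal modulus and the denominators are \<open>M1 - M2\<close> and
  \<open>- M1 - M2\<close>.\<close>

lemma resolvent_compare:
  assumes z: "Im z > 0" and g: "g \<in> H1 \<union> H2"
  shows "norm (resolvent (coupled 1) z g - resolvent decoupled z g) \<le>
    C * norm (resolvent (coupled (- 1)) z g - resolvent decoupled z g)"
proof -
  have z': "Im z \<noteq> 0" using z by simp
  obtain p1 where p1: "(p1, scaleC z p1, - M1 z, 1) \<in> G1" using B1.weyl[OF z'] by blast
  obtain p2 where p2: "(p2, scaleC z p2, - M2 z, 1) \<in> G2" using B2.weyl[OF z'] by blast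
  \<comment> \<open>The missing half is filled with zero data and the zero solution, so one of
    \<open>a1\<close>, \<open>a2\<close> is 0 and changing the sign of \<open>a1\<close> does not
    affect the modulus.\<close>
  have "\<exists>g1 y1 a1 g2 y2 a2. (y1, g1 + scaleC z y1, a1, 0) \<in> G1 \<and> (y2, g2 + scaleC z y2, a2, 0) \<in> G2 \<and>
      g = g1 + g2 \<and> cmod (a1 - a2) = cmod (- a1 - a2)"
    using g
  proof
    assume "g \<in> H1"
    then obtain y a where "(y, g + scaleC z y, a, 0) \<in> G1" using B1.solvable[OF z'] by blast
    then show ?thesis using B2.zero
      by (intro exI[of _ g] exI[of _ y] exI[of _ a] exI[of _ 0]) simp
  next
    assume "g \<in> H2"
    then obtain y a where "(y, g + scaleC z y, a, 0) \<in> G2" using B2.solvable[OF z'] by blast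
    then show ?thesis using B1.zero
      by (intro exI[of _ 0] exI[of _ g] exI[of _ y] exI[of _ a]) simp
  qed
  then obtain g1 y1 a1 g2 y2 a2 where y: "(y1, g1 + scaleC z y1, a1, 0) \<in> G1" "(y2, g2 + scaleC z y2, a2, 0) \<in> G2"
    and g12: "g = g1 + g2" and a: "cmod (a1 - a2) = cmod (- a1 - a2)" by blast
  define \<alpha> where "\<alpha> s = (s * a1 - a2) / (s * M1 z - M2 z)" for s
  have D: "M1 z - M2 z \<noteq> 0" "- 1 * M1 z - M2 z \<noteq> 0" using M_neq[OF z] M_sum_neq[OF z] by auto
  define w where "w = p1 + p2"
  have "\<alpha> 1 * (1 * M1 z - M2 z) = 1 * a1 - a2" "\<alpha> (- 1) * (- 1 * M1 z - M2 z) = - 1 * a1 - a2"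
    using D by (simp_all add: \<alpha>_def)
  from coupled_solution[OF y(1) p1 y(2) p2 this(1)] coupled_solution[OF y(1) p1 y(2) p2 this(2)]
  have r: "resolvent (coupled 1) z g = (y1 + y2) + scaleC (\<alpha> 1) w" "resolvent (coupled (- 1)) z g = (y1 + y2) + scaleC (\<alpha> (- 1)) w"
    by (auto simp: w_def g12 intro!: A.resolvent_unique A1.resolvent_unique z)
  have "resolvent decoupled z g = y1 + y2"
    using decoupledI[OF y] by (intro A0.resolvent_unique z) (simp add: g12 L2R.scale_right_distrib add_ac)
  then have n: "norm (resolvent (coupled 1) z g - resolvent decoupled z g) = cmod (\<alpha> 1) * norm w"
    "norm (resolvent (coupled (- 1)) z g - resolvent decoupled z g) = cmod (\<alpha> (- 1)) * norm w"
    by (simp_all add: r norm_scaleC)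
  have "cmod (\<alpha> 1) \<le> C * cmod (\<alpha> (- 1))"
  proof -
    have n1: "cmod (- 1 * M1 z - M2 z) = cmod (M1 z + M2 z)"
      by (metis minus_add_distrib mult_minus1 norm_minus_cancel uminus_add_conv_diff add.commute diff_conv_add_uminus)
    have pos: "0 < cmod (M1 z - M2 z)" "0 < cmod (M1 z + M2 z)" using D n1 by (metis zero_less_norm_iff)+
    have "cmod (a1 - a2) * cmod (M1 z + M2 z) \<le> cmod (a1 - a2) * (C * cmod (M1 z - M2 z))"
      by (intro mult_left_mono M_le[OF z]) simp
    then have "cmod (a1 - a2) / cmod (M1 z - M2 z) \<le> C * (cmod (a1 - a2) / cmod (M1 z + M2 z))"
      using pos by (simp add: field_simps)
    moreover have "cmod (\<alpha> 1) = cmod (a1 - a2) / cmod (M1 z - M2 z)" by (simp add: \<alpha>_def norm_divide)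
    moreover have "cmod (\<alpha> (- 1)) = cmod (a1 - a2) / cmod (M1 z + M2 z)"
      unfolding \<alpha>_def norm_divide n1 a by simp
    ultimately show ?thesis by simp
  qed
  then show ?thesis unfolding n using mult_right_mono[of _ _ "norm w"] by (simp add: mult.assoc[symmetric])
qed

lemma disc_resolvent_compare:
  assumes \<zeta>: "cmod \<zeta> < 1" and g: "g \<in> H1 \<union> H2"
  shows "norm (disc_resolvent (coupled 1) \<zeta> g - disc_resolvent decoupled \<zeta> g) \<le>
    C * norm (disc_resolvent (coupled (- 1)) \<zeta> g - disc_resolvent decoupled \<zeta> g)"
proof -
  define z where "z = disc_to_plane \<zeta>"
  define c where "c = (z - \<i>) / (1 - \<zeta>)"
  have d: "disc_resolvent T \<zeta> g - disc_resolvent T' \<zeta> g = scaleC c (resolvent T z g - resolvent T' z g)" for T T'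
    by (simp add: disc_resolvent_def z_def[symmetric] c_def L2R.scale_right_distrib L2R.scale_right_diff_distrib)
  show ?thesis
    unfolding d norm_scaleC
    using mult_left_mono[OF resolvent_compare[OF Im_disc_to_plane(1)[OF \<zeta>] g], of "cmod c"]
    by (simp add: z_def[symmetric] mult.left_commute)
qed

theorem similar_to_selfadjoint:
  assumes sv: "single_valued (coupled 1)"
  shows "\<exists>T. selfadjoint T \<and> similar_operators (coupled 1) T"
proof -
  define U where "U = cayley (coupled 1)"
  define K where "K = 128 * C\<^sup>2 + 8"
  have K: "K \<ge> 1" by (simp add: K_def)
  have P: "\<exists>g1\<in>H1 \<union> H2. \<exists>g2\<in>H1 \<union> H2. g = g1 + g2 \<and> norm g1 \<le> norm g \<and> norm g2 \<le> norm g" for g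
  proof -
    obtain g1 g2 where g: "g1 \<in> H1" "g2 \<in> H2" "g = g1 + g2" using decomp by blast
    have "(norm g1)\<^sup>2 \<le> (norm g)\<^sup>2" "(norm g2)\<^sup>2 \<le> (norm g)\<^sup>2" using norm_decomp[OF g(1,2)] by (simp_all add: g(3))
    then have "norm g1 \<le> norm g" "norm g2 \<le> norm g" by (simp_all add: power_mono_iff)
    then show ?thesis using g by blast
  qed
  have iso: "norm (cayley decoupled g) \<le> norm g" "norm (cayley (coupled (- 1)) g) \<le> norm g" for g
    using A0.cayley_isometric[OF decoupled_symmetric] A1.cayley_isometric[OF coupled_minus_symmetric] by simp_all
  note powers = resolvent_compare_powers[OF A.complex_linear_cayley A0.complex_linear_cayley A1.complex_linear_cayley
      iso A.disc_resolvent_right A.disc_resolvent_left A0.disc_resolvent_right A1.disc_resolvent_right C P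
      disc_resolvent_compare, folded U_def K_def]
  \<comment> \<open>The Cayley transform of an operator symmetric in the indefinite form preserves
    that form: the mixed terms cancel.\<close>
  have JU: "inner (J (U f)) (U g) = inner (J f) g" for f g
  proof -
    obtain f1 h1 where 1: "(f1, h1) \<in> coupled 1" "f = h1 - scaleC \<i> f1" "U f = h1 + scaleC \<i> f1"
      using A.cayley_obtain unfolding U_def by blast
    obtain g1 k1 where 2: "(g1, k1) \<in> coupled 1" "g = k1 - scaleC \<i> g1" "U g = k1 + scaleC \<i> g1"
      using A.cayley_obtain unfolding U_def by blast
    have "cinner (J (U f)) (U g) = cinner (J (h1 + scaleC \<i> f1)) (k1 + scaleC \<i> g1)" by (simp only: 1(3) 2(3))
    also have "\<dots> = cinner (J (h1 - scaleC \<i> f1)) (k1 - scaleC \<i> g1)"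
      unfolding complex_linear_add[OF J_linear] complex_linear_diff[OF J_linear] complex_linear_scale[OF J_linear]
      by (simp add: cinner_simps coupled_J_symmetric[OF 1(1) 2(1)] algebra_simps)
    also have "\<dots> = cinner (J f) g" by (simp only: 1(2) 2(2))
    finally have "cinner (J (U f)) (U g) = cinner (J f) g" .
    then show ?thesis by (simp add: inner_L2R_def)
  qed
  obtain b where b: "bounded_bilinear b" "\<And>f g. b f g = b g f" "\<And>f g. b (U f) (U g) = b f g"
    "\<And>a f g. b f (scaleC a g) = b (scaleC (cnj a) f) g"
    "\<And>f. (norm f)\<^sup>2 \<le> K * b f f" "\<And>f. b f f \<le> K * (norm f)\<^sup>2"
    by (rule invariant_form[of U K J]) (use powers A.complex_linear_cayley K J_norm JU in \<open>auto simp: U_def\<close>)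
  interpret b: bounded_bilinear b by (rule b(1))
  \<comment> \<open>Invariance under the Cayley transform, read on the graph: in b (h + \<i> f, k +
    \<i> g) = b (h - \<i> f, k - \<i> g) only the mixed terms remain. As \<open>b\<close> is real
    bilinear, the factor \<open>\<i>\<close> is moved across by the conjugation rule.\<close>
  have bi: "b h (scaleC \<i> g) = b f (scaleC \<i> k)" if 1: "(f, h) \<in> coupled 1" and 2: "(g, k) \<in> coupled 1" for f h g k
  proof -
    have "b (h + scaleC \<i> f) (k + scaleC \<i> g) = b (h - scaleC \<i> f) (k - scaleC \<i> g)"
      using b(3)[of "h - scaleC \<i> f" "k - scaleC \<i> g"] A.cayley_graph[OF 1] A.cayley_graph[OF 2] by (simp add: U_def)
    then have "b h (scaleC \<i> g) + b (scaleC \<i> f) k = 0"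
      by (simp add: b.add_left b.add_right b.diff_left b.diff_right)
    moreover have "b (scaleC \<i> f) k = - b f (scaleC \<i> k)"
      using b(4)[of f "- \<i>" k] by (simp add: b.minus_right)
    ultimately show ?thesis by simp
  qed
  \<comment> \<open>Replacing the second graph element by its multiple with \<open>- \<i>\<close>
    removes the factor \<open>\<i>\<close> on both sides.\<close>
  have bsym: "b h g = b f k" if 1: "(f, h) \<in> coupled 1" and 2: "(g, k) \<in> coupled 1" for f h g k
    using bi[OF 1 coupled_scale[OF 2, of "- \<i>"]] by simp
  show ?thesis
  proof (rule similar_selfadjoint_of_form[OF coupled_zero coupled_add coupled_scale sv _ _ b(1,2,4,5,6) K bsym])
    show "\<exists>f. (f, g + scaleC \<i> f) \<in> coupled 1" for g by (rule A.onto) simp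
    \<comment> \<open>Surjectivity at \<open>- \<i>\<close> comes from the upper half-plane through
      the reflection symmetry of the Weyl functions.\<close>
    have "M1 (cnj \<i>) \<noteq> M2 (cnj \<i>)" using M_neq[of \<i>] B1.M_cnj[of \<i>] B2.M_cnj[of \<i>] by simp
    then show "\<exists>f. (f, g - scaleC \<i> f) \<in> coupled 1" for g
      using coupled_onto[of "- \<i>" 1 g] by simp
  qed
qed

end

section \<open>From the two half-lines to the operator on the line\<close>

subsection \<open>Embedding the half-lines\<close>

lemma LINT_reflect:
  fixes f :: "real \<Rightarrow> 'a::{banach,second_countable_topology}"
  assumes "\<bar>e\<bar> = (1::real)"
  shows "(LINT x|lborel. f (e * x)) = (LINT x|lborel. f x)"
  using lborel_integral_real_affine[of e f 0] assms by simp

lemma integrable_reflect: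
  fixes f :: "real \<Rightarrow> 'a::{banach,second_countable_topology}"
  assumes "\<bar>e\<bar> = (1::real)" "integrable lborel f"
  shows "integrable lborel (\<lambda>x. f (e * x))"
  using lborel_integrable_real_affine[of f e 0] assms by fastforce

lemma borel_measurable_reflect:
  fixes f :: "real \<Rightarrow> 'a::topological_space"
  assumes "f \<in> borel_measurable lborel"
  shows "(\<lambda>x. f (e * x)) \<in> borel_measurable lborel"
proof -
  have "(\<lambda>x :: real. e * x) \<in> borel_measurable borel" by simp
  then show ?thesis using assms by (auto intro: measurable_compose)
qed

lemma sq_integrable_reflect: "\<bar>e\<bar> = 1 \<Longrightarrow> sq_integrable f \<Longrightarrow> sq_integrable (\<lambda>x. f (e * x))"
  unfolding sq_integrable_def
  using borel_measurable_reflect[of f e] integrable_reflect[of e "\<lambda>x. (cmod (f x))\<^sup>2"] by blast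


lemma AE_lborel_neq: "AE x in lborel. x \<noteq> (c::real)"
  by (rule AE_lborel_singleton)

text \<open>For \<open>e = 1\<close> or \<open>e = -1\<close> the argument \<open>e * x\<close> is
  the distance to 0 on the chosen half-line, so both half-lines share one theory on
  \<open>[0, \<infinity>)\<close>.\<close>

definition half_ext :: "real \<Rightarrow> (real \<Rightarrow> complex) \<Rightarrow> real \<Rightarrow> complex" where
  "half_ext e f x = indicator {0..} (e * x) *\<^sub>R f (e * x)"

definition emb :: "real \<Rightarrow> (real \<Rightarrow> complex) \<Rightarrow> L2R" where
  "emb e f = abs_L2R (half_ext e f)"

lemma sq_integrable_half_ext:
  assumes "\<bar>e\<bar> = 1" "sq_integrable_on f {0..}"
  shows "sq_integrable (half_ext e f)"
  using sq_integrable_reflect[OF assms(1)] assms(2) unfolding half_ext_def[abs_def] sq_integrable_on_iff by fast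

lemma emb_combine:
  assumes e: "\<bar>e\<bar> = 1" and f: "sq_integrable_on f {0..}" and g: "sq_integrable_on g {0..}"
  shows "emb e (\<lambda>x. a * f x + b * g x) = scaleC a (emb e f) + scaleC b (emb e g)"
proof -
  have "half_ext e (\<lambda>x. a * f x + b * g x) = (\<lambda>x. a * half_ext e f x + b * half_ext e g x)"
    by (auto simp: half_ext_def indicator_def)
  then show ?thesis
    unfolding emb_def abs_L2R_scaleC[OF sq_integrable_half_ext[OF e f]] abs_L2R_scaleC[OF sq_integrable_half_ext[OF e g]]
    by (simp add: abs_L2R_add sq_integrable_scale sq_integrable_half_ext e f g)
qed

lemma emb_add: "\<bar>e\<bar> = 1 \<Longrightarrow> sq_integrable_on f {0..} \<Longrightarrow> sq_integrable_on g {0..} \<Longrightarrow>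
    emb e (\<lambda>x. f x + g x) = emb e f + emb e g"
  using emb_combine[of e f g 1 1] by simp

lemma emb_scale: "\<bar>e\<bar> = 1 \<Longrightarrow> sq_integrable_on f {0..} \<Longrightarrow> emb e (\<lambda>x. a * f x) = scaleC a (emb e f)"
  using emb_combine[of e f f a 0] by simp


lemma cinner_emb:
  assumes e: "\<bar>e\<bar> = 1" and f: "sq_integrable_on f {0..}" and g: "sq_integrable_on g {0..}"
  shows "cinner (emb e f) (emb e g) = (LINT t:{0..}|lborel. f t * cnj (g t))"
proof -
  have "(\<lambda>x. half_ext e f x * cnj (half_ext e g x)) = (\<lambda>x. (\<lambda>t. indicator {0..} t *\<^sub>R (f t * cnj (g t))) (e * x))"
    by (auto simp: half_ext_def indicator_def)
  then show ?thesis
    unfolding emb_def cinner_abs[OF sq_integrable_half_ext[OF e f] sq_integrable_half_ext[OF e g]] set_lebesgue_integral_def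
    using LINT_reflect[OF e, of "\<lambda>t. indicator {0..} t *\<^sub>R (f t * cnj (g t))"] by (simp only:)
qed

lemma emb_eq_0:
  assumes e: "\<bar>e\<bar> = 1" and y: "continuous_on {0..} y" "sq_integrable_on y {0..}" and 0: "emb e y = 0" and x: "0 \<le> x"
  shows "y x = 0"
proof -
  have "complex_of_real (LINT t:{0..}|lborel. (cmod (y t))\<^sup>2) = (LINT t:{0..}|lborel. y t * cnj (y t))"
    unfolding complex_norm_square[symmetric] of_real_power[symmetric] set_lebesgue_integral_def
    by (subst integral_complex_of_real[symmetric]) (simp add: scaleR_conv_of_real)
  also have "\<dots> = 0" using cinner_emb[OF e y(2) y(2)] 0 by simp
  finally have "(LINT t:{0..}|lborel. (cmod (y t))\<^sup>2) = 0" by simp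
  then have le: "integral {0..x + 1} (\<lambda>t. (cmod (y t))\<^sup>2) \<le> 0" using sq_integral_le(2)[OF y(2), of "x + 1"] by simp
  have c: "continuous_on {0..x + 1} (\<lambda>t. (cmod (y t))\<^sup>2)"
    by (intro continuous_intros continuous_on_subset[OF y(1)]) auto
  have "0 \<le> integral {0..x + 1} (\<lambda>t. (cmod (y t))\<^sup>2)"
    by (intro Henstock_Kurzweil_Integration.integral_nonneg integrable_continuous_real c) simp
  then have "integral {0..x + 1} (\<lambda>t. (cmod (y t))\<^sup>2) = 0" using le by simp
  then show ?thesis using integral_eq_0_iff[OF c] x by force
qed

lemma emb_neq_0:
  assumes q: "continuous_on UNIV q" and e: "\<bar>e\<bar> = 1" and y: "SL_pair q y v h" "sq_integrable_on y {0..}" "v 0 \<noteq> 0"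
  shows "emb e y \<noteq> 0"
proof
  assume "emb e y = 0"
  then have z: "y x = 0" if "0 \<le> x" for x using emb_eq_0[OF e SL_pair_continuous[OF y(1)] y(2)] that by simp
  have "((\<lambda>x. 0) has_vector_derivative v 0) (at 0 within {0..})"
    by (rule has_vector_derivative_transform[OF _ _ SL_pairD(1)[OF y(1)]]) (use z in auto)
  then have "((\<lambda>x. 0) has_vector_derivative v 0) (at 0 within cbox 0 1)"
    by (rule has_vector_derivative_within_subset) auto
  moreover have "((\<lambda>x. 0 :: complex) has_vector_derivative 0) (at 0 within cbox 0 (1 :: real))"
    by (rule has_vector_derivative_const)
  ultimately have "v 0 = 0"
    by (rule vector_derivative_unique_within_closed_interval[of 0 1 0, rotated 2]) auto
  then show False using y(3) by simp
qed

lemma emb_orthogonal: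
  assumes f: "sq_integrable_on f {0..}" and g: "sq_integrable_on g {0..}"
  shows "cinner (emb 1 f) (emb (- 1) g) = 0"
proof -
  have "AE x in lborel. half_ext 1 f x * cnj (half_ext (- 1) g x) = 0"
    using AE_lborel_neq[of 0] by eventually_elim (auto simp: half_ext_def indicator_def)
  then have "(LINT x|lborel. half_ext 1 f x * cnj (half_ext (- 1) g x)) = 0"
    by (rule integral_eq_zero_AE)
  then show ?thesis unfolding emb_def
    by (subst cinner_abs) (auto intro!: sq_integrable_half_ext f g)
qed

lemma sq_integrable_on_reflect:
  assumes "\<bar>e\<bar> = 1" "sq_integrable f"
  shows "sq_integrable_on (\<lambda>x. f (e * x)) {0..}"
  unfolding sq_integrable_on_iff scaleR_conv_of_real
  by (rule sq_integrable_bounded_mult[OF sq_integrable_reflect[OF assms], of _ 1]) (auto simp: indicator_def)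

lemma abs_L2R_split:
  assumes f: "sq_integrable f"
  shows "abs_L2R f = emb 1 f + emb (- 1) (\<lambda>x. f (- x))"
proof -
  have sq: "sq_integrable (half_ext 1 f)" "sq_integrable (half_ext (- 1) (\<lambda>x. f (- x)))"
    using sq_integrable_on_reflect[OF _ f, of 1] sq_integrable_on_reflect[OF _ f, of "- 1"]
    by (auto intro!: sq_integrable_half_ext)
  show ?thesis
    unfolding emb_def abs_L2R_add[OF sq] abs_L2R_eq_iff[OF f sq_integrable_add[OF sq]]
    using AE_lborel_neq[of 0] by eventually_elim (auto simp: half_ext_def indicator_def)
qed

lemma mult_sgn_emb:
  assumes f: "sq_integrable_on f {0..}" and g: "sq_integrable_on g {0..}"
  shows "mult_sgn (emb 1 f + emb (- 1) g) = emb 1 f - emb (- 1) g"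
proof -
  have sq: "sq_integrable (half_ext 1 f)" "sq_integrable (half_ext (- 1) g)"
    by (intro sq_integrable_half_ext f g; simp)+
  define k where "k x = half_ext 1 f x + half_ext (- 1) g x" for x
  have k: "sq_integrable k" unfolding k_def by (rule sq_integrable_add[OF sq])
  have sk: "sq_integrable (\<lambda>x. complex_of_real (sgn x) * k x)"
    by (rule sq_integrable_bounded_mult[OF k, of _ 1]) (auto simp: sgn_if)
  have "mult_sgn (abs_L2R k) = abs_L2R (\<lambda>x. complex_of_real (sgn x) * k x)"
    using k by (simp add: mult_sgn.abs_eq L2_eq_def)
  also have "\<dots> = abs_L2R (\<lambda>x. half_ext 1 f x - half_ext (- 1) g x)"
    unfolding abs_L2R_eq_iff[OF sk sq_integrable_diff[OF sq]]
    using AE_lborel_neq[of 0]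
    by eventually_elim (auto simp: k_def half_ext_def indicator_def sgn_if)
  finally show ?thesis unfolding emb_def k_def abs_L2R_add[OF sq] abs_L2R_diff[OF sq] .
qed

subsection \<open>The boundary relations of the half-lines\<close>

text \<open>For \<open>e = -1\<close> the left half-line is parametrized by \<open>[0, \<infinity>)\<close>; the factor \<open>e\<close> turns \<open>v 0\<close> into
  the derivative at 0 of the reflected function, and \<open>h\<close> into its product with \<open>sgn x\<close>.\<close>

definition half_relation :: "real \<Rightarrow> (real \<Rightarrow> real) \<Rightarrow> (L2R \<times> L2R \<times> complex \<times> complex) set" where
  "half_relation e q = {(emb e y, scaleC (of_real e) (emb e h), y 0, of_real e * v 0) |y v h. SL_half.max_dom q y v h}"

definition half_space :: "real \<Rightarrow> L2R set" where
  "half_space e = {emb e f |f. sq_integrable_on f {0..}}"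

lemma half_spaceI: "g = emb e f \<Longrightarrow> sq_integrable_on f {0..} \<Longrightarrow> g \<in> half_space e"
  unfolding half_space_def by blast

context SL_limit_point
begin

lemma half_relationI:
  "max_dom y v h \<Longrightarrow> (emb e y, scaleC (of_real e) (emb e h), y 0, of_real e * v 0) \<in> half_relation e q"
  unfolding half_relation_def by blast

lemma max_dom_combine:
  assumes "max_dom y1 v1 h1" "max_dom y2 v2 h2"
  shows "max_dom (\<lambda>x. a * y1 x + b * y2 x) (\<lambda>x. a * v1 x + b * v2 x) (\<lambda>x. a * h1 x + b * h2 x)"
  using assms unfolding max_dom_def by (auto intro: SL_pair_combine[OF q] sq_integrable_on_combine)

text \<open>For \<open>e = -1\<close> the image carries the factor \<open>-1\<close>, so the
  spectral parameter on the half-line is \<open>e * z\<close>; \<open>c\<close> is \<open>e\<close>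
  as a complex number, and \<open>c * c = 1\<close> moves the factor from one side to the
  other.\<close>

lemma boundary_relation_half:
  assumes e: "\<bar>e\<bar> = 1"
  shows "boundary_relation (half_space e) (half_relation e q) (\<lambda>z. of_real e * weyl_m_plus q (of_real e * z))"
proof -
  define c where "c = complex_of_real e"
  have c: "c * c = 1" "cnj c = c" using e by (auto simp: c_def abs_if split: if_splits)
  have cc: "c * (c * x) = x" for x using c(1) by (simp flip: mult.assoc)
  have ee: "emb e (\<lambda>_. 0) = 0"
    using emb_scale[OF e, of "\<lambda>_. 0" 0] by (simp add: sq_integrable_on_iff sq_integrable_zero)
  have z0: "max_dom (\<lambda>_. 0) (\<lambda>_. 0) (\<lambda>_. 0)"
    using max_dom_combine[OF max_dom_\<psi>\<^sub>0 max_dom_\<psi>\<^sub>0, of 0 0] by simp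
  show ?thesis
    unfolding c_def[symmetric]
  proof
    show "0 \<in> half_space e" by (rule half_spaceI[OF ee[symmetric]]) (simp add: sq_integrable_on_iff sq_integrable_zero)
    show "f + g \<in> half_space e" if "f \<in> half_space e" "g \<in> half_space e" for f g
    proof -
      from that obtain u w where "f = emb e u" "sq_integrable_on u {0..}" "g = emb e w" "sq_integrable_on w {0..}"
        unfolding half_space_def by blast
      then show ?thesis
        using emb_add[OF e, of u w] sq_integrable_on_combine[of u _ w 1 1]
        by (intro half_spaceI[of _ e "\<lambda>x. u x + w x"]) simp_all
    qed
    show "scaleC a f \<in> half_space e" if "f \<in> half_space e" for a f
    proof -
      from that obtain u where "f = emb e u" "sq_integrable_on u {0..}"
        unfolding half_space_def by blast
      then show ?thesis
        using emb_scale[OF e, of u a] sq_integrable_on_scale[of u _ a]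
        by (intro half_spaceI[of _ e "\<lambda>x. a * u x"]) simp_all
    qed
    show "(0, 0, 0, 0) \<in> half_relation e q"
      using half_relationI[OF z0, of e] by (simp add: ee)
  next
    fix f h a b f' h' a' b' assume "(f, h, a, b) \<in> half_relation e q" "(f', h', a', b') \<in> half_relation e q"
    then obtain y v k y' v' k' where 1: "max_dom y v k" "f = emb e y" "h = scaleC c (emb e k)" "a = y 0" "b = c * v 0"
      and 2: "max_dom y' v' k'" "f' = emb e y'" "h' = scaleC c (emb e k')" "a' = y' 0" "b' = c * v' 0"
      unfolding half_relation_def c_def by blast
    have sq: "sq_integrable_on y {0..}" "sq_integrable_on k {0..}" "sq_integrable_on y' {0..}" "sq_integrable_on k' {0..}"
      using 1(1) 2(1) by (auto simp: max_dom_def)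
    show "(f + f', h + h', a + a', b + b') \<in> half_relation e q"
      using half_relationI[OF max_dom_combine[OF 1(1) 2(1), of 1 1], of e]
      by (simp add: 1(2-) 2(2-) emb_add[OF e] sq L2R.scale_right_distrib distrib_left c_def)
    show "cinner h f' - cinner f h' = b * cnj a' - a * cnj b'"
    proof -
      have "cinner h f' - cinner f h' = c * ((LINT t:{0..}|lborel. k t * cnj (y' t)) - (LINT t:{0..}|lborel. y t * cnj (k' t)))"
        unfolding 1(2,3) 2(2,3) by (simp add: cinner_simps cinner_emb[OF e] sq c right_diff_distrib)
      also have "\<dots> = c * (v 0 * cnj (y' 0) - y 0 * cnj (v' 0))" unfolding green_identity[OF 1(1) 2(1)] ..
      finally show ?thesis by (simp add: 1(4,5) 2(4,5) c right_diff_distrib mult_ac)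
    qed
  next
    fix f h a b d assume "(f, h, a, b) \<in> half_relation e q"
    then obtain y v k where 1: "max_dom y v k" "f = emb e y" "h = scaleC c (emb e k)" "a = y 0" "b = c * v 0"
      unfolding half_relation_def c_def by blast
    have sq: "sq_integrable_on y {0..}" "sq_integrable_on k {0..}" using 1(1) by (auto simp: max_dom_def)
    show "(scaleC d f, scaleC d h, d * a, d * b) \<in> half_relation e q"
      using half_relationI[OF max_dom_combine[OF 1(1) 1(1), of d 0], of e]
      by (simp add: 1(2-) emb_scale[OF e] sq c_def mult_ac)
    show "f \<in> half_space e \<and> h \<in> half_space e"
      unfolding 1(2,3) emb_scale[OF e sq(2), symmetric]
      by (intro conjI half_spaceI[OF refl] sq_integrable_on_scale sq)
  next
    fix z g assume z: "Im z \<noteq> 0" and "g \<in> half_space e"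
    then obtain u where u: "sq_integrable_on u {0..}" "g = emb e u" unfolding half_space_def by blast
    have "Im (c * z) \<noteq> 0" using z e by (auto simp: c_def)
    \<comment> \<open>The equation c h = g + z y, multiplied by \<open>c\<close>, becomes a Neumann
      problem at the point \<open>c * z\<close> with data \<open>c * u\<close>.\<close>
    then obtain y v where y: "SL_pair q y v (\<lambda>x. c * u x + c * z * y x)" "v 0 = 0" "sq_integrable_on y {0..}"
      using neumann_solvable[OF _ sq_integrable_on_scale[OF u(1), of c]] by blast
    have D: "max_dom y v (\<lambda>x. c * u x + (c * z) * y x)"
      unfolding max_dom_def using y u by (auto intro: sq_integrable_on_combine)
    have "scaleC c (emb e (\<lambda>x. c * u x + (c * z) * y x)) = g + scaleC z (emb e y)"
      unfolding emb_combine[OF e u(1) y(3)] u(2) by (simp add: L2R.scale_right_distrib c cc)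
    then show "\<exists>f a. (f, g + scaleC z f, a, 0) \<in> half_relation e q"
      using half_relationI[OF D, of e] y(2) by (auto simp: c_def)
  next
    fix z assume "Im z \<noteq> 0"
    then have z: "Im (c * z) \<noteq> 0" using e by (auto simp: c_def)
    define m where "m = weyl_m_plus q (c * z)"
    define y where "y = \<psi> (c * z) m"
    have D: "max_dom y (\<psi>' (c * z) m) (\<lambda>x. (c * z) * y x)"
      unfolding y_def m_def by (rule max_dom_weyl[OF z])
    \<comment> \<open>The Weyl solution has derivative 1 at 0, while the second boundary value
      carries a factor \<open>c\<close>; scaling by \<open>c\<close> normalises it to 1 and gives
      the first boundary value \<open>- c * m\<close>.\<close>
    have D': "max_dom (\<lambda>x. c * y x) (\<lambda>x. c * \<psi>' (c * z) m x) (\<lambda>x. c * ((c * z) * y x))"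
      using max_dom_combine[OF D D, of c 0] by simp
    have sq: "sq_integrable_on y {0..}" using D by (simp add: max_dom_def)
    have "emb e y \<noteq> 0"
      by (rule emb_neq_0[OF q e _ sq]) (use D in \<open>auto simp: max_dom_def\<close>)
    then have ne: "emb e (\<lambda>x. c * y x) \<noteq> 0" using e by (simp add: emb_scale[OF e sq] c_def)
    have k: "emb e (\<lambda>x. c * ((c * z) * y x)) = scaleC z (emb e y)"
      using emb_scale[OF e sq, of z] by (simp add: cc mult.assoc)
    have "scaleC c (emb e (\<lambda>x. c * ((c * z) * y x))) = scaleC z (emb e (\<lambda>x. c * y x))"
      unfolding k emb_scale[OF e sq] by (simp add: mult.commute)
    then have "(emb e (\<lambda>x. c * y x), scaleC z (emb e (\<lambda>x. c * y x)), - (c * m), 1) \<in> half_relation e q"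
      using half_relationI[OF D', of e] by (simp add: c_def[symmetric] cc c y_def)
    then show "\<exists>p. p \<noteq> 0 \<and> (p, scaleC z p, - (c * weyl_m_plus q (c * z)), 1) \<in> half_relation e q"
      using ne unfolding m_def by blast
  qed
qed

end

subsection \<open>Uniqueness almost everywhere\<close>

text \<open>The rays form an intersection-stable generator of the Borel sets, and the sets over
  which the integral vanishes are closed under complements and countable disjoint unions.\<close>

lemma AE_zero_of_tail_integrals:
  fixes f :: "real \<Rightarrow> 'a::{banach,second_countable_topology}"
  assumes f: "integrable lborel f" and 0: "(LINT x|lborel. f x) = 0" "\<And>a. (LINT x:{a<..}|lborel. f x) = 0"
  shows "AE x in lborel. f x = 0"
proof (rule sigma_finite_measure.density_zero[OF lborel.sigma_finite_measure_axioms f])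
  fix A :: "real set" assume "A \<in> sets lborel"
  then have A: "A \<in> sigma_sets UNIV (range greaterThan)" by (simp add: borel_Ioi)
  have si: "set_integrable lborel B f" if "B \<in> sets borel" for B
    using integrable_mult_indicator[OF _ f, of B] that by (simp add: set_integrable_def)
  have st: "Int_stable (range (greaterThan :: real \<Rightarrow> _))"
    by (auto simp: Int_stable_def lessThan_Int_lessThan)
  have b: "B \<in> sets borel" if "B \<in> sigma_sets UNIV (range greaterThan)" for B :: "real set"
    using that by (simp add: borel_Ioi)
  have "range greaterThan \<subseteq> Pow (UNIV :: real set)" by simp
  from st this A show "set_lebesgue_integral lborel A f = 0"
  proof (induct rule: sigma_sets_induct_disjoint)
    case (compl B)
    have B: "B \<in> sets borel" using b compl(1) by blast
    have "(LINT x:UNIV|lborel. f x) = (LINT x:(UNIV - B)|lborel. f x) + (LINT x:B|lborel. f x)"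
      using set_integral_Un[OF _ si si, of "UNIV - B" B] B by (auto simp: Un_commute)
    then show ?case using compl(2) 0(1) by (simp add: set_lebesgue_integral_def)
  next
    case (union B)
    have B: "B i \<in> sets borel" for i using b union(2) by blast
    have "(LINT x:(\<Union>i. B i)|lborel. f x) = (\<Sum>i. (LINT x:(B i)|lborel. f x))"
      by (rule lebesgue_integral_countable_add) (use B union(1) si in \<open>auto simp: disjoint_family_on_def\<close>)
    then show ?case using union(3) by simp
  qed (use 0 in \<open>auto simp: set_lebesgue_integral_def\<close>)
qed

lemma AE_zero_of_interval_integrals:
  fixes f :: "real \<Rightarrow> 'a::{banach,second_countable_topology}"
  assumes f: "\<And>a b. a \<le> b \<Longrightarrow> set_integrable lborel {a..b} f" and 0: "\<And>a b. a \<le> b \<Longrightarrow> (LINT x:{a..b}|lborel. f x) = 0"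
  shows "AE x in lborel. f x = 0"
proof -
  have "AE x in lborel. indicator {- real n..real n} x *\<^sub>R f x = 0" for n
  proof (rule AE_zero_of_tail_integrals)
    show "integrable lborel (\<lambda>x. indicator {- real n..real n} x *\<^sub>R f x)"
      using f[of "- real n" "real n"] by (simp add: set_integrable_def)
    show "(LINT x|lborel. indicator {- real n..real n} x *\<^sub>R f x) = 0"
      using 0[of "- real n" "real n"] by (simp add: set_lebesgue_integral_def)
    fix a :: real
    \<comment> \<open>The ray meets the interval in \<open>{c..real n}\<close>, up to the single
      point \<open>c\<close>.\<close>
    define c where "c = max a (- real n)"
    show "(LINT x:{a<..}|lborel. indicator {- real n..real n} x *\<^sub>R f x) = 0"
    proof (cases "c \<le> real n")
      case False
      then have "(\<lambda>x. indicator {a<..} x *\<^sub>R indicator {- real n..real n} x *\<^sub>R f x) = (\<lambda>_. 0)"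
        by (auto simp: indicator_def c_def)
      then show ?thesis unfolding set_lebesgue_integral_def by (simp only: Bochner_Integration.integral_zero)
    next
      case True
      have si: "set_integrable lborel {c..real n} f" by (rule f[OF True])
      have si': "set_integrable lborel {c<..real n} f" by (rule set_integrable_subset[OF si]) auto
      have "(LINT x:{a<..}|lborel. indicator {- real n..real n} x *\<^sub>R f x) = (LINT x|lborel. indicator {a<..} x *\<^sub>R indicator {- real n..real n} x *\<^sub>R f x)"
        by (simp add: set_lebesgue_integral_def)
      also have "\<dots> = (LINT x|lborel. indicator {c..real n} x *\<^sub>R f x)"
      proof (rule Bochner_Integration.integral_cong_AE)
        have e: "(\<lambda>x. indicator {a<..} x *\<^sub>R indicator {- real n..real n} x *\<^sub>R f x) = (\<lambda>x. indicator {a<..} x *\<^sub>R (indicator {- real n..real n} x *\<^sub>R f x))"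
          by simp
        show "(\<lambda>x. indicator {c..real n} x *\<^sub>R f x) \<in> borel_measurable lborel"
          using si unfolding set_integrable_def by (rule borel_measurable_integrable)
        have "(\<lambda>x. indicator {- real n..real n} x *\<^sub>R f x) \<in> borel_measurable lborel"
          using f[of "- real n" "real n"] unfolding set_integrable_def by (simp add: borel_measurable_integrable)
        then show "(\<lambda>x. indicator {a<..} x *\<^sub>R indicator {- real n..real n} x *\<^sub>R f x) \<in> borel_measurable lborel"
          by (rule borel_measurable_scaleR[rotated]) simp
        show "AE x in lborel. indicator {a<..} x *\<^sub>R indicator {- real n..real n} x *\<^sub>R f x = indicator {c..real n} x *\<^sub>R f x"
          using AE_lborel_neq[of c] by eventually_elim (auto simp: indicator_def c_def)
      qed
      also have "\<dots> = 0" using 0[OF True] by (simp add: set_lebesgue_integral_def)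
      finally show ?thesis .
    qed
  qed
  then have "AE x in lborel. \<forall>n. indicator {- real n..real n} x *\<^sub>R f x = 0" unfolding AE_all_countable by blast
  then show ?thesis
  proof eventually_elim
    case (elim x)
    obtain n where "\<bar>x\<bar> \<le> real n" using real_arch_simple by blast
    then show ?case using elim[rule_format, of n] by (auto simp: indicator_def abs_le_iff)
  qed
qed

lemma continuous_AE_eq:
  fixes f g :: "real \<Rightarrow> 'a::real_normed_vector"
  assumes U: "open U" and f: "continuous_on U f" and g: "continuous_on U g"
    and ae: "AE x in lborel. x \<in> U \<longrightarrow> f x = g x" and x: "x \<in> U"
  shows "f x = g x"
proof (rule ccontr)
  assume ne: "f x \<noteq> g x"
  define V where "V = U \<inter> (\<lambda>x. f x - g x) -` (- {0})"
  have "open V" unfolding V_def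
    by (rule continuous_open_preimage[OF _ U]) (auto intro!: continuous_intros f g)
  moreover have "x \<in> V" using ne x by (simp add: V_def)
  moreover have "negligible V"
  proof -
    have "AE x in lborel. x \<notin> V" using ae by eventually_elim (auto simp: V_def)
    then have "V \<in> null_sets lborel" using \<open>open V\<close> by (simp add: AE_iff_null_sets)
    then show ?thesis by (simp add: negligible_iff_null_sets null_sets_completionI)
  qed
  ultimately show False using open_not_negligible by blast
qed

lemma sq_integrable_continuous_AE:
  assumes y: "continuous_on UNIV y" and ae: "AE x in lborel. rep_L2R f x = y x"
  shows "sq_integrable y" "f = abs_L2R y"
proof -
  have m: "y \<in> borel_measurable lborel" using y by (simp add: borel_measurable_continuous_onI)
  show sq: "sq_integrable y"
    unfolding sq_integrable_def
  proof (intro conjI m)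
    show "integrable lborel (\<lambda>x. (cmod (y x))\<^sup>2)"
    proof (rule integrable_cong_AE_imp)
      show "integrable lborel (\<lambda>x. (cmod (rep_L2R f x))\<^sup>2)" using sq_integrable_rep[of f] by (simp add: sq_integrable_def)
      show "(\<lambda>x. (cmod (y x))\<^sup>2) \<in> borel_measurable lborel" using m by measurable
      show "AE x in lborel. (cmod (rep_L2R f x))\<^sup>2 = (cmod (y x))\<^sup>2" using ae by eventually_elim simp
    qed
  qed
  show "f = abs_L2R y"
    using abs_L2R_eq_iff[OF sq_integrable_rep sq] ae abs_rep_L2R by metis
qed

subsection \<open>The operator on the line and its restrictions to the half-lines\<close>

text \<open>The second derivative is only determined almost everywhere; this replaces it by the
  version given by the chosen representative of \<open>h\<close>, after which no further null sets
  occur in it.\<close>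

lemma SL_operator_obtain:
  assumes q: "continuous_on UNIV q" and fh: "(f, h) \<in> SL_operator q"
  obtains y v where "\<And>x. (y has_vector_derivative v x) (at x)" "AE x in lborel. rep_L2R f x = y x"
    "has_AC_derivative v (\<lambda>x. of_real (q x) * y x - rep_L2R h x)"
proof -
  obtain y v w where 1: "\<And>x. (y has_vector_derivative v x) (at x)" "has_AC_derivative v w"
    "AE x in lborel. rep_L2R f x = y x" "AE x in lborel. rep_L2R h x = - w x + complex_of_real (q x) * y x"
    using fh unfolding SL_operator_def by blast
  let ?w = "\<lambda>x. of_real (q x) * y x - rep_L2R h x"
  have y: "continuous_on UNIV y"
    using 1(1) by (intro continuous_on_vector_derivative[where f' = v]) simp
  have "continuous_on UNIV (\<lambda>x. complex_of_real (q x) * y x)" by (intro continuous_intros q y)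
  then have "(\<lambda>x. complex_of_real (q x) * y x) \<in> borel_measurable lborel"
    by (simp add: borel_measurable_continuous_onI)
  then have m: "?w \<in> borel_measurable lborel"
    using sq_integrable_rep[of h] by (intro borel_measurable_diff) (auto simp: sq_integrable_def)
  have ae: "AE x in lborel. indicator {a..b} x *\<^sub>R w x = indicator {a..b} x *\<^sub>R ?w x" for a b :: real
    using 1(4) by eventually_elim simp
  have "has_AC_derivative v ?w"
    unfolding has_AC_derivative_def
  proof (intro allI impI)
    fix a b :: real assume ab: "a \<le> b"
    have w: "set_integrable lborel {a..b} w" "v b - v a = (LINT x:{a..b}|lborel. w x)"
      using 1(2) ab unfolding has_AC_derivative_def by blast+
    have m2: "(\<lambda>x. indicator {a..b} x *\<^sub>R w x) \<in> borel_measurable lborel"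
      using w(1) unfolding set_integrable_def by (rule borel_measurable_integrable)
    have m1: "(\<lambda>x. indicator {a..b} x *\<^sub>R ?w x) \<in> borel_measurable lborel"
      by (rule borel_measurable_scaleR[OF _ m]) simp
    show "set_integrable lborel {a..b} ?w \<and> v b - v a = (LINT x:{a..b}|lborel. ?w x)"
      using integrable_cong_AE[OF m2 m1 ae] Bochner_Integration.integral_cong_AE[OF m2 m1 ae] w
      unfolding set_integrable_def set_lebesgue_integral_def by simp
  qed
  then show ?thesis using that 1 by blast
qed

lemma SL_operator_restrict:
  assumes q: "continuous_on UNIV q" and e: "\<bar>e\<bar> = 1"
    and y: "\<And>x. (y has_vector_derivative v x) (at x)" "AE x in lborel. rep_L2R f x = y x"
    and v: "has_AC_derivative v (\<lambda>x. of_real (q x) * y x - rep_L2R h x)"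
  shows "SL_half.max_dom (\<lambda>x. q (e * x)) (\<lambda>x. y (e * x)) (\<lambda>x. of_real e * v (e * x)) (\<lambda>x. rep_L2R h (e * x))"
proof -
  have cq: "continuous_on UNIV (\<lambda>x. q (e * x))"
    by (rule continuous_on_compose2[OF q]) (auto intro!: continuous_intros)
  interpret SL_half "\<lambda>x. q (e * x)" by unfold_locales (rule cq)
  let ?W = "\<lambda>x. of_real (q x) * y x - rep_L2R h x"
  have cy: "continuous_on UNIV y"
    using y(1) by (intro continuous_on_vector_derivative[where f' = v]) simp
  have sy: "sq_integrable y" by (rule sq_integrable_continuous_AE[OF cy y(2)])
  have li: "loc_integrable (\<lambda>x. rep_L2R h (e * x))"
    by (intro sq_integrable_loc_integrable sq_integrable_on_reflect e sq_integrable_rep)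
  have liW: "loc_integrable (\<lambda>t. of_real (q (e * t)) * y (e * t) - rep_L2R h (e * t))"
    by (intro loc_integrable_diff loc_integrable_continuous continuous_on_mult continuous_on_complex_of_real li
        continuous_on_subset[OF cq] continuous_on_compose2[OF cy]) (auto intro!: continuous_intros)
  have AC: "of_real e * v (e * x) = of_real e * v (e * 0) + integral {0..x} (\<lambda>t. of_real (q (e * t)) * y (e * t) - rep_L2R h (e * t))"
    if x: "0 \<le> x" for x
  proof -
    have "of_real e * (v (e * x) - v 0) = (LINT t:{0..x}|lborel. ?W (e * t))"
    proof (cases "e = 1")
      case True
      then show ?thesis using v x unfolding has_AC_derivative_def by simp
    next
      case False
      then have e1: "e = - 1" using e by (auto simp: abs_if split: if_splits)
      have "v 0 - v (- x) = (LINT t:{- x..0}|lborel. ?W t)"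
        using v x unfolding has_AC_derivative_def by simp
      also have "\<dots> = (LINT t|lborel. indicator {- x..0} (- 1 * t) *\<^sub>R ?W (- 1 * t))"
        unfolding set_lebesgue_integral_def
        by (rule LINT_reflect[symmetric, of "- 1" "\<lambda>t. indicator {- x..0} t *\<^sub>R ?W t"]) simp
      also have "(\<lambda>t. indicator {- x..0} (- 1 * t) *\<^sub>R ?W (- 1 * t)) = (\<lambda>t. indicator {0..x} t *\<^sub>R ?W (- 1 * t))"
        by (auto simp: indicator_def)
      finally show ?thesis using e1 by (simp add: set_lebesgue_integral_def)
    qed
    then show ?thesis unfolding loc_integrable_LINT[OF liW order_refl] by (simp add: algebra_simps)
  qed
  have der: "((\<lambda>x. y (e * x)) has_vector_derivative of_real e * v (e * x)) (at x within {0..})" for x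
  proof -
    have "((\<lambda>x. e * x) has_vector_derivative e) (at x)" by (auto intro!: derivative_eq_intros)
    from vector_diff_chain_at[OF this y(1)[of "e * x"]] show ?thesis
      by (simp add: o_def scaleR_conv_of_real has_vector_derivative_at_within)
  qed
  show ?thesis
    unfolding max_dom_def SL_pair_def
    using der li AC sq_integrable_on_reflect[OF e sy] sq_integrable_on_reflect[OF e sq_integrable_rep] by blast
qed

lemma has_AC_derivative_split:
  assumes pos: "\<And>x. 0 \<le> x \<Longrightarrow> set_integrable lborel {0..x} w \<and> v x - v 0 = (LINT t:{0..x}|lborel. w t)"
    and neg: "\<And>x. 0 \<le> x \<Longrightarrow> set_integrable lborel {- x..0} w \<and> v 0 - v (- x) = (LINT t:{- x..0}|lborel. w t)"
  shows "has_AC_derivative v w"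
  unfolding has_AC_derivative_def
proof (intro allI impI)
  fix a b :: real assume ab: "a \<le> b"
  define X where "X = max \<bar>a\<bar> \<bar>b\<bar>"
  have X: "0 \<le> X" "- X \<le> a" "b \<le> X" using ab by (auto simp: X_def)
  have si: "set_integrable lborel {- X..X} w"
    using set_integrable_Un[of lborel "{- X..0}" w "{0..X}"] pos[OF X(1)] neg[OF X(1)] X(1)
    by (simp add: ivl_disj_un_two_touch)
  have si': "set_integrable lborel {c..d} w" if "- X \<le> c" "d \<le> X" for c d
    by (rule set_integrable_subset[OF si]) (use that in auto)
  note HK = set_borel_integral_eq_integral[OF si']
  have 0: "v t - v (- X) = integral {- X..t} w" if t: "- X \<le> t" "t \<le> X" for t
  proof (cases "0 \<le> t")
    case True
    have "integral {- X..t} w = integral {- X..0} w + integral {0..t} w"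
      by (rule Henstock_Kurzweil_Integration.integral_combine[symmetric]) (use True X(1) t HK(1) in auto)
    moreover have "v t - v (- X) = (v 0 - v (- X)) + (v t - v 0)" by simp
    ultimately show ?thesis using pos[OF True] neg[OF X(1)] HK(2)[of "- X" 0] HK(2)[of 0 t] X(1) t
      by (simp del: diff_add_cancel)
  next
    case False
    have "integral {- X..0} w = integral {- X..t} w + integral {t..0} w"
      by (rule Henstock_Kurzweil_Integration.integral_combine[symmetric]) (use False X(1) t HK(1) in auto)
    then show ?thesis using neg[of "- t"] neg[OF X(1)] HK(2)[of "- X" 0] HK(2)[of t 0] X(1) t False
      by (simp add: algebra_simps)
  qed
  have "integral {- X..b} w = integral {- X..a} w + integral {a..b} w"
    by (rule Henstock_Kurzweil_Integration.integral_combine[symmetric]) (use X ab HK(1) in auto)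
  then have "v b - v a = integral {a..b} w" using 0[of a] 0[of b] X ab by (simp add: algebra_simps)
  then show "set_integrable lborel {a..b} w \<and> v b - v a = (LINT t:{a..b}|lborel. w t)"
    using si'[of a b] HK(2)[of a b] X by simp
qed

definition glue :: "(real \<Rightarrow> complex) \<Rightarrow> (real \<Rightarrow> complex) \<Rightarrow> real \<Rightarrow> complex" where
  "glue f g x = (if x \<in> {0..} then f x else g (- x))"

lemma emb_glue:
  assumes f: "sq_integrable_on f {0..}" and g: "sq_integrable_on g {0..}"
  shows "AE x in lborel. rep_L2R (emb 1 f + emb (- 1) g) x = glue f g x"
proof -
  have sq: "sq_integrable (half_ext 1 f)" "sq_integrable (half_ext (- 1) g)"
    by (intro sq_integrable_half_ext f g; simp)+
  show ?thesis
    unfolding emb_def abs_L2R_add[OF sq]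
    using rep_abs_L2R[OF sq_integrable_add[OF sq]] AE_lborel_neq[of 0]
    by eventually_elim (auto simp: half_ext_def glue_def indicator_def)
qed

text \<open>The two matching conditions make the glued function differentiable at 0 with the glued
  derivative, so that increments of the derivative add up across 0.\<close>

lemma SL_operator_glue:
  assumes q: "continuous_on UNIV q" and 1: "SL_half.max_dom q y1 v1 h1"
    and 2: "SL_half.max_dom (\<lambda>x. q (- x)) y2 v2 h2" and 0: "y1 0 = y2 0" "v1 0 = - v2 0"
  shows "(emb 1 y1 + emb (- 1) y2, emb 1 h1 + emb (- 1) h2) \<in> SL_operator q"
proof -
  have q2: "continuous_on UNIV (\<lambda>x. q (- x))"
    by (rule continuous_on_compose2[OF q]) (auto intro!: continuous_intros)
  interpret h1: SL_half q by unfold_locales (rule q)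
  interpret h2: SL_half "\<lambda>x. q (- x)" by unfold_locales (rule q2)
  have p1: "SL_pair q y1 v1 h1" and p2: "SL_pair (\<lambda>x. q (- x)) y2 v2 h2"
    and sq: "sq_integrable_on y1 {0..}" "sq_integrable_on h1 {0..}" "sq_integrable_on y2 {0..}" "sq_integrable_on h2 {0..}"
    using 1 2 by (auto simp: h1.max_dom_def h2.max_dom_def)
  define y where "y = glue y1 y2"
  define v where "v = glue v1 (\<lambda>x. - v2 x)"
  define h where "h = glue h1 h2"
  define w where "w x = of_real (q x) * y x - h x" for x
  define w1 where "w1 t = of_real (q t) * y1 t - h1 t" for t
  define w2 where "w2 t = of_real (q (- t)) * y2 t - h2 t" for t
  have "(y has_vector_derivative v x) (at x within UNIV)" for x
    unfolding y_def v_def glue_def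
  proof (rule has_vector_derivative_If_within_closures[where T = "{..<0}"])
    show "(y1 has_vector_derivative v1 x) (at x within {0..} \<union> (closure {0..} \<inter> closure {..<0}))"
      if "x \<in> {0..} \<union> (closure {0..} \<inter> closure {..<0})"
      using SL_pairD(1)[OF p1, of x] that by (auto simp: Un_absorb2)
    have c: "{..<0} \<union> (closure {0..} \<inter> closure {..<0}) = {..0 :: real}" by auto
    show "((\<lambda>x. y2 (- x)) has_vector_derivative - v2 (- x)) (at x within {..<0} \<union> (closure {0..} \<inter> closure {..<0}))"
      if "x \<in> {..<0} \<union> (closure {0..} \<inter> closure {..<0})"
    proof -
      have x: "x \<le> 0" using that c by blast
      have "((\<lambda>x. - x) has_vector_derivative - 1) (at x within {..0})" by (auto intro!: derivative_eq_intros)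
      moreover have "(y2 has_vector_derivative v2 (- x)) (at (- x) within uminus ` {..0})"
        using SL_pairD(1)[OF p2, of "- x"] x by simp
      ultimately have "(y2 \<circ> uminus has_vector_derivative - 1 *\<^sub>R v2 (- x)) (at x within {..0})"
        by (rule vector_diff_chain_within)
      then show ?thesis unfolding c by (simp add: o_def)
    qed
  qed (use 0 in auto)
  moreover have "has_AC_derivative v w"
  proof (rule has_AC_derivative_split)
    fix x :: real assume x: "0 \<le> x"
    have l1: "loc_integrable w1" unfolding w1_def[abs_def] by (rule SL_pair_loc_integrable[OF q p1])
    have l2: "loc_integrable w2" unfolding w2_def[abs_def] by (rule SL_pair_loc_integrable[OF q2 p2])
    have e1: "(\<lambda>t. indicator {0..x} t *\<^sub>R w t) = (\<lambda>t. indicator {0..x} t *\<^sub>R w1 t)"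
      by (auto simp: indicator_def w_def w1_def y_def h_def glue_def)
    show "set_integrable lborel {0..x} w \<and> v x - v 0 = (LINT t:{0..x}|lborel. w t)"
      using l1 loc_integrable_LINT[OF l1 order_refl, of x] SL_pairD(3)[OF p1 x] x
      unfolding loc_integrable_def set_integrable_def set_lebesgue_integral_def e1
      by (simp add: v_def glue_def w1_def[abs_def])
    have i: "integrable lborel (\<lambda>t. indicator {0..x} (- 1 * t) *\<^sub>R w2 (- 1 * t))"
      by (rule integrable_reflect) (use l2 in \<open>auto simp: loc_integrable_def set_integrable_def\<close>)
    \<comment> \<open>At 0 itself \<open>w\<close> uses \<open>h1\<close> and \<open>w2\<close> uses
      \<open>h2\<close>, so the two agree only almost everywhere. For the same reason the
      measurability proof below treats the point 0 separately.\<close>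
    have e2: "AE t in lborel. indicator {0..x} (- 1 * t) *\<^sub>R w2 (- 1 * t) = indicator {- x..0} t *\<^sub>R w t"
      using AE_lborel_neq[of 0] by eventually_elim (auto simp: indicator_def w_def w2_def y_def h_def glue_def)
    have m: "(\<lambda>t. indicator {- x..0} t *\<^sub>R w t) \<in> borel_measurable lborel"
    proof -
      have "(\<lambda>t. indicator {..<0} t *\<^sub>R (indicator {0..x} (- 1 * t) *\<^sub>R w2 (- 1 * t)) + indicator {0} t *\<^sub>R w 0) \<in> borel_measurable lborel"
        by (intro borel_measurable_add borel_measurable_scaleR[OF _ borel_measurable_integrable[OF i]] borel_measurable_scaleR) auto
      moreover have "(\<lambda>t. indicator {..<0} t *\<^sub>R (indicator {0..x} (- 1 * t) *\<^sub>R w2 (- 1 * t)) + indicator {0} t *\<^sub>R w 0) =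
          (\<lambda>t. indicator {- x..0} t *\<^sub>R w t)"
        using x by (auto simp: indicator_def w_def w2_def y_def h_def glue_def intro!: ext)
      ultimately show ?thesis by (simp only:)
    qed
    note I = integrable_cong_AE[OF borel_measurable_integrable[OF i] m e2] Bochner_Integration.integral_cong_AE[OF borel_measurable_integrable[OF i] m e2]
    have "(LINT t:{- x..0}|lborel. w t) = (LINT t|lborel. indicator {0..x} t *\<^sub>R w2 t)"
      unfolding set_lebesgue_integral_def I(2)[symmetric]
      by (rule LINT_reflect[of "- 1" "\<lambda>t. indicator {0..x} t *\<^sub>R w2 t"]) simp
    also have "\<dots> = v2 x - v2 0"
      using loc_integrable_LINT[OF l2 order_refl, of x] SL_pairD(3)[OF p2 x]
      by (simp add: set_lebesgue_integral_def w2_def[abs_def])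
    also have "\<dots> = v 0 - v (- x)" using x 0 by (cases "x = 0") (auto simp: v_def glue_def)
    finally show "set_integrable lborel {- x..0} w \<and> v 0 - v (- x) = (LINT t:{- x..0}|lborel. w t)"
      using i I(1) by (simp add: set_integrable_def)
  qed
  moreover have "AE x in lborel. rep_L2R (emb 1 y1 + emb (- 1) y2) x = y x"
    unfolding y_def by (rule emb_glue[OF sq(1,3)])
  moreover have "AE x in lborel. rep_L2R (emb 1 h1 + emb (- 1) h2) x = - w x + complex_of_real (q x) * y x"
    using emb_glue[OF sq(2,4)] by eventually_elim (simp add: h_def w_def)
  ultimately show ?thesis unfolding SL_operator_def by auto
qed

lemma SL_operator_split:
  assumes q: "continuous_on UNIV q"
  shows "SL_operator q = {(emb 1 y1 + emb (- 1) y2, emb 1 h1 + emb (- 1) h2) |y1 v1 h1 y2 v2 h2.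
    SL_half.max_dom q y1 v1 h1 \<and> SL_half.max_dom (\<lambda>x. q (- x)) y2 v2 h2 \<and> y1 0 = y2 0 \<and> v1 0 = - v2 0}"
proof (intro set_eqI iffI)
  fix p assume "p \<in> SL_operator q"
  then obtain f h where p: "p = (f, h)" "(f, h) \<in> SL_operator q" by (cases p) auto
  then obtain y v where y: "\<And>x. (y has_vector_derivative v x) (at x)" "AE x in lborel. rep_L2R f x = y x"
    "has_AC_derivative v (\<lambda>x. of_real (q x) * y x - rep_L2R h x)"
    using SL_operator_obtain[OF q p(2)] by blast
  have cy: "continuous_on UNIV y"
    using y(1) by (intro continuous_on_vector_derivative[where f' = v]) simp
  note sy = sq_integrable_continuous_AE[OF cy y(2)]
  have "f = emb 1 y + emb (- 1) (\<lambda>x. y (- x))" unfolding sy(2) by (rule abs_L2R_split[OF sy(1)])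
  moreover have "h = emb 1 (rep_L2R h) + emb (- 1) (\<lambda>x. rep_L2R h (- x))"
    using abs_L2R_split[OF sq_integrable_rep[of h]] by (simp add: abs_rep_L2R)
  moreover have "SL_half.max_dom q y v (rep_L2R h)"
    using SL_operator_restrict[OF q _ y, of 1] by simp
  moreover have "SL_half.max_dom (\<lambda>x. q (- x)) (\<lambda>x. y (- x)) (\<lambda>x. - v (- x)) (\<lambda>x. rep_L2R h (- x))"
    using SL_operator_restrict[OF q _ y, of "- 1"] by simp
  ultimately show "p \<in> {(emb 1 y1 + emb (- 1) y2, emb 1 h1 + emb (- 1) h2) |y1 v1 h1 y2 v2 h2.
    SL_half.max_dom q y1 v1 h1 \<and> SL_half.max_dom (\<lambda>x. q (- x)) y2 v2 h2 \<and> y1 0 = y2 0 \<and> v1 0 = - v2 0}"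
    unfolding p(1) by fastforce
qed (auto intro: SL_operator_glue[OF q])

text \<open>Reflection turns continuity of the derivative into \<open>v1 0 = - v2 0\<close>; the
  factor \<open>e\<close> in \<open>half_relation\<close> makes this the equality of second boundary
  values and at the same time supplies the sign of \<open>mult_sgn\<close> on the left.\<close>

lemma indefinite_SL_operator_eq:
  assumes q: "continuous_on UNIV q"
  shows "indefinite_SL_operator q = {(f1 + f2, h1 + h2) |f1 f2 h1 h2 a b.
    (f1, h1, a, b) \<in> half_relation 1 q \<and> (f2, h2, 1 * a, b) \<in> half_relation (- 1) (\<lambda>x. q (- x))}" (is "_ = ?R")
proof -
  have q2: "continuous_on UNIV (\<lambda>x. q (- x))"
    by (rule continuous_on_compose2[OF q]) (auto intro!: continuous_intros)
  interpret h1: SL_half q by unfold_locales (rule q)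
  interpret h2: SL_half "\<lambda>x. q (- x)" by unfold_locales (rule q2)
  have sgn: "mult_sgn (emb 1 k1 + emb (- 1) k2) = scaleC (of_real 1) (emb 1 k1) + scaleC (of_real (- 1)) (emb (- 1) k2)"
    if "h1.max_dom y1 v1 k1" "h2.max_dom y2 v2 k2" for y1 v1 k1 y2 v2 k2
    using mult_sgn_emb[of k1 k2] that by (simp add: h1.max_dom_def h2.max_dom_def)
  show ?thesis
  proof (intro set_eqI iffI)
    fix p assume "p \<in> indefinite_SL_operator q"
    then obtain f h where p: "p = (f, mult_sgn h)" "(f, h) \<in> SL_operator q" unfolding indefinite_SL_operator_def by blast
    then obtain y1 v1 k1 y2 v2 k2 where 1: "f = emb 1 y1 + emb (- 1) y2" "h = emb 1 k1 + emb (- 1) k2"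
      "h1.max_dom y1 v1 k1" "h2.max_dom y2 v2 k2" "y1 0 = y2 0" "v1 0 = - v2 0"
      unfolding SL_operator_split[OF q] by blast
    have "(emb 1 y1, scaleC (of_real 1) (emb 1 k1), y1 0, v1 0) \<in> half_relation 1 q"
      unfolding half_relation_def using 1(3) by force
    moreover have "(emb (- 1) y2, scaleC (of_real (- 1)) (emb (- 1) k2), 1 * y1 0, v1 0) \<in> half_relation (- 1) (\<lambda>x. q (- x))"
      unfolding half_relation_def using 1(4,5,6) by force
    ultimately show "p \<in> ?R" unfolding p(1) 1(1,2) sgn[OF 1(3,4)] by blast
  next
    fix p assume "p \<in> ?R"
    then obtain y1 v1 k1 y2 v2 k2 where 1: "p = (emb 1 y1 + emb (- 1) y2, scaleC (of_real 1) (emb 1 k1) + scaleC (of_real (- 1)) (emb (- 1) k2))"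
      "h1.max_dom y1 v1 k1" "h2.max_dom y2 v2 k2" "y1 0 = y2 0" "v1 0 = - v2 0"
      unfolding half_relation_def by force
    then show "p \<in> indefinite_SL_operator q"
      unfolding indefinite_SL_operator_def SL_operator_split[OF q] 1(1) sgn[OF 1(2,3), symmetric] by blast
  qed
qed

text \<open>The continuous representative of \<open>f\<close> and its derivative are unique
  everywhere. The two candidates for the second derivative then have equal integrals over all
  intervals.\<close>

lemma SL_operator_single_valued:
  assumes q: "continuous_on UNIV q"
  shows "single_valued (SL_operator q)"
proof (rule single_valuedI)
  fix f h h' assume 1: "(f, h) \<in> SL_operator q" and 2: "(f, h') \<in> SL_operator q"
  obtain y v where y: "\<And>x. (y has_vector_derivative v x) (at x)" "AE x in lborel. rep_L2R f x = y x"
    "has_AC_derivative v (\<lambda>x. of_real (q x) * y x - rep_L2R h x)"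
    using SL_operator_obtain[OF q 1] by blast
  obtain y' v' where y': "\<And>x. (y' has_vector_derivative v' x) (at x)" "AE x in lborel. rep_L2R f x = y' x"
    "has_AC_derivative v' (\<lambda>x. of_real (q x) * y' x - rep_L2R h' x)"
    using SL_operator_obtain[OF q 2] by blast
  have "y x = y' x" for x
  proof (rule continuous_AE_eq[of UNIV])
    show "AE x in lborel. x \<in> UNIV \<longrightarrow> y x = y' x" using y(2) y'(2) by eventually_elim simp
    show "continuous_on UNIV y" "continuous_on UNIV y'"
      using y(1) y'(1) by (auto intro!: continuous_on_vector_derivative)
  qed auto
  then have yy: "y' = y" by auto
  have "v x = v' x" for x using vector_derivative_unique_at[OF y(1) y'(1)[unfolded yy]] .
  then have vv: "v' = v" by auto
  define d where "d x = (of_real (q x) * y x - rep_L2R h' x) - (of_real (q x) * y x - rep_L2R h x)" for x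
  have "AE x in lborel. d x = 0"
  proof (rule AE_zero_of_interval_integrals)
    fix a b :: real assume "a \<le> b"
    note a = y(3)[unfolded has_AC_derivative_def, rule_format, OF this]
      y'(3)[unfolded has_AC_derivative_def yy vv, rule_format, OF this]
    show "set_integrable lborel {a..b} d" unfolding d_def by (rule set_integral_diff(1)) (use a in auto)
    show "(LINT x:{a..b}|lborel. d x) = 0" unfolding d_def
      by (subst set_integral_diff(2)) (use a in auto)
  qed
  then have "AE x in lborel. rep_L2R h x = rep_L2R h' x" by eventually_elim (simp add: d_def)
  then have "abs_L2R (rep_L2R h) = abs_L2R (rep_L2R h')" by (simp add: abs_L2R_eq_iff sq_integrable_rep)
  then show "h = h'" by (simp add: abs_rep_L2R)
qed

subsection \<open>Reflection\<close>

lemma SL_classical_reflect: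
  assumes "SL_classical q z y v"
  shows "SL_classical (\<lambda>x. q (- x)) z (\<lambda>x. c * y (- x)) (\<lambda>x. - c * v (- x))"
proof -
  have n: "((\<lambda>x. - x) has_vector_derivative - 1) (at (x :: real))" for x by (auto intro!: derivative_eq_intros)
  have y: "((\<lambda>x. c * y (- x)) has_vector_derivative c * (- v (- x))) (at x)" for x
    using vector_diff_chain_at[OF n, of y "v (- x)" x] assms
    by (intro has_vector_derivative_mult_right) (simp add: SL_classical_def o_def)
  have "((\<lambda>x. - c * v (- x)) has_vector_derivative - c * (- ((of_real (q (- x)) - z) * y (- x)))) (at x)" for x
    using vector_diff_chain_at[OF n, of v "(of_real (q (- x)) - z) * y (- x)" x] assms
    by (intro has_vector_derivative_mult_right) (simp add: SL_classical_def o_def)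
  then show ?thesis unfolding SL_classical_def using y by (auto simp: mult_ac)
qed

lemma sq_integrable_on_atMost_iff:
  "sq_integrable_on f {..0} \<longleftrightarrow> sq_integrable_on (\<lambda>x. f (- x)) {0..}"
proof -
  have 1: "sq_integrable g \<longleftrightarrow> sq_integrable (\<lambda>x. g (- x))" for g
    using sq_integrable_reflect[of "- 1" g] sq_integrable_reflect[of "- 1" "\<lambda>x. g (- x)"] by auto
  show ?thesis unfolding sq_integrable_on_iff
    by (subst 1) (auto simp: indicator_def intro!: arg_cong[of _ _ sq_integrable])
qed

text \<open>Under reflection \<open>SL_s\<close> changes sign and \<open>SL_c\<close> does not, so
  \<open>s + m c\<close> on the left becomes minus \<open>s - m c\<close> on the right.\<close>

lemma weyl_m_minus_eq:
  assumes q: "continuous_on UNIV q"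
  shows "weyl_m_minus q z = weyl_m_plus (\<lambda>x. q (- x)) z"
proof -
  have q2: "continuous_on UNIV (\<lambda>x. q (- x))"
    by (rule continuous_on_compose2[OF q]) (auto intro!: continuous_intros)
  have s: "SL_s (\<lambda>x. q (- x)) x z = - SL_s q (- x) z" for x
    using SL_solution_unique[OF q2 SL_classical_reflect[OF SL_solution(1)[OF q], of z "- 1" 0 1]] SL_solution(2,3)[OF q, of 0 1 z]
    by (simp add: SL_s_def fun_eq_iff)
  have c: "SL_c (\<lambda>x. q (- x)) x z = SL_c q (- x) z" for x
    using SL_solution_unique[OF q2 SL_classical_reflect[OF SL_solution(1)[OF q], of z 1 1 0]] SL_solution(2,3)[OF q, of 1 0 z]
    by (simp add: SL_c_def fun_eq_iff)
  have "sq_integrable_on (\<lambda>x. SL_s q x z + m * SL_c q x z) {..0} \<longleftrightarrow>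
      sq_integrable_on (\<lambda>x. SL_s (\<lambda>x. q (- x)) x z - m * SL_c (\<lambda>x. q (- x)) x z) {0..}" for m
    unfolding sq_integrable_on_atMost_iff s c
    using sq_integrable_on_scale[of "\<lambda>x. SL_s q (- x) z + m * SL_c q (- x) z" "{0..}" "- 1"]
      sq_integrable_on_scale[of "\<lambda>x. - SL_s q (- x) z - m * SL_c q (- x) z" "{0..}" "- 1"] by (auto simp: add.commute)
  then show ?thesis unfolding weyl_m_minus_def weyl_m_plus_def by simp
qed

subsection \<open>Deficiency indices and the limit point case\<close>

lemma cinner_abs_emb:
  assumes e: "\<bar>e\<bar> = 1" and f: "sq_integrable f" and u: "sq_integrable_on u {0..}"
  shows "cinner (abs_L2R f) (emb e u) = (LINT t:{0..}|lborel. f (e * t) * cnj (u t))"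
proof -
  have ee: "e * (e * t) = t" for t
    using e by (auto simp: abs_if split: if_splits)
  have "cinner (abs_L2R f) (emb e u) = (LINT x|lborel. f x * cnj (half_ext e u x))"
    unfolding emb_def by (rule cinner_abs[OF f sq_integrable_half_ext[OF e u]])
  also have "\<dots> = (LINT t|lborel. f (e * t) * cnj (half_ext e u (e * t)))"
    by (rule LINT_reflect[OF e, of "\<lambda>x. f x * cnj (half_ext e u x)", symmetric])
  also have "(\<lambda>t. f (e * t) * cnj (half_ext e u (e * t))) = (\<lambda>t. indicator {0..} t *\<^sub>R (f (e * t) * cnj (u t)))"
    by (auto simp: half_ext_def ee indicator_def)
  finally show ?thesis by (simp add: set_lebesgue_integral_def)
qed

lemma emb_in_L2_on:
  assumes e: "\<bar>e\<bar> = 1" and u: "sq_integrable_on u {0..}"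
  shows "emb e u \<in> L2_on {x. 0 \<le> e * x}"
  unfolding L2_on_def emb_def
  using rep_abs_L2R[OF sq_integrable_half_ext[OF e u]]
  by (auto elim!: eventually_mono simp: half_ext_def indicator_def)

text \<open>An element supported in a compact subset of the open half-line vanishes near 0 and near
  infinity, so its bracket with the solution has no boundary terms. The resulting identity is a
  closed condition and extends to the closure that defines the minimal operator.\<close>

lemma solution_in_deficiency_space:
  assumes qc: "continuous_on UNIV q" and e: "\<bar>e\<bar> = 1"
    and u: "SL_pair (\<lambda>x. q (e * x)) u u' (\<lambda>x. z * u x)" and sq: "sq_integrable_on u {0..}"
  shows "(emb e u, scaleC z (emb e u)) \<in> adjoint_in (L2_on {x. 0 \<le> e * x}) (SL_minimal q {x. 0 \<le> e * x})"
proof -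
  let ?S = "{x. 0 \<le> e * x}"
  let ?E = "{(f, h). cinner h (emb e u) = cinner f (scaleC z (emb e u))}"
  have cq: "continuous_on UNIV (\<lambda>x. q (e * x))"
    by (rule continuous_on_compose2[OF qc]) (auto intro!: continuous_intros)
  interpret SL_half "\<lambda>x. q (e * x)" by unfold_locales (rule cq)
  have zu: "sq_integrable_on (\<lambda>x. z * u x) {0..}" by (rule sq_integrable_on_scale[OF sq])
  have "(f, h) \<in> ?E" if fh: "(f, h) \<in> SL_operator q" and K: "compact K" "K \<subseteq> interior ?S" and fK: "f \<in> L2_on K" for f h K
  proof -
    obtain y v where y: "\<And>x. (y has_vector_derivative v x) (at x)" "AE x in lborel. rep_L2R f x = y x"
      "has_AC_derivative v (\<lambda>x. of_real (q x) * y x - rep_L2R h x)"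
      using SL_operator_obtain[OF qc fh] by blast
    have cy: "continuous_on UNIV y"
      using y(1) by (intro continuous_on_vector_derivative[where f' = v]) simp
    note f = sq_integrable_continuous_AE[OF cy y(2)]
    have oK: "open (- K)" using K(1) by (simp add: compact_imp_closed open_Compl)
    have y0: "y x = 0" if "x \<notin> K" for x
    proof (rule continuous_AE_eq[OF oK, of y "\<lambda>_. 0"])
      show "AE x in lborel. x \<in> - K \<longrightarrow> y x = 0"
        using y(2) fK unfolding L2_on_def by (auto elim: eventually_elim2)
    qed (use that cy in \<open>auto intro: continuous_on_subset\<close>)
    have v0: "v x = 0" if x: "x \<notin> K" for x
    proof -
      have "((\<lambda>_. 0) has_vector_derivative v x) (at x)"
        by (rule has_vector_derivative_transform_within_open[OF y(1) oK]) (use x y0 in auto)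
      then show ?thesis using vector_derivative_unique_at[OF _ has_vector_derivative_const] by blast
    qed
    \<comment> \<open>Keeps the support away from 0, where the solution itself need not satisfy any
      boundary condition.\<close>
    have "0 \<notin> interior ?S"
    proof
      assume "0 \<in> interior ?S"
      then obtain r where r: "r > 0" "ball 0 r \<subseteq> ?S" using mem_interior[of 0 ?S] by blast
      have "- e * (r / 2) \<in> ball 0 r" using r(1) e by (simp add: abs_mult)
      then have "0 \<le> e * (- e * (r / 2))" using r(2) by blast
      also have "e * (- e * (r / 2)) = - (r / 2)" using e by (auto simp: abs_if split: if_splits)
      finally show False using r(1) by simp
    qed
    then have K0: "0 \<notin> K" using K(2) by blast
    obtain B where B: "\<And>x. x \<in> K \<Longrightarrow> \<bar>x\<bar> \<le> B"
      using compact_imp_bounded[OF K(1)] unfolding bounded_iff by auto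
    define Y V H where "Y x = y (e * x)" and "V x = of_real e * v (e * x)" and "H x = rep_L2R h (e * x)" for x
    have D: "max_dom Y V H" unfolding Y_def[abs_def] V_def[abs_def] H_def[abs_def]
      by (rule SL_operator_restrict[OF qc e y])
    have D': "max_dom (\<lambda>x. cnj (u x)) (\<lambda>x. cnj (u' x)) (\<lambda>x. cnj (z * u x))"
      unfolding max_dom_def by (intro conjI SL_pair_cnj sq_integrable_on_cnj u sq zu)
    have "\<forall>\<^sub>F X in at_top. V X * cnj (u X) - Y X * cnj (u' X) = 0"
      using eventually_gt_at_top[of "\<bar>B\<bar>"]
    proof eventually_elim
      case (elim X)
      then have "e * X \<notin> K" using B[of "e * X"] e by (auto simp: abs_mult)
      then show ?case by (simp add: Y_def V_def y0 v0)
    qed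
    then have "((\<lambda>X. V X * cnj (u X) - Y X * cnj (u' X)) \<longlongrightarrow> 0) at_top"
      by (rule tendsto_eventually)
    from tendsto_unique[OF _ bracket_tendsto[OF D D'] this]
    have "(LINT t:{0..}|lborel. Y t * cnj (z * u t)) = (LINT t:{0..}|lborel. H t * cnj (u t))"
      using y0[OF K0] v0[OF K0] by (simp add: Y_def V_def)
    then have "cinner f (emb e (\<lambda>x. z * u x)) = cinner h (emb e u)"
      using cinner_abs_emb[OF e f(1) zu] cinner_abs_emb[OF e sq_integrable_rep[of h] sq]
      unfolding f(2)[symmetric] abs_rep_L2R Y_def H_def by simp
    then show ?thesis using emb_scale[OF e sq, of z] by simp
  qed
  then have "{(f, h) \<in> SL_operator q. \<exists>K. compact K \<and> K \<subseteq> interior ?S \<and> f \<in> L2_on K} \<subseteq> ?E" by blast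
  moreover have "closed ?E"
    unfolding case_prod_unfold
    by (intro closed_Collect_eq continuous_on_cinner continuous_intros)
  ultimately have "SL_minimal q ?S \<subseteq> ?E" unfolding SL_minimal_def by (rule closure_minimal)
  then show ?thesis
    unfolding adjoint_in_def emb_scale[OF e sq, symmetric]
    using emb_in_L2_on[OF e sq] emb_in_L2_on[OF e zu] emb_scale[OF e sq, of z] by auto
qed

text \<open>If \<open>\<phi>\<close> at \<open>\<i>\<close> were square integrable, then together
  with the Weyl solution it would give two independent vectors in a deficiency space of dimension
  1.\<close>

lemma limit_point_of_deficiency:
  assumes qc: "continuous_on UNIV q" and e: "\<bar>e\<bar> = 1"
    and def: "deficiency_indices (L2_on {x. 0 \<le> e * x}) (SL_minimal q {x. 0 \<le> e * x}) = (1, 1)"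
  shows "SL_limit_point (\<lambda>x. q (e * x))"
proof -
  have cq: "continuous_on UNIV (\<lambda>x. q (e * x))"
    by (rule continuous_on_compose2[OF qc]) (auto intro!: continuous_intros)
  interpret SL_half "\<lambda>x. q (e * x)" by unfold_locales (rule cq)
  let ?N = "{g. (g, scaleC \<i> g) \<in> adjoint_in (L2_on {x. 0 \<le> e * x}) (SL_minimal q {x. 0 \<le> e * x})}"
  show ?thesis
  proof
    show "\<not> sq_integrable_on (\<phi> \<i>) {0..}"
    proof
      assume s1: "sq_integrable_on (\<phi> \<i>) {0..}"
      obtain m where s2: "sq_integrable_on (\<psi> \<i> m) {0..}" using weyl_solution_exists[of \<i>] by auto
      have "L2R.dim ?N = 1" using def by (simp add: deficiency_indices_def)
      then obtain b where b: "?N \<subseteq> L2R.span {b}"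
        using L2R.basis_exists[of ?N] by (metis card_1_singletonE)
      have "emb e (\<phi> \<i>) \<in> ?N" "emb e (\<psi> \<i> m) \<in> ?N"
        using solution_in_deficiency_space[OF qc e pair_\<phi> s1] solution_in_deficiency_space[OF qc e pair_\<psi> s2] by auto
      then obtain c d where cd: "emb e (\<phi> \<i>) = scaleC c b" "emb e (\<psi> \<i> m) = scaleC d b"
        using b unfolding L2R.span_singleton by blast
      have "emb e (\<phi> \<i>) \<noteq> 0" using emb_eq_0[OF e cont_\<phi> s1, of 0] by auto
      then have c: "c \<noteq> 0" using cd by auto
      \<comment> \<open>The combination that dependence would force to vanish; its derivative at 0
        is 1, because that of \<open>\<phi>\<close> is 0 and that of \<open>\<psi>\<close> is
        1.\<close>
      define w where "w x = 1 * \<psi> \<i> m x + (- (d / c)) * \<phi> \<i> x" for x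
      have "emb e w = 0"
        unfolding w_def emb_combine[OF e s2 s1] cd using c by (simp del: L2R.scale_minus_left add: L2R.scale_left_distrib[symmetric])
      moreover have "emb e w \<noteq> 0"
      proof (rule emb_neq_0[OF cq e])
        show "SL_pair (\<lambda>x. q (e * x)) w (\<lambda>x. 1 * \<psi>' \<i> m x + (- (d / c)) * \<phi>' \<i> x) (\<lambda>x. 1 * (\<i> * \<psi> \<i> m x) + (- (d / c)) * (\<i> * \<phi> \<i> x))"
          unfolding w_def by (rule SL_pair_combine[OF cq pair_\<psi> pair_\<phi>])
        show "sq_integrable_on w {0..}" unfolding w_def by (rule sq_integrable_on_combine[OF s2 s1])
      qed simp
      ultimately show False by simp
    qed
  qed
qed

theorem theorem5p8:
  fixes q :: "real \<Rightarrow> real"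
  assumes "continuous_on UNIV q"
    and "deficiency_indices (L2_on {0..}) (SL_minimal q {0..}) = (1, 1)"
    and "deficiency_indices (L2_on {..0}) (SL_minimal q {..0}) = (1, 1)"
    and "(SUP z\<in>{z. Im z > 0}.
            ennreal (cmod (weyl_M_plus q z + weyl_M_minus q z)) /
            ennreal (cmod (weyl_M_plus q z - weyl_M_minus q z))) < \<infinity>"
  shows "\<exists>T. selfadjoint T \<and> similar_operators (indefinite_SL_operator q) T"
proof -
  note q = assms(1)
  interpret p: SL_limit_point q
    using limit_point_of_deficiency[OF q, of 1] assms(2) by (simp add: atLeast_def)
  interpret n: SL_limit_point "\<lambda>x. q (- x)"
    using limit_point_of_deficiency[OF q, of "- 1"] assms(3) by (simp add: atMost_def)
  define M1 where "M1 z = of_real 1 * weyl_m_plus q (of_real 1 * z)" for z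
  define M2 where "M2 z = of_real (- 1) * weyl_m_plus (\<lambda>x. q (- x)) (of_real (- 1) * z)" for z
  have M: "weyl_M_plus q z = M1 z" "weyl_M_minus q z = M2 z" for z
    by (simp_all add: weyl_M_plus_def weyl_M_minus_def M1_def M2_def weyl_m_minus_eq[OF q])
  interpret B1: boundary_relation "half_space 1" "half_relation 1 q" M1
    unfolding M1_def by (rule p.boundary_relation_half) simp
  interpret B2: boundary_relation "half_space (- 1)" "half_relation (- 1) (\<lambda>x. q (- x))" M2
    unfolding M2_def by (rule n.boundary_relation_half) simp
  define C where "C = (SUP z\<in>{z. Im z > 0}. ennreal (cmod (M1 z + M2 z)) / ennreal (cmod (M1 z - M2 z)))"
  have C: "C < \<infinity>" using assms(4) by (simp add: C_def M)
  have le: "M1 z \<noteq> M2 z \<and> cmod (M1 z + M2 z) \<le> enn2real C * cmod (M1 z - M2 z)" if z: "Im z > 0" for z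
  proof -
    have "Im (M1 z + M2 z) > 0" using B1.Im_M_pos[OF z] B2.Im_M_pos[OF z] by simp
    then have "M1 z + M2 z \<noteq> 0" by (metis less_irrefl zero_complex.sel(2))
    then have n0: "cmod (M1 z + M2 z) > 0" by simp
    have C': "ennreal (cmod (M1 z + M2 z)) / ennreal (cmod (M1 z - M2 z)) \<le> C"
      unfolding C_def by (rule SUP_upper) (use z in simp)
    \<comment> \<open>With a positive numerator, division by 0 in \<open>ennreal\<close> gives
      infinity, so finiteness of the supremum already excludes equality of the two Weyl
      functions.\<close>
    have ne: "M1 z \<noteq> M2 z"
    proof
      assume "M1 z = M2 z"
      then have "ennreal (cmod (M1 z + M2 z)) / ennreal (cmod (M1 z - M2 z)) = \<infinity>"
        using n0 by (simp add: ennreal_divide_zero)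
      then show False using C' C by simp
    qed
    then have "ennreal (cmod (M1 z + M2 z) / cmod (M1 z - M2 z)) \<le> ennreal (enn2real C)"
      using C' C by (simp add: divide_ennreal)
    then have "cmod (M1 z + M2 z) / cmod (M1 z - M2 z) \<le> enn2real C" by simp
    then show ?thesis using ne by (simp add: pos_divide_le_eq)
  qed
  interpret boundary_relation_pair "half_space 1" "half_relation 1 q" M1
    "half_space (- 1)" "half_relation (- 1) (\<lambda>x. q (- x))" M2 mult_sgn "enn2real C"
  proof
    show "cinner f g = 0" if "f \<in> half_space 1" "g \<in> half_space (- 1)" for f g
      using that emb_orthogonal unfolding half_space_def by blast
    show "mult_sgn (f + g) = f - g" if "f \<in> half_space 1" "g \<in> half_space (- 1)" for f g
      using that mult_sgn_emb unfolding half_space_def by blast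
    show "\<exists>g1\<in>half_space 1. \<exists>g2\<in>half_space (- 1). g = g1 + g2" for g
    proof -
      have "g = emb 1 (rep_L2R g) + emb (- 1) (\<lambda>x. rep_L2R g (- x))"
        using abs_L2R_split[OF sq_integrable_rep[of g]] by (simp add: abs_rep_L2R)
      moreover have "sq_integrable_on (rep_L2R g) {0..}" "sq_integrable_on (\<lambda>x. rep_L2R g (- x)) {0..}"
        using sq_integrable_on_reflect[OF _ sq_integrable_rep[of g], of 1] sq_integrable_on_reflect[OF _ sq_integrable_rep[of g], of "- 1"]
        by simp_all
      ultimately show ?thesis using half_spaceI[OF refl] by blast
    qed
  qed (use le in auto)
  have eq: "indefinite_SL_operator q = coupled 1"
    unfolding coupled_def by (rule indefinite_SL_operator_eq[OF q])
  have "single_valued (indefinite_SL_operator q)"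
    using SL_operator_single_valued[OF q] unfolding indefinite_SL_operator_def single_valued_def by blast
  then show ?thesis using similar_to_selfadjoint unfolding eq by blast
qed

end
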